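(* Let $F$ be a non-Archimedean local field of residue characteristic $p$, let $\ell\neq p$ be a prime, let $G$ be a connected reductive group over $F$, let $\sigma$ be an automorphism of $G$ of order $\ell$ defined over $F$, and let $\Gamma=\langle\sigma\rangle$. Let $P$ be a $\sigma$-stable $F$-parabolic subgroup of $G$, let $N$ be the unipotent radical of $P$, and let $\Theta:N(F)\to\Lambda^{*}$ be a character with $\Theta^\sigma=\Theta$. Let $\mathcal{L}$ be a smooth $\Lambda[G(F)\rtimes\Gamma]$-module. Then for each $i\in\{0,1\}$ the natural map $$\widehat{H}^i(\Gamma,\mathcal{L})_{N^\sigma(F),\overline{\Theta}}\longrightarrow \widehat{H}^i(\Gamma,\mathcal{L}_{N(F),\Theta})$$ is injective.
   Context: $\Lambda$ is the ring of integers of the maximal unramified extension of $\mathbb{Q}_\ell$ in $\overline{\mathbb{Q}}_\ell$, with residue field $\overline{\mathbb{F}}_\ell$. A module is smooth if every element is fixed by an open subgroup of $G(F)$; characters are smooth (trivial on an open subgroup). $G^\sigma$ denotes the connected component of the $\sigma$-fixed points of $G$, assumed reductive; $N^\sigma$ denotes the $\sigma$-fixed points of $N$, which is the unipotent radical of the parabolic subgroup $P^\sigma$ of $G^\sigma$. For a $\Gamma$-module $M$, with $\mathrm{Nr}=\sum_{g\in\Gamma}g$, put $\widehat{H}^0(\Gamma,M)=\ker(\mathrm{id}-\sigma)/\mathrm{Nr}(M)$ and $\widehat{H}^1(\Gamma,M)=\ker(\mathrm{Nr})/(\mathrm{id}-\sigma)(M)$. For a module $V$ with action $\pi$ of a unipotent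 group $N(F)$ and a character $\Theta$ of $N(F)$, $V(N(F),\Theta)$ is the submodule generated by $\{\pi(n)v-\Theta(n)v: v\in V,\ n\in N(F)\}$, and $V_{N(F),\Theta}=V/V(N(F),\Theta)$ is the twisted Jacquet module. $\overline{\Theta}$ denotes the mod-$\ell$ reduction of $\Theta$, here restricted to $N^\sigma(F)$. The natural map is the one induced by the quotient map $\mathcal{L}\to\mathcal{L}_{N(F),\Theta}$. *)

theory Defs
  imports
    "HOL-Analysis.Determinants"
    "HOL-Analysis.Abstract_Metric_Spaces"
    "HOL-Algebra.Algebra"
    "HOL-Algebra.Algebraic_Closure_Type"
begin

text \<open>
  Notational pitfalls: the locale of modules over a record ring is called \<open>Module.module\<close> here,
  since \<open>module\<close> alone may denote the type-class version, and \<open>M\<lparr>carrier := S\<rparr>\<close> is the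
  substructure of \<open>M\<close> supported on \<open>S\<close>.
\<close>


section \<open>Local fields\<close>

definition nonarch_abs :: "('f::field \<Rightarrow> real) \<Rightarrow> bool" where
  "nonarch_abs v \<longleftrightarrow>
     (\<forall>x. 0 \<le> v x) \<and> (\<forall>x. v x = 0 \<longleftrightarrow> x = 0) \<and>
     (\<forall>x y. v (x * y) = v x * v y) \<and> (\<forall>x y. v (x + y) \<le> max (v x) (v y))"

definition valuation_ring :: "('f::field \<Rightarrow> real) \<Rightarrow> 'f ring" where
  "valuation_ring v = ring_of_type_algebra\<lparr>carrier := {x. v x \<le> 1}\<rparr>"

text \<open>A field complete for a nontrivial discrete absolute value, with finite residue field of
  characteristic \<open>p\<close>; the last condition says that \<open>p\<close> vanishes in the residue field.\<close>

definition nonarch_local_field :: "('f::field \<Rightarrow> real) \<Rightarrow> nat \<Rightarrow> bool" where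
  "nonarch_local_field v p \<longleftrightarrow>
     nonarch_abs v \<and>
     (\<exists>\<pi>. 0 < v \<pi> \<and> v \<pi> < 1 \<and> (\<forall>x. v x < 1 \<longrightarrow> v x \<le> v \<pi>)) \<and>
     Metric_space.mcomplete UNIV (\<lambda>x y. v (x - y)) \<and>
     finite (carrier (valuation_ring v Quot {x. v x < 1})) \<and>
     Factorial_Ring.prime p \<and> v (of_nat p) < 1"


section \<open>The coefficient ring\<close>

text \<open>\<open>\<rat>\<^sub>\<ell>\<close> is given as the completion of \<open>\<rat>\<close> for the \<open>\<ell>\<close>-adic absolute value. On \<open>\<rat>\<close> the latter
  is the only nonarchimedean absolute value with \<open>w \<ell> = 1/\<ell>\<close>.\<close>

definition ladic_field :: "('q::field_char_0 \<Rightarrow> real) \<Rightarrow> nat \<Rightarrow> bool" where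
  "ladic_field w l \<longleftrightarrow>
     nonarch_abs w \<and> w (of_nat l) = 1 / real l \<and>
     Metric_space.mcomplete UNIV (\<lambda>x y. w (x - y)) \<and>
     (Metric_space.mtopology UNIV (\<lambda>x y. w (x - y)) closure_of range of_rat) = UNIV"

text \<open>The integral closure of the valuation ring of the base field in a subfield \<open>E\<close> of the
  algebraic closure.\<close>

definition integers_of ::
  "('q::field \<Rightarrow> real) \<Rightarrow> 'q alg_closure set \<Rightarrow> 'q alg_closure ring" where
  "integers_of w E = ring_of_type_algebra\<lparr>carrier :=
     {x \<in> E. \<exists>f. lead_coeff f = 1 \<and> (\<forall>i. w (coeff f i) \<le> 1) \<and> poly (map_poly to_ac f) x = 0}\<rparr>"

text \<open>Finite extensions of \<open>\<rat>\<^sub>\<ell>\<close> of ramification index one: the uniformizer \<open>\<ell>\<close> generates the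
  maximal ideal upstairs. Residue extensions are automatically separable, \<open>\<bbbF>\<^sub>\<ell>\<close> being perfect.\<close>

definition unramified :: "('q::field \<Rightarrow> real) \<Rightarrow> nat \<Rightarrow> 'q alg_closure set \<Rightarrow> bool" where
  "unramified w l E \<longleftrightarrow>
     subfield E ring_of_type_algebra \<and> range to_ac \<subseteq> E \<and>
     ring.finite_dimension ring_of_type_algebra (range to_ac) E \<and>
     maximalideal (PIdl\<^bsub>integers_of w E\<^esub> (of_nat l)) (integers_of w E)"

definition max_unramified :: "('q::field \<Rightarrow> real) \<Rightarrow> nat \<Rightarrow> 'q alg_closure set" where
  "max_unramified w l = \<Union> {E. unramified w l E}"

definition Lam :: "('q::field \<Rightarrow> real) \<Rightarrow> nat \<Rightarrow> 'q alg_closure ring" where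
  "Lam w l = integers_of w (max_unramified w l)"

text \<open>Since \<open>\<Lambda>\<close> is unramified, \<open>\<ell>\<Lambda>\<close> is its maximal ideal, and \<open>\<Lambda>/\<ell>\<Lambda>\<close> its residue field.\<close>

definition resfield :: "('q::field \<Rightarrow> real) \<Rightarrow> nat \<Rightarrow> 'q alg_closure set ring" where
  "resfield w l = Lam w l Quot (PIdl\<^bsub>Lam w l\<^esub> (of_nat l))"

definition reduction :: "('q::field \<Rightarrow> real) \<Rightarrow> nat \<Rightarrow> 'q alg_closure \<Rightarrow> 'q alg_closure set" where
  "reduction w l a = (PIdl\<^bsub>Lam w l\<^esub> (of_nat l)) +>\<^bsub>Lam w l\<^esub> a"


section \<open>Linear algebraic groups\<close>

text \<open>Algebraic groups over \<open>F\<close> are identified with their groups of points over the algebraic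
  closure \<open>K\<close> of \<open>F\<close>, realised as Zariski closed subgroups of \<open>GL\<^sub>n(K)\<close>.\<close>

definition GL :: "('k::field^'n^'n) monoid" where
  "GL = \<lparr>carrier = {A. invertible A}, mult = (**), one = mat 1\<rparr>"

abbreviation GLsub :: "('k::field^'n^'n) set \<Rightarrow> ('k^'n^'n) monoid" where
  "GLsub H \<equiv> GL\<lparr>carrier := H\<rparr>"

text \<open>The coordinate ring of \<open>GL\<^sub>n\<close> over a subfield \<open>k\<close> of \<open>K\<close>, i.e. \<open>k[x\<^sub>i\<^sub>j, 1/det]\<close>. Its elements are
  viewed as functions on \<open>GL\<^sub>n(K)\<close>; their values on singular matrices are irrelevant.\<close>

inductive_set regular :: "'k set \<Rightarrow> ('k::field^'n^'n \<Rightarrow> 'k) set" for k where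
  const: "c \<in> k \<Longrightarrow> (\<lambda>A. c) \<in> regular k"
| entry: "(\<lambda>A. A $ i $ j) \<in> regular k"
| inv_det: "(\<lambda>A. inverse (det A)) \<in> regular k"
| add: "f \<in> regular k \<Longrightarrow> g \<in> regular k \<Longrightarrow> (\<lambda>A. f A + g A) \<in> regular k"
| mult: "f \<in> regular k \<Longrightarrow> g \<in> regular k \<Longrightarrow> (\<lambda>A. f A * g A) \<in> regular k"

definition zariski :: "('k::field^'n^'n) topology" where
  "zariski = topology_generated_by {{A \<in> carrier GL. f A \<noteq> 0} | f. f \<in> regular UNIV}"

definition closed_subgroup :: "('k::field^'n^'n) set \<Rightarrow> bool" where
  "closed_subgroup H \<longleftrightarrow> subgroup H GL \<and> closedin zariski H"

text \<open>The ideal of \<open>H\<close> in the coordinate ring over \<open>K\<close> is spanned by its members with coefficients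
  in \<open>k\<close>.\<close>

definition defined_over :: "'k set \<Rightarrow> ('k::field^'n^'n) set \<Rightarrow> bool" where
  "defined_over k H \<longleftrightarrow>
     (\<forall>f\<in>regular UNIV. (\<forall>A\<in>H. f A = 0) \<longrightarrow>
        (\<exists>m c h. (\<forall>i<m::nat. h i \<in> regular k \<and> (\<forall>A\<in>H. h i A = 0)) \<and>
                 (\<forall>A\<in>carrier GL. f A = (\<Sum>i<m. c i * h i A))))"

definition unipotent :: "('k::field^'n^'n) \<Rightarrow> bool" where
  "unipotent A \<longleftrightarrow> (\<exists>m. ((\<lambda>B. (A - mat 1) ** B) ^^ m) (mat 1) = 0)"

definition conn_normal_unipotent ::
  "('k::field^'n^'n) set \<Rightarrow> ('k^'n^'n) set \<Rightarrow> bool" where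
  "conn_normal_unipotent U H \<longleftrightarrow>
     closed_subgroup U \<and> connectedin zariski U \<and> U \<lhd> GLsub H \<and> (\<forall>A\<in>U. unipotent A)"

definition unipotent_radical ::
  "('k::field^'n^'n) set \<Rightarrow> ('k^'n^'n) set \<Rightarrow> bool" where
  "unipotent_radical N H \<longleftrightarrow>
     conn_normal_unipotent N H \<and> (\<forall>U. conn_normal_unipotent U H \<longrightarrow> U \<subseteq> N)"

definition connected_reductive :: "('k::field^'n^'n) set \<Rightarrow> bool" where
  "connected_reductive H \<longleftrightarrow>
     closed_subgroup H \<and> connectedin zariski H \<and> unipotent_radical {mat 1} H"

definition conn_solvable_subgroup :: "('k::field^'n^'n) set \<Rightarrow> ('k^'n^'n) set \<Rightarrow> bool" where
  "conn_solvable_subgroup B H \<longleftrightarrow>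
     B \<subseteq> H \<and> closed_subgroup B \<and> connectedin zariski B \<and> solvable (GLsub B)"

definition borel_subgroup :: "('k::field^'n^'n) set \<Rightarrow> ('k^'n^'n) set \<Rightarrow> bool" where
  "borel_subgroup B H \<longleftrightarrow>
     conn_solvable_subgroup B H \<and> (\<forall>C. conn_solvable_subgroup C H \<longrightarrow> B \<subseteq> C \<longrightarrow> C = B)"

definition parabolic_over ::
  "'k set \<Rightarrow> ('k::field^'n^'n) set \<Rightarrow> ('k^'n^'n) set \<Rightarrow> bool" where
  "parabolic_over k P H \<longleftrightarrow>
     P \<subseteq> H \<and> closed_subgroup P \<and> defined_over k P \<and> (\<exists>B. borel_subgroup B H \<and> B \<subseteq> P)"

definition morphism_over ::
  "'k set \<Rightarrow> ('k::field^'n^'n) set \<Rightarrow> ('k^'n^'n \<Rightarrow> 'k^'n^'n) \<Rightarrow> bool" where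
  "morphism_over k H \<phi> \<longleftrightarrow> (\<forall>i j. \<exists>f\<in>regular k. \<forall>A\<in>H. \<phi> A $ i $ j = f A)"

text \<open>Automorphisms are extensional functions on \<open>H\<close>, as in \<^const>\<open>AutoGroup\<close>.\<close>

definition automorphism_over ::
  "'k set \<Rightarrow> ('k::field^'n^'n) set \<Rightarrow> ('k^'n^'n \<Rightarrow> 'k^'n^'n) \<Rightarrow> bool" where
  "automorphism_over k H \<sigma> \<longleftrightarrow>
     \<sigma> \<in> carrier (AutoGroup (GLsub H)) \<and> morphism_over k H \<sigma> \<and>
     morphism_over k H (inv\<^bsub>AutoGroup (GLsub H)\<^esub> \<sigma>)"

definition fixed_points :: "('k \<Rightarrow> 'k) \<Rightarrow> 'k set \<Rightarrow> 'k set" where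
  "fixed_points \<sigma> H = {A \<in> H. \<sigma> A = A}"

definition identity_component :: "('k::field^'n^'n) set \<Rightarrow> ('k^'n^'n) set" where
  "identity_component H = connected_component_of_set (subtopology zariski H) (mat 1)"


section \<open>Rational points\<close>

abbreviation base :: "'f::field alg_closure set" where
  "base \<equiv> range to_ac"

definition rational :: "('f::field alg_closure^'n^'n) set \<Rightarrow> ('f alg_closure^'n^'n) set" where
  "rational H = {A \<in> H. \<forall>i j. A $ i $ j \<in> base}"

definition matrix_topology :: "('f::field \<Rightarrow> real) \<Rightarrow> ('f^'n^'n) topology" where
  "matrix_topology v =
     Metric_space.mtopology UNIV (\<lambda>A B. MAX (i, j) \<in> UNIV. v (A $ i $ j - B $ i $ j))"

definition rational_topology ::
  "('f::field \<Rightarrow> real) \<Rightarrow> ('f alg_closure^'n^'n) set \<Rightarrow> ('f alg_closure^'n^'n) topology" where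
  "rational_topology v H =
     pullback_topology (rational H) (\<lambda>A. \<chi> i j. of_ac (A $ i $ j)) (matrix_topology v)"

definition open_subgroup ::
  "('f::field \<Rightarrow> real) \<Rightarrow> ('f alg_closure^'n^'n) set \<Rightarrow> ('f alg_closure^'n^'n) set \<Rightarrow> bool" where
  "open_subgroup v U H \<longleftrightarrow>
     subgroup U (GLsub (rational H)) \<and> openin (rational_topology v H) U"

definition smooth_character ::
  "('f::field \<Rightarrow> real) \<Rightarrow> ('f alg_closure^'n^'n) set \<Rightarrow> 'r ring \<Rightarrow> ('f alg_closure^'n^'n \<Rightarrow> 'r)
    \<Rightarrow> bool" where
  "smooth_character v H R \<theta> \<longleftrightarrow>
     \<theta> \<in> hom (GLsub (rational H)) (units_of R) \<and>
     (\<exists>U. open_subgroup v U H \<and> (\<forall>u\<in>U. \<theta> u = \<one>\<^bsub>R\<^esub>))"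

definition semidirect :: "'g monoid \<Rightarrow> ('g \<Rightarrow> 'g) monoid \<Rightarrow> ('g \<times> ('g \<Rightarrow> 'g)) monoid" where
  "semidirect H A =
     \<lparr>carrier = carrier H \<times> carrier A,
      mult = (\<lambda>(g, \<gamma>) (h, \<delta>). (g \<otimes>\<^bsub>H\<^esub> \<gamma> h, \<gamma> \<otimes>\<^bsub>A\<^esub> \<delta>)),
      one = (\<one>\<^bsub>H\<^esub>, \<one>\<^bsub>A\<^esub>)\<rparr>"

definition cyclic_auts :: "('k::field^'n^'n) set \<Rightarrow> ('k^'n^'n \<Rightarrow> 'k^'n^'n)
    \<Rightarrow> ('k^'n^'n \<Rightarrow> 'k^'n^'n) monoid" where
  "cyclic_auts H \<sigma> =
     AutoGroup (GLsub H)\<lparr>carrier := generate (AutoGroup (GLsub H)) {\<sigma>}\<rparr>"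


section \<open>Modules\<close>

text \<open>Modules over the group algebra \<open>R[H]\<close>.\<close>

definition group_algebra_module ::
  "('r, 'a) ring_scheme \<Rightarrow> ('h, 'b) monoid_scheme \<Rightarrow> ('r, 'm, 'c) module_scheme
    \<Rightarrow> ('h \<Rightarrow> 'm \<Rightarrow> 'm) \<Rightarrow> bool" where
  "group_algebra_module R H M \<rho> \<longleftrightarrow>
     Module.module R M \<and> group_action H (carrier M) \<rho> \<and>
     (\<forall>h\<in>carrier H. \<forall>x\<in>carrier M. \<forall>y\<in>carrier M. \<rho> h (x \<oplus>\<^bsub>M\<^esub> y) = \<rho> h x \<oplus>\<^bsub>M\<^esub> \<rho> h y) \<and>
     (\<forall>h\<in>carrier H. \<forall>r\<in>carrier R. \<forall>x\<in>carrier M. \<rho> h (r \<odot>\<^bsub>M\<^esub> x) = r \<odot>\<^bsub>M\<^esub> \<rho> h x)"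

definition smooth_action ::
  "('f::field \<Rightarrow> real) \<Rightarrow> ('f alg_closure^'n^'n) set \<Rightarrow> 'm set \<Rightarrow> ('f alg_closure^'n^'n \<Rightarrow> 'm \<Rightarrow> 'm)
    \<Rightarrow> bool" where
  "smooth_action v H V \<pi> \<longleftrightarrow> (\<forall>x\<in>V. \<exists>U. open_subgroup v U H \<and> (\<forall>u\<in>U. \<pi> u x = x))"

definition module_homs ::
  "('r, 'a) ring_scheme \<Rightarrow> ('r, 'm, 'b) module_scheme \<Rightarrow> ('r, 'n, 'c) module_scheme
    \<Rightarrow> ('m \<Rightarrow> 'n) set" where
  "module_homs R M M' =
     {f \<in> hom (add_monoid M) (add_monoid M').
        \<forall>r\<in>carrier R. \<forall>x\<in>carrier M. f (r \<odot>\<^bsub>M\<^esub> x) = r \<odot>\<^bsub>M'\<^esub> f x}"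

text \<open>The map on cosets induced by a map that is constant on each of them.\<close>

definition descend :: "('a \<Rightarrow> 'b) \<Rightarrow> 'a set \<Rightarrow> 'b" where
  "descend g S = the_elem (g ` S)"

text \<open>The subquotient \<open>A/B\<close> of a module, for submodules \<open>B \<subseteq> A\<close>. The multiplicative fields of the
  record play no role for modules.\<close>

definition subquotient ::
  "('r, 'm, 'a) module_scheme \<Rightarrow> 'm set \<Rightarrow> 'm set \<Rightarrow> ('r, 'm set) module" where
  "subquotient M A B =
     \<lparr>carrier = (\<lambda>x. B +>\<^bsub>M\<^esub> x) ` A, monoid.mult = undefined, one = undefined,
      ring.zero = B, add = set_add M, module.smult = (\<lambda>r. descend (\<lambda>x. B +>\<^bsub>M\<^esub> (r \<odot>\<^bsub>M\<^esub> x)))\<rparr>"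

text \<open>A \<open>\<Lambda>\<close>-module annihilated by \<open>\<ell>\<close>, regarded as a module over \<open>\<Lambda>/\<ell>\<Lambda>\<close>.\<close>

definition residual_module ::
  "('r, 'm, 'a) module_scheme \<Rightarrow> ('r set, 'm) module" where
  "residual_module M =
     \<lparr>carrier = carrier M, monoid.mult = undefined, one = undefined,
      ring.zero = \<zero>\<^bsub>M\<^esub>, add = add M, module.smult = (\<lambda>C x. descend (\<lambda>a. a \<odot>\<^bsub>M\<^esub> x) C)\<rparr>"


subsection \<open>Twisted Jacquet modules\<close>

definition jacquet_kernel ::
  "('r, 'a) ring_scheme \<Rightarrow> ('r, 'm, 'b) module_scheme \<Rightarrow> 'g set \<Rightarrow> ('g \<Rightarrow> 'm \<Rightarrow> 'm) \<Rightarrow> ('g \<Rightarrow> 'r)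
    \<Rightarrow> 'm set" where
  "jacquet_kernel R V U \<pi> \<theta> =
     \<Inter> {W. submodule W R V \<and> (\<forall>n\<in>U. \<forall>x\<in>carrier V. \<pi> n x \<ominus>\<^bsub>V\<^esub> \<theta> n \<odot>\<^bsub>V\<^esub> x \<in> W)}"

definition jacquet ::
  "('r, 'a) ring_scheme \<Rightarrow> ('r, 'm, 'b) module_scheme \<Rightarrow> 'g set \<Rightarrow> ('g \<Rightarrow> 'm \<Rightarrow> 'm) \<Rightarrow> ('g \<Rightarrow> 'r)
    \<Rightarrow> ('r, 'm set) module" where
  "jacquet R V U \<pi> \<theta> = subquotient V (carrier V) (jacquet_kernel R V U \<pi> \<theta>)"


subsection \<open>Tate cohomology of a cyclic group\<close>

text \<open>Here \<open>\<Gamma>\<close> is a finite cyclic group with generator \<open>\<sigma>\<close>, acting on \<open>M\<close> by \<open>\<tau>\<close>. The degree is a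
  natural number, of which only \<open>0\<close> and \<open>1\<close> are meaningful.\<close>

definition norm_map ::
  "('r, 'm, 'a) module_scheme \<Rightarrow> 'c set \<Rightarrow> ('c \<Rightarrow> 'm \<Rightarrow> 'm) \<Rightarrow> 'm \<Rightarrow> 'm" where
  "norm_map M \<Gamma> \<tau> x = (\<Oplus>\<^bsub>M\<^esub>\<gamma>\<in>\<Gamma>. \<tau> \<gamma> x)"

definition diff_map ::
  "('r, 'm, 'a) module_scheme \<Rightarrow> 'c \<Rightarrow> ('c \<Rightarrow> 'm \<Rightarrow> 'm) \<Rightarrow> 'm \<Rightarrow> 'm" where
  "diff_map M \<sigma> \<tau> x = x \<ominus>\<^bsub>M\<^esub> \<tau> \<sigma> x"

definition tate_cocycles ::
  "nat \<Rightarrow> ('r, 'm, 'a) module_scheme \<Rightarrow> 'c set \<Rightarrow> 'c \<Rightarrow> ('c \<Rightarrow> 'm \<Rightarrow> 'm) \<Rightarrow> 'm set" where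
  "tate_cocycles i M \<Gamma> \<sigma> \<tau> =
     (if i = 0 then a_kernel M M (diff_map M \<sigma> \<tau>) else a_kernel M M (norm_map M \<Gamma> \<tau>))"

definition tate_boundaries ::
  "nat \<Rightarrow> ('r, 'm, 'a) module_scheme \<Rightarrow> 'c set \<Rightarrow> 'c \<Rightarrow> ('c \<Rightarrow> 'm \<Rightarrow> 'm) \<Rightarrow> 'm set" where
  "tate_boundaries i M \<Gamma> \<sigma> \<tau> =
     (if i = 0 then norm_map M \<Gamma> \<tau> ` carrier M else diff_map M \<sigma> \<tau> ` carrier M)"

definition tate ::
  "nat \<Rightarrow> ('r, 'm, 'a) module_scheme \<Rightarrow> 'c set \<Rightarrow> 'c \<Rightarrow> ('c \<Rightarrow> 'm \<Rightarrow> 'm) \<Rightarrow> ('r, 'm set) module" where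
  "tate i M \<Gamma> \<sigma> \<tau> = subquotient M (tate_cocycles i M \<Gamma> \<sigma> \<tau>) (tate_boundaries i M \<Gamma> \<sigma> \<tau>)"


section \<open>The two sides and the natural map\<close>

text \<open>Throughout, \<open>L\<close> is a \<open>\<Lambda>[G(F) \<rtimes> \<Gamma>]\<close>-module with action \<open>\<rho>\<close>, where \<open>\<Gamma>\<close> is generated by \<open>\<sigma>\<close>
  and \<open>R = \<Lambda>\<close>.\<close>

definition group_part ::
  "('k::field^'n^'n) set \<Rightarrow> (('k^'n^'n) \<times> ('k^'n^'n \<Rightarrow> 'k^'n^'n) \<Rightarrow> 'm \<Rightarrow> 'm)
    \<Rightarrow> 'k^'n^'n \<Rightarrow> 'm \<Rightarrow> 'm" where
  "group_part G \<rho> g = \<rho> (g, \<one>\<^bsub>AutoGroup (GLsub G)\<^esub>)"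

definition Gamma_part ::
  "(('k::field^'n^'n) \<times> ('k^'n^'n \<Rightarrow> 'k^'n^'n) \<Rightarrow> 'm \<Rightarrow> 'm) \<Rightarrow> ('k^'n^'n \<Rightarrow> 'k^'n^'n) \<Rightarrow> 'm \<Rightarrow> 'm" where
  "Gamma_part \<rho> \<gamma> = \<rho> (mat 1, \<gamma>)"

text \<open>Tate cohomology \<open>H\<^sup>i(\<Gamma>, L)\<close> over the residue field, and the action on it of the \<open>\<sigma>\<close>-fixed
  rational points, which commute with \<open>\<Gamma>\<close>.\<close>

definition tate_L where
  "tate_L i G \<sigma> L \<rho> =
     residual_module (tate i L (carrier (cyclic_auts G \<sigma>)) \<sigma> (Gamma_part \<rho>))"

definition tate_L_action where
  "tate_L_action i G \<sigma> L \<rho> n =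
     descend (\<lambda>x. tate_boundaries i L (carrier (cyclic_auts G \<sigma>)) \<sigma> (Gamma_part \<rho>)
                    +>\<^bsub>L\<^esub> group_part G \<rho> n x)"

text \<open>The source of the natural map: the twisted Jacquet module of \<open>H\<^sup>i(\<Gamma>, L)\<close> for \<open>N\<^sup>\<sigma>(F)\<close> and the
  reduction of \<open>\<Theta>\<close>.\<close>

definition jacquet_of_tate where
  "jacquet_of_tate w l i G \<sigma> N \<Theta> L \<rho> =
     jacquet (resfield w l) (tate_L i G \<sigma> L \<rho>) (rational (fixed_points \<sigma> N))
       (tate_L_action i G \<sigma> L \<rho>) (\<lambda>n. reduction w l (\<Theta> n))"

text \<open>\<open>L\<^bsub>N(F),\<Theta>\<^esub>\<close>, the quotient map onto it, and the induced action of \<open>\<Gamma>\<close>.\<close>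

definition jacquet_L_kernel where
  "jacquet_L_kernel R G N \<Theta> L \<rho> = jacquet_kernel R L (rational N) (group_part G \<rho>) \<Theta>"

definition jacquet_L where
  "jacquet_L R G N \<Theta> L \<rho> = jacquet R L (rational N) (group_part G \<rho>) \<Theta>"

definition jacquet_L_proj where
  "jacquet_L_proj R G N \<Theta> L \<rho> x = jacquet_L_kernel R G N \<Theta> L \<rho> +>\<^bsub>L\<^esub> x"

definition jacquet_L_action where
  "jacquet_L_action R G N \<Theta> L \<rho> \<gamma> =
     descend (\<lambda>x. jacquet_L_proj R G N \<Theta> L \<rho> (Gamma_part \<rho> \<gamma> x))"

text \<open>The target of the natural map.\<close>

definition tate_of_jacquet where
  "tate_of_jacquet w l i G \<sigma> N \<Theta> L \<rho> =
     residual_module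
       (tate i (jacquet_L (Lam w l) G N \<Theta> L \<rho>) (carrier (cyclic_auts G \<sigma>)) \<sigma>
         (jacquet_L_action (Lam w l) G N \<Theta> L \<rho>))"

text \<open>The quotient map \<open>L \<rightarrow> L\<^bsub>N(F),\<Theta>\<^esub>\<close> induces \<open>H\<^sup>i(\<Gamma>, L) \<rightarrow> H\<^sup>i(\<Gamma>, L\<^bsub>N(F),\<Theta>\<^esub>)\<close>, and the latter map
  factors through the twisted Jacquet module of its source.\<close>

definition tate_functorial where
  "tate_functorial w l i G \<sigma> N \<Theta> L \<rho> =
     descend (\<lambda>x. tate_boundaries i (jacquet_L (Lam w l) G N \<Theta> L \<rho>)
                    (carrier (cyclic_auts G \<sigma>)) \<sigma> (jacquet_L_action (Lam w l) G N \<Theta> L \<rho>)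
                  +>\<^bsub>jacquet_L (Lam w l) G N \<Theta> L \<rho>\<^esub> jacquet_L_proj (Lam w l) G N \<Theta> L \<rho> x)"

definition natural_map where
  "natural_map w l i G \<sigma> N \<Theta> L \<rho> = descend (tate_functorial w l i G \<sigma> N \<Theta> L \<rho>)"

end

theory Submission
  imports Defs
begin

text \<open>Twist the action of \<open>N(F)\<close> by \<open>\<Theta>\<^sup>-\<^sup>1\<close>, so that \<open>\<Theta> = 1\<close>. An element of the kernel is killed by averaging
  over every large finite quotient \<open>H/K\<close> of a finitely generated \<open>\<sigma>\<close>-stable subgroup \<open>H\<close> of \<open>N(F)\<close>.
  If the image of a class \<open>x\<close> vanishes, then \<open>x\<close> minus a boundary lies in that kernel, so the sum
  of \<open>x\<close> over \<open>H/K\<close> is a boundary. There the free \<open>\<sigma>\<close>-orbits of cosets contribute boundaries, while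
  every \<open>\<sigma>\<close>-fixed coset contains a point of \<open>N\<^sup>\<sigma>(F)\<close>, because \<open>H\<close> is nilpotent and \<open>H/K\<close> has order prime
  to \<open>\<ell>\<close>. Hence a sum of \<open>m\<close> translates of \<open>x\<close> under \<open>N\<^sup>\<sigma>(F)\<close>, with \<open>m\<close> prime to \<open>\<ell>\<close>, is a boundary.
  As \<open>\<ell>\<close> annihilates Tate cohomology, \<open>x\<close> dies in the coinvariants for \<open>N\<^sup>\<sigma>(F)\<close>.

  Nilpotency and the finite quotients come from a flag for \<open>N(F)\<close>, which exists over an arbitrary
  field by the Burnside argument for Kolchin's theorem.\<close>

section \<open>Unipotent monoids stabilize a flag\<close>

text \<open>The delicate step is the lifting of \<open>\<sigma>\<close>-fixed cosets, a nonabelian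
  H^1 problem with values in \<open>K\<close>. \<open>H\<close> and \<open>K\<close> may be infinite
  and are used without a topology, so neither completeness nor an order prime to \<open>l\<close> is
  at hand for \<open>K\<close>. A central series of \<open>H\<close> takes their place: a
  representative is corrected exactly in at most as many steps as the matrix size, and only the
  exponent of \<open>H/K\<close> enters. Since F may have positive characteristic, exp and log are
  avoided: forward differences stand in for polynomial dependence, and the \<open>l\<close>-th power
  map is linearized along a filtration of a lattice.

  That averages detect the kernel is the classical description of Jacquet kernels through compact
  open subgroups. The averages stay unnormalized, because the information needed is a count: the
  number of fixed cosets is congruent to the index of \<open>K\<close> modulo \<open>l\<close>.
  Linear algebra takes place over the algebraic closure, where eigenvalues exist; the subfield F is
  seen only by the coefficients of the lattice.\<close>

interpretation vecf: vector_space_pair "(*s) :: 'k::field \<Rightarrow> 'k^'n \<Rightarrow> 'k^'n" "(*) :: 'k \<Rightarrow> 'k \<Rightarrow> 'k"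
  by unfold_locales

section \<open>Traces on the quotient of two subspaces\<close>

lemma functional_separating:
  fixes z :: "'k::field^'n"
  assumes W: "vec.subspace W" and z: "z \<notin> W"
  obtains f where "Vector_Spaces.linear (*s) (*) f" "\<forall>w\<in>W. f w = 0" "f z = 1"
proof -
  obtain B where B: "B \<subseteq> W" "vec.independent B" "vec.span B = W"
    using vec.basis_exists[of W] W by (metis vec.span_eq_iff vec.span_mono subset_antisym)
  have "vec.independent (insert z B)"
    using B z by (simp add: vec.independent_insertI)
  then obtain f where f: "Vector_Spaces.linear (*s) (*) f" "\<forall>x\<in>insert z B. f x = (if x = z then 1 else 0)"
    using vecf.linear_independent_extend[of "insert z B" "\<lambda>x. if x = z then 1 else 0"] by blast
  have "f w = 0" if "w \<in> W" for w
  proof -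
    have "w \<in> vec.span B" using that B by simp
    moreover have "\<forall>b\<in>B. f b = 0" using f(2) B(1) z by auto
    ultimately show ?thesis
      using vecf.linear_eq_0_on_span[OF f(1)] by blast
  qed
  then show ?thesis using that f by simp
qed

text \<open>A basis of \<open>W/W'\<close> together with its dual basis, lifted to vectors of
  \<open>W\<close> and to functionals on the whole space. The sum of \<open>\<xi> c (f c)\<close> is
  then the trace of \<open>f\<close> on the quotient, with no quotient space to form.\<close>

definition dual_system ::
  "('k::field^'n) set \<Rightarrow> ('k^'n) set \<Rightarrow> ('k^'n) set \<Rightarrow> ('k^'n \<Rightarrow> 'k^'n \<Rightarrow> 'k) \<Rightarrow> bool" where
  "dual_system W' W C \<xi> \<longleftrightarrow>
     finite C \<and> C \<subseteq> W \<and> (\<forall>c\<in>C. Vector_Spaces.linear (*s) (*) (\<xi> c)) \<and> (\<forall>c\<in>C. \<forall>w\<in>W'. \<xi> c w = 0) \<and>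
     (\<forall>c\<in>C. \<forall>d\<in>C. \<xi> c d = (if c = d then 1 else 0)) \<and> (\<forall>w\<in>W. w - (\<Sum>c\<in>C. \<xi> c w *s c) \<in> W')"

lemma functional_simps:
  assumes "Vector_Spaces.linear (*s) (*) f"
  shows "f (x + y) = f x + f y" "f (x - y) = f x - f y" "f (a *s x) = a * f x" "f 0 = 0"
    "f (\<Sum>i\<in>I. g i) = (\<Sum>i\<in>I. f (g i))"
  using assms vecf.linear_add vecf.linear_diff vecf.linear_scale vecf.linear_0 vecf.linear_sum by auto

text \<open>Base change on both sides: \<open>\<xi> c\<close> is expanded in the
  \<open>\<eta> d\<close> on \<open>W\<close>, and \<open>f d\<close> in the \<open>f c\<close>
  modulo \<open>W'\<close>. Exchanging the two sums identifies the traces.\<close>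

lemma dual_system_trace_indep:
  assumes C: "dual_system W' W C \<xi>" and D: "dual_system W' W D \<eta>"
    and f: "Vector_Spaces.linear (*s) (*s) f" "\<And>w. w \<in> W \<Longrightarrow> f w \<in> W" "\<And>w. w \<in> W' \<Longrightarrow> f w \<in> W'"
  shows "(\<Sum>c\<in>C. \<xi> c (f c)) = (\<Sum>d\<in>D. \<eta> d (f d))"
proof -
  have 1: "\<xi> c w = (\<Sum>d\<in>D. \<eta> d w * \<xi> c d)" if "c \<in> C" "w \<in> W" for c w
  proof -
    have l: "Vector_Spaces.linear (*s) (*) (\<xi> c)" using C that by (auto simp: dual_system_def)
    have "\<xi> c (w - (\<Sum>d\<in>D. \<eta> d w *s d)) = 0" using C D that by (auto simp: dual_system_def)
    then show ?thesis by (simp add: functional_simps[OF l])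
  qed
  have 2: "\<eta> d (f d) = (\<Sum>c\<in>C. \<xi> c d * \<eta> d (f c))" if "d \<in> D" for d
  proof -
    have l: "Vector_Spaces.linear (*s) (*) (\<eta> d)" using D that by (auto simp: dual_system_def)
    have "d \<in> W" using D that by (auto simp: dual_system_def)
    then have "f (d - (\<Sum>c\<in>C. \<xi> c d *s c)) \<in> W'" using C f(3) by (auto simp: dual_system_def)
    then have "\<eta> d (f (d - (\<Sum>c\<in>C. \<xi> c d *s c))) = 0" using D that by (auto simp: dual_system_def)
    then show ?thesis
      by (simp add: functional_simps[OF l] vec.linear_diff[OF f(1)] vec.linear_sum[OF f(1)] vec.linear_scale[OF f(1)])
  qed
  have "(\<Sum>c\<in>C. \<xi> c (f c)) = (\<Sum>c\<in>C. \<Sum>d\<in>D. \<eta> d (f c) * \<xi> c d)"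
    using 1 C f(2) by (intro sum.cong) (auto simp: dual_system_def)
  also have "\<dots> = (\<Sum>d\<in>D. \<Sum>c\<in>C. \<xi> c d * \<eta> d (f c))"
    by (subst sum.swap) (simp add: mult.commute)
  also have "\<dots> = (\<Sum>d\<in>D. \<eta> d (f d))" using 2 by simp
  finally show ?thesis .
qed

text \<open>The quotient is built up by lines on which the nilpotent operator vanishes modulo the previous
  step, so the resulting dual basis sees only zeros on the diagonal.\<close>

lemma dual_system_nilpotent:
  fixes f :: "'k::field^'n \<Rightarrow> 'k^'n"
  assumes "vec.subspace W'" "vec.subspace W" "W' \<subseteq> W"
    and f: "Vector_Spaces.linear (*s) (*s) f" "\<And>w. w \<in> W \<Longrightarrow> f w \<in> W" and fW': "\<And>w. w \<in> W' \<Longrightarrow> f w \<in> W'"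
    and nil: "\<And>w. w \<in> W \<Longrightarrow> (f ^^ m) w = 0"
  shows "\<exists>C \<xi>. dual_system W' W C \<xi> \<and> (\<forall>c\<in>C. \<xi> c (f c) = 0)"
  using assms(1,3) fW'
proof (induction "vec.dim W - vec.dim W'" arbitrary: W' rule: less_induct)
  case (less W')
  show ?case
  proof (cases "W = W'")
    case True
    then show ?thesis by (intro exI[of _ "{}"]) (auto simp: dual_system_def)
  next
    case False
    then obtain y where y: "y \<in> W" "y \<notin> W'" using less.prems by blast
    \<comment> \<open>The last iterate of \<open>y\<close> outside \<open>W'\<close> spans a line
      modulo \<open>W'\<close> that \<open>f\<close> kills, so adjoining it enlarges
      \<open>W'\<close> by one dimension and keeps it stable.\<close>
    define k where "k = (LEAST k. (f ^^ k) y \<in> W')"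
    have ex: "(f ^^ m) y \<in> W'" using nil[OF y(1)] less.prems(1) by (simp add: vec.subspace_0)
    have k: "(f ^^ k) y \<in> W'" unfolding k_def by (rule LeastI, rule ex)
    have "k \<noteq> 0" using k y by (cases k) auto
    then obtain j where j: "k = Suc j" by (cases k) auto
    define z where "z = (f ^^ j) y"
    have z': "z \<notin> W'" unfolding z_def using not_less_Least[of j "\<lambda>k. (f ^^ k) y \<in> W'"] j k_def by auto
    have fz: "f z \<in> W'" using k j by (simp add: z_def)
    have iter: "(f ^^ i) y \<in> W" for i by (induction i) (use y f in auto)
    then have zW: "z \<in> W" by (simp add: z_def)
    define W1 where "W1 = vec.span (insert z W')"
    have W1s: "vec.subspace W1" by (simp add: W1_def)
    have W1W: "W1 \<subseteq> W" unfolding W1_def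
      using zW less.prems assms(2) by (intro vec.span_minimal) auto
    have W1f: "f w \<in> W1" if "w \<in> W1" for w
    proof -
      have "\<exists>a. w - a *s z \<in> vec.span W'" using that unfolding W1_def by (simp add: vec.span_breakdown_eq)
      then obtain a where a: "w - a *s z \<in> W'" using less.prems(1) vec.span_eq_iff by metis
      have "f (w - a *s z) \<in> W'" "a *s f z \<in> W'" using a fz less.prems by (auto simp: vec.subspace_scale)
      then have "f (w - a *s z) + a *s f z \<in> W'" using less.prems(1) vec.subspace_add by blast
      then have "f w \<in> W'" by (simp add: vec.linear_diff[OF f(1)] vec.linear_scale[OF f(1)])
      then show ?thesis by (simp add: W1_def vec.span_base)
    qed
    have sub: "W' \<subset> W1"
    proof -
      have "W' \<subseteq> W1" unfolding W1_def using vec.span_superset by blast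
      moreover have "z \<in> W1" by (simp add: W1_def vec.span_base)
      ultimately show ?thesis using z' by blast
    qed
    have "vec.dim W' < vec.dim W1"
      using sub less.prems(1) W1s by (metis vec.dim_psubset vec.span_eq_iff)
    moreover have "vec.dim W1 \<le> vec.dim W" using W1W by (rule vec.dim_subset)
    ultimately have "vec.dim W - vec.dim W1 < vec.dim W - vec.dim W'" by simp
    from less.hyps[OF this W1s W1W W1f]
    obtain D \<eta> where D: "dual_system W1 W D \<eta>" "\<forall>d\<in>D. \<eta> d (f d) = 0" by blast
    obtain \<zeta> where \<zeta>: "Vector_Spaces.linear (*s) (*) \<zeta>" "\<forall>w\<in>W'. \<zeta> w = 0" "\<zeta> z = 1"
      using functional_separating[OF less.prems(1) z'] by blast
    have Dl: "Vector_Spaces.linear (*s) (*) (\<eta> d)" if "d \<in> D" for d using D that by (auto simp: dual_system_def)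
    have D1: "\<eta> d w = 0" if "d \<in> D" "w \<in> W1" for d w using D that by (auto simp: dual_system_def)
    have finD: "finite D" using D by (auto simp: dual_system_def)
    have zW1: "z \<in> W1" by (simp add: W1_def vec.span_base)
    have zD: "z \<notin> D"
    proof
      assume "z \<in> D"
      then have "\<eta> z z = 1" using D by (auto simp: dual_system_def)
      then show False using D1[OF \<open>z \<in> D\<close> zW1] by simp
    qed
    \<comment> \<open>\<open>\<zeta>\<close> need not vanish on \<open>D\<close>. Subtracting its
      values there restores duality, and on \<open>W1\<close> nothing changes because each
      \<open>\<eta> d\<close> vanishes on it.\<close>
    define \<zeta>' where "\<zeta>' w = \<zeta> w - (\<Sum>d\<in>D. \<zeta> d * \<eta> d w)" for w
    have l': "Vector_Spaces.linear (*s) (*) \<zeta>'"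
      by unfold_locales
        (auto simp: \<zeta>'_def functional_simps[OF \<zeta>(1)] functional_simps[OF Dl] algebra_simps sum.distrib
          sum_distrib_left cong: sum.cong)
    have \<zeta>'W: "\<zeta>' w = \<zeta> w" if "w \<in> W1" for w
      using that D1 by (simp add: \<zeta>'_def cong: sum.cong)
    have \<zeta>'D: "\<zeta>' d = 0" if "d \<in> D" for d
    proof -
      have "(\<Sum>e\<in>D. \<zeta> e * \<eta> e d) = (\<Sum>e\<in>D. if e = d then \<zeta> e else 0)"
        using that D by (intro sum.cong) (auto simp: dual_system_def)
      then show ?thesis using that finD by (simp add: \<zeta>'_def)
    qed
    define \<xi> where "\<xi> c = (if c = z then \<zeta>' else \<eta> c)" for c
    have \<xi>D: "\<xi> c = \<eta> c" if "c \<in> D" for c using that zD by (auto simp: \<xi>_def)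
    have \<xi>z: "\<xi> z = \<zeta>'" by (simp add: \<xi>_def)
    have "dual_system W' W (insert z D) \<xi>"
      unfolding dual_system_def
    proof (intro conjI ballI)
      show "finite (insert z D)" using finD by simp
      show "insert z D \<subseteq> W" using zW D by (auto simp: dual_system_def)
    next
      fix c assume "c \<in> insert z D"
      then show "Vector_Spaces.linear (*s) (*) (\<xi> c)" using l' Dl \<xi>D \<xi>z by auto
    next
      fix c w assume "c \<in> insert z D" "w \<in> W'"
      then show "\<xi> c w = 0" using \<zeta>(2) D1 sub \<zeta>'W \<xi>D \<xi>z by auto
    next
      fix c d assume "c \<in> insert z D" "d \<in> insert z D"
      then show "\<xi> c d = (if c = d then 1 else 0)"
        using \<zeta>'D \<zeta>'W[OF zW1] \<zeta>(3) D1[OF _ zW1] zD D(1) unfolding dual_system_def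
        by (auto simp: \<xi>D \<xi>z)
    next
      fix w assume w: "w \<in> W"
      let ?u = "w - (\<Sum>d\<in>D. \<eta> d w *s d)"
      have u: "?u \<in> W1" using D w by (auto simp: dual_system_def)
      then have "\<exists>a. ?u - a *s z \<in> vec.span W'" unfolding W1_def by (simp add: vec.span_breakdown_eq)
      then obtain a where a: "?u - a *s z \<in> W'" using less.prems(1) vec.span_eq_iff by metis
      have "\<zeta>' (?u - a *s z) = 0" using a sub \<zeta>'W \<zeta>(2) by auto
      then have "\<zeta>' ?u = a" using \<zeta>'W[OF zW1] \<zeta>(3) by (simp add: functional_simps[OF l'])
      moreover have "\<zeta>' ?u = \<zeta>' w"
        using \<zeta>'D by (simp add: functional_simps[OF l'] cong: sum.cong)
      ultimately have "a = \<zeta>' w" by simp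
      moreover have "(\<Sum>c\<in>insert z D. \<xi> c w *s c) = \<zeta>' w *s z + (\<Sum>d\<in>D. \<eta> d w *s d)"
        using finD zD by (simp add: \<xi>z \<xi>D cong: sum.cong)
      ultimately show "w - (\<Sum>c\<in>insert z D. \<xi> c w *s c) \<in> W'"
        using a by (simp add: algebra_simps)
    qed
    moreover have "\<forall>c\<in>insert z D. \<xi> c (f c) = 0"
      using D(2) \<xi>D \<xi>z fz sub \<zeta>'W \<zeta>(2) by auto
    ultimately show ?thesis by blast
  qed
qed

lemma dual_system_trace_nilpotent:
  fixes f :: "'k::field^'n \<Rightarrow> 'k^'n"
  assumes "vec.subspace W'" "vec.subspace W" "W' \<subseteq> W"
    and "Vector_Spaces.linear (*s) (*s) f" "\<And>w. w \<in> W \<Longrightarrow> f w \<in> W" "\<And>w. w \<in> W' \<Longrightarrow> f w \<in> W'"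
    and "\<And>w. w \<in> W \<Longrightarrow> (f ^^ m) w = 0" and "dual_system W' W C \<xi>"
  shows "(\<Sum>c\<in>C. \<xi> c (f c)) = 0"
proof -
  obtain D \<eta> where "dual_system W' W D \<eta>" "\<forall>d\<in>D. \<eta> d (f d) = 0"
    using dual_system_nilpotent[OF assms(1-7)] by blast
  then show ?thesis using dual_system_trace_indep[OF assms(8) _ assms(4-6)] by simp
qed

section \<open>The vectors p(f) y and eigenvectors modulo a subspace\<close>

definition poly_op :: "('k::field^'n \<Rightarrow> 'k^'n) \<Rightarrow> 'k^'n \<Rightarrow> 'k poly \<Rightarrow> 'k^'n" where
  "poly_op f y p = fold_coeffs (\<lambda>a b. a *s y + f b) p 0"

context
  fixes f :: "'k::field^'n \<Rightarrow> 'k^'n"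
  assumes f: "Vector_Spaces.linear (*s) (*s) f"
begin

lemma poly_op_0: "poly_op f y 0 = 0"
  by (simp add: poly_op_def)

lemma poly_op_pCons: "poly_op f y (pCons a p) = a *s y + f (poly_op f y p)"
  by (cases "a = 0 \<and> p = 0") (auto simp: poly_op_def vec.linear_0[OF f])

lemma poly_op_add: "poly_op f y (p + q) = poly_op f y p + poly_op f y q"
  by (induction p q rule: poly_induct2)
    (auto simp: poly_op_0 poly_op_pCons vec.linear_add[OF f] algebra_simps vec.scale_left_distrib)

lemma poly_op_smult: "poly_op f y (smult c p) = c *s poly_op f y p"
  by (induction p)
    (auto simp: poly_op_0 poly_op_pCons vec.linear_scale[OF f] vec.scale_right_distrib)

lemma poly_op_monom: "poly_op f y (monom c i) = c *s (f ^^ i) y"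
  by (induction i)
    (auto simp: monom_0 monom_Suc poly_op_0 poly_op_pCons vec.linear_scale[OF f] vec.linear_0[OF f])

lemma poly_op_sum: "poly_op f y (\<Sum>i\<in>I. p i) = (\<Sum>i\<in>I. poly_op f y (p i))"
  by (induction I rule: infinite_finite_induct) (auto simp: poly_op_0 poly_op_add)

lemma poly_op_in:
  assumes "vec.subspace U" "\<And>u. u \<in> U \<Longrightarrow> f u \<in> U" "y \<in> U"
  shows "poly_op f y p \<in> U"
  using assms by (induction p) (auto simp: poly_op_0 poly_op_pCons vec.subspace_0 vec.subspace_add vec.subspace_scale)

lemma poly_op_annihilator: "\<exists>p. p \<noteq> 0 \<and> poly_op f y p = 0"
proof (cases "inj_on (\<lambda>i. (f ^^ i) y) {..CARD('n)}")
  case False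
  then obtain i j where ij: "i \<noteq> j" "(f ^^ i) y = (f ^^ j) y" by (auto simp: inj_on_def)
  let ?p = "monom 1 i + monom (-1) j :: 'k poly"
  have "coeff ?p i = 1" using ij by simp
  then have "?p \<noteq> 0" by (metis coeff_0 zero_neq_one)
  moreover have "poly_op f y ?p = 0" using ij by (simp add: poly_op_add poly_op_monom vec.scale_minus_left)
  ultimately show ?thesis by blast
next
  case True
  let ?X = "(\<lambda>i. (f ^^ i) y) ` {..CARD('n)}"
  have "card ?X = Suc (CARD('n))" using True by (simp add: card_image)
  then have "vec.dependent ?X"
    using vec.independent_bound_general[of ?X] dim_subset_UNIV_cart_gen[of ?X] by linarith
  then obtain u v where u: "v \<in> ?X" "u v \<noteq> 0" "(\<Sum>v\<in>?X. u v *s v) = 0"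
    using vec.dependent_finite[of ?X] by auto
  then obtain j where j: "j \<le> CARD('n)" "v = (f ^^ j) y" by auto
  let ?p = "\<Sum>i\<le>CARD('n). monom (u ((f ^^ i) y)) i"
  have "coeff ?p j = u v" using j by (simp add: coeff_sum)
  then have "?p \<noteq> 0" using u by (metis coeff_0)
  moreover have "poly_op f y ?p = 0"
    using u(3) True by (simp add: poly_op_sum poly_op_monom sum.reindex)
  ultimately show ?thesis by blast
qed

end

text \<open>Take \<open>p\<close> of least degree with p(f) y in \<open>W\<close>. It is nonconstant
  because \<open>y\<close> lies outside \<open>W\<close>, so it has a root \<mu>. With p = (X -
  \<mu>) q the vector q(f) y remains outside \<open>W\<close> by minimality, and f - \<mu> sends it
  into \<open>W\<close>.\<close>

lemma eigenvector_mod: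
  fixes f :: "'k::alg_closed_field^'n \<Rightarrow> 'k^'n"
  assumes f: "Vector_Spaces.linear (*s) (*s) f"
    and U: "vec.subspace U" "\<And>u. u \<in> U \<Longrightarrow> f u \<in> U"
    and W: "vec.subspace W"
    and y: "y \<in> U" "y \<notin> W"
  obtains \<mu> z where "z \<in> U" "z \<notin> W" "f z - \<mu> *s z \<in> W"
proof -
  have "\<exists>p. p \<noteq> 0 \<and> poly_op f y p \<in> W"
    using poly_op_annihilator[OF f, of y] W by (metis vec.subspace_0)
  then obtain p where p: "p \<noteq> 0" "poly_op f y p \<in> W"
    and least: "\<And>q. q \<noteq> 0 \<and> poly_op f y q \<in> W \<Longrightarrow> degree p \<le> degree q"
    using ex_has_least_nat[of "\<lambda>p. p \<noteq> 0 \<and> poly_op f y p \<in> W" _ degree] by blast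
  have "degree p > 0"
  proof (rule ccontr)
    assume "\<not> degree p > 0"
    then obtain a where a: "p = [:a:]" using degree_eq_zeroE by blast
    then have "a *s y \<in> W" "a \<noteq> 0"
      using p by (auto simp: poly_op_pCons[OF f] poly_op_0[OF f] vec.linear_0[OF f])
    then have "inverse a *s (a *s y) \<in> W" using W vec.subspace_scale by blast
    then show False using y \<open>a \<noteq> 0\<close> by simp
  qed
  then obtain \<mu> where "poly p \<mu> = 0" using alg_closed_imp_poly_has_root by blast
  then obtain q where q: "p = [:-\<mu>, 1:] * q" by (auto simp: poly_eq_0_iff_dvd dvd_def)
  have q0: "q \<noteq> 0" using p q by auto
  have "degree p = Suc (degree q)"
    by (subst q, subst degree_mult_eq) (use q0 in auto)
  then have "poly_op f y q \<notin> W" using least[of q] q0 by auto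
  moreover have "poly_op f y q \<in> U" using poly_op_in[OF f U y(1)] .
  moreover have "poly_op f y p = f (poly_op f y q) - \<mu> *s poly_op f y q"
  proof -
    have "p = pCons 0 q + smult (-\<mu>) q" by (simp add: q)
    then show ?thesis
      by (simp only: poly_op_add[OF f] poly_op_smult[OF f] poly_op_pCons[OF f]) (simp add: vec.scale_minus_left)
  qed
  ultimately show ?thesis using p that by metis
qed

text \<open>Rank-nullity for the map induced on \<open>U/W\<close>, phrased without the quotient. A
  basis of \<open>W\<close> is extended by \<open>z\<close> and then to a basis of \<open>U\<close>;
  modulo \<open>W\<close> neither \<open>z\<close> nor the basis of \<open>W\<close> contributes to
  the image.\<close>

lemma dim_drop_mod:
  fixes f :: "'k::field^'n \<Rightarrow> 'k^'n"
  assumes f: "Vector_Spaces.linear (*s) (*s) f"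
    and U: "vec.subspace U" and W: "vec.subspace W" "W \<subseteq> U" "\<And>w. w \<in> W \<Longrightarrow> f w \<in> W"
    and z: "z \<in> U" "z \<notin> W" "f z \<in> W"
  shows "vec.dim (f ` U \<union> W) < vec.dim U"
proof -
  obtain B where B: "B \<subseteq> W" "vec.independent B" "vec.span B = W"
    using vec.basis_exists[of W] W(1) by (metis vec.span_eq_iff vec.span_mono subset_antisym)
  have ind: "vec.independent (insert z B)"
    using B z by (simp add: vec.independent_insertI)
  obtain E where E: "insert z B \<subseteq> E" "E \<subseteq> U" "vec.independent E" "U \<subseteq> vec.span E"
    using vec.maximal_independent_subset_extend[OF _ ind, of U] B W z by blast
  have finE: "finite E" using E(3) vec.independent_bound_general by blast
  have spanE: "vec.span E = U" using E U by (metis subset_antisym vec.span_minimal)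
  let ?F = "B \<union> f ` (E - insert z B)"
  have fE: "f e \<in> vec.span ?F" if "e \<in> E" for e
  proof -
    have WF: "W \<subseteq> vec.span ?F" using B(3) vec.span_mono[of B ?F] by auto
    consider "e \<in> B" | "e = z" | "e \<in> E - insert z B" using \<open>e \<in> E\<close> by auto
    then show ?thesis
    proof cases
      case 1 then show ?thesis using W(3) B(1) WF by blast
    next
      case 2 then show ?thesis using z WF by blast
    next
      case 3 then show ?thesis by (intro vec.span_base) blast
    qed
  qed
  have "f ` U = vec.span (f ` E)" using spanE vec.linear_span_image[OF f] by metis
  also have "\<dots> \<subseteq> vec.span ?F" using fE by (intro vec.span_minimal) auto
  finally have "f ` U \<union> W \<subseteq> vec.span ?F" using B(3) vec.span_mono[of B ?F] by auto
  then have "vec.dim (f ` U \<union> W) \<le> card ?F"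
    using finE E(1) by (intro vec.dim_le_card) (auto intro: finite_subset)
  also have "\<dots> \<le> card B + card (E - insert z B)"
    using finE by (metis card_Un_le card_image_le add_left_mono order_trans finite_Diff)
  also have "\<dots> = card B + (card E - Suc (card B))"
    using finE E(1) B z by (subst card_Diff_subset) (auto intro: finite_subset simp: card_insert_if finite_subset)
  also have "\<dots> < card E"
  proof -
    have "z \<notin> B" using B z by blast
    then have "card (insert z B) = Suc (card B)" using finE E(1) by (metis card_insert_disjoint finite_insert finite_subset)
    then have "Suc (card B) \<le> card E" using finE E(1) card_mono by metis
    then show ?thesis by simp
  qed
  also have "card E = vec.dim U" using spanE E by (metis vec.dim_eq_card vec.span_eq_iff U)
  finally show ?thesis .
qed

section \<open>Unipotent monoids over an algebraically closed field\<close>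

locale unipotent_monoid =
  fixes S :: "('k::alg_closed_field^'n^'n) set"
  assumes one: "mat 1 \<in> S"
    and mult: "g \<in> S \<Longrightarrow> h \<in> S \<Longrightarrow> g ** h \<in> S"
    and unip: "g \<in> S \<Longrightarrow> unipotent g"
begin

definition invariant :: "('k^'n) set \<Rightarrow> bool" where
  "invariant W \<longleftrightarrow> vec.subspace W \<and> (\<forall>g\<in>S. \<forall>w\<in>W. g *v w \<in> W)"

text \<open>The linear span of \<open>S\<close>, which is its enveloping algebra because
  \<open>S\<close> is closed under products. Generation by sums and scalars alone permits linear
  arguments, such as those on traces, by induction.\<close>

inductive_set ops :: "('k^'n \<Rightarrow> 'k^'n) set" where
  gen: "g \<in> S \<Longrightarrow> (\<lambda>x. g *v x) \<in> ops"
| add: "f \<in> ops \<Longrightarrow> h \<in> ops \<Longrightarrow> (\<lambda>x. f x + h x) \<in> ops"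
| scale: "f \<in> ops \<Longrightarrow> (\<lambda>x. c *s f x) \<in> ops"

lemma ops_linear: "f \<in> ops \<Longrightarrow> Vector_Spaces.linear (*s) (*s) f"
  by (induction rule: ops.induct)
    (auto intro: matrix_vector_mul_linear_gen vec.linear_compose_add vec.linear_compose_scale_right)

lemma ops_in: "f \<in> ops \<Longrightarrow> invariant W \<Longrightarrow> w \<in> W \<Longrightarrow> f w \<in> W"
  by (induction rule: ops.induct) (auto simp: invariant_def vec.subspace_add vec.subspace_scale)

lemma ops_gen_comp: "h \<in> ops \<Longrightarrow> g \<in> S \<Longrightarrow> (\<lambda>x. g *v h x) \<in> ops"
proof (induction rule: ops.induct)
  case (gen h)
  then show ?case using ops.gen[OF mult[of g h]] by (simp add: matrix_vector_mul_assoc)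
qed (auto simp: matrix_vector_right_distrib vec.scale intro: ops.intros)

lemma ops_comp: "f \<in> ops \<Longrightarrow> h \<in> ops \<Longrightarrow> (\<lambda>x. f (h x)) \<in> ops"
  by (induction rule: ops.induct) (auto intro: ops.intros ops_gen_comp)

lemma ops_id: "(\<lambda>x. x) \<in> ops"
proof -
  have "(*v) (mat 1) = (\<lambda>x :: 'k^'n. x)" by auto
  then show ?thesis using ops.gen[OF one] by simp
qed

lemma orbit_invariant: "invariant ((\<lambda>f. f x) ` ops)"
  unfolding invariant_def
proof (intro conjI ballI)
  have "(\<lambda>x. 0 *s x) \<in> ops" by (intro ops.scale ops_id)
  then show "vec.subspace ((\<lambda>f. f x) ` ops)"
    unfolding vec.subspace_def
    by (auto intro: ops.intros rev_image_eqI)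
qed (auto intro: ops_gen_comp rev_image_eqI)

lemma invariant_sum:
  assumes "invariant U" "invariant W"
  shows "invariant {u + w | u w. u \<in> U \<and> w \<in> W}"
  unfolding invariant_def
proof (intro conjI ballI)
  show "vec.subspace {u + w | u w. u \<in> U \<and> w \<in> W}"
    using assms vec.subspace_sums by (auto simp: invariant_def)
next
  fix g x assume "g \<in> S" "x \<in> {u + w | u w. u \<in> U \<and> w \<in> W}"
  then show "g *v x \<in> {u + w | u w. u \<in> U \<and> w \<in> W}"
    using assms unfolding invariant_def by (force simp: matrix_vector_right_distrib)
qed

lemma span_augmentation_invariant:
  assumes "invariant W"
  shows "invariant (vec.span {g *v w - w | g w. g \<in> S \<and> w \<in> W})"
  unfolding invariant_def
proof (intro conjI ballI)
  let ?X = "{g *v w - w | g w. g \<in> S \<and> w \<in> W}"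
  fix h x assume h: "h \<in> S" and x: "x \<in> vec.span ?X"
  from x show "h *v x \<in> vec.span ?X"
  proof (induction rule: vec.span_induct)
    case base
    then show ?case
      by (auto simp: vec.subspace_def matrix_vector_right_distrib vec.scale vec.span_add vec.span_scale vec.span_zero)
  next
    case (step x)
    then obtain g w where g: "x = g *v w - w" "g \<in> S" "w \<in> W" by blast
    have "h *v x = ((h ** g) *v w - w) - (h *v w - w)"
      by (simp add: g vec.diff matrix_vector_mul_assoc)
    moreover have "(h ** g) *v w - w \<in> ?X" "h *v w - w \<in> ?X" using mult[OF h g(2)] g h by auto
    ultimately show ?case by (metis (no_types, lifting) vec.span_base vec.span_diff)
  qed
qed simp

text \<open>Burnside's lemma: \<open>W/W'\<close> is irreducible and \<open>T\<close> is an element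
  of the enveloping algebra of least nonzero rank on it. If that rank exceeded one, an eigenvalue of
  an operator on the image of \<open>T\<close> would yield an element of smaller nonzero
  rank.\<close>

lemma rank_one_mod:
  assumes W: "invariant W" and W': "invariant W'" "W' \<subset> W"
    and max: "\<And>Y. invariant Y \<Longrightarrow> W' \<subseteq> Y \<Longrightarrow> Y \<subseteq> W \<Longrightarrow> Y = W' \<or> Y = W"
  obtains T x where "T \<in> ops" "x \<in> W" "T x \<notin> W'" "\<And>w. w \<in> W \<Longrightarrow> \<exists>a. T w - a *s T x \<in> W'"
proof -
  \<comment> \<open>This is the rank of \<open>T\<close> on \<open>W/W'\<close> shifted by the
    dimension of \<open>W'\<close>; only comparisons matter.\<close>
  define rk where "rk T = vec.dim (T ` W \<union> W')" for T :: "'k^'n \<Rightarrow> 'k^'n"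
  have sW: "vec.subspace W" "vec.subspace W'" using W W' by (auto simp: invariant_def)
  obtain y where y: "y \<in> W" "y \<notin> W'" using W' by blast
  have "\<exists>T. T \<in> ops \<and> (\<exists>x\<in>W. T x \<notin> W')" using ops_id y by blast
  then obtain T where T: "T \<in> ops" "\<exists>x\<in>W. T x \<notin> W'"
    and least: "\<And>R. R \<in> ops \<and> (\<exists>x\<in>W. R x \<notin> W') \<Longrightarrow> rk T \<le> rk R"
    using ex_has_least_nat[of "\<lambda>T. T \<in> ops \<and> (\<exists>x\<in>W. T x \<notin> W')" _ rk] by blast
  from T obtain x where x: "x \<in> W" "T x \<notin> W'" by blast
  have lT: "Vector_Spaces.linear (*s) (*s) T" by (rule ops_linear, rule T)
  have "\<exists>a. T w - a *s T x \<in> W'" if w: "w \<in> W" for w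
  proof (rule ccontr)
    assume no: "\<not> (\<exists>a. T w - a *s T x \<in> W')"
    let ?O = "(\<lambda>f. f (T x)) ` ops"
    let ?Y = "{u + v | u v. u \<in> ?O \<and> v \<in> W'}"
    have Tx: "T x \<in> W" using ops_in T W x by blast
    have "invariant ?Y" by (rule invariant_sum[OF orbit_invariant W'(1)])
    moreover have "W' \<subseteq> ?Y"
    proof
      fix v assume "v \<in> W'"
      moreover have "0 \<in> ?O" using orbit_invariant[of "T x"] vec.subspace_0 unfolding invariant_def by blast
      ultimately show "v \<in> ?Y" by force
    qed
    moreover have "?Y \<subseteq> W" using ops_in[OF _ W Tx] W' sW vec.subspace_add by blast
    moreover have "?Y \<noteq> W'"
    proof -
      have "T x \<in> ?O" using ops_id by (auto intro: rev_image_eqI)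
      then have "T x + 0 \<in> ?Y" using vec.subspace_0[OF sW(2)] by blast
      then show ?thesis using x by auto
    qed
    ultimately have "?Y = W" using max by blast
    then have "w \<in> ?Y" using w by simp
    \<comment> \<open>By irreducibility the orbit of \<open>T x\<close> fills \<open>W\<close>
      modulo \<open>W'\<close>, so some \<open>R\<close> carries \<open>T x\<close> to
      \<open>w\<close>. The operator T R acts on the image of \<open>T\<close>, where it has an
      eigenvalue modulo \<open>W'\<close>.\<close>
    then obtain R v where R: "R \<in> ops" "v \<in> W'" "w = R (T x) + v" by blast
    have lR: "Vector_Spaces.linear (*s) (*s) R" by (rule ops_linear, rule R)
    define f where "f u = T (R u)" for u
    have fops: "f \<in> ops" unfolding f_def by (rule ops_comp[OF T(1) R(1)])
    have lf: "Vector_Spaces.linear (*s) (*s) f" by (rule ops_linear, rule fops)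
    define U where "U = {u + v | u v. u \<in> T ` W \<and> v \<in> W'}"
    have sTW: "vec.subspace (T ` W)" using vec.linear_subspace_image[OF lT sW(1)] .
    have sU: "vec.subspace U" unfolding U_def using vec.subspace_sums[OF sTW sW(2)] by simp
    have fW': "f v \<in> W'" if "v \<in> W'" for v using ops_in[OF fops W'(1) that] .
    have RW: "R v \<in> W" if "v \<in> W" for v using ops_in[OF R(1) W that] .
    have UW: "U \<subseteq> W" unfolding U_def using ops_in[OF T(1) W] W'(2) sW vec.subspace_add by blast
    have W'U: "W' \<subseteq> U"
    proof
      fix v assume "v \<in> W'"
      then have "0 + v \<in> U" unfolding U_def using vec.subspace_0[OF sTW] by blast
      then show "v \<in> U" by simp
    qed
    have TWU: "T ` W \<subseteq> U"
    proof
      fix u assume "u \<in> T ` W"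
      then have "u + 0 \<in> U" unfolding U_def using vec.subspace_0[OF sW(2)] by blast
      then show "u \<in> U" by simp
    qed
    have fU: "f u \<in> U" if "u \<in> U" for u
      using that TWU RW UW unfolding f_def by blast
    obtain \<mu> z where z: "z \<in> U" "z \<notin> W'" "f z - \<mu> *s z \<in> W'"
      using eigenvector_mod[OF lf sU fU sW(2) _ x(2)] TWU x(1) by blast
    \<comment> \<open>\<open>h\<close> kills the eigenvector \<open>z\<close> modulo
      \<open>W'\<close> and so lowers the rank on \<open>U\<close>. It does not kill
      \<open>T x\<close>: modulo \<open>W'\<close> its value there is T w - \<mu> T x, nonzero by
      the choice of \<open>w\<close>.\<close>
    define h where "h u = f u + (-\<mu>) *s u" for u
    have hops: "h \<in> ops" unfolding h_def using ops.add[OF fops ops.scale[OF ops_id]] .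
    have lh: "Vector_Spaces.linear (*s) (*s) h" by (rule ops_linear, rule hops)
    have hz: "h z \<in> W'" using z(3) by (simp add: h_def)
    have hW': "h v \<in> W'" if "v \<in> W'" for v using ops_in[OF hops W'(1) that] .
    have d1: "vec.dim (h ` U \<union> W') < vec.dim U"
      by (rule dim_drop_mod[OF lh sU sW(2) W'U hW' z(1,2) hz])
    have R'ops: "(\<lambda>u. h (T u)) \<in> ops" by (rule ops_comp[OF hops T(1)])
    have "h (T x) \<notin> W'"
    proof
      assume "h (T x) \<in> W'"
      moreover have "h (T x) = T (w - v) + (-\<mu>) *s T x" by (simp add: h_def f_def R(3))
      moreover have "T v \<in> W'" using ops_in[OF T(1) W'(1) R(2)] .
      ultimately have "T (w - v) + (-\<mu>) *s T x + T v \<in> W'" using sW(2) vec.subspace_add by metis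
      then have "T w - \<mu> *s T x \<in> W'" by (simp add: vec.linear_diff[OF lT])
      then show False using no by blast
    qed
    then have "rk T \<le> rk (\<lambda>u. h (T u))" using least R'ops x(1) by blast
    also have "\<dots> \<le> vec.dim (h ` U \<union> W')"
      unfolding rk_def by (rule vec.dim_subset) (use TWU in auto)
    also have "\<dots> < vec.dim U" by (rule d1)
    also have "\<dots> \<le> rk T"
    proof -
      have "U \<subseteq> vec.span (T ` W \<union> W')"
        unfolding U_def by (auto intro!: vec.span_add intro: vec.span_base)
      then have "vec.dim U \<le> vec.dim (vec.span (T ` W \<union> W'))" by (rule vec.dim_subset)
      then show ?thesis by (simp add: rk_def vec.dim_span)
    qed
    finally show False by simp
  qed
  then show ?thesis using that T(1) x by blast
qed

lemma unipotent_iterate: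
  fixes g :: "'k^'n^'n"
  assumes "unipotent g"
  obtains m where "\<And>w. ((\<lambda>x. (g - mat 1) *v x) ^^ m) w = 0"
proof -
  from assms obtain m where m: "((\<lambda>B. (g - mat 1) ** B) ^^ m) (mat 1) = 0"
    by (auto simp: unipotent_def)
  have "((\<lambda>x. (g - mat 1) *v x) ^^ j) w = ((\<lambda>B. (g - mat 1) ** B) ^^ j) (mat 1) *v w" for j w
    by (induction j) (simp_all add: matrix_vector_mul_assoc)
  then have "((\<lambda>x. (g - mat 1) *v x) ^^ m) w = 0" for w by (simp only: m) simp
  then show ?thesis by (rule that)
qed

text \<open>On the irreducible quotient each element of \<open>S\<close> has the dimension as its
  trace, since g - 1 is nilpotent. Hence g f and f have the same trace for every \<open>f\<close> in
  the enveloping algebra. Operators of rank one turn these equalities of traces into equalities of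
  vectors modulo \<open>W'\<close>.\<close>

lemma augmentation_in_maximal:
  assumes W: "invariant W" and W': "invariant W'" "W' \<subset> W"
    and max: "\<And>Y. invariant Y \<Longrightarrow> W' \<subseteq> Y \<Longrightarrow> Y \<subseteq> W \<Longrightarrow> Y = W' \<or> Y = W"
    and g: "g \<in> S" and w: "w \<in> W"
  shows "g *v w - w \<in> W'"
proof -
  obtain T x where T: "T \<in> ops" "x \<in> W" "T x \<notin> W'" "\<And>w. w \<in> W \<Longrightarrow> \<exists>a. T w - a *s T x \<in> W'"
    using rank_one_mod[OF W W' max] by blast
  have lT: "Vector_Spaces.linear (*s) (*s) T" by (rule ops_linear, rule T)
  have sW: "vec.subspace W" "vec.subspace W'" using W W' by (auto simp: invariant_def)
  have l0: "Vector_Spaces.linear (*s) (*s) (\<lambda>x::'k^'n. 0::'k^'n)" by (simp add: vec.linear_zero)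
  \<comment> \<open>Any dual system will do, so it is obtained from the zero operator, which is
    nilpotent with exponent 1.\<close>
  obtain C \<xi> where C: "dual_system W' W C \<xi>"
    using dual_system_nilpotent[OF sW(2,1) _ l0, of 1] W' sW vec.subspace_0 by auto
  have l\<xi>: "Vector_Spaces.linear (*s) (*) (\<xi> c)" if "c \<in> C" for c using C that by (auto simp: dual_system_def)
  have \<xi>W: "\<xi> c u = 0" if "c \<in> C" "u \<in> W'" for c u using C that by (auto simp: dual_system_def)
  have CW: "c \<in> W" if "c \<in> C" for c using C that by (auto simp: dual_system_def)
  define tr where "tr f = (\<Sum>c\<in>C. \<xi> c (f c))" for f :: "'k^'n \<Rightarrow> 'k^'n"
  have tr_gen: "tr (\<lambda>x. h *v x) = of_nat (card C)" if h: "h \<in> S" for h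
  proof -
    obtain m where m: "\<And>w. ((\<lambda>x. (h - mat 1) *v x) ^^ m) w = 0"
      using unipotent_iterate[OF unip[OF h]] by blast
    have "(\<Sum>c\<in>C. \<xi> c ((h - mat 1) *v c)) = 0"
    proof (rule dual_system_trace_nilpotent[OF sW(2,1) _ _ _ _ m C])
      show "W' \<subseteq> W" using W' by blast
      show "Vector_Spaces.linear (*s) (*s) (\<lambda>x. (h - mat 1) *v x)" by (rule matrix_vector_mul_linear_gen)
    qed (use h W W' in \<open>auto simp: matrix_vector_mult_diff_rdistrib vec.subspace_diff invariant_def\<close>)
    moreover have "\<xi> c ((h - mat 1) *v c) = \<xi> c (h *v c) - 1" if "c \<in> C" for c
      using that C by (simp add: matrix_vector_mult_diff_rdistrib functional_simps[OF l\<xi>] dual_system_def)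
    ultimately show ?thesis by (simp add: tr_def sum_subtractf)
  qed
  have tr_comp: "tr (\<lambda>x. h *v f x) = tr f" if "f \<in> ops" "h \<in> S" for f h
    using that
  proof (induction rule: ops.induct)
    case (gen g)
    then show ?case using tr_gen[OF mult[of h g]] tr_gen[of g] by (simp add: matrix_vector_mul_assoc)
  next
    case (add f1 f2)
    then show ?case
      by (simp add: tr_def matrix_vector_right_distrib functional_simps[OF l\<xi>] sum.distrib cong: sum.cong)
  next
    case (scale f1 c)
    then show ?case
      by (simp add: tr_def vec.scale functional_simps[OF l\<xi>] flip: sum_distrib_left cong: sum.cong)
  qed
  \<comment> \<open>\<open>\<phi>\<close> is the functional through which \<open>T\<close> acts: T w
    is \<phi>(w) T x modulo \<open>W'\<close>. The trace of R T is therefore \<phi>(R (T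
    x)).\<close>
  define \<phi> where "\<phi> w = (SOME a. T w - a *s T x \<in> W')" for w
  have \<phi>: "T w - \<phi> w *s T x \<in> W'" if "w \<in> W" for w
    unfolding \<phi>_def using T(4)[OF that] by (rule someI_ex)
  have uniq: "a = b" if "u - a *s T x \<in> W'" "u - b *s T x \<in> W'" for a b u
  proof (rule ccontr)
    assume "a \<noteq> b"
    have "(u - b *s T x) - (u - a *s T x) \<in> W'" using that sW(2) vec.subspace_diff by blast
    then have "(a - b) *s T x \<in> W'" by (simp add: vec.scale_left_diff_distrib)
    then have "inverse (a - b) *s ((a - b) *s T x) \<in> W'" using sW(2) vec.subspace_scale by blast
    then show False using \<open>a \<noteq> b\<close> T(3) by simp
  qed
  have \<phi>_sum: "\<phi> (\<Sum>c\<in>C. a c *s c) = (\<Sum>c\<in>C. a c * \<phi> c)" for a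
  proof (rule uniq)
    show "T (\<Sum>c\<in>C. a c *s c) - \<phi> (\<Sum>c\<in>C. a c *s c) *s T x \<in> W'"
      by (intro \<phi> vec.subspace_sum[OF sW(1)] vec.subspace_scale[OF sW(1)] CW)
    have "(\<Sum>c\<in>C. a c *s (T c - \<phi> c *s T x)) \<in> W'"
      by (intro vec.subspace_sum[OF sW(2)] vec.subspace_scale[OF sW(2)] \<phi> CW)
    then show "T (\<Sum>c\<in>C. a c *s c) - (\<Sum>c\<in>C. a c * \<phi> c) *s T x \<in> W'"
      by (simp add: vec.linear_sum[OF lT] vec.linear_scale[OF lT] vec.scale_right_diff_distrib sum_subtractf
        vec.scale_sum_left)
  qed
  have \<phi>_mod: "\<phi> u = \<phi> v" if "u \<in> W" "v \<in> W" "u - v \<in> W'" for u v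
  proof (rule uniq[OF \<phi>[OF that(1)]])
    have "T (u - v) \<in> W'" using ops_in[OF T(1) W'(1) that(3)] .
    then have "(T v - \<phi> v *s T x) + T (u - v) \<in> W'" using \<phi>[OF that(2)] sW(2) vec.subspace_add by blast
    then show "T u - \<phi> v *s T x \<in> W'" by (simp add: vec.linear_diff[OF lT])
  qed
  have tr_rank_one: "tr (\<lambda>w. R (T w)) = \<phi> (R (T x))" if R: "R \<in> ops" for R
  proof -
    have lR: "Vector_Spaces.linear (*s) (*s) R" by (rule ops_linear, rule R)
    have RW: "R (T x) \<in> W" using ops_in[OF R W] ops_in[OF T(1) W T(2)] by blast
    have "\<xi> c (R (T c)) = \<phi> c * \<xi> c (R (T x))" if c: "c \<in> C" for c
    proof -
      have "R (T c - \<phi> c *s T x) \<in> W'" using ops_in[OF R W'(1)] \<phi>[OF CW[OF c]] by blast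
      then have "\<xi> c (R (T c - \<phi> c *s T x)) = 0" using \<xi>W c by blast
      then show ?thesis
        by (simp add: vec.linear_diff[OF lR] vec.linear_scale[OF lR] functional_simps[OF l\<xi>[OF c]])
    qed
    then have "tr (\<lambda>w. R (T w)) = (\<Sum>c\<in>C. \<xi> c (R (T x)) * \<phi> c)"
      unfolding tr_def by (simp add: mult.commute)
    also have "\<dots> = \<phi> (\<Sum>c\<in>C. \<xi> c (R (T x)) *s c)" by (simp add: \<phi>_sum)
    also have "\<dots> = \<phi> (R (T x))"
    proof (rule \<phi>_mod[symmetric, OF RW])
      show "(\<Sum>c\<in>C. \<xi> c (R (T x)) *s c) \<in> W"
        by (intro vec.subspace_sum[OF sW(1)] vec.subspace_scale[OF sW(1)] CW)
      show "R (T x) - (\<Sum>c\<in>C. \<xi> c (R (T x)) *s c) \<in> W'" using C RW by (auto simp: dual_system_def)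
    qed
    finally show ?thesis .
  qed
  text \<open>By irreducibility of \<open>W/W'\<close> every vector is \<open>R (T x)\<close> modulo \<open>W'\<close>.\<close>
  have Tg: "T (h *v u - u) \<in> W'" if h: "h \<in> S" and u: "u \<in> W" for h u
  proof -
    let ?O = "(\<lambda>f. f (T x)) ` ops"
    let ?Y = "{u + v | u v. u \<in> ?O \<and> v \<in> W'}"
    have Tx: "T x \<in> W" using ops_in T W by blast
    have "invariant ?Y" by (rule invariant_sum[OF orbit_invariant W'(1)])
    moreover have "W' \<subseteq> ?Y"
    proof
      fix v assume "v \<in> W'"
      moreover have "0 \<in> ?O" using orbit_invariant[of "T x"] vec.subspace_0 unfolding invariant_def by blast
      ultimately show "v \<in> ?Y" by force
    qed
    moreover have "?Y \<subseteq> W" using ops_in[OF _ W Tx] W' sW vec.subspace_add by blast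
    moreover have "?Y \<noteq> W'"
    proof -
      have "T x \<in> ?O" using ops_id by (auto intro: rev_image_eqI)
      then have "T x + 0 \<in> ?Y" using vec.subspace_0[OF sW(2)] by blast
      then show ?thesis using T(3) by auto
    qed
    ultimately have "?Y = W" using max by blast
    then obtain R v where R: "R \<in> ops" "v \<in> W'" "u = R (T x) + v" using u by blast
    have hu: "h *v u \<in> W" using W h u by (auto simp: invariant_def)
    have RW: "R (T x) \<in> W" using ops_in[OF R(1) W Tx] .
    have hRW: "h *v R (T x) \<in> W" using W h RW by (auto simp: invariant_def)
    have hv: "h *v v \<in> W'" using W' h R(2) by (auto simp: invariant_def)
    have "\<phi> (h *v u) = \<phi> (h *v R (T x))"
      using R(3) hv by (intro \<phi>_mod hu hRW) (simp add: matrix_vector_right_distrib)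
    also have "\<dots> = tr (\<lambda>w. h *v R (T w))"
      using tr_rank_one[OF ops_gen_comp[OF R(1) h]] by simp
    also have "\<dots> = tr (\<lambda>w. R (T w))" using tr_comp[OF ops_comp[OF R(1) T(1)] h] .
    also have "\<dots> = \<phi> (R (T x))" by (rule tr_rank_one[OF R(1)])
    also have "\<dots> = \<phi> u" using R(2,3) by (intro \<phi>_mod[symmetric] u RW) simp
    finally have "\<phi> (h *v u) = \<phi> u" .
    then have "(T (h *v u) - \<phi> u *s T x) - (T u - \<phi> u *s T x) \<in> W'"
      using \<phi>[OF hu] \<phi>[OF u] vec.subspace_diff[OF sW(2)] by metis
    then show ?thesis by (simp add: vec.linear_diff[OF lT])
  qed
  have TRg: "T (R (h *v u - u)) \<in> W'" if R: "R \<in> ops" and h: "h \<in> S" and u: "u \<in> W" for R h u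
    using R
  proof (induction rule: ops.induct)
    case (gen r)
    have "T ((r ** h) *v u - u) \<in> W'" "T (r *v u - u) \<in> W'" using Tg u gen h mult by auto
    then have "T ((r ** h) *v u - u) - T (r *v u - u) \<in> W'" using vec.subspace_diff[OF sW(2)] by blast
    then show ?case
      by (simp add: matrix_vector_mul_assoc vec.diff vec.linear_diff[OF lT])
  next
    case (add f1 f2)
    then show ?case using vec.subspace_add[OF sW(2)] by (auto simp: vec.linear_add[OF lT])
  next
    case (scale f1 c)
    then show ?case using vec.subspace_scale[OF sW(2)] by (auto simp: vec.linear_scale[OF lT])
  qed
  \<comment> \<open>This is the largest invariant subspace of \<open>W\<close> that \<open>T\<close>
    sends into \<open>W'\<close>. It contains \<open>W'\<close> and differs from \<open>W\<close>,
    so maximality of \<open>W'\<close> forces equality.\<close>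
  define Y where "Y = {u \<in> W. \<forall>R\<in>ops. T (R u) \<in> W'}"
  have "invariant Y"
    unfolding invariant_def
  proof (intro conjI ballI)
    have lTR: "Vector_Spaces.linear (*s) (*s) (\<lambda>u. T (R u))" if "R \<in> ops" for R
      by (rule ops_linear, rule ops_comp[OF T(1) that])
    show "vec.subspace Y"
      unfolding vec.subspace_def Y_def
      using sW vec.subspace_0[OF sW(1)] vec.subspace_0[OF sW(2)]
      by (auto simp: vec.linear_add[OF lTR] vec.linear_scale[OF lTR] vec.linear_0[OF lTR] vec.subspace_add
          vec.subspace_scale)
  next
    fix h u assume "h \<in> S" "u \<in> Y"
    then show "h *v u \<in> Y"
      using W ops_comp[OF _ ops.gen[of h]] unfolding Y_def invariant_def by auto
  qed
  moreover have "W' \<subseteq> Y"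
    using W' ops_in[OF _ W'(1)] T(1) by (auto simp: Y_def)
  moreover have "Y \<noteq> W" using T(2,3) ops_id by (auto simp: Y_def)
  ultimately have "Y = W'" using max[of Y] by (auto simp: Y_def)
  moreover have "g *v w - w \<in> Y"
    using TRg[OF _ g w] W g w by (auto simp: Y_def invariant_def vec.subspace_diff)
  ultimately show ?thesis by simp
qed

text \<open>A proper invariant subspace of largest dimension is maximal, so the quotient by it is
  irreducible and all g - 1 map \<open>W\<close> into it.\<close>

lemma span_augmentation_proper:
  assumes W: "invariant W" "W \<noteq> {0}"
  shows "vec.span {g *v w - w | g w. g \<in> S \<and> w \<in> W} \<noteq> W"
proof -
  have inv0: "invariant {0}" by (auto simp: invariant_def vec.subspace_def)
  have "0 \<in> W" using W vec.subspace_0 by (auto simp: invariant_def)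
  then have "invariant {0} \<and> {0} \<subset> W" using inv0 W by auto
  moreover have "\<forall>Y. invariant Y \<and> Y \<subset> W \<longrightarrow> vec.dim Y < Suc (vec.dim W)"
    using vec.dim_subset by (auto simp: less_Suc_eq_le)
  ultimately obtain W' where W': "invariant W'" "W' \<subset> W"
    and great: "\<And>Y. invariant Y \<and> Y \<subset> W \<Longrightarrow> vec.dim Y \<le> vec.dim W'"
    using ex_has_greatest_nat[of "\<lambda>Y. invariant Y \<and> Y \<subset> W" "{0}" vec.dim "Suc (vec.dim W)"] by blast
  have max: "Y = W' \<or> Y = W" if "invariant Y" "W' \<subseteq> Y" "Y \<subseteq> W" for Y
  proof (cases "Y = W")
    case False
    then have "vec.dim Y \<le> vec.dim W'" using great that by blast
    then show ?thesis
      using vec.subspace_dim_equal[of W' Y] that W' by (auto simp: invariant_def)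
  qed simp
  have "vec.span {g *v w - w | g w. g \<in> S \<and> w \<in> W} \<subseteq> W'"
    using augmentation_in_maximal[OF W(1) W' max] W' by (intro vec.span_minimal) (auto simp: invariant_def)
  then show ?thesis using W'(2) by blast
qed

text \<open>Level \<open>k\<close> is spanned by the products of \<open>k\<close> differences g - 1
  applied to all vectors. With this choice each g - 1 lowers the level by construction, and the only
  thing left to prove is that zero is reached.\<close>

fun flag :: "nat \<Rightarrow> ('k^'n) set" where
  "flag 0 = UNIV"
| "flag (Suc k) = vec.span {g *v w - w | g w. g \<in> S \<and> w \<in> flag k}"

lemma flag_invariant: "invariant (flag k)"
proof (induction k)
  case 0
  then show ?case by (auto simp: invariant_def)
next
  case (Suc k)
  then show ?case using span_augmentation_invariant by simp
qed

lemma flag_Suc_subset: "flag (Suc k) \<subseteq> flag k"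
  unfolding flag.simps
proof (rule vec.span_minimal)
  show "{g *v w - w | g w. g \<in> S \<and> w \<in> flag k} \<subseteq> flag k"
    using flag_invariant[of k] by (auto simp: invariant_def vec.subspace_diff)
qed (use flag_invariant[of k] in \<open>simp add: invariant_def\<close>)

lemma flag_dim: "vec.dim (flag k) \<le> CARD('n) - k"
proof (induction k)
  case 0
  then show ?case using vec_dim_card[where 'a='k and 'n='n] by (simp del: vec.dim_UNIV)
next
  case (Suc k)
  show ?case
  proof (cases "flag k = {0}")
    case True
    then have "flag (Suc k) \<subseteq> {0}" using flag_Suc_subset[of k] by simp
    then show ?thesis by (metis vec.dim_eq_0 zero_le)
  next
    case False
    have "flag (Suc k) \<noteq> flag k"
      using span_augmentation_proper[OF flag_invariant False] by simp
    then have "vec.dim (flag (Suc k)) < vec.dim (flag k)"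
      using flag_Suc_subset[of k] flag_invariant[of k] flag_invariant[of "Suc k"]
      by (metis invariant_def psubsetI vec.dim_psubset vec.span_eq_iff)
    then show ?thesis using Suc by simp
  qed
qed

theorem flag_end: "flag (CARD('n)) = {0}"
  using flag_dim[of "CARD('n)"] flag_invariant[of "CARD('n)"] vec.subspace_0
  by (auto simp: invariant_def)

end

section \<open>Automorphisms and the unipotent radical\<close>

definition fwd_diff :: "(nat \<Rightarrow> 'a::ab_group_add) \<Rightarrow> nat \<Rightarrow> 'a" where
  "fwd_diff f = (\<lambda>k. f (Suc k) - f k)"

text \<open>Sequences annihilated by an iterated forward difference: a substitute for polynomial
  dependence on \<open>k\<close> that makes sense in every characteristic.\<close>

definition diff_nilpotent :: "(nat \<Rightarrow> 'a::comm_ring_1) \<Rightarrow> bool" where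
  "diff_nilpotent f \<longleftrightarrow> (\<exists>m. (fwd_diff ^^ m) f = (\<lambda>_. 0))"

lemma fwd_diff_pow_0: "(fwd_diff ^^ m) (\<lambda>_. 0) = (\<lambda>_. 0 :: 'a::ab_group_add)"
  by (induction m) (auto simp: fwd_diff_def)

lemma fwd_diff_pow_mono:
  assumes "(fwd_diff ^^ m) f = (\<lambda>_. 0)" "m \<le> m'"
  shows "(fwd_diff ^^ m') f = (\<lambda>_. 0)"
proof -
  have "fwd_diff ^^ m' = fwd_diff ^^ (m' - m) \<circ> (fwd_diff ^^ m :: (nat \<Rightarrow> 'a) \<Rightarrow> _)"
    using assms(2) by (simp flip: funpow_add)
  then show ?thesis using assms(1) fwd_diff_pow_0 by simp
qed

lemma fwd_diff_pow_add:
  "(fwd_diff ^^ m) (\<lambda>k. f k + g k) = (\<lambda>k. (fwd_diff ^^ m) f k + (fwd_diff ^^ m) g k)"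
proof (induction m)
  case (Suc m)
  have "fwd_diff (\<lambda>k. F k + G k) = (\<lambda>k. fwd_diff F k + fwd_diff G k)" for F G :: "nat \<Rightarrow> 'a"
    by (auto simp: fwd_diff_def)
  then show ?case by (simp add: Suc)
qed simp

lemma diff_nilpotent_const: "diff_nilpotent (\<lambda>_. c)"
  unfolding diff_nilpotent_def by (rule exI[of _ 1]) (auto simp: fwd_diff_def)

lemma diff_nilpotent_add:
  assumes "diff_nilpotent f" "diff_nilpotent g"
  shows "diff_nilpotent (\<lambda>k. f k + g k)"
proof -
  obtain m m' where m: "(fwd_diff ^^ m) f = (\<lambda>_. 0)" "(fwd_diff ^^ m') g = (\<lambda>_. 0)"
    using assms by (auto simp: diff_nilpotent_def)
  have "(fwd_diff ^^ max m m') (\<lambda>k. f k + g k) = (\<lambda>_. 0)"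
    using fwd_diff_pow_mono[OF m(1), of "max m m'"] fwd_diff_pow_mono[OF m(2), of "max m m'"]
    by (simp add: fwd_diff_pow_add)
  then show ?thesis unfolding diff_nilpotent_def by blast
qed

lemma diff_nilpotent_fwd_diffD:
  assumes "diff_nilpotent (fwd_diff f)"
  shows "diff_nilpotent f"
proof -
  from assms obtain m where "(fwd_diff ^^ m) (fwd_diff f) = (\<lambda>_. 0)" by (auto simp: diff_nilpotent_def)
  then have "(fwd_diff ^^ Suc m) f = (\<lambda>_. 0)" by (simp only: funpow_Suc_right o_apply)
  then show ?thesis unfolding diff_nilpotent_def by blast
qed

text \<open>Discrete Leibniz rule, with induction on the sum of the two nilpotency orders: every
  term of the difference of f g has at least one factor replaced by its own difference.\<close>

lemma diff_nilpotent_mult: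
  assumes "diff_nilpotent f" "diff_nilpotent g"
  shows "diff_nilpotent (\<lambda>k. f k * g k)"
proof -
  obtain m m' where m: "(fwd_diff ^^ m) f = (\<lambda>_. 0)" "(fwd_diff ^^ m') g = (\<lambda>_. 0)"
    using assms by (auto simp: diff_nilpotent_def)
  then show ?thesis
  proof (induction "m + m'" arbitrary: m m' f g rule: less_induct)
    case less
    show ?case
    proof (cases "m = 0 \<or> m' = 0")
      case True
      then have "(\<lambda>k. f k * g k) = (\<lambda>_. 0)" using less.prems by auto
      then show ?thesis by (simp add: diff_nilpotent_const)
    next
      case False
      then obtain j j' where j: "m = Suc j" "m' = Suc j'" by (metis not0_implies_Suc)
      have f: "(fwd_diff ^^ j) (fwd_diff f) = (\<lambda>_. 0)" and g: "(fwd_diff ^^ j') (fwd_diff g) = (\<lambda>_. 0)"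
        using less.prems j by (simp_all only: funpow_Suc_right o_apply)
      have "fwd_diff (\<lambda>k. f k * g k) =
          (\<lambda>k. fwd_diff f k * fwd_diff g k + (fwd_diff f k * g k + f k * fwd_diff g k))"
        by (auto simp: fwd_diff_def algebra_simps)
      then have "diff_nilpotent (fwd_diff (\<lambda>k. f k * g k))"
        using less.hyps[OF _ f g] less.hyps[OF _ f less.prems(2)] less.hyps[OF _ less.prems(1) g] j
        by (simp add: diff_nilpotent_add)
      then show ?thesis by (rule diff_nilpotent_fwd_diffD)
    qed
  qed
qed

lemma diff_nilpotent_sum:
  "(\<And>i. i \<in> I \<Longrightarrow> diff_nilpotent (f i)) \<Longrightarrow> diff_nilpotent (\<lambda>k. \<Sum>i\<in>I. f i k)"
  by (induction I rule: infinite_finite_induct) (auto intro: diff_nilpotent_const diff_nilpotent_add)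

lemma diff_nilpotent_prod:
  "(\<And>i. i \<in> I \<Longrightarrow> diff_nilpotent (f i)) \<Longrightarrow> diff_nilpotent (\<lambda>k. \<Prod>i\<in>I. f i k)"
  by (induction I rule: infinite_finite_induct) (auto intro: diff_nilpotent_const diff_nilpotent_mult)

lemma diff_nilpotent_det:
  fixes A :: "nat \<Rightarrow> 'k::comm_ring_1^'n^'n"
  assumes "\<And>i j. diff_nilpotent (\<lambda>k. A k $ i $ j)"
  shows "diff_nilpotent (\<lambda>k. det (A k))"
  unfolding det_def by (intro diff_nilpotent_sum diff_nilpotent_mult diff_nilpotent_prod diff_nilpotent_const assms)

primrec matrix_pow :: "('k::comm_ring_1^'n^'n) \<Rightarrow> nat \<Rightarrow> 'k^'n^'n" where
  "matrix_pow A 0 = mat 1"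
| "matrix_pow A (Suc k) = A ** matrix_pow A k"

lemma unipotent_def': "unipotent A \<longleftrightarrow> (\<exists>m. matrix_pow (A - mat 1) m = 0)"
proof -
  have "((\<lambda>B. (A - mat 1) ** B) ^^ m) (mat 1) = matrix_pow (A - mat 1) m" for m
    by (induction m) auto
  then show ?thesis by (simp add: unipotent_def)
qed

lemma matrix_diff_ldistrib:
  fixes A :: "'k::comm_ring_1^'n^'m"
  shows "A ** (B - C) = A ** B - A ** C"
  by (simp add: matrix_matrix_mult_def vec_eq_iff algebra_simps sum_subtractf)

lemma matrix_diff_rdistrib:
  fixes A :: "'k::comm_ring_1^'n^'m"
  shows "(A - B) ** C = A ** C - B ** C"
  by (simp add: matrix_matrix_mult_def vec_eq_iff algebra_simps sum_subtractf)

lemma fwd_diff_pow_matrix: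
  fixes A :: "'k::comm_ring_1^'n^'n"
  shows "(fwd_diff ^^ m) (\<lambda>k. matrix_pow A k) = (\<lambda>k. matrix_pow A k ** matrix_pow (A - mat 1) m)"
proof (induction m)
  case (Suc m)
  have comm: "A ** matrix_pow A k = matrix_pow A k ** A" for k
    by (induction k) (simp_all add: matrix_mul_assoc)
  have "matrix_pow A (Suc k) ** B - matrix_pow A k ** B = matrix_pow A k ** ((A - mat 1) ** B)" for k B
    by (simp add: comm matrix_mul_assoc matrix_diff_ldistrib matrix_diff_rdistrib)
  then have "fwd_diff (\<lambda>k. matrix_pow A k ** B) = (\<lambda>k. matrix_pow A k ** ((A - mat 1) ** B))" for B
    unfolding fwd_diff_def by auto
  then show ?case by (simp add: Suc)
qed simp

lemma fwd_diff_pow_entry: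
  fixes F :: "nat \<Rightarrow> 'k::comm_ring_1^'n^'m"
  shows "(fwd_diff ^^ m) (\<lambda>k. F k $ i $ j) = (\<lambda>k. (fwd_diff ^^ m) F k $ i $ j)"
proof (induction m)
  case (Suc m)
  have "fwd_diff (\<lambda>k. G k $ i $ j) = (\<lambda>k. fwd_diff G k $ i $ j)" for G :: "nat \<Rightarrow> 'k^'n^'m"
    by (simp add: fwd_diff_def)
  then show ?case by (simp add: Suc)
qed simp

text \<open>The \<open>m\<close>-th forward difference of the powers of \<open>A\<close> is A^k (A -
  1)^m, and k = 0 recovers (A - 1)^m. The criterion refers only to entries of powers, so it passes
  through homomorphisms given by regular functions.\<close>

lemma unipotent_iff_diff_nilpotent:
  fixes A :: "'k::comm_ring_1^'n^'n"
  shows "(\<exists>m. matrix_pow (A - mat 1) m = 0) \<longleftrightarrow> (\<forall>i j. diff_nilpotent (\<lambda>k. matrix_pow A k $ i $ j))"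
proof
  assume "\<exists>m. matrix_pow (A - mat 1) m = 0"
  then obtain m where "matrix_pow (A - mat 1) m = 0" by blast
  then have "(fwd_diff ^^ m) (\<lambda>k. matrix_pow A k $ i $ j) = (\<lambda>_. 0)" for i j
    by (simp add: fwd_diff_pow_entry fwd_diff_pow_matrix)
  then show "\<forall>i j. diff_nilpotent (\<lambda>k. matrix_pow A k $ i $ j)" unfolding diff_nilpotent_def by blast
next
  assume "\<forall>i j. diff_nilpotent (\<lambda>k. matrix_pow A k $ i $ j)"
  then obtain m where m: "\<And>i j. (fwd_diff ^^ m i j) (\<lambda>k. matrix_pow A k $ i $ j) = (\<lambda>_. 0)"
    unfolding diff_nilpotent_def by metis
  define M where "M = Max (range (\<lambda>(i, j). m i j))"
  have "m i j \<le> M" for i j unfolding M_def by (rule Max_ge) (auto intro: rev_image_eqI[of "(i, j)"])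
  then have "(fwd_diff ^^ M) (\<lambda>k. matrix_pow A k $ i $ j) = (\<lambda>_. 0)" for i j
    using fwd_diff_pow_mono[OF m] by blast
  then have "(matrix_pow A 0 ** matrix_pow (A - mat 1) M) $ i $ j = 0" for i j
    unfolding fwd_diff_pow_entry fwd_diff_pow_matrix by (rule fun_cong)
  then have "matrix_pow (A - mat 1) M = 0" by (simp add: vec_eq_iff)
  then show "\<exists>m. matrix_pow (A - mat 1) m = 0" by blast
qed

lemma det_matrix_pow: "det (matrix_pow A k) = det A ^ k"
  by (induction k) (auto simp: det_mul)

text \<open>Some iterated difference kills the sequence (det A)^k, whereas the differences of c^k
  are c^k (c - 1)^m; at k = 0 this leaves (det A - 1)^m = 0.\<close>

lemma unipotent_det:
  fixes A :: "'k::field^'n^'n"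
  assumes "unipotent A"
  shows "det A = 1"
proof -
  have "diff_nilpotent (\<lambda>k. det A ^ k)"
    using diff_nilpotent_det[of "matrix_pow A"] assms unipotent_iff_diff_nilpotent[of A]
    by (simp add: unipotent_def' det_matrix_pow)
  then obtain m where "(fwd_diff ^^ m) (\<lambda>k. det A ^ k) = (\<lambda>_. 0)" by (auto simp: diff_nilpotent_def)
  moreover have "(fwd_diff ^^ m) (\<lambda>k. c ^ k) = (\<lambda>k. c ^ k * (c - 1) ^ m)" for c :: 'k
  proof (induction m)
    case (Suc m)
    have "fwd_diff (\<lambda>k. c ^ k * a) = (\<lambda>k. c ^ k * ((c - 1) * a))" for a
      by (auto simp: fwd_diff_def algebra_simps)
    then show ?case by (simp add: Suc)
  qed simp
  ultimately have "det A ^ 0 * (det A - 1) ^ m = 0" by metis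
  then show ?thesis by simp
qed

text \<open>Coordinates give the entries of the powers, and the inverse determinant is constantly 1
  along them. Everything else follows because such sequences form a ring.\<close>

lemma regular_unipotent:
  assumes "f \<in> regular k" "unipotent A"
  shows "diff_nilpotent (\<lambda>j. f (matrix_pow A j))"
  using assms(1)
proof (induction rule: regular.induct)
  case (entry i j)
  then show ?case using assms(2) unipotent_iff_diff_nilpotent by (auto simp: unipotent_def')
next
  case inv_det
  then show ?case using unipotent_det[OF assms(2)] by (simp add: det_matrix_pow diff_nilpotent_const)
qed (auto intro: diff_nilpotent_const diff_nilpotent_add diff_nilpotent_mult)

section \<open>Morphisms in the Zariski topology and the unipotent radical\<close>

lemma regular_mono: "k \<subseteq> k' \<Longrightarrow> f \<in> regular k \<Longrightarrow> f \<in> regular k'"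
  by (rotate_tac 1, induction rule: regular.induct) (auto intro: regular.intros)

lemma regular_sum: "(\<And>i. i \<in> I \<Longrightarrow> f i \<in> regular UNIV) \<Longrightarrow> (\<lambda>A. \<Sum>i\<in>I. f i A) \<in> regular UNIV"
proof (induction I rule: infinite_finite_induct)
  case (insert i I)
  then have "(\<lambda>A. f i A + (\<Sum>i\<in>I. f i A)) \<in> regular UNIV" by (intro regular.add) auto
  then show ?case using insert by simp
qed (simp_all add: regular.const)

lemma regular_prod: "(\<And>i. i \<in> I \<Longrightarrow> f i \<in> regular UNIV) \<Longrightarrow> (\<lambda>A. \<Prod>i\<in>I. f i A) \<in> regular UNIV"
proof (induction I rule: infinite_finite_induct)
  case (insert i I)
  then have "(\<lambda>A. f i A * (\<Prod>i\<in>I. f i A)) \<in> regular UNIV" by (intro regular.mult) auto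
  then show ?case using insert by simp
qed (simp_all add: regular.const)

lemma group_GL: "group (GL :: ('k::field^'n^'n) monoid)"
proof (rule groupI)
  fix x :: "'k^'n^'n" assume "x \<in> carrier GL"
  then show "\<exists>y\<in>carrier GL. y \<otimes>\<^bsub>GL\<^esub> x = \<one>\<^bsub>GL\<^esub>"
    by (auto simp: GL_def invertible_def)
qed (auto simp: GL_def matrix_mul_assoc invertible_det_nz det_mul)

definition principal_opens :: "('k::field^'n^'n) set set" where
  "principal_opens = {{A \<in> carrier GL. f A \<noteq> 0} | f. f \<in> regular UNIV}"

lemma GL_principal_open: "carrier GL \<in> principal_opens"
  unfolding principal_opens_def mem_Collect_eq
  by (rule exI[of _ "\<lambda>A. 1"]) (auto intro: regular.const)

lemma zariski_principal_opens: "zariski = topology_generated_by principal_opens"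
  by (simp add: zariski_def principal_opens_def)

lemma topspace_zariski: "topspace zariski = carrier GL"
  unfolding zariski_principal_opens topology_generated_by_topspace
  using GL_principal_open by (auto simp: principal_opens_def)

lemma morphism_continuous:
  fixes H :: "('k::field^'n^'n) set"
  assumes H: "H \<subseteq> carrier GL" and \<phi>: "morphism_over k H \<phi>" "\<phi> ` H \<subseteq> H"
  shows "continuous_map (subtopology zariski H) zariski \<phi>"
proof -
  obtain F where F: "\<And>i j. F i j \<in> regular UNIV" "\<And>i j A. A \<in> H \<Longrightarrow> \<phi> A $ i $ j = F i j A"
    using \<phi>(1) regular_mono[OF subset_UNIV] unfolding morphism_over_def by metis
  let ?d = "\<lambda>A. det (\<chi> i j. F i j A)"
  have d: "?d \<in> regular UNIV"
  proof -
    have "(\<lambda>A. of_int (sign p) * (\<Prod>i\<in>UNIV. F i (p i) A)) \<in> regular UNIV" for p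
      by (rule regular.mult[OF regular.const[OF UNIV_I] regular_prod[OF F(1)]])
    then have "(\<lambda>A. \<Sum>p\<in>{p. p permutes UNIV}. of_int (sign p) * (\<Prod>i\<in>UNIV. F i (p i) A)) \<in> regular UNIV"
      by (rule regular_sum)
    then show ?thesis by (simp add: det_def)
  qed
  have phi: "\<phi> A = (\<chi> i j. F i j A)" if "A \<in> H" for A using F(2)[OF that] by (simp add: vec_eq_iff)
  have d0: "?d A \<noteq> 0" if "A \<in> H" for A
  proof -
    have "invertible (\<phi> A)" using \<phi>(2) H that by (auto simp: GL_def)
    then show ?thesis using phi[OF that] by (simp add: invertible_det_nz)
  qed
  text \<open>Regular functions are polynomials up to powers of the determinant, so pulling them back
    only introduces powers of the determinant, which do not change the zero set.\<close>
  have pull: "\<exists>h\<in>regular UNIV. \<exists>n. \<forall>A\<in>H. h A = ?d A ^ n * f (\<phi> A)" if "f \<in> regular UNIV" for f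
    using that
  proof (induction rule: regular.induct)
    case (const c)
    then show ?case by (intro bexI[of _ "\<lambda>A. c"] exI[of _ 0]) (auto intro: regular.const)
  next
    case (entry i j)
    then show ?case using F by (intro bexI[of _ "F i j"] exI[of _ 0]) auto
  next
    case inv_det
    then show ?case using d0 phi by (intro bexI[of _ "\<lambda>A. 1"] exI[of _ 1]) (auto intro: regular.const)
  next
    case (add f g)
    then obtain h1 n1 h2 n2 where h: "h1 \<in> regular UNIV" "\<forall>A\<in>H. h1 A = ?d A ^ n1 * f (\<phi> A)"
      "h2 \<in> regular UNIV" "\<forall>A\<in>H. h2 A = ?d A ^ n2 * g (\<phi> A)" by blast
    have dn: "(\<lambda>A. ?d A ^ n) \<in> regular UNIV" for n
      using regular_prod[of "{..<n}" "\<lambda>_. ?d"] d by simp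
    show ?case
    proof (intro bexI[of _ "\<lambda>A. ?d A ^ n2 * h1 A + ?d A ^ n1 * h2 A"] exI[of _ "n1 + n2"])
      show "(\<lambda>A. ?d A ^ n2 * h1 A + ?d A ^ n1 * h2 A) \<in> regular UNIV"
        by (rule regular.add[OF regular.mult[OF dn h(1)] regular.mult[OF dn h(3)]])
    qed (use h in \<open>auto simp: algebra_simps power_add\<close>)
  next
    case (mult f g)
    then obtain h1 n1 h2 n2 where h: "h1 \<in> regular UNIV" "\<forall>A\<in>H. h1 A = ?d A ^ n1 * f (\<phi> A)"
      "h2 \<in> regular UNIV" "\<forall>A\<in>H. h2 A = ?d A ^ n2 * g (\<phi> A)" by blast
    show ?case
    proof (intro bexI[of _ "\<lambda>A. h1 A * h2 A"] exI[of _ "n1 + n2"] ballI)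
      show "(\<lambda>A. h1 A * h2 A) \<in> regular UNIV" by (rule regular.mult[OF h(1,3)])
    qed (use h in \<open>auto simp: algebra_simps power_add\<close>)
  qed
  have top: "topspace (subtopology zariski H) = H"
    using H by (auto simp: topspace_zariski)
  have "continuous_map (subtopology zariski H) (topology_generated_by principal_opens) \<phi>"
  proof (rule continuous_on_generated_topo, unfold top)
    fix U :: "('k^'n^'n) set" assume "U \<in> principal_opens"
    then obtain f where f: "f \<in> regular UNIV" "U = {A \<in> carrier GL. f A \<noteq> 0}" unfolding principal_opens_def by blast
    then obtain h n where h: "h \<in> regular UNIV" "\<forall>A\<in>H. h A = ?d A ^ n * f (\<phi> A)" using pull by blast
    have "\<phi> -` U \<inter> H = {A \<in> carrier GL. h A \<noteq> 0} \<inter> H"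
      using f h d0 \<phi>(2) H by auto
    moreover have "openin zariski {A \<in> carrier GL. h A \<noteq> 0}"
      unfolding zariski_principal_opens principal_opens_def by (rule topology_generated_by_Basis) (use h in blast)
    ultimately show "openin (subtopology zariski H) (\<phi> -` U \<inter> H)"
      unfolding openin_subtopology by blast
  next
    show "\<phi> ` H \<subseteq> \<Union> principal_opens" using \<phi>(2) H Union_upper[OF GL_principal_open] by (meson subset_trans)
  qed
  then show ?thesis by (simp add: zariski_principal_opens)
qed

lemma subgroup_GLsub:
  assumes "subgroup U GL" "subgroup H GL" "U \<subseteq> H"
  shows "subgroup U (GLsub H)"
  using group.subgroup_incl[OF group_GL] assms by blast

text \<open>The image of \<open>N\<close> is again closed, connected, normal in \<open>P\<close> and
  unipotent, so the maximality of the radical puts it inside \<open>N\<close>. This is what lets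
  \<open>\<sigma>\<close> act on N(F).\<close>

lemma unipotent_radical_stable:
  fixes G P N :: "('k::field^'n^'n) set"
  assumes G: "closed_subgroup G" and \<sigma>: "automorphism_over k G \<sigma>"
    and P: "subgroup P GL" "P \<subseteq> G" "\<sigma> ` P = P" and N: "unipotent_radical N P"
  shows "\<sigma> ` N \<subseteq> N"
proof -
  let ?A = "AutoGroup (GLsub G)"
  have sG: "subgroup G GL" and cG: "closedin zariski G" using G by (auto simp: closed_subgroup_def)
  have GGL: "G \<subseteq> carrier GL" using sG subgroup.subset by blast
  interpret GL: group "GL :: ('k^'n^'n) monoid" by (rule group_GL)
  interpret GG: group "GLsub G" using sG GL.subgroup_imp_group by blast
  interpret AG: group ?A by (rule GG.AutoGroup)
  define \<tau> where "\<tau> = inv\<^bsub>?A\<^esub> \<sigma>"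
  have \<sigma>A: "\<sigma> \<in> carrier ?A" and \<tau>A: "\<tau> \<in> carrier ?A"
    using \<sigma> by (auto simp: automorphism_over_def \<tau>_def)
  have \<sigma>B: "\<sigma> \<in> Bij G" "\<sigma> \<in> hom (GLsub G) (GLsub G)" and \<tau>B: "\<tau> \<in> Bij G" "\<tau> \<in> hom (GLsub G) (GLsub G)"
    using \<sigma>A \<tau>A by (auto simp: AutoGroup_def auto_def)
  have "\<tau> \<otimes>\<^bsub>?A\<^esub> \<sigma> = \<one>\<^bsub>?A\<^esub>" "\<sigma> \<otimes>\<^bsub>?A\<^esub> \<tau> = \<one>\<^bsub>?A\<^esub>" using \<sigma>A by (simp_all add: \<tau>_def)
  then have "compose G \<tau> \<sigma> = (\<lambda>x\<in>G. x)" "compose G \<sigma> \<tau> = (\<lambda>x\<in>G. x)"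
    using \<sigma>B \<tau>B by (simp_all add: AutoGroup_def BijGroup_def)
  then have inv: "\<tau> (\<sigma> x) = x" "\<sigma> (\<tau> x) = x" if "x \<in> G" for x
    using that by (metis compose_eq restrict_apply')+
  have \<sigma>G: "\<sigma> x \<in> G" and \<tau>G: "\<tau> x \<in> G" if "x \<in> G" for x
    using that \<sigma>B(1) \<tau>B(1) Bij_imp_funcset by blast+
  have \<sigma>m: "\<sigma> (x ** y) = \<sigma> x ** \<sigma> y" if "x \<in> G" "y \<in> G" for x y
    using \<sigma>B(2) that by (auto simp: hom_def GL_def)
  have cN: "conn_normal_unipotent N P" and big: "\<And>U. conn_normal_unipotent U P \<Longrightarrow> U \<subseteq> N"
    using N by (auto simp: unipotent_radical_def)
  have sN: "subgroup N GL" "closedin zariski N" "connectedin zariski N" "N \<lhd> GLsub P" "\<And>A. A \<in> N \<Longrightarrow> unipotent A"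
    using cN by (auto simp: conn_normal_unipotent_def closed_subgroup_def)
  interpret GP: group "GLsub P" using P GL.subgroup_imp_group by blast
  have NP: "N \<subseteq> P" using sN(4) normal_imp_subgroup subgroup.subset by fastforce
  then have NG: "N \<subseteq> G" using P by blast
  have hom: "group_hom (GLsub G) (GLsub G) \<sigma>"
    using \<sigma>B(2) by (simp add: group_hom_def group_hom_axioms_def GG.is_group)
  have "subgroup (\<sigma> ` N) (GLsub G)"
    using group_hom.subgroup_img_is_subgroup[OF hom subgroup_GLsub[OF sN(1) sG NG]] .
  then have s\<sigma>N: "subgroup (\<sigma> ` N) GL" using GL.incl_subgroup[OF sG] by blast
  have "conn_normal_unipotent (\<sigma> ` N) P"
    unfolding conn_normal_unipotent_def closed_subgroup_def
  proof (intro conjI ballI s\<sigma>N)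
    have cont: "continuous_map (subtopology zariski G) zariski \<sigma>"
        "continuous_map (subtopology zariski G) zariski \<tau>"
      using morphism_continuous[OF GGL, of k] \<sigma> \<sigma>G \<tau>G by (auto simp: automorphism_over_def \<tau>_def)
    \<comment> \<open>Written as the preimage of \<open>N\<close> under the inverse morphism, the
      image is visibly closed.\<close>
    have "\<sigma> ` N = {x \<in> topspace (subtopology zariski G). \<tau> x \<in> N}"
    proof -
      have "topspace (subtopology zariski G) = G" using GGL by (auto simp: topspace_zariski)
      then show ?thesis using NG inv \<sigma>G by (auto intro: rev_image_eqI)
    qed
    then have "closedin (subtopology zariski G) (\<sigma> ` N)"
      using closedin_continuous_map_preimage[OF cont(2) sN(2)] by simp
    then show "closedin zariski (\<sigma> ` N)" using closedin_closed_subtopology[OF cG] by blast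
    show "connectedin zariski (\<sigma> ` N)"
      using connectedin_continuous_map_image[OF cont(1)] sN(3) NG by (simp add: connectedin_subtopology)
    show "\<sigma> ` N \<lhd> GLsub P"
      unfolding GP.normal_inv_iff
    proof (intro conjI ballI)
      have "\<sigma> ` N \<subseteq> P" using NP P by blast
      then show "subgroup (\<sigma> ` N) (GLsub P)" by (rule subgroup_GLsub[OF s\<sigma>N P(1)])
    next
      fix x h assume x: "x \<in> carrier (GLsub P)" and h: "h \<in> \<sigma> ` N"
      have "x \<in> \<sigma> ` P" using x P(3) by simp
      then obtain y m where y: "y \<in> P" "x = \<sigma> y" "m \<in> N" "h = \<sigma> m" using h by blast
      have iG: "inv\<^bsub>GLsub P\<^esub> z = inv\<^bsub>GLsub G\<^esub> z" if "z \<in> P" for z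
        using GL.m_inv_consistent[OF P(1) that] GL.m_inv_consistent[OF sG, of z] that P(2) by auto
      have yG: "y \<in> carrier (GLsub G)" "m \<in> carrier (GLsub G)" using y P NG by auto
      have "inv\<^bsub>GLsub P\<^esub> x = \<sigma> (inv\<^bsub>GLsub P\<^esub> y)"
        using group_hom.hom_inv[OF hom yG(1)] iG y x by simp
      moreover have "inv\<^bsub>GLsub P\<^esub> y \<in> P" using GP.inv_closed y(1) by simp
      ultimately have "x \<otimes>\<^bsub>GLsub P\<^esub> h \<otimes>\<^bsub>GLsub P\<^esub> inv\<^bsub>GLsub P\<^esub> x
          = \<sigma> (y \<otimes>\<^bsub>GLsub P\<^esub> m \<otimes>\<^bsub>GLsub P\<^esub> inv\<^bsub>GLsub P\<^esub> y)"
        using y yG P(2) GG.m_closed[OF yG] by (simp add: GL_def \<sigma>m subset_iff)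
      moreover have "y \<otimes>\<^bsub>GLsub P\<^esub> m \<otimes>\<^bsub>GLsub P\<^esub> inv\<^bsub>GLsub P\<^esub> y \<in> N"
        using sN(4) y unfolding GP.normal_inv_iff by simp
      ultimately show "x \<otimes>\<^bsub>GLsub P\<^esub> h \<otimes>\<^bsub>GLsub P\<^esub> inv\<^bsub>GLsub P\<^esub> x \<in> \<sigma> ` N" by blast
    qed
    fix A assume "A \<in> \<sigma> ` N"
    then obtain B where B: "B \<in> N" "A = \<sigma> B" by blast
    \<comment> \<open>\<open>\<sigma>\<close> commutes with powers, so each entry of A^j is a
      regular function evaluated along the powers of the unipotent \<open>B\<close>, to which the
      difference criterion applies.\<close>
    have pow: "matrix_pow B j \<in> G \<and> \<sigma> (matrix_pow B j) = matrix_pow A j" for j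
    proof (induction j)
      case 0
      have "\<sigma> (mat 1) = mat 1" using group_hom.hom_one[OF hom] by (simp add: GL_def)
      moreover have "mat 1 \<in> G" using subgroup.one_closed[OF sG] by (simp add: GL_def)
      ultimately show ?case by simp
    next
      case (Suc j)
      have "B \<in> G" using B NG by blast
      moreover have "B ** matrix_pow B j \<in> G"
        using subgroup.m_closed[OF sG \<open>B \<in> G\<close>] Suc by (simp add: GL_def)
      ultimately show ?case using Suc \<sigma>m B by simp
    qed
    have "diff_nilpotent (\<lambda>j. matrix_pow A j $ a $ b)" for a b
    proof -
      obtain f where f: "f \<in> regular k" "\<forall>A\<in>G. \<sigma> A $ a $ b = f A"
        using \<sigma> unfolding automorphism_over_def morphism_over_def by blast
      have "(\<lambda>j. matrix_pow A j $ a $ b) = (\<lambda>j. f (matrix_pow B j))"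
        using pow f(2) by metis
      then show ?thesis using regular_unipotent[OF f(1) sN(5)[OF B(1)]] by simp
    qed
    then show "unipotent A" unfolding unipotent_def' unipotent_iff_diff_nilpotent by blast
  qed
  then show ?thesis by (rule big)
qed

section \<open>Fixed points in fixed cosets\<close>

text \<open>Cauchy's theorem, drawn from Sylow's theorem with exponent one: a subgroup of order
  \<open>l\<close> would contain a nontrivial element killed by \<open>l\<close>.\<close>

lemma coprime_order_if_torsion_free:
  fixes l :: nat
  assumes Q: "group Q" "finite (carrier Q)" and l: "Factorial_Ring.prime l"
    and tf: "\<And>x. x \<in> carrier Q \<Longrightarrow> x [^]\<^bsub>Q\<^esub> l = \<one>\<^bsub>Q\<^esub> \<Longrightarrow> x = \<one>\<^bsub>Q\<^esub>"
  shows "coprime l (Coset.order Q)"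
proof (rule ccontr)
  interpret Q: group Q by fact
  assume "\<not> coprime l (Coset.order Q)"
  then have "l dvd Coset.order Q" using l prime_imp_coprime by blast
  then obtain m where m: "Coset.order Q = l ^ 1 * m" by auto
  obtain H where H: "subgroup H Q" "card H = l ^ 1" using sylow_thm[OF l Q(1) m Q(2)] by blast
  have "H \<noteq> {\<one>\<^bsub>Q\<^esub>}" using H(2) prime_gt_1_nat[OF l] by auto
  then obtain x where x: "x \<in> H" "x \<noteq> \<one>\<^bsub>Q\<^esub>" using subgroup.one_closed[OF H(1)] by blast
  interpret H: group "Q\<lparr>carrier := H\<rparr>" using H(1) Q.subgroup_imp_group by blast
  have "x [^]\<^bsub>Q\<lparr>carrier := H\<rparr>\<^esub> Coset.order (Q\<lparr>carrier := H\<rparr>) = \<one>\<^bsub>Q\<lparr>carrier := H\<rparr>\<^esub>"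
    using H.pow_order_eq_1 x by simp
  then have "x [^]\<^bsub>Q\<^esub> l = \<one>\<^bsub>Q\<^esub>"
    using H(2) by (simp add: Coset.order_def Q.nat_pow_consistent[symmetric])
  then show False using tf[OF subgroup.mem_carrier[OF H(1) x(1)]] x(2) by simp
qed

context group
begin

lemma rcos_map_hom:
  assumes "K \<lhd> G"
  shows "group_hom G (G Mod K) (\<lambda>x. K #> x)"
  using assms by (simp add: group_hom_def group_hom_axioms_def normal.factorgroup_is_group
      normal.r_coset_hom_Mod)

lemma rcos_stable:
  assumes K: "K \<lhd> G" and s: "s \<in> hom G G" "s ` K \<subseteq> K"
    and ab: "a \<in> carrier G" "b \<in> carrier G" "K #> a = K #> b"
  shows "K #> s a = K #> s b"
proof -
  have sK: "subgroup K G" using K normal_imp_subgroup by blast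
  have "a \<in> K #> b" using ab rcos_self[OF _ sK] by metis
  then obtain k where k: "k \<in> K" "a = k \<otimes> b" by (auto simp: r_coset_def)
  then have "s a = s k \<otimes> s b" using s ab subgroup.mem_carrier[OF sK] by (auto simp: hom_def)
  then have "s a \<in> K #> s b" using s k by (auto simp: r_coset_def)
  moreover have "s b \<in> carrier G" using s ab by (auto simp: hom_def)
  ultimately show ?thesis using repr_independence[OF _ _ sK] by blast
qed

text \<open>The product x s(x) s^2(x) ..., a noncommutative norm. If s^k is the identity, then
  \<open>s\<close> changes the \<open>k\<close>-th such product only by conjugation with
  \<open>x\<close>.\<close>

primrec twisted_pow :: "('a \<Rightarrow> 'a) \<Rightarrow> 'a \<Rightarrow> nat \<Rightarrow> 'a" where
  "twisted_pow s x 0 = \<one>"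
| "twisted_pow s x (Suc k) = x \<otimes> s (twisted_pow s x k)"

context
  fixes s x
  assumes s: "s \<in> hom G G" and x: "x \<in> carrier G"
begin

lemma s_closed: "y \<in> carrier G \<Longrightarrow> s y \<in> carrier G"
  and s_mult: "y \<in> carrier G \<Longrightarrow> z \<in> carrier G \<Longrightarrow> s (y \<otimes> z) = s y \<otimes> s z"
  using s by (auto simp: hom_def)

lemma s_hom: "group_hom G G s"
  using s by (simp add: group_hom_def group_hom_axioms_def is_group)

lemma twisted_pow_closed: "twisted_pow s x k \<in> carrier G"
  by (induction k) (auto simp: x s_closed)

lemma funpow_s_closed: "(s ^^ k) x \<in> carrier G"
  by (induction k) (auto simp: x s_closed)

lemma twisted_pow_Suc': "twisted_pow s x (Suc k) = twisted_pow s x k \<otimes> (s ^^ k) x"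
proof (induction k)
  case 0
  then show ?case using x group_hom.hom_one[OF s_hom] by simp
next
  case (Suc k)
  have "twisted_pow s x (Suc (Suc k)) = x \<otimes> s (twisted_pow s x k \<otimes> (s ^^ k) x)"
    using Suc by simp
  also have "\<dots> = x \<otimes> s (twisted_pow s x k) \<otimes> s ((s ^^ k) x)"
    by (simp add: s_mult twisted_pow_closed funpow_s_closed s_closed x m_assoc)
  finally show ?case by simp
qed

text \<open>Modulo \<open>K\<close> all conjugates s^j(x) coincide with \<open>x\<close>, and the
  norm becomes an ordinary power.\<close>

lemma twisted_pow_coset:
  assumes K: "K \<lhd> G" "s ` K \<subseteq> K" and Kx: "K #> s x = K #> x"
  shows "K #> twisted_pow s x k = K #> (x [^] k)"
proof (induction k)
  case (Suc k)
  interpret p: group_hom G "G Mod K" "\<lambda>x. K #> x" by (rule rcos_map_hom[OF K(1)])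
  have "K #> s (twisted_pow s x k) = K #> s (x [^] k)"
    using rcos_stable[OF K(1) s K(2) twisted_pow_closed _ Suc] x by simp
  also have "\<dots> = K #> (s x [^] k)" using group_hom.hom_nat_pow[OF s_hom x] by simp
  also have "\<dots> = K #> (x [^] k)" using Kx x s_closed by (simp add: p.hom_nat_pow)
  finally have 1: "K #> s (twisted_pow s x k) = K #> (x [^] k)" .
  have "K #> twisted_pow s x (Suc k) = (K #> x) \<otimes>\<^bsub>G Mod K\<^esub> (K #> s (twisted_pow s x k))"
    using x s_closed twisted_pow_closed p.hom_mult by simp
  also have "\<dots> = K #> (x \<otimes> x [^] k)" using 1 x p.hom_mult by simp
  finally show ?case by (simp only: nat_pow_Suc2[OF x])
qed simp

end

text \<open>Along a central series \<open>D\<close>, the product \<open>u\<close> of the \<open>s\<close>-conjugates of \<open>x\<close> satisfies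
  \<open>s u = x\<^sup>-\<^sup>1 u x\<close>, which improves \<open>s\<close>-invariance by one step, and \<open>u\<close> lies in the coset of \<open>x^l\<close>.
  As \<open>l\<close> is prime to the exponent \<open>q\<close> of \<open>G/K\<close>, a power of \<open>u\<close> returns to the coset of \<open>x\<close>.\<close>

lemma fixed_coset_has_fixed_point:
  fixes l q d :: nat and D :: "nat \<Rightarrow> 'a set"
  assumes s: "s \<in> hom G G" and sl: "\<And>x. x \<in> carrier G \<Longrightarrow> (s ^^ l) x = x"
    and K: "K \<lhd> G" "s ` K \<subseteq> K" and q: "\<And>x. x \<in> carrier G \<Longrightarrow> x [^] q \<in> K" "coprime l q" "l > (0::nat)"
    and D: "\<And>i. D i \<lhd> G" "\<And>i. s ` D i \<subseteq> D i" "D 0 = carrier G" "D d = {\<one>}"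
    and comm: "\<And>i x y. x \<in> carrier G \<Longrightarrow> y \<in> D i \<Longrightarrow> D (Suc i) #> (x \<otimes> y) = D (Suc i) #> (y \<otimes> x)"
    and x: "x \<in> carrier G" "K #> s x = K #> x"
  obtains y where "y \<in> carrier G" "K #> y = K #> x" "s y = y"
proof -
  interpret s: group_hom G G s by (rule s_hom[OF s x(1)])
  interpret p: group_hom G "G Mod K" "\<lambda>x. K #> x" by (rule rcos_map_hom[OF K(1)])
  have "\<exists>y\<in>carrier G. K #> y = K #> x \<and> D i #> s y = D i #> y" for i
  proof (induction i)
    case 0
    have "carrier G #> z = carrier G" if "z \<in> carrier G" for z
      using that coset_join2 subgroup_self by blast
    then show ?case using x D(3) by auto
  next
    case (Suc i)
    then obtain y where y: "y \<in> carrier G" "K #> y = K #> x" "D i #> s y = D i #> y" by blast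
    interpret r: group_hom G "G Mod D (Suc i)" "\<lambda>x. D (Suc i) #> x" by (rule rcos_map_hom[OF D(1)])
    have sy: "K #> s y = K #> y" using rcos_stable[OF K(1) s K(2) y(1) x(1) y(2)] x y by simp
    define u where "u = twisted_pow s y l"
    have u: "u \<in> carrier G" unfolding u_def by (rule twisted_pow_closed[OF s y(1)])
    have uK: "K #> u = K #> (y [^] l)" unfolding u_def by (rule twisted_pow_coset[OF s y(1) K sy])
    have uD: "D i #> u = D i #> (y [^] l)" unfolding u_def by (rule twisted_pow_coset[OF s y(1) D(1,2) y(3)])
    have sD: "subgroup (D i) G" using D(1) normal_imp_subgroup by blast
    have "u \<in> D i #> (y [^] l)" using uD rcos_self[OF u sD] by simp
    then obtain e where e: "e \<in> D i" "u = e \<otimes> y [^] l" by (auto simp: r_coset_def)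
    have ec: "e \<in> carrier G" using subgroup.mem_carrier[OF sD e(1)] .
    \<comment> \<open>Both sides are the twisted power of exponent l + 1: the left one splits off
      the first factor, the right one the last factor, which is s^l(y) = y.\<close>
    have "y \<otimes> s u = u \<otimes> y" using twisted_pow_Suc'[OF s y(1), of l] sl[OF y(1)] by (simp add: u_def)
    then have su: "s u = inv y \<otimes> (u \<otimes> y)" using y u by (metis inv_solve_left m_closed s.hom_closed)
    \<comment> \<open>\<open>u\<close> is \<open>e\<close> times a power of \<open>y\<close>, and
      \<open>e\<close> is central modulo the next term of the series. So \<open>u\<close> commutes
      with \<open>y\<close> there, and the conjugation in the formula for \<open>s u\<close>
      disappears.\<close>
    have "y [^] l \<otimes> y = y \<otimes> y [^] l" using nat_pow_Suc2[OF y(1), of l] by simp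
    then have "D (Suc i) #> (u \<otimes> y) = D (Suc i) #> ((e \<otimes> y) \<otimes> y [^] l)"
      using e(2) ec y(1) by (simp add: m_assoc)
    also have "\<dots> = (D (Suc i) #> (e \<otimes> y)) \<otimes>\<^bsub>G Mod D (Suc i)\<^esub> (D (Suc i) #> y [^] l)"
      using ec y by (simp add: r.hom_mult)
    also have "D (Suc i) #> (e \<otimes> y) = D (Suc i) #> (y \<otimes> e)" using comm[OF y(1) e(1)] by simp
    also have "(D (Suc i) #> (y \<otimes> e)) \<otimes>\<^bsub>G Mod D (Suc i)\<^esub> (D (Suc i) #> y [^] l) = D (Suc i) #> (y \<otimes> u)"
      using ec y e(2) r.hom_mult[of "y \<otimes> e" "y [^] l"] by (simp add: m_assoc)
    finally have uy: "D (Suc i) #> (u \<otimes> y) = D (Suc i) #> (y \<otimes> u)" .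
    have "D (Suc i) #> s u = (D (Suc i) #> inv y) \<otimes>\<^bsub>G Mod D (Suc i)\<^esub> (D (Suc i) #> (u \<otimes> y))"
      using su u y r.hom_mult[of "inv y" "u \<otimes> y"] by simp
    also have "\<dots> = D (Suc i) #> (inv y \<otimes> (y \<otimes> u))"
      using uy u y r.hom_mult[of "inv y" "y \<otimes> u"] by simp
    also have "inv y \<otimes> (y \<otimes> u) = u" using u y by (simp flip: m_assoc)
    finally have sDu: "D (Suc i) #> s u = D (Suc i) #> u" .
    \<comment> \<open>The exponent \<open>a\<close> undoes the passage to the \<open>l\<close>-th
      power: modulo \<open>K\<close>, u^a is y^(l a) = (y^q)^b y, and y^q lies in
      \<open>K\<close>.\<close>
    obtain a b where ab: "l * a = q * b + 1" using bezout_nat[of l q] q(2,3) by auto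
    have y': "u [^] a \<in> carrier G" using u by simp
    have "K #> (u [^] a) = (K #> u) [^]\<^bsub>G Mod K\<^esub> a" using u by (simp add: p.hom_nat_pow)
    also have "\<dots> = K #> ((y [^] l) [^] a)" using uK y by (simp add: p.hom_nat_pow)
    also have "(y [^] l) [^] a = (y [^] q) [^] b \<otimes> y"
      using y ab by (simp add: nat_pow_pow)
    also have "K #> ((y [^] q) [^] b \<otimes> y) = (K #> (y [^] q)) [^]\<^bsub>G Mod K\<^esub> b \<otimes>\<^bsub>G Mod K\<^esub> (K #> y)"
      using y by (simp add: p.hom_mult p.hom_nat_pow)
    also have "K #> (y [^] q) = \<one>\<^bsub>G Mod K\<^esub>"
      using q(1)[OF y(1)] K(1) by (simp add: coset_join2 normal_imp_subgroup y subgroup.mem_carrier FactGroup_def)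
    also have "\<one>\<^bsub>G Mod K\<^esub> [^]\<^bsub>G Mod K\<^esub> b \<otimes>\<^bsub>G Mod K\<^esub> (K #> y) = K #> y"
      by (simp only: p.H.nat_pow_one p.H.l_one p.hom_closed y(1))
    finally have "K #> (u [^] a) = K #> y" .
    moreover have "D (Suc i) #> s (u [^] a) = D (Suc i) #> (u [^] a)"
      using sDu u by (simp add: s.hom_nat_pow r.hom_nat_pow)
    ultimately show ?case using y' y(2) by auto
  qed
  then obtain y where y: "y \<in> carrier G" "K #> y = K #> x" "D d #> s y = D d #> y" by blast
  then have "s y = y" using D(4) s.hom_closed by (auto simp: r_coset_def)
  then show ?thesis using that y by blast
qed

end

section \<open>Finite quotients of finitely generated unipotent groups\<close>

lemma nonarch_abs_props:
  assumes "nonarch_abs v"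
  shows nonarch_abs_nonneg: "0 \<le> v x" and nonarch_abs_eq_0: "v x = 0 \<longleftrightarrow> x = 0"
    and nonarch_abs_mult: "v (x * y) = v x * v y" and nonarch_abs_add: "v (x + y) \<le> max (v x) (v y)"
    and nonarch_abs_one: "v 1 = 1" and nonarch_abs_minus: "v (- x) = v x"
    and nonarch_abs_diff: "v (x - y) \<le> max (v x) (v y)"
proof -
  have nn: "0 \<le> v x" and z: "v x = 0 \<longleftrightarrow> x = 0" and m: "v (x * y) = v x * v y"
    and a: "v (x + y) \<le> max (v x) (v y)" for x y
    using assms by (auto simp: nonarch_abs_def)
  have "v 1 * v 1 = v 1" using m[of 1 1] by simp
  then have one: "v 1 = 1" using z[of 1] by simp
  have "v (-1) * v (-1) = 1" using m[of "-1" "-1"] one by simp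
  then have "v (-1) = 1" using nn[of "-1"] by (metis abs_of_nonneg power2_eq_square real_sqrt_abs real_sqrt_one)
  then have minus: "v (- x) = v x" for x using m[of "-1" x] by simp
  show "0 \<le> v x" "v x = 0 \<longleftrightarrow> x = 0" "v (x * y) = v x * v y" "v (x + y) \<le> max (v x) (v y)"
    "v 1 = 1" "v (- x) = v x" "v (x - y) \<le> max (v x) (v y)"
    using nn z m a one minus a[of x "-y"] by auto
qed

lemma nonarch_abs_power: "nonarch_abs v \<Longrightarrow> v (x ^ k) = v x ^ k"
  by (induction k) (auto simp: nonarch_abs_one nonarch_abs_mult)

lemma nonarch_abs_inverse: "nonarch_abs v \<Longrightarrow> v (inverse x) = inverse (v x)"
proof (cases "x = 0")
  case True
  assume "nonarch_abs v"
  then have "v 0 = 0" using nonarch_abs_eq_0[of v 0] by simp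
  then show ?thesis using True by simp
next
  case False
  assume v: "nonarch_abs v"
  have "v (x * inverse x) = v x * v (inverse x)" by (rule nonarch_abs_mult[OF v])
  then show ?thesis using False nonarch_abs_one[OF v] by (simp add: inverse_unique)
qed

lemma nonarch_abs_of_nat: "nonarch_abs v \<Longrightarrow> v (of_nat n) \<le> 1"
proof (induction n)
  case (Suc n)
  then show ?case using nonarch_abs_add[of v 1 "of_nat n"] nonarch_abs_one[of v] by auto
qed (simp add: nonarch_abs_eq_0[THEN iffD2])

text \<open>In 1 = l a - p b the term p b is strictly smaller than 1, so l a must have absolute
  value 1. This makes \<open>l\<close> a unit among the integers of F.\<close>

lemma nonarch_abs_coprime:
  assumes v: "nonarch_abs v" and p: "v (of_nat p) < 1" and l: "coprime l p" "l > 0"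
  shows "v (of_nat l) = 1"
proof -
  obtain a b where ab: "l * a = p * b + 1" using bezout_nat[of l p] l by auto
  have "v 1 = v (of_nat (l * a) - of_nat (p * b))" by (simp only: ab) simp
  also have "\<dots> \<le> max (v (of_nat l) * v (of_nat a)) (v (of_nat p) * v (of_nat b))"
    using nonarch_abs_diff[OF v] by (simp add: nonarch_abs_mult[OF v, symmetric])
  finally have 1: "1 \<le> max (v (of_nat l) * v (of_nat a)) (v (of_nat p) * v (of_nat b))"
    by (simp add: nonarch_abs_one[OF v])
  have "v (of_nat p) * v (of_nat b) \<le> v (of_nat p)"
    using nonarch_abs_of_nat[OF v, of b] nonarch_abs_nonneg[OF v, of "of_nat p"] by (simp add: mult_left_le)
  then have "1 \<le> v (of_nat l) * v (of_nat a)" using 1 p by auto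
  also have "\<dots> \<le> v (of_nat l)"
    using nonarch_abs_of_nat[OF v, of a] nonarch_abs_nonneg[OF v, of "of_nat l"] by (simp add: mult_left_le)
  finally show ?thesis using nonarch_abs_of_nat[OF v, of l] by simp
qed

text \<open>One \<pi>-adic digit per step: the error of an approximation to order \<open>k\<close>
  is rescaled by \<pi>^k to an integer and approximated by one of the finitely many representatives
  of the residue field.\<close>

lemma finite_residues:
  assumes v: "nonarch_abs v"
    and fin: "finite (carrier (valuation_ring v Quot {x. v x < 1}))"
    and \<pi>: "0 < v \<pi>" "\<And>x. v x < 1 \<Longrightarrow> v x \<le> v \<pi>"
  shows "\<exists>R. finite R \<and> (\<forall>x. v x \<le> 1 \<longrightarrow> (\<exists>r\<in>R. v (x - r) \<le> v \<pi> ^ k))"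
proof (induction k)
  case 0
  show ?case by (rule exI[of _ "{0}"]) auto
next
  case (Suc k)
  then obtain R where R: "finite R" "\<And>x. v x \<le> 1 \<Longrightarrow> \<exists>r\<in>R. v (x - r) \<le> v \<pi> ^ k" by blast
  let ?I = "{x. v x < 1}"
  let ?C = "carrier (valuation_ring v Quot ?I)"
  define R1 where "R1 = (\<lambda>C. SOME x. x \<in> C) ` ?C"
  have R1: "\<exists>r\<in>R1. v (y - r) \<le> v \<pi>" if "v y \<le> 1" for y
  proof -
    let ?K = "?I +>\<^bsub>valuation_ring v\<^esub> y"
    have K: "?K = {i + y | i. v i < 1}"
      by (auto simp: a_r_coset_def' valuation_ring_def ring_of_type_algebra_def)
    have "?K \<in> ?C"
      using that by (auto simp: FactRing_def A_RCOSETS_def' valuation_ring_def)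
    then have "(SOME x. x \<in> ?K) \<in> R1" unfolding R1_def by (rule imageI)
    moreover have "y \<in> ?K" unfolding K using nonarch_abs_eq_0[OF v, of 0] by (intro CollectI exI[of _ 0]) auto
    then have "(SOME x. x \<in> ?K) \<in> ?K" by (rule someI)
    then obtain i where "v i < 1" "(SOME x. x \<in> ?K) = i + y" unfolding K by blast
    then have "v (y - (SOME x. x \<in> ?K)) \<le> v \<pi>" using \<pi>(2) nonarch_abs_minus[OF v, of i] by simp
    ultimately show ?thesis by (rule rev_bexI)
  qed
  have p0: "\<pi> \<noteq> 0" using \<pi>(1) nonarch_abs_eq_0[OF v, of \<pi>] by auto
  show ?case
  proof (intro exI conjI allI impI)
    show "finite ((\<lambda>(r, s). r + \<pi> ^ k * s) ` (R \<times> R1))" using R(1) fin by (simp add: R1_def)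
    fix x assume "v x \<le> 1"
    then obtain r where r: "r \<in> R" "v (x - r) \<le> v \<pi> ^ k" using R(2) by blast
    let ?y = "inverse (\<pi> ^ k) * (x - r)"
    have "v ?y = inverse (v \<pi> ^ k) * v (x - r)"
      by (simp only: nonarch_abs_mult[OF v] nonarch_abs_inverse[OF v] nonarch_abs_power[OF v])
    also have "\<dots> \<le> inverse (v \<pi> ^ k) * v \<pi> ^ k" using r(2) \<pi>(1) by (intro mult_left_mono) auto
    also have "\<dots> = 1" using \<pi>(1) by simp
    finally have "v ?y \<le> 1" .
    then obtain s where s: "s \<in> R1" "v (?y - s) \<le> v \<pi>" using R1 by blast
    have "x - (r + \<pi> ^ k * s) = \<pi> ^ k * (?y - s)" using p0 by (simp add: field_simps)
    then have "v (x - (r + \<pi> ^ k * s)) = v \<pi> ^ k * v (?y - s)"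
      by (simp add: nonarch_abs_mult[OF v] nonarch_abs_power[OF v])
    also have "\<dots> \<le> v \<pi> ^ k * v \<pi>" using s(2) \<pi>(1) by (intro mult_left_mono) auto
    finally have "v (x - (r + \<pi> ^ k * s)) \<le> v \<pi> ^ Suc k" by (simp add: mult.commute)
    then show "\<exists>r\<in>(\<lambda>(r, s). r + \<pi> ^ k * s) ` (R \<times> R1). v (x - r) \<le> v \<pi> ^ Suc k"
      using r(1) s(1) by (intro bexI[of _ "r + \<pi> ^ k * s"] image_eqI[of _ _ "(r, s)"]) auto
  qed
qed

section \<open>Matrices filtered by their effect on the flag\<close>

definition smat :: "'k::comm_ring_1 \<Rightarrow> 'k^'n^'m \<Rightarrow> 'k^'n^'m" where
  "smat c A = (\<chi> i j. c * A $ i $ j)"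

lemma smat_nth [simp]: "smat c A $ i $ j = c * A $ i $ j"
  by (simp add: smat_def)

lemma smat_mult_left: "smat c A ** B = smat c (A ** B)"
  by (simp add: vec_eq_iff matrix_matrix_mult_def sum_distrib_left mult.assoc)

lemma smat_mult_right: "A ** smat c B = smat c (A ** B)"
  by (simp add: vec_eq_iff matrix_matrix_mult_def sum_distrib_left mult_ac)

lemma smat_smat: "smat c (smat d A) = smat (c * d) A"
  by (simp add: vec_eq_iff mult_ac)

lemma smat_add_right: "smat c (A + B) = smat c A + smat c B"
  and smat_add_left: "smat (c + d) A = smat c A + smat d A"
  and smat_diff_right: "smat c (A - B) = smat c A - smat c B"
  and smat_diff_left: "smat (c - d) A = smat c A - smat d A"
  and smat_one: "smat 1 A = A" and smat_zero: "smat 0 A = 0" "smat c 0 = 0"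
  and smat_minus_one: "smat (- 1) A = - A"
  by (simp_all add: vec_eq_iff algebra_simps)

lemma smat_vec: "smat c A *v x = c *s (A *v x)"
  by (simp add: vec_eq_iff matrix_vector_mult_def sum_distrib_left mult.assoc)

context unipotent_monoid
begin

text \<open>Since the shift is demanded at every level of the flag, degrees add under
  multiplication. Degree one contains all g - 1 with g in \<open>S\<close>, and degree
  \<open>CARD('n)\<close> is zero.\<close>

definition filt :: "nat \<Rightarrow> ('k^'n^'n) set" where
  "filt i = {A. \<forall>k. \<forall>w\<in>flag k. A *v w \<in> flag (k + i)}"

lemma flag_subspace: "vec.subspace (flag k)"
  using flag_invariant invariant_def by blast

lemma filt_add: "A \<in> filt i \<Longrightarrow> B \<in> filt i \<Longrightarrow> A + B \<in> filt i"
  unfolding filt_def by (simp add: matrix_vector_mult_add_rdistrib vec.subspace_add[OF flag_subspace])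

lemma filt_diff: "A \<in> filt i \<Longrightarrow> B \<in> filt i \<Longrightarrow> A - B \<in> filt i"
  unfolding filt_def by (simp add: matrix_vector_mult_diff_rdistrib vec.subspace_diff[OF flag_subspace])

lemma filt_zero: "0 \<in> filt i"
  unfolding filt_def by (simp add: vec.subspace_0[OF flag_subspace])

lemma filt_smat: "A \<in> filt i \<Longrightarrow> smat c A \<in> filt i"
  unfolding filt_def by (simp add: smat_vec vec.subspace_scale[OF flag_subspace])

lemma filt_mult: "A \<in> filt i \<Longrightarrow> B \<in> filt j \<Longrightarrow> A ** B \<in> filt (i + j)"
  unfolding filt_def by (auto simp flip: matrix_vector_mul_assoc) (metis add.assoc add.commute)

lemma flag_antimono: "i \<le> j \<Longrightarrow> flag j \<subseteq> flag i"
  by (rule lift_Suc_antimono_le[of flag, OF flag_Suc_subset])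

lemma filt_antimono:
  assumes "i \<le> j"
  shows "filt j \<subseteq> filt i"
proof -
  have "flag (k + j) \<subseteq> flag (k + i)" for k using assms by (intro flag_antimono) simp
  then show ?thesis unfolding filt_def by blast
qed

lemma filt_gen:
  assumes "g \<in> S"
  shows "g - mat 1 \<in> filt 1"
  unfolding filt_def
proof (intro CollectI allI ballI)
  fix k w assume "w \<in> flag k"
  then have "g *v w - w \<in> flag (Suc k)" unfolding flag.simps using assms by (intro vec.span_base) blast
  then show "(g - mat 1) *v w \<in> flag (k + 1)" by (simp add: matrix_vector_mult_diff_rdistrib)
qed

lemma S_filt_0: "g \<in> S \<Longrightarrow> g \<in> filt 0"
  unfolding filt_def using flag_invariant by (auto simp: invariant_def)

lemma filt_end:
  assumes "A \<in> filt i" "CARD('n) \<le> i"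
  shows "A = 0"
proof -
  have "A *v w = 0" for w
  proof -
    have "w \<in> flag 0" by simp
    then have "A *v w \<in> flag (0 + i)" using assms(1) unfolding filt_def by blast
    then show ?thesis using flag_antimono[OF assms(2)] flag_end by auto
  qed
  then show ?thesis by (simp add: matrix_eq)
qed

end

lemma matrix_add_rdistrib:
  fixes A :: "'k::comm_ring_1^'n^'m"
  shows "(A + B) ** C = A ** C + B ** C"
  by (simp add: matrix_matrix_mult_def vec_eq_iff algebra_simps sum.distrib)

lemma smat_sum_right: "smat c (\<Sum>i\<in>I. f i) = (\<Sum>i\<in>I. smat c (f i))"
  by (induction I rule: infinite_finite_induct) (auto simp: smat_zero smat_add_right)

section \<open>The lattice spanned by products of differences g - 1\<close>

locale unipotent_lattice = unipotent_monoid S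
  for S :: "('f::field alg_closure^'n^'n) set" +
  fixes v :: "'f \<Rightarrow> real" and \<pi> :: 'f and T :: "('f alg_closure^'n^'n) set"
  assumes v: "nonarch_abs v"
    and \<pi>: "0 < v \<pi>" "v \<pi> < 1" "\<And>x. v x < 1 \<Longrightarrow> v x \<le> v \<pi>"
    and residues: "finite (carrier (valuation_ring v Quot {x. v x < 1}))"
    and T: "finite T" "T \<subseteq> S"
    and T_rational: "\<And>g i j. g \<in> T \<Longrightarrow> g $ i $ j \<in> base"
begin

primrec aug_prod :: "('f alg_closure^'n^'n) list \<Rightarrow> 'f alg_closure^'n^'n" where
  "aug_prod [] = mat 1"
| "aug_prod (g # gs) = (g - mat 1) ** aug_prod gs"

lemma aug_prod_append: "aug_prod (xs @ ys) = aug_prod xs ** aug_prod ys"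
  by (induction xs) (auto simp: matrix_mul_assoc)

lemma aug_prod_filt: "set xs \<subseteq> S \<Longrightarrow> aug_prod xs \<in> filt (length xs)"
proof (induction xs)
  case Nil
  then show ?case using S_filt_0[OF one] by simp
next
  case (Cons g xs)
  then have "(g - mat 1) ** aug_prod xs \<in> filt (1 + length xs)" by (intro filt_mult filt_gen) auto
  then show ?case by simp
qed

definition gens :: "('f alg_closure^'n^'n) set" where
  "gens = {aug_prod xs | xs. set xs \<subseteq> T \<and> xs \<noteq> []}"

text \<open>A product of more than \<open>CARD('n)\<close> differences falls into the zero part of
  the filtration, so only words of bounded length count.\<close>

lemma finite_gens: "finite gens"
proof -
  have "gens \<subseteq> insert 0 (aug_prod ` {xs. set xs \<subseteq> T \<and> length xs \<le> CARD('n)})"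
  proof
    fix b assume "b \<in> gens"
    then obtain xs where xs: "b = aug_prod xs" "set xs \<subseteq> T" unfolding gens_def by blast
    show "b \<in> insert 0 (aug_prod ` {xs. set xs \<subseteq> T \<and> length xs \<le> CARD('n)})"
    proof (cases "length xs \<le> CARD('n)")
      case True
      then show ?thesis using xs by simp
    next
      case False
      then have "aug_prod xs = 0" using filt_end[OF aug_prod_filt] xs T by simp
      then show ?thesis using xs by simp
    qed
  qed
  then show ?thesis using finite_lists_length_le[OF T(1)] by (meson finite_imageI finite_insert finite_subset)
qed

lemma gens_mult: "a \<in> gens \<Longrightarrow> b \<in> gens \<Longrightarrow> a ** b \<in> gens"
  unfolding gens_def
proof clarify
  fix xs ys :: "('f alg_closure^'n^'n) list" assume "set xs \<subseteq> T" "xs \<noteq> []" "set ys \<subseteq> T" "ys \<noteq> []"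
  then show "\<exists>zs. aug_prod xs ** aug_prod ys = aug_prod zs \<and> set zs \<subseteq> T \<and> zs \<noteq> []"
    by (intro exI[of _ "xs @ ys"]) (auto simp: aug_prod_append)
qed

lemma gens_filt: "b \<in> gens \<Longrightarrow> b \<in> filt 1"
proof -
  assume "b \<in> gens"
  then obtain xs where xs: "b = aug_prod xs" "set xs \<subseteq> T" "xs \<noteq> []" unfolding gens_def by blast
  then have "b \<in> filt (length xs)" "1 \<le> length xs" using aug_prod_filt[of xs] T by (auto simp: Suc_le_eq)
  then show ?thesis using filt_antimono by blast
qed

lemma base_closed:
  "0 \<in> base" "1 \<in> base" "x \<in> base \<Longrightarrow> y \<in> base \<Longrightarrow> x + y \<in> base" "x \<in> base \<Longrightarrow> y \<in> base \<Longrightarrow> x - y \<in> base"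
  "x \<in> base \<Longrightarrow> y \<in> base \<Longrightarrow> x * y \<in> base" for x y :: "'a::field alg_closure"
  by (auto simp flip: to_ac_0 to_ac_1 to_ac_add to_ac_diff to_ac_mult)

lemma base_sum: "(\<And>i. i \<in> I \<Longrightarrow> f i \<in> base) \<Longrightarrow> (\<Sum>i\<in>I. f i) \<in> (base :: 'f alg_closure set)"
  by (induction I rule: infinite_finite_induct) (auto simp: base_closed)

lemma gens_rational: "b \<in> gens \<Longrightarrow> b $ i $ j \<in> base"
proof -
  assume "b \<in> gens"
  then obtain xs where xs: "b = aug_prod xs" "set xs \<subseteq> T" unfolding gens_def by blast
  have "\<forall>i j. aug_prod xs $ i $ j \<in> base" using xs(2)
  proof (induction xs)
    case Nil
    then show ?case by (simp add: mat_def base_closed)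
  next
    case (Cons g xs)
    then have "(g - mat 1) $ i $ k * aug_prod xs $ k $ j \<in> base" for i j k
      using T_rational[of g] by (intro base_closed(5)) (auto simp: mat_def intro!: base_closed(4) base_closed(1,2))
    then show ?case by (simp add: matrix_matrix_mult_def base_sum)
  qed
  then show ?thesis using xs by simp
qed

text \<open>The module spanned by \<open>gens\<close> over the integers of F. It is closed under
  multiplication and lies in degree one of the filtration; 1 + M will contain the group generated by
  \<open>T\<close> once \<open>T\<close> is closed under inverses.\<close>

inductive_set M :: "('f alg_closure^'n^'n) set" where
  M_zero: "0 \<in> M"
| M_gens: "b \<in> gens \<Longrightarrow> b \<in> M"
| M_add: "A \<in> M \<Longrightarrow> B \<in> M \<Longrightarrow> A + B \<in> M"
| M_scale: "v c \<le> 1 \<Longrightarrow> A \<in> M \<Longrightarrow> smat (to_ac c) A \<in> M"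

lemma M_minus: "A \<in> M \<Longrightarrow> - A \<in> M"
  using M_scale[of "-1" A] by (simp add: nonarch_abs_minus[OF v] nonarch_abs_one[OF v] smat_minus_one)

lemma M_sum: "(\<And>i. i \<in> I \<Longrightarrow> f i \<in> M) \<Longrightarrow> (\<Sum>i\<in>I. f i) \<in> M"
  by (induction I rule: infinite_finite_induct) (auto simp: M_zero M_add)

lemma M_gen_mult: "A \<in> M \<Longrightarrow> b \<in> gens \<Longrightarrow> b ** A \<in> M"
  by (induction rule: M.induct)
    (simp_all add: M_zero M_add M_scale M_gens gens_mult matrix_add_ldistrib smat_mult_right)

lemma M_mult: "A \<in> M \<Longrightarrow> B \<in> M \<Longrightarrow> A ** B \<in> M"
  by (induction rule: M.induct)
    (simp_all add: M_zero M_add M_scale M_gen_mult matrix_add_rdistrib smat_mult_left)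

lemma M_filt: "A \<in> M \<Longrightarrow> A \<in> filt 1"
  by (induction rule: M.induct) (simp_all add: filt_zero gens_filt filt_add filt_smat del: One_nat_def)

lemma M_rational: "A \<in> M \<Longrightarrow> A $ i $ j \<in> base"
  by (induction rule: M.induct) (auto simp: base_closed gens_rational)

lemma of_ac_hom:
  assumes "x \<in> base" "y \<in> base"
  shows "of_ac (x + y) = of_ac x + of_ac y" "of_ac (x * y) = of_ac x * of_ac y"
  using assms by (auto simp flip: to_ac_add to_ac_mult)

lemma M_bounded: "\<exists>R. \<forall>A\<in>M. \<forall>i j. v (of_ac (A $ i $ j)) \<le> R"
proof -
  let ?V = "insert 0 ((\<lambda>(b, i, j). v (of_ac (b $ i $ j))) ` (gens \<times> UNIV))"
  define R where "R = Max ?V"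
  have fin: "finite ?V" using finite_gens by simp
  have R0: "0 \<le> R" unfolding R_def by (rule Max_ge[OF fin]) simp
  have "v (of_ac (A $ i $ j)) \<le> R" if "A \<in> M" for A :: "'f alg_closure^'n^'n" and i j
    using that
  proof (induction rule: M.induct)
    case M_zero
    then show ?case using R0 nonarch_abs_eq_0[OF v, of 0] by simp
  next
    case (M_gens b)
    have "v (of_ac (b $ i $ j)) \<in> ?V"
      by (rule insertI2, rule image_eqI[of _ _ "(b, i, j)"]) (use M_gens in auto)
    then show ?case unfolding R_def by (rule Max_ge[OF fin])
  next
    case (M_add A B)
    have "v (of_ac ((A + B) $ i $ j)) \<le> max (v (of_ac (A $ i $ j))) (v (of_ac (B $ i $ j)))"
      using nonarch_abs_add[OF v] M_add M_rational by (simp add: of_ac_hom)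
    then show ?case using M_add by simp
  next
    case (M_scale c A)
    have "v (of_ac (smat (to_ac c) A $ i $ j)) = v c * v (of_ac (A $ i $ j))"
      using M_scale M_rational by (simp add: of_ac_hom nonarch_abs_mult[OF v])
    also have "\<dots> \<le> 1 * R"
      using M_scale R0 nonarch_abs_nonneg[OF v] by (intro mult_mono) auto
    finally show ?case by simp
  qed
  then show ?thesis by blast
qed

lemma M_explicit: "A \<in> M \<Longrightarrow> \<exists>c. (\<forall>b\<in>gens. v (c b) \<le> 1) \<and> A = (\<Sum>b\<in>gens. smat (to_ac (c b)) b)"
proof (induction rule: M.induct)
  case M_zero
  then show ?case
    using nonarch_abs_eq_0[OF v, of 0] by (intro exI[of _ "\<lambda>_. 0"]) (simp add: smat_zero)
next
  case (M_gens b)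
  let ?c = "\<lambda>a. if a = b then 1 else 0"
  have "(\<Sum>a\<in>gens. smat (to_ac (?c a)) a) = (\<Sum>a\<in>gens. if a = b then b else 0)"
    by (intro sum.cong) (auto simp: smat_zero smat_one)
  then have "b = (\<Sum>a\<in>gens. smat (to_ac (?c a)) a)" using M_gens finite_gens by simp
  then show ?case
    using nonarch_abs_eq_0[OF v, of 0] nonarch_abs_one[OF v] by (intro exI[of _ ?c]) auto
next
  case (M_add A B)
  then obtain c d where c: "\<forall>b\<in>gens. v (c b) \<le> 1" "A = (\<Sum>b\<in>gens. smat (to_ac (c b)) b)"
    and d: "\<forall>b\<in>gens. v (d b) \<le> 1" "B = (\<Sum>b\<in>gens. smat (to_ac (d b)) b)" by blast
  have "v (c b + d b) \<le> 1" if "b \<in> gens" for b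
    using nonarch_abs_add[OF v, of "c b" "d b"] c(1) d(1) that by fastforce
  moreover have "A + B = (\<Sum>b\<in>gens. smat (to_ac (c b + d b)) b)"
    by (simp add: c(2) d(2) sum.distrib smat_add_left)
  ultimately show ?case by (intro exI[of _ "\<lambda>b. c b + d b"]) simp
next
  case (M_scale e A)
  then obtain c where c: "\<forall>b\<in>gens. v (c b) \<le> 1" "A = (\<Sum>b\<in>gens. smat (to_ac (c b)) b)" by blast
  have "v (e * c b) \<le> 1" if "b \<in> gens" for b
    using c(1) that M_scale(1) nonarch_abs_nonneg[OF v] by (simp add: nonarch_abs_mult[OF v] mult_le_one)
  moreover have "smat (to_ac e) A = (\<Sum>b\<in>gens. smat (to_ac (e * c b)) b)"
    by (simp add: c(2) smat_sum_right smat_smat)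
  ultimately show ?case by (intro exI[of _ "\<lambda>b. e * c b"]) simp
qed

text \<open>A two-sided ideal of \<open>M\<close> whose entries become arbitrarily small as k grows;
  it serves as the modulus for the subgroup \<open>K\<close>.\<close>

definition scaled :: "nat \<Rightarrow> ('f alg_closure^'n^'n) set" where
  "scaled k = smat (to_ac (\<pi> ^ k)) ` M"

lemma scaled_subset: "scaled k \<subseteq> M"
  using \<pi> by (auto simp: scaled_def nonarch_abs_power[OF v] power_le_one simp del: to_ac_power intro: M_scale)

lemma scaled_add: "A \<in> scaled k \<Longrightarrow> B \<in> scaled k \<Longrightarrow> A + B \<in> scaled k"
  and scaled_minus: "A \<in> scaled k \<Longrightarrow> - A \<in> scaled k"
  and scaled_mult_left: "A \<in> scaled k \<Longrightarrow> B \<in> M \<Longrightarrow> B ** A \<in> scaled k"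
  and scaled_mult_right: "A \<in> scaled k \<Longrightarrow> B \<in> M \<Longrightarrow> A ** B \<in> scaled k"
proof -
  show "A + B \<in> scaled k" if "A \<in> scaled k" "B \<in> scaled k"
    using that unfolding scaled_def by (auto simp: M_add simp flip: smat_add_right)
  show "- A \<in> scaled k" if "A \<in> scaled k"
  proof -
    obtain A' where "A' \<in> M" "A = smat (to_ac (\<pi> ^ k)) A'" using \<open>A \<in> scaled k\<close> unfolding scaled_def by blast
    then have "- A = smat (to_ac (\<pi> ^ k)) (- A')" "- A' \<in> M" by (simp_all add: M_minus vec_eq_iff)
    then show ?thesis unfolding scaled_def by blast
  qed
  show "B ** A \<in> scaled k" if "A \<in> scaled k" "B \<in> M"
    using that unfolding scaled_def by (auto simp: smat_mult_right M_mult)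
  show "A ** B \<in> scaled k" if "A \<in> scaled k" "B \<in> M"
    using that unfolding scaled_def by (auto simp: smat_mult_left M_mult)
qed

lemma scaled_zero: "0 \<in> scaled k"
  unfolding scaled_def by (rule image_eqI[of _ _ 0]) (auto simp: smat_zero M_zero)

lemma scaled_small:
  assumes "0 < \<epsilon>"
  shows "\<exists>k. \<forall>A\<in>scaled k. \<forall>i j. v (of_ac (A $ i $ j)) < \<epsilon>"
proof -
  obtain R where R: "\<And>(A :: 'f alg_closure^'n^'n) i j. A \<in> M \<Longrightarrow> v (of_ac (A $ i $ j)) \<le> R" using M_bounded by blast
  define R' where "R' = max R 1"
  have R': "R' > 0" "R \<le> R'" by (auto simp: R'_def)
  obtain k where k: "v \<pi> ^ k < \<epsilon> / R'"
    using real_arch_pow_inv[of "\<epsilon> / R'" "v \<pi>"] assms R' \<pi> by auto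
  have "v (of_ac (A $ i $ j)) < \<epsilon>" if "A \<in> scaled k" for A :: "'f alg_closure^'n^'n" and i j
  proof -
    obtain B where B: "B \<in> M" "A = smat (to_ac (\<pi> ^ k)) B" using \<open>A \<in> scaled k\<close> unfolding scaled_def by blast
    have "v (of_ac (A $ i $ j)) = v (\<pi> ^ k) * v (of_ac (B $ i $ j))"
      using M_rational[OF B(1)] by (simp add: B(2) of_ac_hom nonarch_abs_mult[OF v] del: to_ac_power)
    also have "\<dots> \<le> v \<pi> ^ k * R'"
      using R[OF B(1), of i j] R' \<pi> nonarch_abs_nonneg[OF v] by (simp add: nonarch_abs_power[OF v] mult_left_mono)
    also have "\<dots> < \<epsilon>" using k R' by (simp add: field_simps)
    finally show ?thesis .
  qed
  then show ?thesis by blast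
qed

text \<open>A label lists residues modulo \<pi>^k of one chosen family of coefficients. As
  \<open>gens\<close> may be linearly dependent, coefficients are not canonical, and only the
  passage from equal labels to a small difference is claimed.\<close>

lemma finite_labels:
  "\<exists>\<kappa> :: 'f alg_closure^'n^'n \<Rightarrow> 'f alg_closure^'n^'n \<Rightarrow> 'f. finite (\<kappa> ` M) \<and>
     (\<forall>A\<in>M. \<forall>B\<in>M. \<kappa> A = \<kappa> B \<longrightarrow> A - B \<in> scaled k)"
proof -
  obtain R where R: "finite R" "\<And>x. v x \<le> 1 \<Longrightarrow> \<exists>r\<in>R. v (x - r) \<le> v \<pi> ^ k"
    using finite_residues[OF v residues \<pi>(1,3), of k] by blast
  obtain c where c: "\<And>A b. A \<in> M \<Longrightarrow> b \<in> gens \<Longrightarrow> v (c A b) \<le> 1"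
    "\<And>A. A \<in> M \<Longrightarrow> A = (\<Sum>b\<in>gens. smat (to_ac (c A b)) b)"
  proof -
    have "\<forall>A\<in>M. \<exists>c. (\<forall>b\<in>gens. v (c b) \<le> 1) \<and> A = (\<Sum>b\<in>gens. smat (to_ac (c b)) b)"
      by (rule ballI, rule M_explicit)
    from bchoice[OF this] show ?thesis using that by blast
  qed
  obtain r where r: "\<And>x. v x \<le> 1 \<Longrightarrow> r x \<in> R" "\<And>x. v x \<le> 1 \<Longrightarrow> v (x - r x) \<le> v \<pi> ^ k"
  proof -
    have "\<forall>x\<in>{x. v x \<le> 1}. \<exists>r. r \<in> R \<and> v (x - r) \<le> v \<pi> ^ k" using R(2) by blast
    from bchoice[OF this] show ?thesis using that by blast
  qed
  define \<kappa> where "\<kappa> A = (\<lambda>b\<in>gens. r (c A b))" for A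
  have "\<kappa> ` M \<subseteq> (\<Pi>\<^sub>E b\<in>gens. R)" using c(1) r(1) by (auto simp: \<kappa>_def)
  then have "finite (\<kappa> ` M)" using finite_PiE[OF finite_gens, of "\<lambda>_. R"] R(1) finite_subset by blast
  moreover have "A - B \<in> scaled k" if A: "A \<in> M" and B: "B \<in> M" and eq: "\<kappa> A = \<kappa> B" for A B
  proof -
    define e where "e b = inverse (\<pi> ^ k) * (c A b - c B b)" for b
    have p0: "\<pi> \<noteq> 0" using \<pi>(1) nonarch_abs_eq_0[OF v, of \<pi>] by auto
    have e: "v (e b) \<le> 1" if b: "b \<in> gens" for b
    proof -
      have rr: "r (c A b) = r (c B b)" using eq b unfolding \<kappa>_def by (metis restrict_apply')
      have "c A b - c B b = (c A b - r (c A b)) - (c B b - r (c B b))" using rr by simp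
      then have "v (c A b - c B b) \<le> max (v (c A b - r (c A b))) (v (c B b - r (c B b)))"
        using nonarch_abs_diff[OF v] by metis
      also have "\<dots> \<le> v \<pi> ^ k" using r(2) c(1) A B b by simp
      finally have "inverse (v \<pi> ^ k) * v (c A b - c B b) \<le> inverse (v \<pi> ^ k) * v \<pi> ^ k"
        using \<pi>(1) by (intro mult_left_mono) auto
      moreover have "inverse (v \<pi> ^ k) * v \<pi> ^ k = 1" using \<pi>(1) by simp
      ultimately show ?thesis
        by (simp only: e_def nonarch_abs_mult[OF v] nonarch_abs_inverse[OF v] nonarch_abs_power[OF v])
    qed
    have ec: "\<pi> ^ k * e b = c A b - c B b" for b using p0 by (simp add: e_def)
    have "A - B = (\<Sum>b\<in>gens. smat (to_ac (c A b)) b) - (\<Sum>b\<in>gens. smat (to_ac (c B b)) b)"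
      using c(2)[OF A] c(2)[OF B] by simp
    also have "\<dots> = (\<Sum>b\<in>gens. smat (to_ac (\<pi> ^ k * e b)) b)"
      by (simp only: sum_subtractf[symmetric] ec to_ac_diff smat_diff_left)
    also have "\<dots> = smat (to_ac (\<pi> ^ k)) (\<Sum>b\<in>gens. smat (to_ac (e b)) b)"
      by (simp only: smat_sum_right smat_smat to_ac_mult)
    finally show ?thesis
      unfolding scaled_def by (rule image_eqI) (intro M_sum M_scale M_gens e)
  qed
  ultimately show ?thesis by blast
qed

text \<open>The flag filtration as it appears modulo \<pi>^k \<open>M\<close>. From degree one on, a
  product of two elements of \<open>J i k\<close> lies one step deeper, so that powers become linear
  to first order.\<close>

definition J :: "nat \<Rightarrow> nat \<Rightarrow> ('f alg_closure^'n^'n) set" where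
  "J i k = {A + B | A B. A \<in> M \<and> A \<in> filt i \<and> B \<in> scaled k}"

lemma J_add: "x \<in> J i k \<Longrightarrow> y \<in> J i k \<Longrightarrow> x + y \<in> J i k"
proof -
  assume "x \<in> J i k" "y \<in> J i k"
  then obtain A B C D where "x = A + B" "y = C + D" "A \<in> M" "A \<in> filt i" "B \<in> scaled k" "C \<in> M" "C \<in> filt i" "D \<in> scaled k"
    unfolding J_def by blast
  then have "x + y = (A + C) + (B + D)" "A + C \<in> M" "A + C \<in> filt i" "B + D \<in> scaled k"
    by (simp_all add: M_add filt_add scaled_add)
  then show ?thesis unfolding J_def by blast
qed

lemma J_scale: "x \<in> J i k \<Longrightarrow> v c \<le> 1 \<Longrightarrow> smat (to_ac c) x \<in> J i k"
proof -
  assume "x \<in> J i k" and c: "v c \<le> 1"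
  then obtain A B where x: "x = A + smat (to_ac (\<pi> ^ k)) B" "A \<in> M" "A \<in> filt i" "B \<in> M"
    unfolding J_def scaled_def by blast
  then have "smat (to_ac c) x = smat (to_ac c) A + smat (to_ac (\<pi> ^ k)) (smat (to_ac c) B)"
    by (simp add: smat_add_right smat_smat mult.commute)
  moreover have "smat (to_ac c) A \<in> M" "smat (to_ac c) A \<in> filt i" "smat (to_ac (\<pi> ^ k)) (smat (to_ac c) B) \<in> scaled k"
    using x c M_scale filt_smat unfolding scaled_def by blast+
  ultimately show ?thesis unfolding J_def by blast
qed

lemma J_minus: "x \<in> J i k \<Longrightarrow> - x \<in> J i k"
  using J_scale[of x i k "-1"] by (simp add: nonarch_abs_minus[OF v] nonarch_abs_one[OF v] smat_minus_one)

lemma J_scaled: "A \<in> scaled k \<Longrightarrow> A \<in> J i k"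
proof -
  assume "A \<in> scaled k"
  then have "A = 0 + A" by simp
  then show ?thesis unfolding J_def using M_zero filt_zero \<open>A \<in> scaled k\<close> by blast
qed

lemma J_mult:
  assumes "x \<in> J i k" "y \<in> J i k" "1 \<le> i"
  shows "x ** y \<in> J (Suc i) k"
proof -
  obtain A B C D where x: "x = A + B" "y = C + D" "A \<in> M" "A \<in> filt i" "B \<in> scaled k" "C \<in> M" "C \<in> filt i" "D \<in> scaled k"
    using assms unfolding J_def by blast
  have "x ** y = A ** C + (A ** D + (B ** C + B ** D))"
    by (simp add: x(1,2) matrix_add_ldistrib matrix_add_rdistrib add.assoc)
  moreover have "A ** C \<in> M" using x M_mult by blast
  moreover have "A ** C \<in> filt (Suc i)"
    using filt_antimono[of "Suc i" "i + i"] filt_mult[OF x(4) x(7)] assms(3) by auto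
  moreover have "A ** D + (B ** C + B ** D) \<in> scaled k"
    using x scaled_subset by (intro scaled_add scaled_mult_left scaled_mult_right) auto
  ultimately show ?thesis unfolding J_def by blast
qed

lemma J_Suc: "J (Suc i) k \<subseteq> J i k"
  unfolding J_def using filt_antimono[of i "Suc i"] by auto

lemma J_end: "J (CARD('n)) k \<subseteq> scaled k"
  unfolding J_def by (auto dest!: filt_end[OF _ order_refl])

text \<open>Induction with h^(j+1) - 1 = (h^j - 1) + (h - 1) + (h - 1)(h^j - 1), whose last term
  lies one step deeper. It does the work of a logarithm in every characteristic.\<close>

lemma pow_congruence:
  assumes a: "h - mat 1 \<in> J i k" and i: "1 \<le> i"
  shows "matrix_pow h j - mat 1 - smat (of_nat j) (h - mat 1) \<in> J (Suc i) k"
proof (induction j)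
  case 0
  show ?case using J_scaled[OF scaled_zero] by (simp add: smat_zero)
next
  case (Suc j)
  let ?E = "matrix_pow h j - mat 1 - smat (of_nat j) (h - mat 1)"
  have "smat (to_ac (of_nat j)) (h - mat 1) \<in> J i k"
    by (rule J_scale[OF a nonarch_abs_of_nat[OF v]])
  then have "?E + smat (of_nat j) (h - mat 1) \<in> J i k"
    by (intro J_add subsetD[OF J_Suc Suc]) simp
  then have p: "matrix_pow h j - mat 1 \<in> J i k" by simp
  have "matrix_pow h (Suc j) - mat 1 - smat (of_nat (Suc j)) (h - mat 1)
      = ?E + (h - mat 1) ** (matrix_pow h j - mat 1)"
    by (simp add: matrix_diff_ldistrib matrix_diff_rdistrib smat_add_left smat_one algebra_simps)
  then show ?case using J_add[OF Suc J_mult[OF a p i]] by (simp only:)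
qed

text \<open>Along the chain \<open>J 1 = M \<supseteq> J 2 \<supseteq> \<dots> \<supseteq> J n = \<pi>\<^sup>k M\<close> the power map is multiplication by \<open>l\<close>.\<close>

lemma torsion_free_mod_scaled:
  assumes h: "h - mat 1 \<in> M" and l: "v (of_nat l) = 1" and hl: "matrix_pow h l - mat 1 \<in> scaled k"
  shows "h - mat 1 \<in> scaled k"
proof -
  have "h - mat 1 \<in> J (Suc i) k" for i
  proof (induction i)
    case 0
    have "h - mat 1 = (h - mat 1) + 0" by simp
    then show ?case unfolding J_def using h M_filt[OF h] scaled_zero unfolding One_nat_def by blast
  next
    case (Suc i)
    let ?E = "matrix_pow h l - mat 1 - smat (of_nat l) (h - mat 1)"
    have "?E \<in> J (Suc (Suc i)) k" by (rule pow_congruence[OF Suc]) simp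
    \<comment> \<open>As h^l - 1 already lies in \<pi>^k \<open>M\<close>, the congruence leaves l
      (h - 1) in the deeper step, and \<open>l\<close> can be divided out because it is a
      unit.\<close>
    then have "(matrix_pow h l - mat 1) + - ?E \<in> J (Suc (Suc i)) k"
      using J_add[OF J_scaled[OF hl] J_minus] by blast
    then have "smat (of_nat l) (h - mat 1) \<in> J (Suc (Suc i)) k" by simp
    then have "smat (to_ac (inverse (of_nat l))) (smat (of_nat l) (h - mat 1)) \<in> J (Suc (Suc i)) k"
      by (rule J_scale) (simp add: nonarch_abs_inverse[OF v] l)
    moreover have "(of_nat l :: 'f) \<noteq> 0" using l nonarch_abs_eq_0[OF v, of 0] by auto
    then have "to_ac (inverse (of_nat l)) * of_nat l = (1 :: 'f alg_closure)"
      by (metis left_inverse to_ac_1 to_ac_mult to_ac_of_nat)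
    ultimately show ?case by (simp add: smat_smat smat_one)
  qed
  \<comment> \<open>The claim is indexed by \<open>Suc i\<close>, so this index reaches degree
    \<open>CARD('n)\<close>, where \<open>J\<close> has shrunk to \<pi>^k \<open>M\<close>.\<close>
  from this[of "CARD('n) - 1"] show ?thesis using J_end by (auto simp: Suc_diff_1)
qed

end

lemma GL_simps [simp]: "x \<otimes>\<^bsub>GL\<^esub> y = x ** y" "\<one>\<^bsub>GL\<^esub> = mat 1"
  by (simp_all add: GL_def)

section \<open>Congruence subgroups stable under an automorphism\<close>

locale matrix_group_auto =
  fixes H :: "('k::field^'n^'n) set" and \<sigma> :: "'k^'n^'n \<Rightarrow> 'k^'n^'n"
  assumes H: "subgroup H GL" and \<sigma>H: "x \<in> H \<Longrightarrow> \<sigma> x \<in> H"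
    and \<sigma>m: "x \<in> H \<Longrightarrow> y \<in> H \<Longrightarrow> \<sigma> (x ** y) = \<sigma> x ** \<sigma> y"
begin

sublocale Y: group "GLsub H"
  using group.subgroup_imp_group[OF group_GL H] .

lemma Y_simps [simp]: "carrier (GLsub H) = H" "x \<otimes>\<^bsub>GLsub H\<^esub> y = x ** y" "\<one>\<^bsub>GLsub H\<^esub> = mat 1"
  by (simp_all add: GL_def)

definition minv :: "'k^'n^'n \<Rightarrow> 'k^'n^'n" where "minv x = inv\<^bsub>GLsub H\<^esub> x"

lemma minv: "x \<in> H \<Longrightarrow> minv x \<in> H" "x \<in> H \<Longrightarrow> minv x ** x = mat 1" "x \<in> H \<Longrightarrow> x ** minv x = mat 1"
  using Y.inv_closed[of x] Y.l_inv[of x] Y.r_inv[of x] by (simp_all add: minv_def)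

lemma one_H: "mat 1 \<in> H"
  using Y.one_closed by simp

lemma mult_H: "x \<in> H \<Longrightarrow> y \<in> H \<Longrightarrow> x ** y \<in> H"
  using Y.m_closed by simp

lemma \<sigma>j: "x \<in> H \<Longrightarrow> (\<sigma> ^^ j) x \<in> H" "x \<in> H \<Longrightarrow> y \<in> H \<Longrightarrow> (\<sigma> ^^ j) (x ** y) = (\<sigma> ^^ j) x ** (\<sigma> ^^ j) y"
proof -
  show H: "x \<in> H \<Longrightarrow> (\<sigma> ^^ j) x \<in> H" for x by (induction j) (auto simp: \<sigma>H)
  show "x \<in> H \<Longrightarrow> y \<in> H \<Longrightarrow> (\<sigma> ^^ j) (x ** y) = (\<sigma> ^^ j) x ** (\<sigma> ^^ j) y"
  proof (induction j)
    case (Suc j)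
    have "(\<sigma> ^^ j) z \<in> H" if "z \<in> H" for z using that by (induction j) (auto simp: \<sigma>H)
    then show ?case using Suc \<sigma>m by simp
  qed simp
qed

lemma \<sigma>j_hom: "group_hom (GLsub H) (GLsub H) (\<sigma> ^^ j)"
  using \<sigma>j by (auto simp: group_hom_def group_hom_axioms_def hom_def Y.is_group)

lemma \<sigma>j_one: "(\<sigma> ^^ j) (mat 1) = mat 1"
  using group_hom.hom_one[OF \<sigma>j_hom] by simp

lemma \<sigma>j_minv: "x \<in> H \<Longrightarrow> (\<sigma> ^^ j) (minv x) = minv ((\<sigma> ^^ j) x)"
  using group_hom.hom_inv[OF \<sigma>j_hom, of x] by (simp add: minv_def)

lemma \<sigma>_hom: "\<sigma> \<in> hom (GLsub H) (GLsub H)"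
  by (auto simp: hom_def \<sigma>H \<sigma>m)

lemma nat_pow_matrix_pow: "x \<in> H \<Longrightarrow> x [^]\<^bsub>GLsub H\<^esub> (n::nat) = matrix_pow x n"
proof (induction n)
  case (Suc n)
  then show ?case using Y.nat_pow_Suc2[of x n] by simp
qed simp

text \<open>Two moduli will be used: \<pi>^k times the lattice, which defines \<open>K\<close>, and
  the degrees of the flag filtration, which define a central series.\<close>

definition bimodule :: "('k^'n^'n) set \<Rightarrow> bool" where
  "bimodule I \<longleftrightarrow> 0 \<in> I \<and> (\<forall>A\<in>I. \<forall>B\<in>I. A + B \<in> I) \<and> (\<forall>A\<in>I. - A \<in> I) \<and> (\<forall>g\<in>H. \<forall>A\<in>I. g ** A \<in> I \<and> A ** g \<in> I)"

text \<open>The congruence is imposed on all \<open>\<sigma>\<close>-conjugates, as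
  \<open>\<sigma>\<close> may fail to preserve \<open>I\<close>. Stability under
  \<open>\<sigma>\<close> then amounts to a shift of j.\<close>

definition congruence_subgroup :: "('k^'n^'n) set \<Rightarrow> ('k^'n^'n) set" where
  "congruence_subgroup I = {h \<in> H. \<forall>j. (\<sigma> ^^ j) h - mat 1 \<in> I}"

lemma congruence_subgroup_normal:
  assumes I: "bimodule I"
  shows "congruence_subgroup I \<lhd> GLsub H"
  unfolding Y.normal_inv_iff
proof (intro conjI ballI)
  have I': "0 \<in> I" "\<And>A B. A \<in> I \<Longrightarrow> B \<in> I \<Longrightarrow> A + B \<in> I" "\<And>A. A \<in> I \<Longrightarrow> - A \<in> I"
    "\<And>g A. g \<in> H \<Longrightarrow> A \<in> I \<Longrightarrow> g ** A \<in> I" "\<And>g A. g \<in> H \<Longrightarrow> A \<in> I \<Longrightarrow> A ** g \<in> I"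
    using I by (auto simp: bimodule_def)
  show "subgroup (congruence_subgroup I) (GLsub H)"
  proof (rule Y.subgroupI)
    show "congruence_subgroup I \<subseteq> carrier (GLsub H)" by (auto simp: congruence_subgroup_def)
    have "mat 1 \<in> congruence_subgroup I" by (simp add: congruence_subgroup_def one_H \<sigma>j_one I')
    then show "congruence_subgroup I \<noteq> {}" by blast
  next
    fix a assume a: "a \<in> congruence_subgroup I"
    then have aH: "a \<in> H" by (simp add: congruence_subgroup_def)
    have "(\<sigma> ^^ j) (minv a) - mat 1 \<in> I" for j
    proof -
      let ?x = "(\<sigma> ^^ j) a"
      have x: "?x \<in> H" "?x - mat 1 \<in> I" using a by (auto simp: congruence_subgroup_def \<sigma>j)
      have "minv ?x - mat 1 = - (minv ?x ** (?x - mat 1))"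
        by (simp add: matrix_diff_ldistrib minv x)
      then show ?thesis using I' x minv aH by (simp add: \<sigma>j_minv)
    qed
    then show "inv\<^bsub>GLsub H\<^esub> a \<in> congruence_subgroup I"
      using minv aH by (simp add: congruence_subgroup_def flip: minv_def)
  next
    fix a b assume ab: "a \<in> congruence_subgroup I" "b \<in> congruence_subgroup I"
    then have H: "a \<in> H" "b \<in> H" by (auto simp: congruence_subgroup_def)
    have "(\<sigma> ^^ j) (a ** b) - mat 1 \<in> I" for j
    proof -
      have "(\<sigma> ^^ j) (a ** b) - mat 1 = (\<sigma> ^^ j) a ** ((\<sigma> ^^ j) b - mat 1) + ((\<sigma> ^^ j) a - mat 1)"
        by (simp add: matrix_diff_ldistrib \<sigma>j H)
      moreover have ab': "(\<sigma> ^^ j) a - mat 1 \<in> I" "(\<sigma> ^^ j) b - mat 1 \<in> I"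
        using ab by (auto simp: congruence_subgroup_def)
      have "(\<sigma> ^^ j) a ** ((\<sigma> ^^ j) b - mat 1) + ((\<sigma> ^^ j) a - mat 1) \<in> I"
        by (rule I'(2)[OF I'(4)[OF \<sigma>j(1)[OF H(1)] ab'(2)] ab'(1)])
      ultimately show ?thesis by (simp only:)
    qed
    then show "a \<otimes>\<^bsub>GLsub H\<^esub> b \<in> congruence_subgroup I" using H by (simp add: congruence_subgroup_def mult_H)
  qed
  fix g h assume "g \<in> carrier (GLsub H)" and h: "h \<in> congruence_subgroup I"
  then have H: "g \<in> H" "h \<in> H" by (auto simp: congruence_subgroup_def)
  have "(\<sigma> ^^ j) (g ** h ** minv g) - mat 1 \<in> I" for j
  proof -
    let ?x = "(\<sigma> ^^ j) g" and ?y = "(\<sigma> ^^ j) h"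
    have x: "?x \<in> H" "?y \<in> H" "?y - mat 1 \<in> I" using H h by (auto simp: congruence_subgroup_def \<sigma>j)
    have "(\<sigma> ^^ j) (g ** h ** minv g) - mat 1 = ?x ** (?y - mat 1) ** minv ?x"
      by (simp add: matrix_diff_ldistrib matrix_diff_rdistrib \<sigma>j H mult_H minv x \<sigma>j_minv)
    then show ?thesis using I' x minv by simp
  qed
  then show "g \<otimes>\<^bsub>GLsub H\<^esub> h \<otimes>\<^bsub>GLsub H\<^esub> inv\<^bsub>GLsub H\<^esub> g \<in> congruence_subgroup I"
    using minv H by (simp add: congruence_subgroup_def mult_H flip: minv_def)
qed

lemma congruence_subgroup_stable: "\<sigma> ` congruence_subgroup I \<subseteq> congruence_subgroup I"
proof clarify
  fix h assume h: "h \<in> congruence_subgroup I"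
  have "(\<sigma> ^^ j) (\<sigma> h) - mat 1 \<in> I" for j
  proof -
    have "(\<sigma> ^^ Suc j) h - mat 1 \<in> I" using h unfolding congruence_subgroup_def by blast
    then show ?thesis by (simp only: funpow_Suc_right o_apply)
  qed
  then show "\<sigma> h \<in> congruence_subgroup I" using h by (simp add: congruence_subgroup_def \<sigma>H)
qed

lemma congruence_subgroup_coset:
  assumes I: "bimodule I" and x: "x \<in> H" "y \<in> H" and xy: "\<And>j. (\<sigma> ^^ j) x - (\<sigma> ^^ j) y \<in> I"
  shows "congruence_subgroup I #>\<^bsub>GLsub H\<^esub> x = congruence_subgroup I #>\<^bsub>GLsub H\<^esub> y"
proof -
  have s: "subgroup (congruence_subgroup I) (GLsub H)"
    using congruence_subgroup_normal[OF I] normal_imp_subgroup by blast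
  have "(\<sigma> ^^ j) (x ** minv y) - mat 1 \<in> I" for j
  proof -
    let ?x = "(\<sigma> ^^ j) x" and ?y = "(\<sigma> ^^ j) y"
    have H: "?y \<in> H" "minv ?y \<in> H" using x \<sigma>j minv by auto
    have "(\<sigma> ^^ j) (x ** minv y) - mat 1 = (?x - ?y) ** minv ?y"
      using x by (simp add: matrix_diff_rdistrib \<sigma>j minv \<sigma>j_minv)
    then show ?thesis using I xy H by (simp add: bimodule_def)
  qed
  then have "x ** minv y \<in> congruence_subgroup I" using x minv by (simp add: congruence_subgroup_def mult_H)
  then have "(x ** minv y) ** y \<in> congruence_subgroup I #>\<^bsub>GLsub H\<^esub> y" by (auto simp: r_coset_def)
  moreover have "(x ** minv y) ** y = x" using x minv by (simp flip: matrix_mul_assoc)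
  ultimately have "x \<in> congruence_subgroup I #>\<^bsub>GLsub H\<^esub> y" by simp
  then show ?thesis using Y.repr_independence[OF _ _ s] x by simp
qed

end

lemma uniformizer_of_local_field:
  assumes "nonarch_local_field v p"
  obtains \<pi> where "0 < v \<pi>" "v \<pi> < 1" "\<And>x. v x < 1 \<Longrightarrow> v x \<le> v \<pi>"
  using assms unfolding nonarch_local_field_def by blast

text \<open>Only the subgroup generated by finitely many elements is needed, not a compact open one. It lies
  in \<open>1 + M\<close> for the finitely generated lattice \<open>M\<close> spanned by the products \<open>(g\<^sub>1 - 1) \<dots> (g\<^sub>r - 1)\<close>
  of generators, and \<open>K\<close> is a \<open>\<sigma>\<close>-stable congruence subgroup; \<open>\<sigma>\<close> need not be continuous.\<close>

lemma good_quotient: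
  fixes NF :: "('f::field alg_closure^'n^'n) set" and \<sigma> :: "'f alg_closure^'n^'n \<Rightarrow> 'f alg_closure^'n^'n"
  assumes F: "nonarch_local_field v p" and l: "Factorial_Ring.prime l" "l \<noteq> p"
    and NF: "subgroup NF GL" "\<And>A. A \<in> NF \<Longrightarrow> unipotent A" "\<And>A i j. A \<in> NF \<Longrightarrow> A $ i $ j \<in> base"
    and \<sigma>: "\<And>x. x \<in> NF \<Longrightarrow> \<sigma> x \<in> NF" "\<And>x y. x \<in> NF \<Longrightarrow> y \<in> NF \<Longrightarrow> \<sigma> (x ** y) = \<sigma> x ** \<sigma> y"
      "\<And>x. x \<in> NF \<Longrightarrow> (\<sigma> ^^ l) x = x"
    and E: "finite E" "E \<subseteq> NF" and \<epsilon>: "0 < \<epsilon>"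
  obtains H K where "subgroup H GL" "E \<subseteq> H" "H \<subseteq> NF" "\<sigma> ` H \<subseteq> H" "K \<lhd> GLsub H" "\<sigma> ` K \<subseteq> K"
    "finite (rcosets\<^bsub>GLsub H\<^esub> K)" "coprime l (card (rcosets\<^bsub>GLsub H\<^esub> K))"
    "\<And>h i j. h \<in> K \<Longrightarrow> v (of_ac ((h - mat 1) $ i $ j)) < \<epsilon>"
    "\<And>x. x \<in> H \<Longrightarrow> K #>\<^bsub>GLsub H\<^esub> \<sigma> x = K #>\<^bsub>GLsub H\<^esub> x \<Longrightarrow>
       \<exists>y\<in>H. K #>\<^bsub>GLsub H\<^esub> y = K #>\<^bsub>GLsub H\<^esub> x \<and> \<sigma> y = y"
proof -
  have v: "nonarch_abs v" and residues: "finite (carrier (valuation_ring v Quot {x. v x < 1}))"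
    and p: "Factorial_Ring.prime p" "v (of_nat p) < 1"
    using F by (auto simp: nonarch_local_field_def)
  obtain \<pi> where \<pi>: "0 < v \<pi>" "v \<pi> < 1" "\<And>x. v x < 1 \<Longrightarrow> v x \<le> v \<pi>"
    using uniformizer_of_local_field[OF F] by blast
  have l0: "l > 0" using l(1) prime_gt_0_nat by blast
  have vl: "v (of_nat l) = 1"
    using nonarch_abs_coprime[OF v p(2) _ l0] primes_coprime[OF l(1) p(1) l(2)] by blast
  interpret N: matrix_group_auto NF \<sigma> by (rule matrix_group_auto.intro) (use NF(1) \<sigma> in auto)
  \<comment> \<open>The lattice only knows differences t - 1 with t in \<open>T\<close>, so inverses
    are included among the generators; conjugates are included to make \<open>H\<close> stable under
    \<open>\<sigma>\<close>. Exponents below \<open>l\<close> suffice, since \<sigma>^l is the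
    identity on \<open>NF\<close>.\<close>
  define T where "T = (\<Union>j<l. (\<sigma> ^^ j) ` (E \<union> N.minv ` E))"
  have ET: "E \<subseteq> T" using l0 by (auto simp: T_def intro!: bexI[of _ 0])
  have TN: "T \<subseteq> NF" using E N.minv N.\<sigma>j by (auto simp: T_def)
  have Tinv: "N.minv t \<in> T" if "t \<in> T" for t
  proof -
    obtain j x where j: "j < l" "x \<in> E \<union> N.minv ` E" "t = (\<sigma> ^^ j) x" using \<open>t \<in> T\<close> unfolding T_def by blast
    have xN: "x \<in> NF" using j(2) E N.minv by auto
    have "N.minv x \<in> E \<union> N.minv ` E"
      using j(2) E N.Y.inv_inv by (auto simp: N.minv_def)
    moreover have "N.minv t = (\<sigma> ^^ j) (N.minv x)" using N.\<sigma>j_minv[OF xN] j by simp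
    ultimately show ?thesis using j(1) unfolding T_def by blast
  qed
  have T\<sigma>: "\<sigma> t \<in> T" if "t \<in> T" for t
  proof -
    obtain j x where j: "j < l" "x \<in> E \<union> N.minv ` E" "t = (\<sigma> ^^ j) x" using \<open>t \<in> T\<close> unfolding T_def by blast
    have xN: "x \<in> NF" using j(2) E N.minv by auto
    have "\<sigma> t = (\<sigma> ^^ (Suc j mod l)) x"
    proof (cases "Suc j = l")
      case True
      then have "\<sigma> t = (\<sigma> ^^ l) x" using j(3) by auto
      then show ?thesis using \<sigma>(3)[OF xN] True by simp
    qed (use j in auto)
    moreover have "Suc j mod l < l" using l0 by simp
    ultimately show ?thesis using j(2) unfolding T_def by blast
  qed
  define H where "H = generate (GLsub NF) T"
  have HN: "subgroup H (GLsub NF)" unfolding H_def using N.Y.generate_is_subgroup TN by simp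
  have HNF: "H \<subseteq> NF" using subgroup.subset[OF HN] by simp
  have HGL: "subgroup H GL" using group.incl_subgroup[OF group_GL NF(1) HN] .
  have H\<sigma>: "\<sigma> h \<in> H" if "h \<in> H" for h
    using that unfolding H_def
  proof (induction rule: generate.induct)
    case one
    then show ?case using N.\<sigma>j_one[of 1] generate.one[of "GLsub NF" T] by simp
  next
    case (incl h)
    then show ?case using T\<sigma> generate.incl by metis
  next
    case (inv h)
    have "\<sigma> (inv\<^bsub>GLsub NF\<^esub> h) = inv\<^bsub>GLsub NF\<^esub> (\<sigma> h)"
      using N.\<sigma>j_minv[of h 1] inv TN by (auto simp: N.minv_def)
    then show ?case using generate.inv[OF T\<sigma>[OF inv], of "GLsub NF"] by simp
  next
    case (eng h1 h2)
    have "h1 \<in> NF" "h2 \<in> NF" using eng(1,2) HNF unfolding H_def by auto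
    then show ?case using generate.eng[OF eng(3,4)] \<sigma>(2) by simp
  qed
  interpret L: unipotent_lattice NF v \<pi> T
  proof unfold_locales
    show "mat 1 \<in> NF" by (rule N.one_H)
    show "finite T" using E by (auto simp: T_def)
  qed (use N.mult_H NF v \<pi> residues TN in auto)
  interpret Y: matrix_group_auto H \<sigma>
  proof (rule matrix_group_auto.intro[OF HGL H\<sigma>])
    fix x y assume "x \<in> H" "y \<in> H"
    then show "\<sigma> (x ** y) = \<sigma> x ** \<sigma> y" using \<sigma>(2)[OF subsetD[OF HNF] subsetD[OF HNF]] by simp
  qed
  \<comment> \<open>Induction over words, with g h - 1 = (g - 1) + (h - 1) + (g - 1)(h - 1).\<close>
  have HM: "h - mat 1 \<in> L.M" if "h \<in> H" for h
    using that unfolding H_def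
  proof (induction rule: generate.induct)
    case one
    then show ?case using L.M_zero by simp
  next
    case (incl h)
    then have "h - mat 1 \<in> L.gens" unfolding L.gens_def by (intro CollectI exI[of _ "[h]"]) simp
    then show ?case by (rule L.M_gens)
  next
    case (inv h)
    then have "N.minv h - mat 1 \<in> L.gens"
      using Tinv unfolding L.gens_def by (intro CollectI exI[of _ "[N.minv h]"]) simp
    then show ?case using L.M_gens by (simp add: N.minv_def)
  next
    case (eng h1 h2)
    have "h1 ** h2 - mat 1 = (h1 - mat 1) + ((h2 - mat 1) + (h1 - mat 1) ** (h2 - mat 1))"
      by (simp add: matrix_diff_ldistrib matrix_diff_rdistrib)
    then have "h1 ** h2 - mat 1 \<in> L.M" using L.M_add[OF eng(3) L.M_add[OF eng(4) L.M_mult[OF eng(3,4)]]] by (simp only:)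
    then show ?case by simp
  qed
  obtain k where k: "\<And>(A :: 'f alg_closure^'n^'n) i j. A \<in> L.scaled k \<Longrightarrow> v (of_ac (A $ i $ j)) < \<epsilon>"
    using L.scaled_small[OF \<epsilon>] by blast
  \<comment> \<open>The lattice contains g - 1 but not g, so multiplication by g is split as A + (g
    - 1) A, and likewise on the right.\<close>
  have bs: "Y.bimodule (L.scaled k)"
    unfolding Y.bimodule_def
  proof (intro conjI ballI L.scaled_zero L.scaled_add L.scaled_minus)
    fix g A assume g: "g \<in> H" and A: "A \<in> L.scaled k"
    have "A + (g - mat 1) ** A \<in> L.scaled k" "A + A ** (g - mat 1) \<in> L.scaled k"
      using L.scaled_add[OF A L.scaled_mult_left[OF A HM[OF g]]] L.scaled_add[OF A L.scaled_mult_right[OF A HM[OF g]]]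
      by auto
    then show "g ** A \<in> L.scaled k" "A ** g \<in> L.scaled k"
      by (simp_all add: matrix_diff_ldistrib matrix_diff_rdistrib)
  qed
  define K where "K = Y.congruence_subgroup (L.scaled k)"
  have KY: "K \<lhd> GLsub H" unfolding K_def by (rule Y.congruence_subgroup_normal[OF bs])
  interpret K: normal K "GLsub H" by (rule KY)
  have sK: "subgroup K (GLsub H)" by (rule K.subgroup_axioms)
  have \<sigma>mod: "(\<sigma> ^^ j) x = (\<sigma> ^^ (j mod l)) x" if "x \<in> H" for j x
    by (rule funpow_mod_eq[symmetric], rule \<sigma>(3)) (use that HNF in blast)
  have fin: "finite (rcosets\<^bsub>GLsub H\<^esub> K)"
  proof -
    obtain \<kappa> :: "'f alg_closure^'n^'n \<Rightarrow> 'f alg_closure^'n^'n \<Rightarrow> 'f" where \<kappa>: "finite (\<kappa> ` L.M)"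
      "\<And>A B. A \<in> L.M \<Longrightarrow> B \<in> L.M \<Longrightarrow> \<kappa> A = \<kappa> B \<Longrightarrow> A - B \<in> L.scaled k"
      using L.finite_labels[of k] by blast
    \<comment> \<open>Membership in \<open>K\<close> involves all
      \<open>\<sigma>\<close>-conjugates, so the label records each of them; by periodicity the
      exponents below \<open>l\<close> are enough.\<close>
    define lab where "lab h = (\<lambda>j\<in>{..<l}. \<kappa> ((\<sigma> ^^ j) h - mat 1))" for h
    have "lab ` H \<subseteq> (\<Pi>\<^sub>E j\<in>{..<l}. \<kappa> ` L.M)"
      using HM Y.\<sigma>j by (auto simp: lab_def)
    moreover have "finite (\<Pi>\<^sub>E j\<in>{..<l}. \<kappa> ` L.M)" by (rule finite_PiE) (auto intro: \<kappa>(1))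
    ultimately have finlab: "finite (lab ` H)" by (rule finite_subset)
    have coset: "K #>\<^bsub>GLsub H\<^esub> x = K #>\<^bsub>GLsub H\<^esub> y" if xy: "x \<in> H" "y \<in> H" "lab x = lab y" for x y
      unfolding K_def
    proof (rule Y.congruence_subgroup_coset[OF bs xy(1,2)])
      fix j
      have jl: "j mod l < l" using l0 by simp
      have "lab x (j mod l) = lab y (j mod l)" using xy(3) by simp
      then have "\<kappa> ((\<sigma> ^^ (j mod l)) x - mat 1) = \<kappa> ((\<sigma> ^^ (j mod l)) y - mat 1)"
        unfolding lab_def using jl by simp
      then have "((\<sigma> ^^ (j mod l)) x - mat 1) - ((\<sigma> ^^ (j mod l)) y - mat 1) \<in> L.scaled k"
        using \<kappa>(2)[OF HM[OF Y.\<sigma>j(1)[OF xy(1)]] HM[OF Y.\<sigma>j(1)[OF xy(2)]]] by blast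
      then show "(\<sigma> ^^ j) x - (\<sigma> ^^ j) y \<in> L.scaled k"
        using \<sigma>mod[OF xy(1), of j] \<sigma>mod[OF xy(2), of j] by simp
    qed
    define pick where "pick a = (SOME x. x \<in> H \<and> lab x = a)" for a
    have pick: "pick (lab x) \<in> H \<and> lab (pick (lab x)) = lab x" if "x \<in> H" for x
      unfolding pick_def by (rule someI[of _ x]) (use that in simp)
    have "rcosets\<^bsub>GLsub H\<^esub> K \<subseteq> (\<lambda>a. K #>\<^bsub>GLsub H\<^esub> pick a) ` (lab ` H)"
    proof
      fix C assume "C \<in> rcosets\<^bsub>GLsub H\<^esub> K"
      then obtain x where x: "x \<in> H" "C = K #>\<^bsub>GLsub H\<^esub> x" by (auto simp: RCOSETS_def)
      then have "C = K #>\<^bsub>GLsub H\<^esub> pick (lab x)" using coset pick by metis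
      then show "C \<in> (\<lambda>a. K #>\<^bsub>GLsub H\<^esub> pick a) ` (lab ` H)" using x(1) by blast
    qed
    then show ?thesis using finlab by (meson finite_imageI finite_subset)
  qed
  let ?Q = "GLsub H Mod K"
  have cQ: "carrier ?Q = rcosets\<^bsub>GLsub H\<^esub> K" by (simp add: FactGroup_def)
  interpret q: group_hom "GLsub H" ?Q "\<lambda>x. K #>\<^bsub>GLsub H\<^esub> x" by (rule Y.Y.rcos_map_hom[OF KY])
  have oneQ: "\<one>\<^bsub>?Q\<^esub> = K" by (simp add: FactGroup_def)
  have K_iff: "K #>\<^bsub>GLsub H\<^esub> x = K \<longleftrightarrow> x \<in> K" if "x \<in> H" for x
    using Y.Y.coset_join1[OF _ _ sK] Y.Y.coset_join2[OF _ sK] that K.subset by auto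
  \<comment> \<open>If x^l lies in \<open>K\<close>, then every \<open>\<sigma>\<close>-conjugate of
    x has its \<open>l\<close>-th power congruent to 1 and is therefore congruent to 1 itself. So
    the quotient has no \<open>l\<close>-torsion, and Cauchy's theorem applies.\<close>
  have cop: "coprime l (card (rcosets\<^bsub>GLsub H\<^esub> K))"
  proof -
    have "C = \<one>\<^bsub>?Q\<^esub>" if C: "C \<in> carrier ?Q" "C [^]\<^bsub>?Q\<^esub> l = \<one>\<^bsub>?Q\<^esub>" for C
    proof -
      obtain x where x: "x \<in> H" "C = K #>\<^bsub>GLsub H\<^esub> x" using C(1) by (auto simp: cQ RCOSETS_def)
      have "C [^]\<^bsub>?Q\<^esub> l = K #>\<^bsub>GLsub H\<^esub> (x [^]\<^bsub>GLsub H\<^esub> l)" using q.hom_nat_pow[of x l] x by simp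
      then have "K #>\<^bsub>GLsub H\<^esub> (x [^]\<^bsub>GLsub H\<^esub> l) = K" using C(2) oneQ by simp
      moreover have "x [^]\<^bsub>GLsub H\<^esub> l \<in> H" using Y.Y.nat_pow_closed[of x l] x(1) by simp
      ultimately have "x [^]\<^bsub>GLsub H\<^esub> l \<in> K" using K_iff by blast
      then have xl: "(\<sigma> ^^ j) (x [^]\<^bsub>GLsub H\<^esub> l) - mat 1 \<in> L.scaled k" for j
        unfolding K_def Y.congruence_subgroup_def by blast
      have "(\<sigma> ^^ j) x - mat 1 \<in> L.scaled k" for j
      proof (rule L.torsion_free_mod_scaled[OF HM vl])
        show "(\<sigma> ^^ j) x \<in> H" by (rule Y.\<sigma>j(1)[OF x(1)])
        have "(\<sigma> ^^ j) (x [^]\<^bsub>GLsub H\<^esub> l) = matrix_pow ((\<sigma> ^^ j) x) l"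
          using group_hom.hom_nat_pow[OF Y.\<sigma>j_hom, of x j l] x(1) Y.\<sigma>j(1) by (simp add: Y.nat_pow_matrix_pow)
        then show "matrix_pow ((\<sigma> ^^ j) x) l - mat 1 \<in> L.scaled k" using xl[of j] by simp
      qed
      then have "x \<in> K" unfolding K_def Y.congruence_subgroup_def using x(1) by blast
      then show ?thesis using K_iff[OF x(1)] x(2) oneQ by simp
    qed
    moreover have "finite (carrier ?Q)" using fin cQ by simp
    ultimately have "coprime l (Coset.order ?Q)"
      using coprime_order_if_torsion_free[OF K.factorgroup_is_group _ l(1)] by blast
    then show ?thesis by (simp add: Coset.order_def cQ)
  qed
  have bf: "Y.bimodule (L.filt i)" for i
    unfolding Y.bimodule_def
  proof (intro conjI ballI L.filt_zero L.filt_add)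
    fix A assume "A \<in> L.filt i"
    then show "- A \<in> L.filt i" using L.filt_diff[OF L.filt_zero, of A i] by simp
  next
    fix g A assume "g \<in> H" "A \<in> L.filt i"
    then show "g ** A \<in> L.filt i" "A ** g \<in> L.filt i"
      using L.filt_mult[OF L.S_filt_0, of g A i] L.filt_mult[OF _ L.S_filt_0, of A i g] HNF by auto
  qed
  have lift: "\<exists>y\<in>H. K #>\<^bsub>GLsub H\<^esub> y = K #>\<^bsub>GLsub H\<^esub> x \<and> \<sigma> y = y"
    if x: "x \<in> H" "K #>\<^bsub>GLsub H\<^esub> \<sigma> x = K #>\<^bsub>GLsub H\<^esub> x" for x
  proof -
    \<comment> \<open>The degrees of the flag filtration cut \<open>H\<close> into a central series
      that reaches the identity after \<open>CARD('n)\<close> steps.\<close>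
    let ?D = "\<lambda>i. Y.congruence_subgroup (L.filt i)"
    obtain y where "y \<in> carrier (GLsub H)" "K #>\<^bsub>GLsub H\<^esub> y = K #>\<^bsub>GLsub H\<^esub> x" "\<sigma> y = y"
    proof (rule Y.Y.fixed_coset_has_fixed_point[where D = ?D and d = "CARD('n)" and s = \<sigma> and l = l
          and K = K and q = "card (rcosets\<^bsub>GLsub H\<^esub> K)" and x = x])
      show "\<sigma> \<in> hom (GLsub H) (GLsub H)" by (rule Y.\<sigma>_hom)
      show "(\<sigma> ^^ l) z = z" if "z \<in> carrier (GLsub H)" for z using that \<sigma>(3) HNF by auto
      show "K \<lhd> GLsub H" by (rule KY)
      show "\<sigma> ` K \<subseteq> K" unfolding K_def by (rule Y.congruence_subgroup_stable)
      show "z [^]\<^bsub>GLsub H\<^esub> card (rcosets\<^bsub>GLsub H\<^esub> K) \<in> K" if z: "z \<in> carrier (GLsub H)" for z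
      proof -
        have "(K #>\<^bsub>GLsub H\<^esub> z) [^]\<^bsub>?Q\<^esub> Coset.order ?Q = \<one>\<^bsub>?Q\<^esub>"
          by (rule group.pow_order_eq_1[OF K.factorgroup_is_group q.hom_closed[OF z]])
        then have "K #>\<^bsub>GLsub H\<^esub> (z [^]\<^bsub>GLsub H\<^esub> card (rcosets\<^bsub>GLsub H\<^esub> K)) = K"
          using q.hom_nat_pow[OF z] oneQ by (simp add: Coset.order_def cQ)
        then show ?thesis using K_iff Y.Y.nat_pow_closed[OF z] by simp
      qed
      show "coprime l (card (rcosets\<^bsub>GLsub H\<^esub> K))" by (rule cop)
      show "l > 0" by (rule l0)
      show "?D i \<lhd> GLsub H" for i by (rule Y.congruence_subgroup_normal[OF bf])
      show "\<sigma> ` ?D i \<subseteq> ?D i" for i by (rule Y.congruence_subgroup_stable)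
      have "h - mat 1 \<in> L.filt 0" if "h \<in> H" for h
        using L.filt_diff[OF L.S_filt_0 L.S_filt_0[OF N.one_H]] that HNF by blast
      then show "?D 0 = carrier (GLsub H)" using Y.\<sigma>j by (auto simp: Y.congruence_subgroup_def)
      show "?D (CARD('n)) = {\<one>\<^bsub>GLsub H\<^esub>}"
      proof
        show "?D (CARD('n)) \<subseteq> {\<one>\<^bsub>GLsub H\<^esub>}"
        proof
          fix h assume "h \<in> ?D (CARD('n))"
          then have "(\<sigma> ^^ 0) h - mat 1 \<in> L.filt (CARD('n))" unfolding Y.congruence_subgroup_def by blast
          then have "(\<sigma> ^^ 0) h - mat 1 = 0" by (rule L.filt_end[OF _ order_refl])
          then show "h \<in> {\<one>\<^bsub>GLsub H\<^esub>}" by simp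
        qed
        show "{\<one>\<^bsub>GLsub H\<^esub>} \<subseteq> ?D (CARD('n))"
          using Y.one_H Y.\<sigma>j_one L.filt_zero by (simp add: Y.congruence_subgroup_def)
      qed
      show "?D (Suc i) #>\<^bsub>GLsub H\<^esub> (z \<otimes>\<^bsub>GLsub H\<^esub> y) = ?D (Suc i) #>\<^bsub>GLsub H\<^esub> (y \<otimes>\<^bsub>GLsub H\<^esub> z)"
        if z: "z \<in> carrier (GLsub H)" and y: "y \<in> ?D i" for i z y
        unfolding Y.Y_simps
      proof (rule Y.congruence_subgroup_coset[OF bf])
        have zH: "z \<in> H" "y \<in> H" using z y by (auto simp: Y.congruence_subgroup_def)
        then show "z ** y \<in> H" "y ** z \<in> H" using Y.mult_H by auto
        fix j
        let ?a = "(\<sigma> ^^ j) z" and ?b = "(\<sigma> ^^ j) y"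
        have a: "?a - mat 1 \<in> L.filt 1" using L.filt_gen Y.\<sigma>j(1)[OF zH(1)] HNF by blast
        have b: "?b - mat 1 \<in> L.filt i" using y by (auto simp: Y.congruence_subgroup_def)
        \<comment> \<open>The commutator of two matrices does not change when 1 is subtracted from
          each, and the degrees 1 and i add up; this is centrality modulo the next term.\<close>
        have "(?a - mat 1) ** (?b - mat 1) - (?b - mat 1) ** (?a - mat 1) \<in> L.filt (Suc i)"
          using L.filt_diff[OF L.filt_mult[OF a b], of "(?b - mat 1) ** (?a - mat 1)"] L.filt_mult[OF b a] by simp
        moreover have "(\<sigma> ^^ j) (z ** y) - (\<sigma> ^^ j) (y ** z)
            = (?a - mat 1) ** (?b - mat 1) - (?b - mat 1) ** (?a - mat 1)"
          by (simp add: Y.\<sigma>j zH matrix_diff_ldistrib matrix_diff_rdistrib)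
        ultimately show "(\<sigma> ^^ j) (z ** y) - (\<sigma> ^^ j) (y ** z) \<in> L.filt (Suc i)" by simp
      qed
      show "x \<in> carrier (GLsub H)" "K #>\<^bsub>GLsub H\<^esub> \<sigma> x = K #>\<^bsub>GLsub H\<^esub> x" using x by auto
    qed
    then show ?thesis by auto
  qed
  show ?thesis
  proof (rule that[OF HGL _ HNF _ KY _ fin cop _ lift])
    show "E \<subseteq> H" unfolding H_def using ET generate.incl[of _ T "GLsub NF"] by blast
    show "\<sigma> ` H \<subseteq> H" using H\<sigma> by blast
    show "\<sigma> ` K \<subseteq> K" unfolding K_def by (rule Y.congruence_subgroup_stable)
    show "v (of_ac ((h - mat 1) $ i $ j)) < \<epsilon>" if "h \<in> K" for h i j
    proof -
      have "(\<sigma> ^^ 0) h - mat 1 \<in> L.scaled k" using that unfolding K_def Y.congruence_subgroup_def by blast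
      then show ?thesis using k[of "h - mat 1" i j] by simp
    qed
  qed
qed

section \<open>Averaging over a finite quotient\<close>

text \<open>Since \<open>l\<close> is prime, an orbit is a single point or has exactly
  \<open>l\<close> elements. \<open>D\<close> is a transversal of the orbits of the second
  kind.\<close>

lemma prime_period_orbits:
  fixes f :: "'a \<Rightarrow> 'a" and l :: nat
  assumes C: "finite C" "\<And>c. c \<in> C \<Longrightarrow> f c \<in> C" and fl: "\<And>c. c \<in> C \<Longrightarrow> (f ^^ l) c = c"
    and l: "Factorial_Ring.prime l"
  obtains D where "D \<subseteq> C" "inj_on (\<lambda>(j, d). (f ^^ j) d) ({..<l} \<times> D)"
    "(\<lambda>(j, d). (f ^^ j) d) ` ({..<l} \<times> D) = {c \<in> C. f c \<noteq> c}"
proof -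
  have l0: "l > 0" using l prime_gt_0_nat by blast
  have fC: "(f ^^ j) c \<in> C" if "c \<in> C" for c j using that by (induction j) (auto simp: C(2))
  have fmod: "(f ^^ (j mod l)) c = (f ^^ j) c" if "c \<in> C" for c j
    by (rule funpow_mod_eq, rule fl, rule that)
  have mult: "(f ^^ (j * k)) c = c" if "(f ^^ j) c = c" for c j k
    using that by (induction k) (auto simp: funpow_add)
  \<comment> \<open>A period k with 0 < k < l is prime to \<open>l\<close>, and a Bezout relation
    turns the periods k and \<open>l\<close> into the period 1.\<close>
  have period: "f c = c" if c: "c \<in> C" and k: "(f ^^ k) c = c" "0 < k" "k < l" for c k
  proof -
    have "coprime k l" using k l by (metis coprime_commute nat_dvd_not_less prime_imp_coprime)
    then obtain a b where ab: "k * a = l * b + 1" using bezout_nat[of k l] k by auto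
    have "c = (f ^^ (k * a)) c" using mult[OF k(1)] by simp
    also have "\<dots> = f ((f ^^ (l * b)) c)" by (simp only: ab) simp
    also have "\<dots> = f c" using mult[OF fl[OF c]] by simp
    finally show ?thesis by simp
  qed
  \<comment> \<open>Applying \<open>f\<close> a further l - (j mod l) times undoes the
    \<open>j\<close>-fold iterate, so a coincidence of two iterates becomes a return to
    \<open>d\<close>.\<close>
  have cancel: "(f ^^ ((l - j mod l) mod l + i)) c = d"
    if "c \<in> C" "d \<in> C" "(f ^^ i) c = (f ^^ j) d" for c d i j
  proof -
    have "(f ^^ ((l - j mod l) mod l + i)) c = (f ^^ ((l - j mod l) mod l)) ((f ^^ j) d)"
      using that(3) by (simp add: funpow_add)
    also have "\<dots> = (f ^^ (l - j mod l)) ((f ^^ j) d)" using fmod[OF fC[OF that(2)]] .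
    also have "\<dots> = (f ^^ (l - j mod l)) ((f ^^ (j mod l)) d)" using fmod[OF that(2)] by simp
    also have "\<dots> = (f ^^ (l - j mod l + j mod l)) d" by (simp add: funpow_add)
    also have "l - j mod l + j mod l = l" using l0 by (simp add: less_imp_le)
    finally show ?thesis using fl[OF that(2)] by simp
  qed
  define orb where "orb c = {(f ^^ j) c | j. True}" for c
  have orb_self: "c \<in> orb c" for c unfolding orb_def by (rule CollectI, rule exI[of _ 0]) simp
  have orb_sub: "orb d \<subseteq> orb c" if dc: "d \<in> orb c" for c d
  proof
    fix e assume "e \<in> orb d"
    then obtain i j where "e = (f ^^ i) d" "d = (f ^^ j) c" using dc unfolding orb_def by blast
    then have "e = (f ^^ (i + j)) c" by (simp add: funpow_add)
    then show "e \<in> orb c" unfolding orb_def by blast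
  qed
  have orb_C: "d \<in> C" if "c \<in> C" "d \<in> orb c" for c d using that fC unfolding orb_def by blast
  have orb_sym: "c \<in> orb d" if c: "c \<in> C" and d: "d \<in> orb c" for c d
  proof -
    obtain i where i: "d = (f ^^ i) c" using d unfolding orb_def by blast
    have "(f ^^ ((l - i mod l) mod l + 0)) d = c"
      by (rule cancel[of d c 0 i]) (use c i fC in auto)
    then show ?thesis unfolding orb_def by blast
  qed
  have orb_eq: "orb d = orb c" if "c \<in> C" "d \<in> orb c" for c d
    using orb_sub[OF that(2)] orb_sub[OF orb_sym[OF that]] by blast
  \<comment> \<open>The choice depends on the orbit only as a set and is thus constant along
    it.\<close>
  define rep where "rep c = (SOME d. d \<in> orb c)" for c
  have rep: "rep c \<in> orb c" for c unfolding rep_def by (rule someI[of _ c], rule orb_self)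
  define M where "M = {c \<in> C. f c \<noteq> c}"
  define D where "D = rep ` M"
  have fix_orb: "f c = c" if c: "c \<in> C" and d: "d \<in> orb c" "f d = d" for c d
  proof -
    obtain i where i: "c = (f ^^ i) d" using orb_sym[OF c d(1)] unfolding orb_def by blast
    have "(f ^^ i) d = d" by (induction i) (use d in auto)
    then show ?thesis using i d by simp
  qed
  have M_orb: "d \<in> M" if "c \<in> M" "d \<in> orb c" for c d
    using that fix_orb[OF _ that(2)] orb_C[OF _ that(2)] unfolding M_def by blast
  have DM: "D \<subseteq> M" unfolding D_def using M_orb rep by blast
  have Drep: "rep d = d" if d: "d \<in> D" for d
  proof -
    obtain c where c: "c \<in> M" "d = rep c" using d unfolding D_def by blast
    have "orb d = orb c" using orb_eq[OF _ rep, of c] c unfolding M_def by simp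
    then show ?thesis unfolding rep_def c(2) by simp
  qed
  show ?thesis
  proof (rule that[of D])
    show "D \<subseteq> C" using DM unfolding M_def by blast
    show "inj_on (\<lambda>(j, d). (f ^^ j) d) ({..<l} \<times> D)"
    proof (rule inj_onI, clarify)
      fix i d j e assume ij: "i < l" "j < l" and de: "d \<in> D" "e \<in> D" and eq: "(f ^^ i) d = (f ^^ j) e"
      have dC: "d \<in> C" "e \<in> C" using de DM unfolding M_def by auto
      have "(f ^^ i) d \<in> orb d" "(f ^^ j) e \<in> orb e" unfolding orb_def by auto
      then have "orb d = orb e" using orb_eq[OF dC(1)] orb_eq[OF dC(2)] eq by metis
      then have "rep d = rep e" unfolding rep_def by simp
      then have "d = e" using Drep de by simp
      moreover have "i = j" if "i < j" "(f ^^ i) d = (f ^^ j) d" "j < l" for i j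
      proof -
        have "(f ^^ ((l - j mod l) mod l + i)) d = d" by (rule cancel[OF dC(1) dC(1) that(2)])
        moreover have "(l - j mod l) mod l + i = l - j + i" using that by simp
        ultimately have "f d = d" using period[OF dC(1), of "l - j + i"] that by simp
        then show ?thesis using de(1) DM unfolding M_def by blast
      qed
      ultimately show "i = j \<and> d = e" using eq ij by (metis linorder_neqE_nat)
    qed
    show "(\<lambda>(j, d). (f ^^ j) d) ` ({..<l} \<times> D) = {c \<in> C. f c \<noteq> c}"
    proof (intro equalityI subsetI)
      fix c assume "c \<in> (\<lambda>(j, d). (f ^^ j) d) ` ({..<l} \<times> D)"
      then obtain j d where "d \<in> D" "c = (f ^^ j) d" by auto
      then show "c \<in> {c \<in> C. f c \<noteq> c}" using M_orb[of d c] DM unfolding M_def orb_def by blast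
    next
      fix c assume c: "c \<in> {c \<in> C. f c \<noteq> c}"
      then have "rep c \<in> D" unfolding D_def M_def by blast
      moreover have "c \<in> orb (rep c)" using orb_sym[OF _ rep] c by blast
      then obtain j where "c = (f ^^ j) (rep c)" unfolding orb_def by blast
      then have "c = (f ^^ (j mod l)) (rep c)" using fmod[of "rep c" j] orb_C[OF _ rep] c by simp
      ultimately show "c \<in> (\<lambda>(j, d). (f ^^ j) d) ` ({..<l} \<times> D)"
        using l0 by (intro image_eqI[of _ _ "(j mod l, rep c)"]) auto
    qed
  qed
qed

section \<open>Additive maps of abelian groups\<close>

context abelian_group
begin

lemma additive_zero:
  assumes "\<And>x. x \<in> carrier G \<Longrightarrow> f x \<in> carrier G"
    "\<And>x y. x \<in> carrier G \<Longrightarrow> y \<in> carrier G \<Longrightarrow> f (x \<oplus> y) = f x \<oplus> f y"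
  shows "f \<zero> = \<zero>"
proof -
  have "f \<zero> \<oplus> f \<zero> = f \<zero>" using assms(2)[of \<zero> \<zero>] by simp
  then show ?thesis using assms(1)[of \<zero>] by simp
qed

lemma additive_minus:
  assumes f: "\<And>x. x \<in> carrier G \<Longrightarrow> f x \<in> carrier G"
    "\<And>x y. x \<in> carrier G \<Longrightarrow> y \<in> carrier G \<Longrightarrow> f (x \<oplus> y) = f x \<oplus> f y"
    and x: "x \<in> carrier G"
  shows "f (\<ominus> x) = \<ominus> f x"
proof -
  have "f (\<ominus> x) \<oplus> f x = \<zero>" using f(2)[of "\<ominus> x" x] x additive_zero[of f, OF f] by (simp add: l_neg)
  then show ?thesis using f(1) x minus_equality[of "f (\<ominus> x)" "f x"] by simp
qed

lemma additive_diff: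
  assumes f: "\<And>x. x \<in> carrier G \<Longrightarrow> f x \<in> carrier G"
    "\<And>x y. x \<in> carrier G \<Longrightarrow> y \<in> carrier G \<Longrightarrow> f (x \<oplus> y) = f x \<oplus> f y"
    and x: "x \<in> carrier G" "y \<in> carrier G"
  shows "f (x \<ominus> y) = f x \<ominus> f y"
  using additive_minus[of f, OF f x(2)] f(2)[of x "\<ominus> y"] x by (simp add: a_minus_def)

lemma additive_finsum:
  assumes f: "\<And>x. x \<in> carrier G \<Longrightarrow> f x \<in> carrier G"
    "\<And>x y. x \<in> carrier G \<Longrightarrow> y \<in> carrier G \<Longrightarrow> f (x \<oplus> y) = f x \<oplus> f y"
    and g: "g \<in> I \<rightarrow> carrier G"
  shows "f (\<Oplus>i\<in>I. g i) = (\<Oplus>i\<in>I. f (g i))"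
  using g
proof (induction I rule: infinite_finite_induct)
  case (insert i I)
  then have "(\<lambda>i. f (g i)) \<in> I \<rightarrow> carrier G" "f (g i) \<in> carrier G" using f(1) by auto
  then show ?case using insert f by (simp add: finsum_insert finsum_closed)
qed (use additive_zero[of f, OF f] in auto)

lemma minus_minus_cancel_left:
  assumes "x \<in> carrier G" "y \<in> carrier G" "z \<in> carrier G"
  shows "(x \<ominus> z) \<oplus> \<ominus> (x \<ominus> y) = y \<ominus> z"
proof -
  have "(x \<ominus> z) \<oplus> \<ominus> (x \<ominus> y) = (x \<oplus> \<ominus> x) \<oplus> (y \<oplus> \<ominus> z)"
    using assms by (simp add: minus_eq minus_add a_ac)
  also have "\<dots> = y \<ominus> z" using assms by (simp add: r_neg minus_eq)
  finally show ?thesis .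
qed

lemma finsum_in_subgroup:
  assumes B: "subgroup B (add_monoid G)" and g: "\<And>i. i \<in> I \<Longrightarrow> g i \<in> B"
  shows "(\<Oplus>i\<in>I. g i) \<in> B"
  using g
proof (induction I rule: infinite_finite_induct)
  case (infinite I)
  then show ?case using subgroup.one_closed[OF B] by (simp add: finsum_infinite)
next
  case empty
  then show ?case using subgroup.one_closed[OF B] by simp
next
  case (insert i I)
  have "g ` insert i I \<subseteq> carrier G" using insert subgroup.subset[OF B] by auto
  then have "(\<Oplus>i\<in>insert i I. g i) = g i \<oplus> (\<Oplus>i\<in>I. g i)" using insert by (intro finsum_insert) auto
  then show ?case using insert subgroup.m_closed[OF B, of "g i" "\<Oplus>i\<in>I. g i"] by simp
qed

end

section \<open>Norms and boundaries for a cyclic action\<close>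

locale cyclic_action = A: abelian_group A for A :: "('m, 'x) ring_scheme" +
  fixes s :: "'m \<Rightarrow> 'm" and l :: nat
  assumes s_closed: "y \<in> carrier A \<Longrightarrow> s y \<in> carrier A"
    and s_add: "y \<in> carrier A \<Longrightarrow> z \<in> carrier A \<Longrightarrow> s (y \<oplus>\<^bsub>A\<^esub> z) = s y \<oplus>\<^bsub>A\<^esub> s z"
    and s_pow: "y \<in> carrier A \<Longrightarrow> (s ^^ l) y = y"
    and l0: "l > 0"
begin

definition nr :: "'m \<Rightarrow> 'm" where
  "nr y = (\<Oplus>\<^bsub>A\<^esub>j\<in>{..<l}. (s ^^ j) y)"

lemma sj_closed: "y \<in> carrier A \<Longrightarrow> (s ^^ j) y \<in> carrier A"
  by (induction j) (auto simp: s_closed)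

lemma sj_add: "y \<in> carrier A \<Longrightarrow> z \<in> carrier A \<Longrightarrow> (s ^^ j) (y \<oplus>\<^bsub>A\<^esub> z) = (s ^^ j) y \<oplus>\<^bsub>A\<^esub> (s ^^ j) z"
  by (induction j) (auto simp: s_add sj_closed)

lemma nr_closed: "y \<in> carrier A \<Longrightarrow> nr y \<in> carrier A"
  unfolding nr_def by (rule A.finsum_closed) (auto simp: sj_closed)

lemma nr_add: "y \<in> carrier A \<Longrightarrow> z \<in> carrier A \<Longrightarrow> nr (y \<oplus>\<^bsub>A\<^esub> z) = nr y \<oplus>\<^bsub>A\<^esub> nr z"
  unfolding nr_def by (simp add: sj_add A.finsum_addf sj_closed Pi_iff)

lemma s_diff: "y \<in> carrier A \<Longrightarrow> z \<in> carrier A \<Longrightarrow> s (y \<ominus>\<^bsub>A\<^esub> z) = s y \<ominus>\<^bsub>A\<^esub> s z"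
  by (rule A.additive_diff[of s, OF s_closed s_add])

definition nr_boundaries :: "'m set" where "nr_boundaries = nr ` carrier A"
definition diff_boundaries :: "'m set" where "diff_boundaries = (\<lambda>y. y \<ominus>\<^bsub>A\<^esub> s y) ` carrier A"

lemma additive_image_subgroup:
  assumes f: "\<And>x. x \<in> carrier A \<Longrightarrow> f x \<in> carrier A"
    "\<And>x y. x \<in> carrier A \<Longrightarrow> y \<in> carrier A \<Longrightarrow> f (x \<oplus>\<^bsub>A\<^esub> y) = f x \<oplus>\<^bsub>A\<^esub> f y"
  shows "subgroup (f ` carrier A) (add_monoid A)"
proof -
  have "group_hom (add_monoid A) (add_monoid A) f"
    using f A.a_group by (auto simp: group_hom_def group_hom_axioms_def hom_def)
  then show ?thesis using group_hom.img_is_subgroup by fastforce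
qed

lemma nr_boundaries_subgroup: "subgroup nr_boundaries (add_monoid A)"
  unfolding nr_boundaries_def by (rule additive_image_subgroup[of nr, OF nr_closed nr_add])

lemma diff_boundaries_subgroup: "subgroup diff_boundaries (add_monoid A)"
  unfolding diff_boundaries_def
proof (rule additive_image_subgroup)
  fix x y assume "x \<in> carrier A" "y \<in> carrier A"
  then show "x \<oplus>\<^bsub>A\<^esub> y \<ominus>\<^bsub>A\<^esub> s (x \<oplus>\<^bsub>A\<^esub> y) = x \<ominus>\<^bsub>A\<^esub> s x \<oplus>\<^bsub>A\<^esub> (y \<ominus>\<^bsub>A\<^esub> s y)"
    by (simp add: s_add s_closed A.minus_add A.a_ac A.minus_eq)
qed (simp add: s_closed)

lemma telescope: "z \<in> carrier A \<Longrightarrow> (s ^^ j) z \<ominus>\<^bsub>A\<^esub> z \<in> diff_boundaries"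
proof (induction j)
  case 0
  then show ?case using subgroup.one_closed[OF diff_boundaries_subgroup] by (simp add: A.minus_eq A.r_neg)
next
  case (Suc j)
  let ?u = "(s ^^ j) z"
  have u: "?u \<in> carrier A" "s ?u \<in> carrier A" using Suc sj_closed s_closed by auto
  have "\<ominus>\<^bsub>A\<^esub> (?u \<ominus>\<^bsub>A\<^esub> s ?u) \<in> diff_boundaries"
    using subgroup.m_inv_closed[OF diff_boundaries_subgroup, of "?u \<ominus>\<^bsub>A\<^esub> s ?u"] u
    unfolding diff_boundaries_def by (auto simp: a_inv_def)
  then have "(?u \<ominus>\<^bsub>A\<^esub> z) \<oplus>\<^bsub>A\<^esub> \<ominus>\<^bsub>A\<^esub> (?u \<ominus>\<^bsub>A\<^esub> s ?u) \<in> diff_boundaries"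
    using subgroup.m_closed[OF diff_boundaries_subgroup, OF Suc.IH[OF Suc.prems]] by simp
  also have "(?u \<ominus>\<^bsub>A\<^esub> z) \<oplus>\<^bsub>A\<^esub> \<ominus>\<^bsub>A\<^esub> (?u \<ominus>\<^bsub>A\<^esub> s ?u) = s ?u \<ominus>\<^bsub>A\<^esub> z"
    using u Suc.prems by (intro A.minus_minus_cancel_left)
  finally show ?case by simp
qed

text \<open>The exponents run from \<open>l\<close> down to 1. As s^l is the identity, the exponent
  \<open>l\<close> is renamed 0, which turns the reversal into a permutation of the range below
  \<open>l\<close>.\<close>

lemma nr_rotate:
  assumes x: "x \<in> carrier A"
  shows "(\<Oplus>\<^bsub>A\<^esub>j\<in>{..<l}. (s ^^ (l - j)) x) = nr x"
proof -
  have "(\<Oplus>\<^bsub>A\<^esub>j\<in>{..<l}. (s ^^ (l - j)) x) = (\<Oplus>\<^bsub>A\<^esub>j\<in>{..<l}. (s ^^ (if j = 0 then 0 else l - j)) x)"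
    using sj_closed[OF x] s_pow[OF x] by (intro A.finsum_cong') auto
  also have "\<dots> = (\<Oplus>\<^bsub>A\<^esub>j\<in>(\<lambda>j. if j = 0 then 0 else l - j) ` {..<l}. (s ^^ j) x)"
  proof (rule A.finsum_reindex[symmetric])
    show "inj_on (\<lambda>j. if j = 0 then 0 else l - j) {..<l}"
      by (rule inj_onI) (auto split: if_splits)
  qed (use sj_closed[OF x] in auto)
  also have "(\<lambda>j. if j = 0 then 0 else l - j) ` {..<l} = {..<l}"
  proof (rule endo_inj_surj)
    show "inj_on (\<lambda>j. if j = 0 then 0 else l - j) {..<l}"
      by (rule inj_onI) (auto split: if_splits)
  qed (use l0 in auto)
  finally show ?thesis by (simp add: nr_def)
qed

text \<open>Both sides add up s^j y for j from 0 to n, arranged so that no subtraction occurs. For n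
  = l the extra terms cancel, and the norm is seen to be invariant.\<close>

lemma partial_nr_s:
  "y \<in> carrier A \<Longrightarrow> (\<Oplus>\<^bsub>A\<^esub>j\<in>{..<n}. (s ^^ j) (s y)) \<oplus>\<^bsub>A\<^esub> y = (\<Oplus>\<^bsub>A\<^esub>j\<in>{..<n}. (s ^^ j) y) \<oplus>\<^bsub>A\<^esub> (s ^^ n) y"
proof (induction n)
  case (Suc n)
  let ?S = "\<Oplus>\<^bsub>A\<^esub>j\<in>{..<n}. (s ^^ j) (s y)" and ?T = "\<Oplus>\<^bsub>A\<^esub>j\<in>{..<n}. (s ^^ j) y"
  have c: "?S \<in> carrier A" "?T \<in> carrier A" "(s ^^ n) y \<in> carrier A" "(s ^^ n) (s y) \<in> carrier A"
    using Suc.prems by (auto intro!: A.finsum_closed simp: sj_closed s_closed)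
  have e: "(\<Oplus>\<^bsub>A\<^esub>j\<in>{..<Suc n}. (s ^^ j) z) = (s ^^ n) z \<oplus>\<^bsub>A\<^esub> (\<Oplus>\<^bsub>A\<^esub>j\<in>{..<n}. (s ^^ j) z)" if "z \<in> carrier A" for z
    unfolding lessThan_Suc using that by (intro A.finsum_insert) (auto simp: sj_closed)
  have "(\<Oplus>\<^bsub>A\<^esub>j\<in>{..<Suc n}. (s ^^ j) (s y)) \<oplus>\<^bsub>A\<^esub> y = (s ^^ n) (s y) \<oplus>\<^bsub>A\<^esub> (?S \<oplus>\<^bsub>A\<^esub> y)"
    using c Suc.prems e[OF s_closed[OF Suc.prems]] by (simp only: A.a_assoc)
  also have "\<dots> = ((s ^^ n) y \<oplus>\<^bsub>A\<^esub> ?T) \<oplus>\<^bsub>A\<^esub> (s ^^ n) (s y)"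
    using c Suc by (simp add: A.a_ac)
  also have "\<dots> = (\<Oplus>\<^bsub>A\<^esub>j\<in>{..<Suc n}. (s ^^ j) y) \<oplus>\<^bsub>A\<^esub> (s ^^ Suc n) y"
    by (simp only: e[OF Suc.prems] funpow_Suc_right o_apply)
  finally show ?case .
qed simp

lemma nr_s:
  assumes "y \<in> carrier A"
  shows "nr (s y) = nr y" "s (nr y) = nr y"
proof -
  show 1: "nr (s y) = nr y"
    using partial_nr_s[OF assms, of l] s_pow[OF assms] nr_closed[OF assms] nr_closed[OF s_closed[OF assms]] assms
    by (simp add: nr_def[symmetric])
  have "s (nr y) = (\<Oplus>\<^bsub>A\<^esub>j\<in>{..<l}. s ((s ^^ j) y))"
    unfolding nr_def by (rule A.additive_finsum[of s, OF s_closed s_add]) (auto simp: sj_closed assms)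
  also have "\<dots> = nr (s y)" by (simp add: nr_def funpow_swap1)
  finally show "s (nr y) = nr y" using 1 by simp
qed

lemma multiple_fixed:
  assumes x: "x \<in> carrier A" "s x = x"
  shows "[l] \<cdot>\<^bsub>A\<^esub> x = nr x"
proof -
  have "(s ^^ j) x = x" for j by (induction j) (use x in auto)
  then have "nr x = (\<Oplus>\<^bsub>A\<^esub>j\<in>{..<l}. x)" by (simp add: nr_def)
  then show ?thesis using A.add.finprod_const[of x "{..<l}"] x by simp
qed

text \<open>Termwise, s^j x - x is a boundary. On the kernel of the norm this says that
  \<open>l\<close> annihilates Tate cohomology in degree one.\<close>

lemma multiple_minus_nr:
  assumes x: "x \<in> carrier A"
  shows "[l] \<cdot>\<^bsub>A\<^esub> x \<ominus>\<^bsub>A\<^esub> nr x \<in> diff_boundaries"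
proof -
  have "nr x = (\<Oplus>\<^bsub>A\<^esub>j\<in>{..<l}. ((s ^^ j) x \<ominus>\<^bsub>A\<^esub> x) \<oplus>\<^bsub>A\<^esub> x)"
    unfolding nr_def using x sj_closed[OF x] by (intro A.finsum_cong') (auto simp: A.minus_eq A.a_assoc A.l_neg)
  also have "\<dots> = (\<Oplus>\<^bsub>A\<^esub>j\<in>{..<l}. (s ^^ j) x \<ominus>\<^bsub>A\<^esub> x) \<oplus>\<^bsub>A\<^esub> [l] \<cdot>\<^bsub>A\<^esub> x"
    using x sj_closed[OF x] A.add.finprod_const[of x "{..<l}"] by (simp add: A.finsum_addf)
  finally have e: "nr x = (\<Oplus>\<^bsub>A\<^esub>j\<in>{..<l}. (s ^^ j) x \<ominus>\<^bsub>A\<^esub> x) \<oplus>\<^bsub>A\<^esub> [l] \<cdot>\<^bsub>A\<^esub> x" .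
  let ?D = "\<Oplus>\<^bsub>A\<^esub>j\<in>{..<l}. (s ^^ j) x \<ominus>\<^bsub>A\<^esub> x"
  have D: "?D \<in> diff_boundaries"
    by (rule A.finsum_in_subgroup[OF diff_boundaries_subgroup]) (rule telescope[OF x])
  have Dc: "?D \<in> carrier A" using subgroup.mem_carrier[OF diff_boundaries_subgroup D] by simp
  have "[l] \<cdot>\<^bsub>A\<^esub> x \<ominus>\<^bsub>A\<^esub> nr x = \<ominus>\<^bsub>A\<^esub> ?D"
    unfolding e using Dc x by (simp add: A.minus_eq A.minus_add A.a_ac A.r_neg1 A.r_neg2)
  then show ?thesis using subgroup.m_inv_closed[OF diff_boundaries_subgroup D] by (simp add: a_inv_def)
qed

end

section \<open>Sums over the cosets of a finite quotient\<close>

locale averaging = cyclic_action A s l + Y: group Y + K: normal K Y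
  for A :: "('m, 'x) ring_scheme" and s :: "'m \<Rightarrow> 'm" and l :: nat and Y :: "('g, 'y) monoid_scheme" and K +
  fixes b :: "'g \<Rightarrow> 'm \<Rightarrow> 'm" and \<sigma> :: "'g \<Rightarrow> 'g"
  assumes b_closed: "h \<in> carrier Y \<Longrightarrow> y \<in> carrier A \<Longrightarrow> b h y \<in> carrier A"
    and b_add: "h \<in> carrier Y \<Longrightarrow> y \<in> carrier A \<Longrightarrow> z \<in> carrier A \<Longrightarrow> b h (y \<oplus>\<^bsub>A\<^esub> z) = b h y \<oplus>\<^bsub>A\<^esub> b h z"
    and b_mult: "g \<in> carrier Y \<Longrightarrow> h \<in> carrier Y \<Longrightarrow> y \<in> carrier A \<Longrightarrow> b (g \<otimes>\<^bsub>Y\<^esub> h) y = b g (b h y)"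
    and s_b: "h \<in> carrier Y \<Longrightarrow> y \<in> carrier A \<Longrightarrow> s (b h y) = b (\<sigma> h) (s y)"
    and \<sigma>_hom: "\<sigma> \<in> hom Y Y" and \<sigma>_pow: "h \<in> carrier Y \<Longrightarrow> (\<sigma> ^^ l) h = h"
    and \<sigma>K: "\<sigma> ` K \<subseteq> K" and fin: "finite (rcosets\<^bsub>Y\<^esub> K)" and l: "Factorial_Ring.prime l"
begin

definition fixedK :: "'m set" where
  "fixedK = {y \<in> carrier A. \<forall>k\<in>K. b k y = y}"

definition F :: "'m \<Rightarrow> 'g set \<Rightarrow> 'm" where
  "F y C = the_elem ((\<lambda>h. b h y) ` C)"

definition E :: "'m \<Rightarrow> 'm" where
  "E y = (\<Oplus>\<^bsub>A\<^esub>C\<in>rcosets\<^bsub>Y\<^esub> K. F y C)"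

lemma sK: "subgroup K Y"
  by (rule K.subgroup_axioms)

lemma \<sigma>_closed: "h \<in> carrier Y \<Longrightarrow> \<sigma> h \<in> carrier Y"
  using \<sigma>_hom by (auto simp: hom_def)

lemma \<sigma>j_closed: "h \<in> carrier Y \<Longrightarrow> (\<sigma> ^^ j) h \<in> carrier Y"
  by (induction j) (auto simp: \<sigma>_closed)

lemma sj_b: "h \<in> carrier Y \<Longrightarrow> y \<in> carrier A \<Longrightarrow> (s ^^ j) (b h y) = b ((\<sigma> ^^ j) h) ((s ^^ j) y)"
  by (induction j) (auto simp: s_b \<sigma>j_closed sj_closed)

lemma fixedK_carrier: "y \<in> fixedK \<Longrightarrow> y \<in> carrier A"
  by (simp add: fixedK_def)

text \<open>In a product k h the factor k acts last, so normality is used to move it to the right of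
  \<open>h\<close>, where it meets the fixed vector.\<close>

lemma fixedK_coset:
  assumes y: "y \<in> fixedK" and h: "h \<in> carrier Y" and g: "g \<in> K #>\<^bsub>Y\<^esub> h"
  shows "b g y = b h y"
proof -
  obtain k where k: "k \<in> K" "g = k \<otimes>\<^bsub>Y\<^esub> h" using g by (auto simp: r_coset_def)
  have kY: "k \<in> carrier Y" using k(1) subgroup.mem_carrier[OF sK] by blast
  let ?k = "inv\<^bsub>Y\<^esub> h \<otimes>\<^bsub>Y\<^esub> k \<otimes>\<^bsub>Y\<^esub> h"
  have k': "?k \<in> K" by (rule K.inv_op_closed1[OF h k(1)])
  have k'Y: "?k \<in> carrier Y" using k' subgroup.mem_carrier[OF sK] by blast
  have "h \<otimes>\<^bsub>Y\<^esub> ?k = g" using h kY by (simp add: k(2) Y.m_assoc Y.inv_solve_left' flip: Y.m_assoc)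
  then have "b g y = b h (b ?k y)" using b_mult[OF h k'Y fixedK_carrier[OF y]] by simp
  also have "b ?k y = y" using y k' by (simp add: fixedK_def)
  finally show ?thesis .
qed

lemma F_coset: "y \<in> fixedK \<Longrightarrow> h \<in> carrier Y \<Longrightarrow> F y (K #>\<^bsub>Y\<^esub> h) = b h y"
proof -
  assume y: "y \<in> fixedK" and h: "h \<in> carrier Y"
  have "(\<lambda>g. b g y) ` (K #>\<^bsub>Y\<^esub> h) = {b h y}"
    using fixedK_coset[OF y h] Y.rcos_self[OF h sK] by blast
  then show ?thesis by (simp add: F_def)
qed

lemma rcosetsE:
  assumes "C \<in> rcosets\<^bsub>Y\<^esub> K"
  obtains h where "h \<in> carrier Y" "C = K #>\<^bsub>Y\<^esub> h"
  using assms by (auto simp: RCOSETS_def)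

lemma F_closed: "y \<in> fixedK \<Longrightarrow> C \<in> rcosets\<^bsub>Y\<^esub> K \<Longrightarrow> F y C \<in> carrier A"
  by (erule rcosetsE) (simp add: F_coset b_closed fixedK_carrier)

lemma F_funcset: "y \<in> fixedK \<Longrightarrow> F y \<in> (rcosets\<^bsub>Y\<^esub> K) \<rightarrow> carrier A"
  using F_closed by blast

lemma E_closed: "y \<in> fixedK \<Longrightarrow> E y \<in> carrier A"
  unfolding E_def by (rule A.finsum_closed[OF F_funcset])

lemma fixedK_add: "y \<in> fixedK \<Longrightarrow> z \<in> fixedK \<Longrightarrow> y \<oplus>\<^bsub>A\<^esub> z \<in> fixedK"
  using subgroup.mem_carrier[OF sK] by (simp add: fixedK_def b_add)

lemma E_add: "y \<in> fixedK \<Longrightarrow> z \<in> fixedK \<Longrightarrow> E (y \<oplus>\<^bsub>A\<^esub> z) = E y \<oplus>\<^bsub>A\<^esub> E z"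
proof -
  assume y: "y \<in> fixedK" and z: "z \<in> fixedK"
  have "F (y \<oplus>\<^bsub>A\<^esub> z) C = F y C \<oplus>\<^bsub>A\<^esub> F z C" if C: "C \<in> rcosets\<^bsub>Y\<^esub> K" for C
  proof (rule rcosetsE[OF C])
    fix h assume "h \<in> carrier Y" "C = K #>\<^bsub>Y\<^esub> h"
    then show ?thesis using y z fixedK_add[OF y z] by (simp add: F_coset b_add fixedK_carrier)
  qed
  then have "E (y \<oplus>\<^bsub>A\<^esub> z) = (\<Oplus>\<^bsub>A\<^esub>C\<in>rcosets\<^bsub>Y\<^esub> K. F y C \<oplus>\<^bsub>A\<^esub> F z C)"
    unfolding E_def using F_closed[OF fixedK_add[OF y z]] F_closed[OF y] F_closed[OF z]
    by (intro A.finsum_cong') auto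
  then show ?thesis unfolding E_def by (simp add: A.finsum_addf F_funcset y z)
qed

lemma fixedK_b:
  assumes y: "y \<in> fixedK" and n: "n \<in> carrier Y"
  shows "b n y \<in> fixedK"
proof -
  have "b k (b n y) = b n y" if k: "k \<in> K" for k
  proof -
    have kY: "k \<in> carrier Y" using k subgroup.mem_carrier[OF sK] by blast
    have "b k (b n y) = b (k \<otimes>\<^bsub>Y\<^esub> n) y" using b_mult[OF kY n fixedK_carrier[OF y]] by simp
    also have "\<dots> = b n y" by (rule fixedK_coset[OF y n]) (use k in \<open>auto simp: r_coset_def\<close>)
    finally show ?thesis .
  qed
  then show ?thesis using b_closed[OF n fixedK_carrier[OF y]] by (simp add: fixedK_def)
qed

text \<open>Right multiplication by the coset of \<open>n\<close> permutes the quotient. This is why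
  the average kills b n y - y, and with it the generators of the twisted Jacquet kernel.\<close>

lemma E_b:
  assumes y: "y \<in> fixedK" and n: "n \<in> carrier Y"
  shows "E (b n y) = E y"
proof -
  let ?Q = "Y Mod K"
  interpret Q: group ?Q by (rule K.factorgroup_is_group)
  interpret q: group_hom Y ?Q "\<lambda>x. K #>\<^bsub>Y\<^esub> x" by (rule Y.rcos_map_hom[OF K.normal_axioms])
  have cQ: "carrier ?Q = rcosets\<^bsub>Y\<^esub> K" by (simp add: FactGroup_def)
  let ?t = "\<lambda>C. C \<otimes>\<^bsub>?Q\<^esub> (K #>\<^bsub>Y\<^esub> n)"
  have nQ: "K #>\<^bsub>Y\<^esub> n \<in> carrier ?Q" by (rule q.hom_closed[OF n])
  have inj: "inj_on ?t (rcosets\<^bsub>Y\<^esub> K)" using Q.inj_on_cmult nQ unfolding cQ[symmetric] inj_on_def by (meson Q.r_cancel)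
  have im: "?t ` (rcosets\<^bsub>Y\<^esub> K) = rcosets\<^bsub>Y\<^esub> K"
    by (rule endo_inj_surj[OF fin _ inj]) (use Q.m_closed nQ cQ in blast)
  have Ft: "F (b n y) C = F y (?t C)" if C: "C \<in> rcosets\<^bsub>Y\<^esub> K" for C
  proof (rule rcosetsE[OF C])
    fix h assume h: "h \<in> carrier Y" "C = K #>\<^bsub>Y\<^esub> h"
    have "F (b n y) C = b h (b n y)" using F_coset[OF fixedK_b[OF y n] h(1)] h(2) by simp
    also have "\<dots> = b (h \<otimes>\<^bsub>Y\<^esub> n) y" using b_mult[OF h(1) n fixedK_carrier[OF y]] by simp
    also have "\<dots> = F y (K #>\<^bsub>Y\<^esub> (h \<otimes>\<^bsub>Y\<^esub> n))" by (rule F_coset[OF y Y.m_closed[OF h(1) n], symmetric])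
    also have "K #>\<^bsub>Y\<^esub> (h \<otimes>\<^bsub>Y\<^esub> n) = ?t C" using q.hom_mult[OF h(1) n] h(2) by simp
    finally show ?thesis .
  qed
  have "E y = (\<Oplus>\<^bsub>A\<^esub>C\<in>?t ` (rcosets\<^bsub>Y\<^esub> K). F y C)" unfolding E_def im ..
  also have "\<dots> = (\<Oplus>\<^bsub>A\<^esub>C\<in>rcosets\<^bsub>Y\<^esub> K. F y (?t C))"
    using F_funcset[OF y] im by (intro A.finsum_reindex inj) auto
  also have "\<dots> = E (b n y)" unfolding E_def
    using Ft F_closed[OF fixedK_b[OF y n]] by (intro A.finsum_cong') auto
  finally show ?thesis by simp
qed

definition \<phi> :: "'g set \<Rightarrow> 'g set" where
  "\<phi> C = K #>\<^bsub>Y\<^esub> \<sigma> (SOME h. h \<in> C)"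

lemma \<phi>_coset: "h \<in> carrier Y \<Longrightarrow> \<phi> (K #>\<^bsub>Y\<^esub> h) = K #>\<^bsub>Y\<^esub> \<sigma> h"
proof -
  assume h: "h \<in> carrier Y"
  let ?g = "SOME g. g \<in> K #>\<^bsub>Y\<^esub> h"
  have g: "?g \<in> K #>\<^bsub>Y\<^esub> h" using Y.rcos_self[OF h sK] by (rule someI)
  have gY: "?g \<in> carrier Y" using g Y.r_coset_subset_G[OF K.subset h] by blast
  have "K #>\<^bsub>Y\<^esub> ?g = K #>\<^bsub>Y\<^esub> h" using Y.repr_independence[OF g h sK] by simp
  then show ?thesis unfolding \<phi>_def by (rule Y.rcos_stable[OF K.normal_axioms \<sigma>_hom \<sigma>K gY h])
qed

lemma \<phi>_closed: "C \<in> rcosets\<^bsub>Y\<^esub> K \<Longrightarrow> \<phi> C \<in> rcosets\<^bsub>Y\<^esub> K"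
  by (erule rcosetsE) (simp add: \<phi>_coset Y.rcosetsI[OF K.subset] \<sigma>_closed)

lemma \<phi>j_coset: "h \<in> carrier Y \<Longrightarrow> (\<phi> ^^ j) (K #>\<^bsub>Y\<^esub> h) = K #>\<^bsub>Y\<^esub> (\<sigma> ^^ j) h"
  by (induction j) (auto simp: \<phi>_coset \<sigma>j_closed)

lemma \<phi>_pow: "C \<in> rcosets\<^bsub>Y\<^esub> K \<Longrightarrow> (\<phi> ^^ l) C = C"
  by (erule rcosetsE) (simp add: \<phi>j_coset \<sigma>_pow)

lemma fixedK_s:
  assumes y: "y \<in> fixedK"
  shows "s y \<in> fixedK"
proof -
  have "b k (s y) = s y" if k: "k \<in> K" for k
  proof -
    have kj: "(\<sigma> ^^ j) k \<in> K" for j by (induction j) (use k \<sigma>K in auto)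
    \<comment> \<open>\<open>\<sigma>\<close> is only known to map \<open>K\<close> into itself; the
      power l - 1 supplies a preimage of \<open>k\<close> inside \<open>K\<close>.\<close>
    let ?k = "(\<sigma> ^^ (l - 1)) k"
    have "\<sigma> ?k = (\<sigma> ^^ Suc (l - 1)) k" by simp
    also have "\<dots> = k" using l0 \<sigma>_pow[OF subgroup.mem_carrier[OF sK k]] by simp
    finally have "b k (s y) = b (\<sigma> ?k) (s y)" by simp
    also have "\<dots> = s (b ?k y)" using s_b[OF subgroup.mem_carrier[OF sK kj] fixedK_carrier[OF y]] by simp
    also have "\<dots> = s y" using y kj by (simp add: fixedK_def)
    finally show ?thesis .
  qed
  then show ?thesis using s_closed[OF fixedK_carrier[OF y]] by (simp add: fixedK_def)
qed

lemma fixedK_sj: "y \<in> fixedK \<Longrightarrow> (s ^^ j) y \<in> fixedK"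
  by (induction j) (auto simp: fixedK_s)

lemma \<phi>_inj: "inj_on \<phi> (rcosets\<^bsub>Y\<^esub> K)"
proof (rule inj_onI)
  fix C D assume CD: "C \<in> rcosets\<^bsub>Y\<^esub> K" "D \<in> rcosets\<^bsub>Y\<^esub> K" "\<phi> C = \<phi> D"
  have "(\<phi> ^^ l) C = (\<phi> ^^ (l - 1)) (\<phi> C)" for C
    using l0 by (metis Suc_diff_1 funpow_Suc_right o_apply)
  then show "C = D" using CD \<phi>_pow by metis
qed

text \<open>\<open>s\<close> carries the summand of \<open>y\<close> at a coset to the summand of
  \<open>s y\<close> at the image coset, and \<phi> permutes the cosets.\<close>

lemma E_s:
  assumes y: "y \<in> fixedK"
  shows "s (E y) = E (s y)"
proof -
  have im: "\<phi> ` (rcosets\<^bsub>Y\<^esub> K) = rcosets\<^bsub>Y\<^esub> K"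
    by (rule endo_inj_surj[OF fin _ \<phi>_inj]) (use \<phi>_closed in blast)
  have Ft: "s (F y C) = F (s y) (\<phi> C)" if C: "C \<in> rcosets\<^bsub>Y\<^esub> K" for C
  proof (rule rcosetsE[OF C])
    fix h assume h: "h \<in> carrier Y" "C = K #>\<^bsub>Y\<^esub> h"
    then show ?thesis
      using F_coset[OF fixedK_s[OF y] \<sigma>_closed[OF h(1)]] F_coset[OF y h(1)] s_b[OF h(1) fixedK_carrier[OF y]]
      by (simp add: \<phi>_coset)
  qed
  have "s (E y) = (\<Oplus>\<^bsub>A\<^esub>C\<in>rcosets\<^bsub>Y\<^esub> K. s (F y C))"
    unfolding E_def using s_closed s_add F_funcset[OF y] by (rule A.additive_finsum)
  also have "\<dots> = (\<Oplus>\<^bsub>A\<^esub>C\<in>rcosets\<^bsub>Y\<^esub> K. F (s y) (\<phi> C))"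
    using Ft F_closed[OF fixedK_s[OF y]] \<phi>_closed by (intro A.finsum_cong') auto
  also have "\<dots> = (\<Oplus>\<^bsub>A\<^esub>C\<in>\<phi> ` (rcosets\<^bsub>Y\<^esub> K). F (s y) C)"
    using F_funcset[OF fixedK_s[OF y]] im by (intro A.finsum_reindex[symmetric] \<phi>_inj) auto
  also have "\<dots> = E (s y)" unfolding E_def im ..
  finally show ?thesis .
qed

lemma b_zero: "h \<in> carrier Y \<Longrightarrow> b h \<zero>\<^bsub>A\<^esub> = \<zero>\<^bsub>A\<^esub>"
  by (rule A.additive_zero[of "b h", OF b_closed b_add])

text \<open>The contribution of a free \<open>\<sigma>\<close>-orbit of cosets is a boundary.\<close>

lemma orbit_sum_nr:
  assumes x: "x \<in> carrier A" "s x = x" and h: "h \<in> carrier Y"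
  shows "(\<Oplus>\<^bsub>A\<^esub>j\<in>{..<l}. b ((\<sigma> ^^ j) h) x) = nr (b h x)"
proof -
  have "(s ^^ j) x = x" for j by (induction j) (use x in auto)
  then have "b ((\<sigma> ^^ j) h) x = (s ^^ j) (b h x)" for j using sj_b[OF h x(1), of j] by simp
  then show ?thesis by (simp add: nr_def)
qed

lemma orbit_sum_diff:
  assumes x: "x \<in> carrier A" "nr x = \<zero>\<^bsub>A\<^esub>" and h: "h \<in> carrier Y"
  shows "(\<Oplus>\<^bsub>A\<^esub>j\<in>{..<l}. b ((\<sigma> ^^ j) h) x) \<in> diff_boundaries"
proof -
  \<comment> \<open>The exponent l - j makes the \<open>j\<close>-th summand equal to s^j applied to
    \<open>?z j\<close>. The plain sum of the \<open>?z j\<close> is the image under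
    \<open>b h\<close> of the norm of \<open>x\<close>, which is zero; so the orbit sum is a sum of
    terms s^j z - z.\<close>
  let ?z = "\<lambda>j. b h ((s ^^ (l - j)) x)"
  have z: "?z j \<in> carrier A" for j by (rule b_closed[OF h sj_closed[OF x(1)]])
  have bj: "b ((\<sigma> ^^ j) h) x = (s ^^ j) (?z j)" if "j < l" for j
  proof -
    have "(s ^^ j) ((s ^^ (l - j)) x) = (s ^^ (j + (l - j))) x" by (simp add: funpow_add)
    also have "\<dots> = x" using that s_pow[OF x(1)] by simp
    finally show ?thesis using sj_b[OF h sj_closed[OF x(1)], of j "l - j"] by simp
  qed
  have "(\<Oplus>\<^bsub>A\<^esub>j\<in>{..<l}. ?z j) = b h (\<Oplus>\<^bsub>A\<^esub>j\<in>{..<l}. (s ^^ (l - j)) x)"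
    by (rule A.additive_finsum[of "b h", OF b_closed[OF h] b_add[OF h], symmetric]) (auto simp: sj_closed x)
  also have "\<dots> = \<zero>\<^bsub>A\<^esub>" using x nr_rotate[OF x(1)] b_zero[OF h] by simp
  finally have z0: "(\<Oplus>\<^bsub>A\<^esub>j\<in>{..<l}. ?z j) = \<zero>\<^bsub>A\<^esub>" .
  have "(\<Oplus>\<^bsub>A\<^esub>j\<in>{..<l}. b ((\<sigma> ^^ j) h) x) = (\<Oplus>\<^bsub>A\<^esub>j\<in>{..<l}. ((s ^^ j) (?z j) \<ominus>\<^bsub>A\<^esub> ?z j) \<oplus>\<^bsub>A\<^esub> ?z j)"
    using bj z sj_closed[OF z] by (intro A.finsum_cong') (auto simp: A.minus_eq A.a_assoc A.l_neg)
  also have "\<dots> = (\<Oplus>\<^bsub>A\<^esub>j\<in>{..<l}. (s ^^ j) (?z j) \<ominus>\<^bsub>A\<^esub> ?z j) \<oplus>\<^bsub>A\<^esub> (\<Oplus>\<^bsub>A\<^esub>j\<in>{..<l}. ?z j)"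
    using z sj_closed[OF z] by (intro A.finsum_addf) auto
  also have "\<dots> = (\<Oplus>\<^bsub>A\<^esub>j\<in>{..<l}. (s ^^ j) (?z j) \<ominus>\<^bsub>A\<^esub> ?z j)"
    unfolding z0 using z sj_closed[OF z] by (intro A.r_zero A.finsum_closed) auto
  also have "\<dots> \<in> diff_boundaries"
    by (rule A.finsum_in_subgroup[OF diff_boundaries_subgroup]) (rule telescope[OF z])
  finally show ?thesis .
qed

lemma E_diff: "y \<in> fixedK \<Longrightarrow> z \<in> fixedK \<Longrightarrow> E (y \<ominus>\<^bsub>A\<^esub> z) = E y \<ominus>\<^bsub>A\<^esub> E z"
  and fixedK_minus: "z \<in> fixedK \<Longrightarrow> \<ominus>\<^bsub>A\<^esub> z \<in> fixedK"
proof -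
  show m: "\<ominus>\<^bsub>A\<^esub> z \<in> fixedK" if z: "z \<in> fixedK" for z
  proof -
    have "b k (\<ominus>\<^bsub>A\<^esub> z) = \<ominus>\<^bsub>A\<^esub> z" if k: "k \<in> K" for k
    proof -
      have kY: "k \<in> carrier Y" using subgroup.mem_carrier[OF sK k] .
      have "b k (\<ominus>\<^bsub>A\<^esub> z) = \<ominus>\<^bsub>A\<^esub> b k z"
        by (rule A.additive_minus[of "b k", OF b_closed[OF kY] b_add[OF kY] fixedK_carrier[OF z]])
      then show ?thesis using z k by (simp add: fixedK_def)
    qed
    then show ?thesis using fixedK_carrier[OF z] by (simp add: fixedK_def)
  qed
  assume y: "y \<in> fixedK" and z: "z \<in> fixedK"
  have c: "E y \<in> carrier A" "E z \<in> carrier A" "y \<in> carrier A" "z \<in> carrier A"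
    using E_closed fixedK_carrier y z by auto
  have yz: "y \<ominus>\<^bsub>A\<^esub> z \<in> fixedK" using fixedK_add[OF y m[OF z]] by (simp add: A.minus_eq)
  have "E (y \<ominus>\<^bsub>A\<^esub> z) \<oplus>\<^bsub>A\<^esub> E z = E y"
    using E_add[OF yz z] c by (simp add: A.minus_eq A.a_assoc A.l_neg)
  then show "E (y \<ominus>\<^bsub>A\<^esub> z) = E y \<ominus>\<^bsub>A\<^esub> E z"
    using c E_closed[OF yz] by (metis A.add.inv_solve_right A.minus_eq A.minus_closed)
qed

lemma fixedK_finsum:
  assumes "\<And>i. i \<in> I \<Longrightarrow> g i \<in> fixedK"
  shows "(\<Oplus>\<^bsub>A\<^esub>i\<in>I. g i) \<in> fixedK \<and> E (\<Oplus>\<^bsub>A\<^esub>i\<in>I. g i) = (\<Oplus>\<^bsub>A\<^esub>i\<in>I. E (g i))"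
proof -
  have z: "\<zero>\<^bsub>A\<^esub> \<in> fixedK" using b_zero subgroup.mem_carrier[OF sK] by (simp add: fixedK_def)
  have Ez: "E \<zero>\<^bsub>A\<^esub> = \<zero>\<^bsub>A\<^esub>"
    using E_diff[OF z z] E_closed[OF z] by (simp add: A.minus_eq A.r_neg)
  show ?thesis using assms
  proof (induction I rule: infinite_finite_induct)
    case (insert i I)
    have "g \<in> I \<rightarrow> carrier A" "g i \<in> carrier A" "(\<lambda>i. E (g i)) \<in> I \<rightarrow> carrier A" "E (g i) \<in> carrier A"
      using insert(4) fixedK_carrier E_closed by auto
    then show ?case using insert fixedK_add E_add by (simp add: A.finsum_insert)
  qed (use z Ez in \<open>auto simp: A.finsum_infinite\<close>)
qed

lemma nr_fixedK: "y \<in> fixedK \<Longrightarrow> nr y \<in> fixedK \<and> E (nr y) = nr (E y)"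
proof -
  assume y: "y \<in> fixedK"
  have "E ((s ^^ j) y) = (s ^^ j) (E y)" for j
    by (induction j) (simp_all add: E_s[OF fixedK_sj[OF y], symmetric])
  then show ?thesis using fixedK_finsum[of "{..<l}" "\<lambda>j. (s ^^ j) y"] fixedK_sj[OF y] by (simp add: nr_def)
qed

definition fixed_cosets :: "'g set set" where
  "fixed_cosets = {C \<in> rcosets\<^bsub>Y\<^esub> K. \<phi> C = C}"

text \<open>The number of fixed cosets is congruent to the index modulo \<open>l\<close>, hence
  prime to \<open>l\<close>. \<open>B\<close> stands for the boundaries of either degree, so that
  both degrees share the argument; only the sums over single orbits depend on the degree.\<close>

lemma average_over_fixed_points:
  assumes B: "subgroup B (add_monoid A)"
    and orbit: "\<And>h. h \<in> carrier Y \<Longrightarrow> (\<Oplus>\<^bsub>A\<^esub>j\<in>{..<l}. b ((\<sigma> ^^ j) h) x) \<in> B"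
    and x: "x \<in> fixedK" "E x \<in> B"
    and cop: "coprime l (card (rcosets\<^bsub>Y\<^esub> K))"
    and lift: "\<And>h. h \<in> carrier Y \<Longrightarrow> K #>\<^bsub>Y\<^esub> \<sigma> h = K #>\<^bsub>Y\<^esub> h \<Longrightarrow>
       \<exists>g\<in>carrier Y. K #>\<^bsub>Y\<^esub> g = K #>\<^bsub>Y\<^esub> h \<and> \<sigma> g = g"
  obtains R where "finite R" "R \<subseteq> {h \<in> carrier Y. \<sigma> h = h}" "coprime l (card R)"
    "(\<Oplus>\<^bsub>A\<^esub>h\<in>R. b h x) \<in> B"
proof -
  let ?C = "rcosets\<^bsub>Y\<^esub> K"
  obtain D where D: "D \<subseteq> ?C" "inj_on (\<lambda>(j, d). (\<phi> ^^ j) d) ({..<l} \<times> D)"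
    "(\<lambda>(j, d). (\<phi> ^^ j) d) ` ({..<l} \<times> D) = {c \<in> ?C. \<phi> c \<noteq> c}"
    using prime_period_orbits[OF fin \<phi>_closed \<phi>_pow l] by blast
  have finD: "finite D" using D(1) fin finite_subset by blast
  let ?M = "{c \<in> ?C. \<phi> c \<noteq> c}"
  have split: "?C = fixed_cosets \<union> ?M" "fixed_cosets \<inter> ?M = {}" by (auto simp: fixed_cosets_def)
  have finF: "finite fixed_cosets" "finite ?M" using fin by (auto simp: fixed_cosets_def)
  have "card ?M = l * card D"
    using card_image[OF D(2)] D(3) by (simp add: card_cartesian_product)
  then have card: "card ?C = card fixed_cosets + l * card D"
    using card_Un_disjoint[OF finF split(2)] split(1) by simp
  have Fx: "F x \<in> S \<rightarrow> carrier A" if "S \<subseteq> ?C" for S using F_closed[OF x(1)] that by blast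
  have M: "(\<Oplus>\<^bsub>A\<^esub>C\<in>?M. F x C) \<in> B"
  proof -
    have FD: "(\<lambda>(j, d). F x ((\<phi> ^^ j) d)) \<in> {..<l} \<times> D \<rightarrow> carrier A"
    proof
      fix c assume "c \<in> {..<l} \<times> D"
      then have "(\<lambda>(j, d). (\<phi> ^^ j) d) c \<in> ?C" using D(3) by blast
      then show "(\<lambda>(j, d). F x ((\<phi> ^^ j) d)) c \<in> carrier A" using F_closed[OF x(1)] by (cases c) simp
    qed
    have FD': "F x ((\<phi> ^^ j) d) \<in> carrier A" if "d \<in> D" "j < l" for d j
      using funcset_mem[OF FD, of "(j, d)"] that by simp
    have fib: "(\<Oplus>\<^bsub>A\<^esub>j\<in>{..<l}. F x ((\<phi> ^^ j) d)) \<in> B" if d: "d \<in> D" for d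
    proof -
      have "d \<in> ?C" using D(1) d by blast
      then obtain h where h: "h \<in> carrier Y" "d = K #>\<^bsub>Y\<^esub> h" by (rule rcosetsE)
      have "F x ((\<phi> ^^ j) d) = b ((\<sigma> ^^ j) h) x" for j
        using h F_coset[OF x(1) \<sigma>j_closed[OF h(1)]] by (simp add: \<phi>j_coset)
      then show ?thesis using orbit[OF h(1)] by simp
    qed
    have "(\<Oplus>\<^bsub>A\<^esub>C\<in>?M. F x C) = (\<Oplus>\<^bsub>A\<^esub>C\<in>(\<lambda>(j, d). (\<phi> ^^ j) d) ` ({..<l} \<times> D). F x C)" by (simp only: D(3))
    also have "\<dots> = (\<Oplus>\<^bsub>A\<^esub>c\<in>{..<l} \<times> D. F x ((\<lambda>(j, d). (\<phi> ^^ j) d) c))"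
      by (rule A.finsum_reindex[OF _ D(2)]) (use D(3) in \<open>intro Fx, blast\<close>)
    also have "\<dots> = (\<Oplus>\<^bsub>A\<^esub>c\<in>(\<lambda>(d, j). (j, d)) ` (D \<times> {..<l}). F x ((\<lambda>(j, d). (\<phi> ^^ j) d) c))"
    proof -
      have "(\<lambda>(d, j). (j, d)) ` (D \<times> {..<l}) = {..<l} \<times> D" by auto
      then show ?thesis by simp
    qed
    also have "\<dots> = (\<Oplus>\<^bsub>A\<^esub>c\<in>D \<times> {..<l}. F x ((\<phi> ^^ snd c) (fst c)))"
    proof (subst A.finsum_reindex)
      show "inj_on (\<lambda>(d, j). (j, d)) (D \<times> {..<l})" by (auto simp: inj_on_def)
    qed (use FD' in \<open>auto simp: case_prod_unfold intro!: A.finsum_cong'\<close>)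
    also have "\<dots> \<in> B"
    proof -
      \<comment> \<open>The double sum is built up one orbit at a time, each orbit contributing an
        element of the subgroup \<open>B\<close>.\<close>
      have "\<forall>D'. finite D' \<longrightarrow> D' \<subseteq> D \<longrightarrow> (\<Oplus>\<^bsub>A\<^esub>c\<in>D' \<times> {..<l}. F x ((\<phi> ^^ snd c) (fst c))) \<in> B"
      proof (intro allI impI)
        fix D' assume "finite D'" "D' \<subseteq> D"
        then show "(\<Oplus>\<^bsub>A\<^esub>c\<in>D' \<times> {..<l}. F x ((\<phi> ^^ snd c) (fst c))) \<in> B"
        proof (induction D')
          case empty
          then show ?case using subgroup.one_closed[OF B] by simp
        next
          case (insert d D')
          let ?f = "\<lambda>c. F x ((\<phi> ^^ snd c) (fst c))"
          have f: "?f \<in> D \<times> {..<l} \<rightarrow> carrier A" using FD' by auto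
          have "insert d D' \<times> {..<l} = Pair d ` {..<l} \<union> D' \<times> {..<l}" by auto
          then have "(\<Oplus>\<^bsub>A\<^esub>c\<in>insert d D' \<times> {..<l}. ?f c)
              = (\<Oplus>\<^bsub>A\<^esub>c\<in>Pair d ` {..<l} \<union> D' \<times> {..<l}. ?f c)" by simp
          also have "\<dots> = (\<Oplus>\<^bsub>A\<^esub>c\<in>Pair d ` {..<l}. ?f c) \<oplus>\<^bsub>A\<^esub> (\<Oplus>\<^bsub>A\<^esub>c\<in>D' \<times> {..<l}. ?f c)"
            using insert f by (intro A.finsum_Un_disjoint) auto
          also have "(\<Oplus>\<^bsub>A\<^esub>c\<in>Pair d ` {..<l}. ?f c) = (\<Oplus>\<^bsub>A\<^esub>j\<in>{..<l}. ?f (d, j))"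
            using insert f by (intro A.finsum_reindex) (auto simp: inj_on_def)
          finally show ?case
            using subgroup.m_closed[OF B] fib insert by simp
        qed
      qed
      then show ?thesis using finD by blast
    qed
    finally show ?thesis .
  qed
  have E: "E x = (\<Oplus>\<^bsub>A\<^esub>C\<in>fixed_cosets. F x C) \<oplus>\<^bsub>A\<^esub> (\<Oplus>\<^bsub>A\<^esub>C\<in>?M. F x C)"
    unfolding E_def by (subst split(1), rule A.finsum_Un_disjoint[OF finF split(2)])
      (intro Fx, force simp: fixed_cosets_def)+
  have Fc: "(\<Oplus>\<^bsub>A\<^esub>C\<in>fixed_cosets. F x C) \<in> carrier A" "(\<Oplus>\<^bsub>A\<^esub>C\<in>?M. F x C) \<in> carrier A"
    by (intro A.finsum_closed Fx, force simp: fixed_cosets_def)+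
  have "E x \<oplus>\<^bsub>A\<^esub> \<ominus>\<^bsub>A\<^esub> (\<Oplus>\<^bsub>A\<^esub>C\<in>?M. F x C) \<in> B"
    using subgroup.m_closed[OF B x(2) subgroup.m_inv_closed[OF B M]] by (simp add: a_inv_def)
  then have fixB: "(\<Oplus>\<^bsub>A\<^esub>C\<in>fixed_cosets. F x C) \<in> B"
    unfolding E using Fc by (simp add: A.a_assoc A.r_neg)
  have "\<forall>C\<in>fixed_cosets. \<exists>g. g \<in> carrier Y \<and> K #>\<^bsub>Y\<^esub> g = C \<and> \<sigma> g = g"
  proof
    fix C assume "C \<in> fixed_cosets"
    then have C: "C \<in> ?C" "\<phi> C = C" by (auto simp: fixed_cosets_def)
    from C(1) obtain h where h: "h \<in> carrier Y" "C = K #>\<^bsub>Y\<^esub> h" by (rule rcosetsE)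
    have "K #>\<^bsub>Y\<^esub> \<sigma> h = K #>\<^bsub>Y\<^esub> h" using C(2) h by (simp add: \<phi>_coset)
    from lift[OF h(1) this] show "\<exists>g. g \<in> carrier Y \<and> K #>\<^bsub>Y\<^esub> g = C \<and> \<sigma> g = g" using h(2) by blast
  qed
  from bchoice[OF this] obtain r where r: "\<And>C. C \<in> fixed_cosets \<Longrightarrow> r C \<in> carrier Y \<and> K #>\<^bsub>Y\<^esub> r C = C \<and> \<sigma> (r C) = r C"
    by blast
  have inj: "inj_on r fixed_cosets" by (rule inj_onI) (metis r)
  have br: "b (r C) x = F x C" if "C \<in> fixed_cosets" for C
    using F_coset[OF x(1), of "r C"] r[OF that] by simp
  have "(\<Oplus>\<^bsub>A\<^esub>h\<in>r ` fixed_cosets. b h x) = (\<Oplus>\<^bsub>A\<^esub>C\<in>fixed_cosets. b (r C) x)"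
    using r b_closed fixedK_carrier[OF x(1)] by (intro A.finsum_reindex inj) auto
  also have "\<dots> = (\<Oplus>\<^bsub>A\<^esub>C\<in>fixed_cosets. F x C)"
    using br r b_closed fixedK_carrier[OF x(1)] Fx[of fixed_cosets]
    by (intro A.finsum_cong') (auto simp: fixed_cosets_def)
  finally have sum: "(\<Oplus>\<^bsub>A\<^esub>h\<in>r ` fixed_cosets. b h x) \<in> B" using fixB by simp
  have "coprime l (card (r ` fixed_cosets))"
  proof -
    have "\<not> l dvd card fixed_cosets"
    proof
      assume "l dvd card fixed_cosets"
      then have "l dvd card ?C" using card by simp
      then have "l dvd 1" using cop by (metis coprime_common_divisor dvd_refl)
      then show False using l by (simp add: not_prime_1)
    qed
    then show ?thesis using l card_image[OF inj] by (simp add: prime_imp_coprime)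
  qed
  then show ?thesis using that[of "r ` fixed_cosets"] finF(1) r sum by blast
qed

end

section \<open>Tate cohomology of twisted Jacquet modules\<close>

lemma descend_eq: "x \<in> S \<Longrightarrow> (\<And>y. y \<in> S \<Longrightarrow> g y = g x) \<Longrightarrow> descend g S = g x"
proof -
  assume x: "x \<in> S" and g: "\<And>y. y \<in> S \<Longrightarrow> g y = g x"
  have "g ` S = {g x}" using x g by blast
  then show ?thesis by (simp add: descend_def)
qed

section \<open>Submodules, subquotients and scalars in a residue ring\<close>

context module
begin

lemma submodule_abelian: "submodule B R M \<Longrightarrow> abelian_subgroup B M"
  by (rule abelian_subgroupI3) (auto simp: additive_subgroup_def submodule_def M.abelian_group_axioms)

lemma submodule_closed:
  assumes "submodule B R M"
  shows "B \<subseteq> carrier M" "\<zero>\<^bsub>M\<^esub> \<in> B" "x \<in> B \<Longrightarrow> y \<in> B \<Longrightarrow> x \<oplus>\<^bsub>M\<^esub> y \<in> B" "x \<in> B \<Longrightarrow> \<ominus>\<^bsub>M\<^esub> x \<in> B"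
    "x \<in> B \<Longrightarrow> y \<in> B \<Longrightarrow> x \<ominus>\<^bsub>M\<^esub> y \<in> B" "r \<in> carrier R \<Longrightarrow> x \<in> B \<Longrightarrow> r \<odot>\<^bsub>M\<^esub> x \<in> B"
proof -
  note s = submodule.axioms(1)[OF assms]
  show "B \<subseteq> carrier M" "\<zero>\<^bsub>M\<^esub> \<in> B" using subgroup.subset[OF s] subgroup.one_closed[OF s] by auto
  show a: "x \<in> B \<Longrightarrow> y \<in> B \<Longrightarrow> x \<oplus>\<^bsub>M\<^esub> y \<in> B" for x y using subgroup.m_closed[OF s] by simp
  show m: "x \<in> B \<Longrightarrow> \<ominus>\<^bsub>M\<^esub> x \<in> B" for x using subgroup.m_inv_closed[OF s] by (simp add: a_inv_def)
  show "x \<in> B \<Longrightarrow> y \<in> B \<Longrightarrow> x \<ominus>\<^bsub>M\<^esub> y \<in> B" using a m by (simp add: M.minus_eq)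
  show "r \<in> carrier R \<Longrightarrow> x \<in> B \<Longrightarrow> r \<odot>\<^bsub>M\<^esub> x \<in> B" using submodule.smult_closed[OF assms] .
qed

lemma submodule_criterion:
  assumes "B \<subseteq> carrier M" "\<zero>\<^bsub>M\<^esub> \<in> B" "\<And>x y. x \<in> B \<Longrightarrow> y \<in> B \<Longrightarrow> x \<oplus>\<^bsub>M\<^esub> y \<in> B"
    "\<And>r x. r \<in> carrier R \<Longrightarrow> x \<in> B \<Longrightarrow> r \<odot>\<^bsub>M\<^esub> x \<in> B"
  shows "submodule B R M"
proof (rule submoduleI)
  show "\<ominus>\<^bsub>M\<^esub> a \<in> B" if "a \<in> B" for a
    using assms(4)[of "\<ominus> \<one>" a] smult_l_minus[of \<one> a] assms(1) that by auto
qed (use assms in auto)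

lemma coset_mem: "submodule B R M \<Longrightarrow> x \<in> carrier M \<Longrightarrow> y \<in> B +>\<^bsub>M\<^esub> x \<longleftrightarrow> y \<in> carrier M \<and> y \<ominus>\<^bsub>M\<^esub> x \<in> B"
proof
  assume B: "submodule B R M" and x: "x \<in> carrier M" and y: "y \<in> B +>\<^bsub>M\<^esub> x"
  then obtain b where b: "b \<in> B" "y = b \<oplus>\<^bsub>M\<^esub> x" by (auto simp: a_r_coset_def')
  then have "b \<in> carrier M" using submodule_closed(1)[OF B] by blast
  then show "y \<in> carrier M \<and> y \<ominus>\<^bsub>M\<^esub> x \<in> B" using b x by (simp add: M.minus_eq M.a_assoc M.r_neg)
next
  assume B: "submodule B R M" and x: "x \<in> carrier M" and y: "y \<in> carrier M \<and> y \<ominus>\<^bsub>M\<^esub> x \<in> B"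
  have "y = (y \<ominus>\<^bsub>M\<^esub> x) \<oplus>\<^bsub>M\<^esub> x" using x y by (simp add: M.minus_eq M.a_assoc M.l_neg)
  then show "y \<in> B +>\<^bsub>M\<^esub> x" using y by (auto simp: a_r_coset_def')
qed

lemma coset_self: "submodule B R M \<Longrightarrow> x \<in> carrier M \<Longrightarrow> x \<in> B +>\<^bsub>M\<^esub> x"
  using coset_mem submodule_closed(2) by (simp add: M.minus_eq M.r_neg)

lemma coset_eq_iff:
  assumes B: "submodule B R M" and x: "x \<in> carrier M" "y \<in> carrier M"
  shows "B +>\<^bsub>M\<^esub> x = B +>\<^bsub>M\<^esub> y \<longleftrightarrow> x \<ominus>\<^bsub>M\<^esub> y \<in> B"
proof
  assume "B +>\<^bsub>M\<^esub> x = B +>\<^bsub>M\<^esub> y"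
  then show "x \<ominus>\<^bsub>M\<^esub> y \<in> B" using coset_self[OF B x(1)] coset_mem[OF B x(2)] by simp
next
  assume "x \<ominus>\<^bsub>M\<^esub> y \<in> B"
  then have "x \<in> B +>\<^bsub>M\<^esub> y" using coset_mem[OF B x(2)] x by simp
  then show "B +>\<^bsub>M\<^esub> x = B +>\<^bsub>M\<^esub> y"
    using abelian_subgroup.a_repr_independence'[OF submodule_abelian[OF B]] x by simp
qed

lemma coset_zero_iff:
  assumes B: "submodule B R M" and x: "x \<in> carrier M"
  shows "B +>\<^bsub>M\<^esub> x = B \<longleftrightarrow> x \<in> B"
proof -
  have "B +>\<^bsub>M\<^esub> \<zero>\<^bsub>M\<^esub> = B" using submodule_closed(1)[OF B] M.a_coset_add_zero by simp
  then show ?thesis using coset_eq_iff[OF B x, of "\<zero>\<^bsub>M\<^esub>"] x M.minus_equality[of "\<zero>\<^bsub>M\<^esub>" "\<zero>\<^bsub>M\<^esub>"]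
    by (simp add: M.minus_eq)
qed

lemma descend_coset:
  assumes B: "submodule B R M" and x: "x \<in> carrier M"
    and g: "\<And>y. y \<in> carrier M \<Longrightarrow> y \<ominus>\<^bsub>M\<^esub> x \<in> B \<Longrightarrow> g y = g x"
  shows "descend g (B +>\<^bsub>M\<^esub> x) = g x"
proof (rule descend_eq)
  show "x \<in> B +>\<^bsub>M\<^esub> x" by (rule coset_self[OF B x])
  fix y assume "y \<in> B +>\<^bsub>M\<^esub> x"
  then have "y \<in> carrier M" "y \<ominus>\<^bsub>M\<^esub> x \<in> B" unfolding coset_mem[OF B x] by auto
  then show "g y = g x" by (rule g)
qed

context
  fixes U B
  assumes U: "submodule U R M" and B: "submodule B R M" and BU: "B \<subseteq> U"
begin

abbreviation "Q \<equiv> subquotient M U B"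

lemma subquotient_carrier: "carrier Q = (\<lambda>x. B +>\<^bsub>M\<^esub> x) ` U"
  and subquotient_zero: "\<zero>\<^bsub>Q\<^esub> = B"
  by (simp_all add: subquotient_def)

lemma U_carrier: "x \<in> U \<Longrightarrow> x \<in> carrier M"
  using submodule_closed(1)[OF U] by blast

lemma subquotient_add: "x \<in> U \<Longrightarrow> y \<in> U \<Longrightarrow> (B +>\<^bsub>M\<^esub> x) \<oplus>\<^bsub>Q\<^esub> (B +>\<^bsub>M\<^esub> y) = B +>\<^bsub>M\<^esub> (x \<oplus>\<^bsub>M\<^esub> y)"
  using abelian_subgroup.a_rcos_sum[OF submodule_abelian[OF B]] U_carrier by (simp add: subquotient_def)

lemma subquotient_smult: "r \<in> carrier R \<Longrightarrow> x \<in> U \<Longrightarrow> r \<odot>\<^bsub>Q\<^esub> (B +>\<^bsub>M\<^esub> x) = B +>\<^bsub>M\<^esub> (r \<odot>\<^bsub>M\<^esub> x)"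
proof -
  assume r: "r \<in> carrier R" and x: "x \<in> U"
  have "descend (\<lambda>x. B +>\<^bsub>M\<^esub> (r \<odot>\<^bsub>M\<^esub> x)) (B +>\<^bsub>M\<^esub> x) = B +>\<^bsub>M\<^esub> (r \<odot>\<^bsub>M\<^esub> x)"
  proof (rule descend_coset[OF B U_carrier[OF x]])
    fix y assume y: "y \<in> carrier M" "y \<ominus>\<^bsub>M\<^esub> x \<in> B"
    have "r \<odot>\<^bsub>M\<^esub> (y \<ominus>\<^bsub>M\<^esub> x) \<in> B" using submodule_closed(6)[OF B r y(2)] .
    then have "r \<odot>\<^bsub>M\<^esub> y \<ominus>\<^bsub>M\<^esub> r \<odot>\<^bsub>M\<^esub> x \<in> B"
      using r y U_carrier[OF x] by (simp add: M.minus_eq smult_r_distr smult_r_minus)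
    then show "B +>\<^bsub>M\<^esub> (r \<odot>\<^bsub>M\<^esub> y) = B +>\<^bsub>M\<^esub> (r \<odot>\<^bsub>M\<^esub> x)"
      using coset_eq_iff[OF B] r y U_carrier[OF x] by simp
  qed
  then show ?thesis by (simp add: subquotient_def)
qed

lemma subquotient_module: "Module.module R Q"
proof (rule moduleI)
  show "cring R" by (rule R.is_cring)
  note Uc = submodule_closed[OF U]
  show "abelian_group Q"
  proof (rule abelian_groupI)
    fix x y z assume "x \<in> carrier Q" "y \<in> carrier Q" "z \<in> carrier Q"
    then obtain a b c where "x = B +>\<^bsub>M\<^esub> a" "y = B +>\<^bsub>M\<^esub> b" "z = B +>\<^bsub>M\<^esub> c" "a \<in> U" "b \<in> U" "c \<in> U"
      by (auto simp: subquotient_carrier)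
    then show "(x \<oplus>\<^bsub>Q\<^esub> y) \<oplus>\<^bsub>Q\<^esub> z = x \<oplus>\<^bsub>Q\<^esub> (y \<oplus>\<^bsub>Q\<^esub> z)"
      using Uc U_carrier by (simp add: subquotient_add M.a_assoc)
  next
    fix x y assume "x \<in> carrier Q" "y \<in> carrier Q"
    then obtain a b where "x = B +>\<^bsub>M\<^esub> a" "y = B +>\<^bsub>M\<^esub> b" "a \<in> U" "b \<in> U"
      by (auto simp: subquotient_carrier)
    then show "x \<oplus>\<^bsub>Q\<^esub> y \<in> carrier Q" "x \<oplus>\<^bsub>Q\<^esub> y = y \<oplus>\<^bsub>Q\<^esub> x"
      using Uc U_carrier by (auto simp: subquotient_add subquotient_carrier M.a_comm)
  next
    have z: "\<zero>\<^bsub>Q\<^esub> = B +>\<^bsub>M\<^esub> \<zero>\<^bsub>M\<^esub>"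
      using submodule_closed(1)[OF B] M.a_coset_add_zero by (simp add: subquotient_zero)
    then show "\<zero>\<^bsub>Q\<^esub> \<in> carrier Q" using Uc(2) by (auto simp: subquotient_carrier)
    fix x assume "x \<in> carrier Q"
    then obtain a where a: "x = B +>\<^bsub>M\<^esub> a" "a \<in> U" by (auto simp: subquotient_carrier)
    show "\<zero>\<^bsub>Q\<^esub> \<oplus>\<^bsub>Q\<^esub> x = x" unfolding z a(1) using a Uc U_carrier by (simp add: subquotient_add)
    have "(B +>\<^bsub>M\<^esub> (\<ominus>\<^bsub>M\<^esub> a)) \<oplus>\<^bsub>Q\<^esub> x = \<zero>\<^bsub>Q\<^esub>"
      unfolding z a(1) using a Uc U_carrier by (simp add: subquotient_add M.l_neg)
    then show "\<exists>y\<in>carrier Q. y \<oplus>\<^bsub>Q\<^esub> x = \<zero>\<^bsub>Q\<^esub>" using a Uc(4) by (auto simp: subquotient_carrier)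
  qed
next
  note Uc = submodule_closed[OF U]
  fix r x assume r: "r \<in> carrier R" and "x \<in> carrier Q"
  then obtain a where a: "x = B +>\<^bsub>M\<^esub> a" "a \<in> U" by (auto simp: subquotient_carrier)
  show "r \<odot>\<^bsub>Q\<^esub> x \<in> carrier Q" using a r Uc by (auto simp: subquotient_smult subquotient_carrier)
next
  note Uc = submodule_closed[OF U]
  fix r t x assume r: "r \<in> carrier R" "t \<in> carrier R" and "x \<in> carrier Q"
  then obtain a where a: "x = B +>\<^bsub>M\<^esub> a" "a \<in> U" by (auto simp: subquotient_carrier)
  show "(r \<oplus> t) \<odot>\<^bsub>Q\<^esub> x = r \<odot>\<^bsub>Q\<^esub> x \<oplus>\<^bsub>Q\<^esub> t \<odot>\<^bsub>Q\<^esub> x"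
    using a r Uc U_carrier by (simp add: subquotient_smult subquotient_add smult_l_distr)
  show "(r \<otimes> t) \<odot>\<^bsub>Q\<^esub> x = r \<odot>\<^bsub>Q\<^esub> (t \<odot>\<^bsub>Q\<^esub> x)"
    using a r Uc U_carrier by (simp add: subquotient_smult smult_assoc1)
next
  note Uc = submodule_closed[OF U]
  fix r x y assume r: "r \<in> carrier R" and "x \<in> carrier Q" "y \<in> carrier Q"
  then obtain a b where a: "x = B +>\<^bsub>M\<^esub> a" "a \<in> U" "y = B +>\<^bsub>M\<^esub> b" "b \<in> U" by (auto simp: subquotient_carrier)
  show "r \<odot>\<^bsub>Q\<^esub> (x \<oplus>\<^bsub>Q\<^esub> y) = r \<odot>\<^bsub>Q\<^esub> x \<oplus>\<^bsub>Q\<^esub> r \<odot>\<^bsub>Q\<^esub> y"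
    using a r Uc U_carrier by (simp add: subquotient_smult subquotient_add smult_r_distr)
next
  fix x assume "x \<in> carrier Q"
  then obtain a where a: "x = B +>\<^bsub>M\<^esub> a" "a \<in> U" by (auto simp: subquotient_carrier)
  then show "\<one> \<odot>\<^bsub>Q\<^esub> x = x" using U_carrier by (simp add: subquotient_smult)
qed

lemma subquotient_minus: "x \<in> U \<Longrightarrow> y \<in> U \<Longrightarrow> (B +>\<^bsub>M\<^esub> x) \<ominus>\<^bsub>Q\<^esub> (B +>\<^bsub>M\<^esub> y) = B +>\<^bsub>M\<^esub> (x \<ominus>\<^bsub>M\<^esub> y)"
proof -
  assume x: "x \<in> U" and y: "y \<in> U"
  interpret Q: module R Q by (rule subquotient_module)
  note Uc = submodule_closed[OF U]
  have c: "B +>\<^bsub>M\<^esub> (x \<ominus>\<^bsub>M\<^esub> y) \<in> carrier Q" "B +>\<^bsub>M\<^esub> y \<in> carrier Q" "B +>\<^bsub>M\<^esub> x \<in> carrier Q"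
    using Uc(5)[OF x y] x y by (auto simp: subquotient_carrier)
  have "(B +>\<^bsub>M\<^esub> (x \<ominus>\<^bsub>M\<^esub> y)) \<oplus>\<^bsub>Q\<^esub> (B +>\<^bsub>M\<^esub> y) = B +>\<^bsub>M\<^esub> x"
    using x y Uc(5)[OF x y] U_carrier by (simp add: subquotient_add M.minus_eq M.a_assoc M.l_neg)
  then show ?thesis using c by (metis Q.M.add.inv_solve_right Q.M.minus_eq)
qed

lemma subquotient_finsum:
  assumes "\<And>i. i \<in> I \<Longrightarrow> f i \<in> U"
  shows "(\<Oplus>\<^bsub>M\<^esub>i\<in>I. f i) \<in> U \<and> (\<Oplus>\<^bsub>Q\<^esub>i\<in>I. B +>\<^bsub>M\<^esub> f i) = B +>\<^bsub>M\<^esub> (\<Oplus>\<^bsub>M\<^esub>i\<in>I. f i)"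
proof -
  interpret Q: module R Q by (rule subquotient_module)
  have z: "\<zero>\<^bsub>Q\<^esub> = B +>\<^bsub>M\<^esub> \<zero>\<^bsub>M\<^esub>"
    using submodule_closed(1)[OF B] M.a_coset_add_zero by (simp add: subquotient_zero)
  show ?thesis using assms
  proof (induction I rule: infinite_finite_induct)
    case (infinite I)
    then show ?case using submodule_closed(2)[OF U] z by (simp add: M.finsum_infinite Q.M.finsum_infinite)
  next
    case empty
    then show ?case using submodule_closed(2)[OF U] z by simp
  next
    case (insert i I)
    have "f \<in> I \<rightarrow> carrier M" "f i \<in> carrier M" using insert(4) U_carrier by auto
    moreover have "(\<lambda>i. B +>\<^bsub>M\<^esub> f i) \<in> I \<rightarrow> carrier Q" "B +>\<^bsub>M\<^esub> f i \<in> carrier Q"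
      using insert(4) by (auto simp: subquotient_carrier)
    ultimately show ?case
      using insert submodule_closed(3)[OF U] by (simp add: subquotient_add)
  qed
qed

end

text \<open>All members of a coset of \<open>I\<close> act alike because \<open>I\<close> acts by
  zero; this is what gives the scalar action through \<open>descend\<close> its meaning.\<close>

lemma residual_module:
  assumes I: "ideal I R" and kill: "\<And>a x. a \<in> I \<Longrightarrow> x \<in> carrier M \<Longrightarrow> a \<odot>\<^bsub>M\<^esub> x = \<zero>\<^bsub>M\<^esub>"
  shows residual_smult: "\<And>a x. a \<in> carrier R \<Longrightarrow> x \<in> carrier M \<Longrightarrow>
      (I +>\<^bsub>R\<^esub> a) \<odot>\<^bsub>residual_module M\<^esub> x = a \<odot>\<^bsub>M\<^esub> x"
    and residual_is_module: "Module.module (R Quot I) (residual_module M)"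
proof -
  interpret I: ideal I R by (rule I)
  show sm: "(I +>\<^bsub>R\<^esub> a) \<odot>\<^bsub>residual_module M\<^esub> x = a \<odot>\<^bsub>M\<^esub> x" if a: "a \<in> carrier R" and x: "x \<in> carrier M" for a x
  proof -
    have "descend (\<lambda>a. a \<odot>\<^bsub>M\<^esub> x) (I +>\<^bsub>R\<^esub> a) = a \<odot>\<^bsub>M\<^esub> x"
    proof (rule descend_eq)
      show "a \<in> I +>\<^bsub>R\<^esub> a" by (rule I.a_rcos_self[OF a])
      fix c assume "c \<in> I +>\<^bsub>R\<^esub> a"
      then obtain i where i: "i \<in> I" "c = i \<oplus> a" by (auto simp: a_r_coset_def')
      then show "c \<odot>\<^bsub>M\<^esub> x = a \<odot>\<^bsub>M\<^esub> x" using kill[OF i(1) x] a x I.Icarr[OF i(1)] by (simp add: smult_l_distr)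
    qed
    then show ?thesis by (simp add: residual_module_def)
  qed
  let ?T = "residual_module M"
  have [simp]: "carrier ?T = carrier M" "\<And>x y. x \<oplus>\<^bsub>?T\<^esub> y = x \<oplus>\<^bsub>M\<^esub> y" "\<zero>\<^bsub>?T\<^esub> = \<zero>\<^bsub>M\<^esub>"
    by (simp_all add: residual_module_def)
  have car: "\<exists>a\<in>carrier R. C = I +>\<^bsub>R\<^esub> a" if "C \<in> carrier (R Quot I)" for C
    using that by (auto simp: FactRing_def A_RCOSETS_def')
  have qa: "(I +>\<^bsub>R\<^esub> a) \<oplus>\<^bsub>R Quot I\<^esub> (I +>\<^bsub>R\<^esub> c) = I +>\<^bsub>R\<^esub> (a \<oplus> c)"
    and qm: "(I +>\<^bsub>R\<^esub> a) \<otimes>\<^bsub>R Quot I\<^esub> (I +>\<^bsub>R\<^esub> c) = I +>\<^bsub>R\<^esub> (a \<otimes> c)" if "a \<in> carrier R" "c \<in> carrier R" for a c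
    using that by (simp_all add: FactRing_def I.a_rcos_sum I.rcoset_mult_add)
  show "Module.module (R Quot I) ?T"
  proof (rule moduleI)
    show "cring (R Quot I)" by (rule I.quotient_is_cring[OF R.is_cring])
    show "abelian_group ?T"
    proof (rule abelian_groupI)
      show "\<exists>y\<in>carrier ?T. y \<oplus>\<^bsub>?T\<^esub> x = \<zero>\<^bsub>?T\<^esub>" if "x \<in> carrier ?T" for x
        using that by (intro bexI[of _ "\<ominus>\<^bsub>M\<^esub> x"]) (auto simp: M.l_neg)
      show "x \<oplus>\<^bsub>?T\<^esub> y = y \<oplus>\<^bsub>?T\<^esub> x" if "x \<in> carrier ?T" "y \<in> carrier ?T" for x y
        using that by (simp add: M.a_comm)
    qed (simp_all add: M.a_assoc)
  next
    fix C x assume "C \<in> carrier (R Quot I)" "x \<in> carrier ?T"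
    then show "C \<odot>\<^bsub>?T\<^esub> x \<in> carrier ?T" using car by (fastforce simp: sm)
  next
    fix C D x assume C: "C \<in> carrier (R Quot I)" "D \<in> carrier (R Quot I)" and x: "x \<in> carrier ?T"
    obtain a c where "a \<in> carrier R" "C = I +>\<^bsub>R\<^esub> a" "c \<in> carrier R" "D = I +>\<^bsub>R\<^esub> c" using car C by meson
    then show "(C \<oplus>\<^bsub>R Quot I\<^esub> D) \<odot>\<^bsub>?T\<^esub> x = C \<odot>\<^bsub>?T\<^esub> x \<oplus>\<^bsub>?T\<^esub> D \<odot>\<^bsub>?T\<^esub> x"
      "(C \<otimes>\<^bsub>R Quot I\<^esub> D) \<odot>\<^bsub>?T\<^esub> x = C \<odot>\<^bsub>?T\<^esub> (D \<odot>\<^bsub>?T\<^esub> x)"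
      using x by (simp_all add: qa qm sm smult_l_distr smult_assoc1)
  next
    fix C x y assume C: "C \<in> carrier (R Quot I)" and x: "x \<in> carrier ?T" "y \<in> carrier ?T"
    obtain a where "a \<in> carrier R" "C = I +>\<^bsub>R\<^esub> a" using car C by meson
    then show "C \<odot>\<^bsub>?T\<^esub> (x \<oplus>\<^bsub>?T\<^esub> y) = C \<odot>\<^bsub>?T\<^esub> x \<oplus>\<^bsub>?T\<^esub> C \<odot>\<^bsub>?T\<^esub> y"
      using x by (simp add: sm smult_r_distr)
  next
    fix x assume "x \<in> carrier ?T"
    then show "\<one>\<^bsub>R Quot I\<^esub> \<odot>\<^bsub>?T\<^esub> x = x" by (simp add: FactRing_def sm)
  qed
qed

lemma jacquet_kernel_submodule:
  assumes "\<And>n x. n \<in> N \<Longrightarrow> x \<in> carrier M \<Longrightarrow> \<pi> n x \<ominus>\<^bsub>M\<^esub> \<theta> n \<odot>\<^bsub>M\<^esub> x \<in> carrier M"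
  shows "submodule (jacquet_kernel R M N \<pi> \<theta>) R M"
    and "\<And>n x. n \<in> N \<Longrightarrow> x \<in> carrier M \<Longrightarrow> \<pi> n x \<ominus>\<^bsub>M\<^esub> \<theta> n \<odot>\<^bsub>M\<^esub> x \<in> jacquet_kernel R M N \<pi> \<theta>"
    and "\<And>W. submodule W R M \<Longrightarrow> (\<And>n x. n \<in> N \<Longrightarrow> x \<in> carrier M \<Longrightarrow> \<pi> n x \<ominus>\<^bsub>M\<^esub> \<theta> n \<odot>\<^bsub>M\<^esub> x \<in> W) \<Longrightarrow>
      jacquet_kernel R M N \<pi> \<theta> \<subseteq> W"
proof -
  let ?P = "\<lambda>W. submodule W R M \<and> (\<forall>n\<in>N. \<forall>x\<in>carrier M. \<pi> n x \<ominus>\<^bsub>M\<^esub> \<theta> n \<odot>\<^bsub>M\<^esub> x \<in> W)"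
  \<comment> \<open>The whole module belongs to the intersected family, which keeps the intersection
    inside the carrier.\<close>
  have c: "?P (carrier M)" using assms carrier_is_submodule by blast
  show "submodule (jacquet_kernel R M N \<pi> \<theta>) R M"
  proof (rule submodule_criterion)
    show "jacquet_kernel R M N \<pi> \<theta> \<subseteq> carrier M" using c unfolding jacquet_kernel_def by blast
    show "\<zero>\<^bsub>M\<^esub> \<in> jacquet_kernel R M N \<pi> \<theta>" unfolding jacquet_kernel_def using submodule_closed(2) by auto
    show "x \<oplus>\<^bsub>M\<^esub> y \<in> jacquet_kernel R M N \<pi> \<theta>"
      if "x \<in> jacquet_kernel R M N \<pi> \<theta>" "y \<in> jacquet_kernel R M N \<pi> \<theta>" for x y
      using that unfolding jacquet_kernel_def by (auto intro: submodule_closed(3))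
    show "r \<odot>\<^bsub>M\<^esub> x \<in> jacquet_kernel R M N \<pi> \<theta>"
      if "r \<in> carrier R" "x \<in> jacquet_kernel R M N \<pi> \<theta>" for r x
      using that unfolding jacquet_kernel_def by (auto intro: submodule_closed(6))
  qed
qed (auto simp: jacquet_kernel_def)

end

section \<open>Tate cohomology of a module with cyclic action\<close>

locale cyclic_module = module R L + cyclic_action L s l
  for R :: "('r, 'x) ring_scheme" and L :: "('r, 'm, 'y) module_scheme" and s :: "'m \<Rightarrow> 'm" and l :: nat +
  fixes \<Gamma> :: "'c set" and \<gamma> :: 'c and \<tau> :: "'c \<Rightarrow> 'm \<Rightarrow> 'm" and e :: "nat \<Rightarrow> 'c"
  assumes s_smult: "r \<in> carrier R \<Longrightarrow> x \<in> carrier L \<Longrightarrow> s (r \<odot>\<^bsub>L\<^esub> x) = r \<odot>\<^bsub>L\<^esub> s x"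
    and e: "bij_betw e {..<l} \<Gamma>"
    and \<tau>_e: "j < l \<Longrightarrow> x \<in> carrier L \<Longrightarrow> \<tau> (e j) x = (s ^^ j) x"
    and \<tau>_\<gamma>: "x \<in> carrier L \<Longrightarrow> \<tau> \<gamma> x = s x"
begin

lemma norm_map_eq: "x \<in> carrier L \<Longrightarrow> norm_map L \<Gamma> \<tau> x = nr x"
proof -
  assume x: "x \<in> carrier L"
  have img: "\<Gamma> = e ` {..<l}" "inj_on e {..<l}" using e by (auto simp: bij_betw_def)
  have "norm_map L \<Gamma> \<tau> x = (\<Oplus>\<^bsub>L\<^esub>j\<in>{..<l}. \<tau> (e j) x)"
    unfolding norm_map_def img(1) using x by (intro M.finsum_reindex img(2)) (auto simp: \<tau>_e sj_closed)
  also have "\<dots> = nr x"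
    unfolding nr_def using x by (intro M.finsum_cong') (auto simp: \<tau>_e sj_closed)
  finally show ?thesis .
qed

lemma diff_map_eq: "x \<in> carrier L \<Longrightarrow> diff_map L \<gamma> \<tau> x = x \<ominus>\<^bsub>L\<^esub> s x"
  by (simp add: diff_map_def \<tau>_\<gamma>)

text \<open>One boundary map for both degrees lets images, lifts and averages be handled uniformly
  in \<open>i\<close>.\<close>

definition bd :: "nat \<Rightarrow> 'm \<Rightarrow> 'm" where
  "bd i y = (if i = 0 then nr y else y \<ominus>\<^bsub>L\<^esub> s y)"

abbreviation "Z i \<equiv> tate_cocycles i L \<Gamma> \<gamma> \<tau>"
abbreviation "B i \<equiv> tate_boundaries i L \<Gamma> \<gamma> \<tau>"

lemma Z_iff: "x \<in> Z i \<longleftrightarrow> x \<in> carrier L \<and> (if i = 0 then s x = x else nr x = \<zero>\<^bsub>L\<^esub>)"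
proof (cases "x \<in> carrier L")
  case True
  have "x \<ominus>\<^bsub>L\<^esub> s x = \<zero>\<^bsub>L\<^esub> \<longleftrightarrow> s x = x"
  proof
    assume z: "x \<ominus>\<^bsub>L\<^esub> s x = \<zero>\<^bsub>L\<^esub>"
    have "x = (x \<ominus>\<^bsub>L\<^esub> s x) \<oplus>\<^bsub>L\<^esub> s x" using True s_closed by (simp add: M.minus_eq M.a_assoc M.l_neg)
    then show "s x = x" using z True s_closed by simp
  qed (use True in \<open>simp add: M.minus_eq M.r_neg\<close>)
  then show ?thesis using True
    by (simp add: tate_cocycles_def a_kernel_def' norm_map_eq diff_map_eq)
next
  case False
  then show ?thesis by (simp add: tate_cocycles_def a_kernel_def')
qed

lemma B_eq: "B i = bd i ` carrier L"
  by (simp add: tate_boundaries_def bd_def norm_map_eq diff_map_eq cong: image_cong)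

lemma B_eq': "B i = (if i = 0 then nr_boundaries else diff_boundaries)"
  by (simp add: B_eq bd_def nr_boundaries_def diff_boundaries_def)

lemma nr_smult: "r \<in> carrier R \<Longrightarrow> x \<in> carrier L \<Longrightarrow> nr (r \<odot>\<^bsub>L\<^esub> x) = r \<odot>\<^bsub>L\<^esub> nr x"
proof -
  assume r: "r \<in> carrier R" and x: "x \<in> carrier L"
  have "(s ^^ j) (r \<odot>\<^bsub>L\<^esub> x) = r \<odot>\<^bsub>L\<^esub> (s ^^ j) x" for j
    by (induction j) (simp_all add: s_smult r x sj_closed)
  then have "nr (r \<odot>\<^bsub>L\<^esub> x) = (\<Oplus>\<^bsub>L\<^esub>j\<in>{..<l}. r \<odot>\<^bsub>L\<^esub> (s ^^ j) x)" by (simp add: nr_def)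
  also have "\<dots> = r \<odot>\<^bsub>L\<^esub> nr x"
    unfolding nr_def by (rule M.additive_finsum[symmetric]) (auto simp: r x sj_closed smult_r_distr)
  finally show ?thesis .
qed

lemma bd_closed: "y \<in> carrier L \<Longrightarrow> bd i y \<in> carrier L"
  by (simp add: bd_def nr_closed s_closed)

lemma bd_smult: "r \<in> carrier R \<Longrightarrow> y \<in> carrier L \<Longrightarrow> bd i (r \<odot>\<^bsub>L\<^esub> y) = r \<odot>\<^bsub>L\<^esub> bd i y"
  by (simp add: bd_def nr_smult s_smult M.minus_eq s_closed smult_r_distr smult_r_minus)

lemma B_subgroup: "subgroup (B i) (add_monoid L)"
  by (simp add: B_eq' nr_boundaries_subgroup diff_boundaries_subgroup)

lemma B_submodule: "submodule (B i) R L"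
proof (rule submodule_criterion)
  show "B i \<subseteq> carrier L" "\<zero>\<^bsub>L\<^esub> \<in> B i" using subgroup.subset[OF B_subgroup] subgroup.one_closed[OF B_subgroup, of i] by auto
  show "x \<oplus>\<^bsub>L\<^esub> y \<in> B i" if "x \<in> B i" "y \<in> B i" for x y using subgroup.m_closed[OF B_subgroup that] by simp
  show "r \<odot>\<^bsub>L\<^esub> x \<in> B i" if r: "r \<in> carrier R" and x: "x \<in> B i" for r x
  proof -
    obtain y where y: "y \<in> carrier L" "x = bd i y" using x by (auto simp: B_eq)
    then have "r \<odot>\<^bsub>L\<^esub> x = bd i (r \<odot>\<^bsub>L\<^esub> y)" by (simp add: bd_smult r)
    then show ?thesis using r y by (auto simp: B_eq)
  qed
qed

lemma nr_zero: "nr \<zero>\<^bsub>L\<^esub> = \<zero>\<^bsub>L\<^esub>"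
  by (rule M.additive_zero[of nr, OF nr_closed nr_add])

lemma Z_submodule: "submodule (Z i) R L"
proof (rule submodule_criterion)
  show "\<zero>\<^bsub>L\<^esub> \<in> Z i" using M.additive_zero[of s, OF s_closed s_add] nr_zero by (simp add: Z_iff)
qed (auto simp: Z_iff s_add nr_add s_smult nr_smult)

lemma B_subset_Z: "B i \<subseteq> Z i"
proof
  fix x assume "x \<in> B i"
  then obtain y where y: "y \<in> carrier L" "x = bd i y" by (auto simp: B_eq)
  show "x \<in> Z i"
  proof (cases "i = 0")
    case True
    then show ?thesis using y by (simp add: Z_iff bd_def nr_closed nr_s)
  next
    case False
    have "nr (y \<ominus>\<^bsub>L\<^esub> s y) = nr y \<ominus>\<^bsub>L\<^esub> nr (s y)"
      using y s_closed by (intro M.additive_diff[of nr, OF nr_closed nr_add])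
    also have "\<dots> = \<zero>\<^bsub>L\<^esub>" using y nr_closed by (simp add: nr_s M.minus_eq M.r_neg)
    finally show ?thesis using False y by (simp add: Z_iff bd_def s_closed)
  qed
qed

lemma multiple_Z: "x \<in> Z i \<Longrightarrow> [l] \<cdot>\<^bsub>L\<^esub> x \<in> B i"
proof -
  assume x: "x \<in> Z i"
  then have xc: "x \<in> carrier L" by (simp add: Z_iff)
  show ?thesis
  proof (cases "i = 0")
    case True
    then show ?thesis using x multiple_fixed[OF xc] xc by (auto simp: Z_iff B_eq' nr_boundaries_def)
  next
    case False
    then have "[l] \<cdot>\<^bsub>L\<^esub> x \<ominus>\<^bsub>L\<^esub> \<zero>\<^bsub>L\<^esub> \<in> diff_boundaries" using multiple_minus_nr[OF xc] x by (simp add: Z_iff)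
    moreover have "[l] \<cdot>\<^bsub>L\<^esub> x \<ominus>\<^bsub>L\<^esub> \<zero>\<^bsub>L\<^esub> = [l] \<cdot>\<^bsub>L\<^esub> x"
      using xc M.minus_equality[of "\<zero>\<^bsub>L\<^esub>" "\<zero>\<^bsub>L\<^esub>"] M.add.nat_pow_closed[OF xc] by (simp add: M.minus_eq)
    ultimately show ?thesis using False by (simp add: B_eq')
  qed
qed

lemma tate_eq: "tate i L \<Gamma> \<gamma> \<tau> = subquotient L (Z i) (B i)"
  by (simp add: tate_def)

lemmas tate_module = subquotient_module[OF Z_submodule B_submodule B_subset_Z, folded tate_eq]
lemmas tate_carrier = subquotient_carrier[OF Z_submodule B_submodule B_subset_Z, folded tate_eq]
lemmas tate_zero = subquotient_zero[OF Z_submodule B_submodule B_subset_Z, folded tate_eq]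
lemmas tate_add = subquotient_add[OF Z_submodule B_submodule B_subset_Z, folded tate_eq]
lemmas tate_smult = subquotient_smult[OF Z_submodule B_submodule B_subset_Z, folded tate_eq]
lemmas tate_minus = subquotient_minus[OF Z_submodule B_submodule B_subset_Z, folded tate_eq]

text \<open>\<open>l\<close> times a cocycle is a boundary, so a scalar that acts as a multiple of
  \<open>l\<close> on the module acts by zero on its Tate groups. This is what turns them into
  modules over the residue ring.\<close>

lemma tate_killed:
  assumes r: "r \<in> carrier R" "q \<in> carrier R" "\<And>x. x \<in> carrier L \<Longrightarrow> r \<odot>\<^bsub>L\<^esub> x = q \<odot>\<^bsub>L\<^esub> ([l] \<cdot>\<^bsub>L\<^esub> x)"
    and t: "t \<in> carrier (tate i L \<Gamma> \<gamma> \<tau>)"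
  shows "r \<odot>\<^bsub>tate i L \<Gamma> \<gamma> \<tau>\<^esub> t = \<zero>\<^bsub>tate i L \<Gamma> \<gamma> \<tau>\<^esub>"
proof -
  obtain x where x: "x \<in> Z i" "t = B i +>\<^bsub>L\<^esub> x" using t by (auto simp: tate_carrier)
  have xc: "x \<in> carrier L" using x by (simp add: Z_iff)
  have "r \<odot>\<^bsub>L\<^esub> x \<in> B i" using submodule_closed(6)[OF B_submodule r(2) multiple_Z[OF x(1)]] r(3)[OF xc] by simp
  then show ?thesis using x r xc coset_zero_iff[OF B_submodule] by (simp add: tate_smult tate_zero)
qed

end

section \<open>Source, target and natural map in an abstract setting\<close>

locale tate_jacquet = cyclic_module R L s l \<Gamma> \<gamma> \<tau> e
  for R :: "('r, 'x) ring_scheme" and L :: "('r, 'm, 'y) module_scheme" and s :: "'m \<Rightarrow> 'm" and l :: nat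
    and \<Gamma> :: "'c set" and \<gamma> :: 'c and \<tau> :: "'c \<Rightarrow> 'm \<Rightarrow> 'm" and e :: "nat \<Rightarrow> 'c" +
  fixes NF :: "'g set" and a :: "'g \<Rightarrow> 'm \<Rightarrow> 'm" and \<theta> :: "'g \<Rightarrow> 'r" and \<sigma> :: "'g \<Rightarrow> 'g" and I :: "'r set" and i :: nat
  assumes a_closed: "n \<in> NF \<Longrightarrow> x \<in> carrier L \<Longrightarrow> a n x \<in> carrier L"
    and a_add: "n \<in> NF \<Longrightarrow> x \<in> carrier L \<Longrightarrow> y \<in> carrier L \<Longrightarrow> a n (x \<oplus>\<^bsub>L\<^esub> y) = a n x \<oplus>\<^bsub>L\<^esub> a n y"
    and s_a: "n \<in> NF \<Longrightarrow> x \<in> carrier L \<Longrightarrow> s (a n x) = a (\<sigma> n) (s x)"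
    and \<sigma>_NF: "n \<in> NF \<Longrightarrow> \<sigma> n \<in> NF"
    and \<theta>: "n \<in> NF \<Longrightarrow> \<theta> n \<in> carrier R" "n \<in> NF \<Longrightarrow> \<theta> (\<sigma> n) = \<theta> n"
    and I: "ideal I R" "r \<in> I \<Longrightarrow> \<exists>q\<in>carrier R. r = q \<otimes>\<^bsub>R\<^esub> ([l] \<cdot>\<^bsub>R\<^esub> \<one>\<^bsub>R\<^esub>)"
begin

abbreviation "KL \<equiv> jacquet_kernel R L NF a \<theta>"
abbreviation "QL \<equiv> jacquet R L NF a \<theta>"
abbreviation "proj x \<equiv> KL +>\<^bsub>L\<^esub> x"

lemma gen_closed: "n \<in> NF \<Longrightarrow> x \<in> carrier L \<Longrightarrow> a n x \<ominus>\<^bsub>L\<^esub> \<theta> n \<odot>\<^bsub>L\<^esub> x \<in> carrier L"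
  by (simp add: a_closed \<theta>)

lemma KL_submodule: "submodule KL R L"
  by (rule jacquet_kernel_submodule(1)) (rule gen_closed)

lemma KL_gen: "n \<in> NF \<Longrightarrow> x \<in> carrier L \<Longrightarrow> a n x \<ominus>\<^bsub>L\<^esub> \<theta> n \<odot>\<^bsub>L\<^esub> x \<in> KL"
  by (rule jacquet_kernel_submodule(2)) (auto intro: gen_closed)

lemma KL_least:
  assumes "submodule W R L" "\<And>n x. n \<in> NF \<Longrightarrow> x \<in> carrier L \<Longrightarrow> a n x \<ominus>\<^bsub>L\<^esub> \<theta> n \<odot>\<^bsub>L\<^esub> x \<in> W"
  shows "KL \<subseteq> W"
  by (rule jacquet_kernel_submodule(3)) (use assms gen_closed in blast)+

lemmas KL_subset = submodule_closed(1)[OF KL_submodule]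

text \<open>\<open>s\<close> sends the generator for \<open>n\<close> and \<open>x\<close> to the
  generator for \<open>\<sigma> n\<close> and \<open>s x\<close>, thanks to the invariance of
  \<theta>. So the preimage of the kernel under \<open>s\<close> is a submodule that contains all
  generators.\<close>

lemma s_KL: "x \<in> KL \<Longrightarrow> s x \<in> KL"
proof -
  have "KL \<subseteq> {x \<in> carrier L. s x \<in> KL}"
  proof (rule KL_least)
    show "submodule {x \<in> carrier L. s x \<in> KL} R L"
      by (rule submodule_criterion)
        (auto simp: s_add s_smult submodule_closed[OF KL_submodule] M.additive_zero[of s, OF s_closed s_add])
    fix n x assume n: "n \<in> NF" and x: "x \<in> carrier L"
    have "s (a n x \<ominus>\<^bsub>L\<^esub> \<theta> n \<odot>\<^bsub>L\<^esub> x) = a (\<sigma> n) (s x) \<ominus>\<^bsub>L\<^esub> \<theta> (\<sigma> n) \<odot>\<^bsub>L\<^esub> s x"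
      using n x by (simp add: s_diff a_closed \<theta> s_smult s_a)
    also have "\<dots> \<in> KL" by (rule KL_gen[OF \<sigma>_NF[OF n] s_closed[OF x]])
    finally show "a n x \<ominus>\<^bsub>L\<^esub> \<theta> n \<odot>\<^bsub>L\<^esub> x \<in> {x \<in> carrier L. s x \<in> KL}" using gen_closed[OF n x] by simp
  qed
  then show "x \<in> KL \<Longrightarrow> s x \<in> KL" by blast
qed

lemma sj_KL: "x \<in> KL \<Longrightarrow> (s ^^ j) x \<in> KL"
  by (induction j) (auto simp: s_KL)

lemma QL_eq: "QL = subquotient L (carrier L) KL"
  by (simp add: jacquet_def)

lemmas QL_module = subquotient_module[OF carrier_is_submodule KL_submodule KL_subset, folded QL_eq]
lemmas QL_carrier = subquotient_carrier[OF carrier_is_submodule KL_submodule KL_subset, folded QL_eq]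
lemmas QL_zero = subquotient_zero[OF carrier_is_submodule KL_submodule KL_subset, folded QL_eq]
lemmas QL_add = subquotient_add[OF carrier_is_submodule KL_submodule KL_subset, folded QL_eq]
lemmas QL_smult = subquotient_smult[OF carrier_is_submodule KL_submodule KL_subset, folded QL_eq]
lemmas QL_minus = subquotient_minus[OF carrier_is_submodule KL_submodule KL_subset, folded QL_eq]
lemmas QL_finsum = subquotient_finsum[OF carrier_is_submodule KL_submodule KL_subset, folded QL_eq]

definition s' :: "'m set \<Rightarrow> 'm set" where "s' = descend (\<lambda>x. proj (s x))"
definition \<tau>' :: "'c \<Rightarrow> 'm set \<Rightarrow> 'm set" where "\<tau>' g = descend (\<lambda>x. proj (\<tau> g x))"

lemma proj_sj_cong:
  assumes "x \<in> carrier L" "y \<in> carrier L" "y \<ominus>\<^bsub>L\<^esub> x \<in> KL"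
  shows "proj ((s ^^ j) y) = proj ((s ^^ j) x)"
proof -
  have "(s ^^ j) y \<ominus>\<^bsub>L\<^esub> (s ^^ j) x = (s ^^ j) (y \<ominus>\<^bsub>L\<^esub> x)"
    using M.additive_diff[of "s ^^ j", OF sj_closed sj_add assms(2,1)] by simp
  then show ?thesis using coset_eq_iff[OF KL_submodule] sj_closed assms sj_KL by simp
qed

lemma s'_proj: "x \<in> carrier L \<Longrightarrow> s' (proj x) = proj (s x)"
  unfolding s'_def by (rule descend_coset[OF KL_submodule]) (use proj_sj_cong[of _ _ 1] in auto)

lemma s'j_proj: "x \<in> carrier L \<Longrightarrow> (s' ^^ j) (proj x) = proj ((s ^^ j) x)"
  by (induction j) (simp_all add: s'_proj sj_closed)

lemma \<tau>'_proj:
  assumes x: "x \<in> carrier L"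
  shows "j < l \<Longrightarrow> \<tau>' (e j) (proj x) = proj ((s ^^ j) x)" and "\<tau>' \<gamma> (proj x) = proj (s x)"
proof -
  have d: "\<tau>' g (proj x) = proj ((s ^^ k) x)" if g: "\<And>y. y \<in> carrier L \<Longrightarrow> \<tau> g y = (s ^^ k) y" for g k
  proof -
    have "descend (\<lambda>x. proj (\<tau> g x)) (proj x) = proj (\<tau> g x)"
    proof (rule descend_coset[OF KL_submodule x])
      fix y assume "y \<in> carrier L" "y \<ominus>\<^bsub>L\<^esub> x \<in> KL"
      then show "proj (\<tau> g y) = proj (\<tau> g x)" using proj_sj_cong[OF x, of y k] g x by simp
    qed
    then show ?thesis using g[OF x] by (simp add: \<tau>'_def)
  qed
  show "j < l \<Longrightarrow> \<tau>' (e j) (proj x) = proj ((s ^^ j) x)" by (rule d) (simp add: \<tau>_e)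
  show "\<tau>' \<gamma> (proj x) = proj (s x)" using d[of \<gamma> 1] \<tau>_\<gamma> by simp
qed

lemma QLE:
  assumes "q \<in> carrier QL"
  obtains x where "x \<in> carrier L" "q = proj x"
  using assms by (auto simp: QL_carrier)

lemma proj_carrier: "x \<in> carrier L \<Longrightarrow> proj x \<in> carrier QL"
  by (auto simp: QL_carrier)

text \<open>The quotient inherits the cyclic structure, which makes all facts on Tate groups
  available for the target as well.\<close>

sublocale Q: cyclic_module R QL s' l \<Gamma> \<gamma> \<tau>' e
proof -
  interpret QM: module R QL by (rule QL_module)
  show "cyclic_module R QL s' l \<Gamma> \<gamma> \<tau>' e"
  proof unfold_locales
    fix y assume "y \<in> carrier QL"
    then obtain x where x: "x \<in> carrier L" "y = proj x" by (rule QLE)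
    show "s' y \<in> carrier QL" using x by (simp add: s'_proj proj_carrier s_closed)
    show "(s' ^^ l) y = y" using x by (simp add: s'j_proj s_pow)
    show "\<tau>' \<gamma> y = s' y" using x by (simp add: s'_proj \<tau>'_proj)
    show "\<tau>' (e j) y = (s' ^^ j) y" if "j < l" for j using x that by (simp add: s'j_proj \<tau>'_proj)
    show "s' (r \<odot>\<^bsub>QL\<^esub> y) = r \<odot>\<^bsub>QL\<^esub> s' y" if "r \<in> carrier R" for r
      using x that by (simp add: QL_smult s'_proj s_closed s_smult)
    fix z assume "z \<in> carrier QL"
    then obtain w where w: "w \<in> carrier L" "z = proj w" by (rule QLE)
    show "s' (y \<oplus>\<^bsub>QL\<^esub> z) = s' y \<oplus>\<^bsub>QL\<^esub> s' z"
      using x w by (simp add: QL_add s'_proj s_closed s_add)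
  qed (use l0 e in auto)
qed

lemma bd_proj: "x \<in> carrier L \<Longrightarrow> Q.bd i (proj x) = proj (bd i x)"
proof -
  assume x: "x \<in> carrier L"
  have "Q.nr (proj x) = (\<Oplus>\<^bsub>QL\<^esub>j\<in>{..<l}. proj ((s ^^ j) x))" using x by (simp add: Q.nr_def s'j_proj)
  also have "\<dots> = proj (nr x)" unfolding nr_def using QL_finsum[of "{..<l}" "\<lambda>j. (s ^^ j) x"] sj_closed[OF x] by simp
  finally show ?thesis using x by (simp add: Q.bd_def bd_def s'_proj QL_minus s_closed)
qed

abbreviation "NS \<equiv> {n \<in> NF. \<sigma> n = n}"
abbreviation "T \<equiv> tate i L \<Gamma> \<gamma> \<tau>"
abbreviation "T' \<equiv> tate i QL \<Gamma> \<gamma> \<tau>'"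
abbreviation "Rbar \<equiv> R Quot I"
abbreviation "cl x \<equiv> B i +>\<^bsub>L\<^esub> x"
abbreviation "cl' q \<equiv> Q.B i +>\<^bsub>QL\<^esub> q"

definition act :: "'g \<Rightarrow> 'm set \<Rightarrow> 'm set" where "act n = descend (\<lambda>x. cl (a n x))"
definition tf :: "'m set \<Rightarrow> 'm set set" where "tf = descend (\<lambda>x. cl' (proj x))"

abbreviation "K0 \<equiv> jacquet_kernel Rbar (residual_module T) NS act (\<lambda>n. I +>\<^bsub>R\<^esub> \<theta> n)"
abbreviation "JT \<equiv> jacquet Rbar (residual_module T) NS act (\<lambda>n. I +>\<^bsub>R\<^esub> \<theta> n)"

lemma Z_carrier: "x \<in> Z i \<Longrightarrow> x \<in> carrier L"
  by (simp add: Z_iff)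

lemma proj_Z: "x \<in> Z i \<Longrightarrow> proj x \<in> Q.Z i"
proof -
  assume x: "x \<in> Z i"
  have "Q.nr (proj x) = proj (nr x)" if "i \<noteq> 0" using bd_proj[OF Z_carrier[OF x]]
  proof -
    have "Q.nr (proj x) = (\<Oplus>\<^bsub>QL\<^esub>j\<in>{..<l}. proj ((s ^^ j) x))" using Z_carrier[OF x] by (simp add: Q.nr_def s'j_proj)
    then show ?thesis unfolding nr_def using QL_finsum[of "{..<l}" "\<lambda>j. (s ^^ j) x"] sj_closed[OF Z_carrier[OF x]] by simp
  qed
  moreover have "proj \<zero>\<^bsub>L\<^esub> = KL" using coset_zero_iff[OF KL_submodule] submodule_closed(2)[OF KL_submodule] by simp
  ultimately show ?thesis using x by (auto simp: Z_iff Q.Z_iff proj_carrier s'_proj QL_zero split: if_splits)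
qed

lemma proj_B: "x \<in> B i \<Longrightarrow> proj x \<in> Q.B i"
  using bd_proj by (auto simp: B_eq Q.B_eq proj_carrier intro!: rev_image_eqI[of "proj _"])

lemma tf_cl: "x \<in> Z i \<Longrightarrow> tf (cl x) = cl' (proj x)"
  unfolding tf_def
proof (rule descend_coset[OF B_submodule Z_carrier], assumption)
  fix y assume x: "x \<in> Z i" and y: "y \<in> carrier L" "y \<ominus>\<^bsub>L\<^esub> x \<in> B i"
  have "proj y \<ominus>\<^bsub>QL\<^esub> proj x \<in> Q.B i" using proj_B[OF y(2)] y Z_carrier[OF x] by (simp add: QL_minus)
  then show "cl' (proj y) = cl' (proj x)"
    using Q.coset_eq_iff[OF Q.B_submodule] proj_carrier y Z_carrier[OF x] by simp
qed

lemma TE: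
  assumes "t \<in> carrier T"
  obtains x where "x \<in> Z i" "t = cl x"
  using assms by (auto simp: tate_carrier)

lemma cl_carrier: "x \<in> Z i \<Longrightarrow> cl x \<in> carrier T"
  by (auto simp: tate_carrier)

lemma a_minus: "n \<in> NF \<Longrightarrow> x \<in> carrier L \<Longrightarrow> y \<in> carrier L \<Longrightarrow> a n (x \<ominus>\<^bsub>L\<^esub> y) = a n x \<ominus>\<^bsub>L\<^esub> a n y"
  by (rule M.additive_diff[of "a n", OF a_closed a_add])

lemma a_bd:
  assumes n: "n \<in> NS" and x: "x \<in> carrier L"
  shows "bd k (a n x) = a n (bd k x)"
proof -
  have nF: "n \<in> NF" "\<sigma> n = n" using n by auto
  have sa: "s (a n y) = a n (s y)" if "y \<in> carrier L" for y using s_a[OF nF(1) that] nF(2) by simp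
  have "(s ^^ j) (a n x) = a n ((s ^^ j) x)" for j by (induction j) (simp_all add: sa sj_closed x)
  then have "nr (a n x) = (\<Oplus>\<^bsub>L\<^esub>j\<in>{..<l}. a n ((s ^^ j) x))" by (simp add: nr_def)
  also have "\<dots> = a n (nr x)" unfolding nr_def
    by (rule M.additive_finsum[of "a n", OF a_closed[OF nF(1)] a_add[OF nF(1)], symmetric]) (auto simp: sj_closed x)
  finally show ?thesis using x nF by (simp add: bd_def sa a_minus s_closed)
qed

lemma a_Z:
  assumes n: "n \<in> NS" and x: "x \<in> Z i"
  shows "a n x \<in> Z i"
proof -
  have nF: "n \<in> NF" "\<sigma> n = n" using n by auto
  have z: "a n \<zero>\<^bsub>L\<^esub> = \<zero>\<^bsub>L\<^esub>" by (rule M.additive_zero[of "a n", OF a_closed[OF nF(1)] a_add[OF nF(1)]])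
  show ?thesis
    using x a_closed[OF nF(1) Z_carrier[OF x]] a_bd[OF n Z_carrier[OF x], of 0] s_a[OF nF(1) Z_carrier[OF x]] nF(2) z
    by (auto simp: Z_iff bd_def split: if_splits)
qed

lemma a_B: "n \<in> NS \<Longrightarrow> x \<in> B i \<Longrightarrow> a n x \<in> B i"
proof -
  assume n: "n \<in> NS" and "x \<in> B i"
  then obtain y where y: "y \<in> carrier L" "x = bd i y" by (auto simp: B_eq)
  then have "a n x = bd i (a n y)" using a_bd[OF n y(1)] by simp
  then show "a n x \<in> B i" using a_closed y n by (auto simp: B_eq)
qed

lemma act_cl: "n \<in> NS \<Longrightarrow> x \<in> Z i \<Longrightarrow> act n (cl x) = cl (a n x)"
  unfolding act_def
proof (rule descend_coset[OF B_submodule Z_carrier], assumption)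
  fix y assume n: "n \<in> NS" and x: "x \<in> Z i" and y: "y \<in> carrier L" "y \<ominus>\<^bsub>L\<^esub> x \<in> B i"
  have nF: "n \<in> NF" using n by simp
  have "a n y \<ominus>\<^bsub>L\<^esub> a n x \<in> B i" using a_B[OF n y(2)] a_minus[OF nF y(1) Z_carrier[OF x]] by simp
  then show "cl (a n y) = cl (a n x)"
    using coset_eq_iff[OF B_submodule] a_closed[OF nF] y Z_carrier[OF x] by simp
qed

lemma l_smult:
  assumes "Module.module R V" "x \<in> carrier V"
  shows "([l] \<cdot>\<^bsub>R\<^esub> \<one>\<^bsub>R\<^esub>) \<odot>\<^bsub>V\<^esub> x = [l] \<cdot>\<^bsub>V\<^esub> x"
proof -
  interpret V: module R V by fact
  have "add_pow R k \<one>\<^bsub>R\<^esub> \<odot>\<^bsub>V\<^esub> x = add_pow V k x" for k :: nat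
  proof (induction k)
    case (Suc k)
    have "add_pow R (Suc k) \<one>\<^bsub>R\<^esub> = add_pow R k \<one>\<^bsub>R\<^esub> \<oplus>\<^bsub>R\<^esub> \<one>\<^bsub>R\<^esub>" by (simp add: add_pow_def)
    moreover have "add_pow V (Suc k) x = add_pow V k x \<oplus>\<^bsub>V\<^esub> x" by (simp add: add_pow_def)
    ultimately show ?case using Suc assms(2) by (simp add: V.smult_l_distr)
  qed (use assms(2) in \<open>simp add: add_pow_def\<close>)
  then show ?thesis .
qed

lemma I_killsL: "r \<in> I \<Longrightarrow> \<exists>q\<in>carrier R. \<forall>x\<in>carrier L. r \<odot>\<^bsub>L\<^esub> x = q \<odot>\<^bsub>L\<^esub> ([l] \<cdot>\<^bsub>L\<^esub> x)"
  using I(2)[of r] l_smult[OF module_axioms] smult_assoc1 by fastforce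

lemma I_killsQ: "r \<in> I \<Longrightarrow> \<exists>q\<in>carrier R. \<forall>x\<in>carrier QL. r \<odot>\<^bsub>QL\<^esub> x = q \<odot>\<^bsub>QL\<^esub> ([l] \<cdot>\<^bsub>QL\<^esub> x)"
  using I(2)[of r] l_smult[OF QL_module] Q.smult_assoc1 by fastforce

lemma I_carrier: "r \<in> I \<Longrightarrow> r \<in> carrier R"
  using I(1) ideal.Icarr by metis

lemma kill_T: "r \<in> I \<Longrightarrow> t \<in> carrier T \<Longrightarrow> r \<odot>\<^bsub>T\<^esub> t = \<zero>\<^bsub>T\<^esub>"
  using I_killsL[of r] tate_killed[OF I_carrier] by blast

lemma kill_T': "r \<in> I \<Longrightarrow> t \<in> carrier T' \<Longrightarrow> r \<odot>\<^bsub>T'\<^esub> t = \<zero>\<^bsub>T'\<^esub>"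
  using I_killsQ[of r] Q.tate_killed[OF I_carrier] by blast

lemma RT_module: "Module.module Rbar (residual_module T)"
  by (rule module.residual_is_module[OF tate_module I(1)]) (rule kill_T)

lemma RT_smult: "r \<in> carrier R \<Longrightarrow> t \<in> carrier T \<Longrightarrow> (I +>\<^bsub>R\<^esub> r) \<odot>\<^bsub>residual_module T\<^esub> t = r \<odot>\<^bsub>T\<^esub> t"
  by (rule module.residual_smult[OF tate_module I(1)]) (simp_all add: kill_T)

lemma RT'_smult: "r \<in> carrier R \<Longrightarrow> t \<in> carrier T' \<Longrightarrow> (I +>\<^bsub>R\<^esub> r) \<odot>\<^bsub>residual_module T'\<^esub> t = r \<odot>\<^bsub>T'\<^esub> t"
  by (rule module.residual_smult[OF Q.tate_module I(1)]) (simp_all add: kill_T')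

lemma residual_simps:
  "carrier (residual_module V) = carrier V" "x \<oplus>\<^bsub>residual_module V\<^esub> y = x \<oplus>\<^bsub>V\<^esub> y"
  "\<zero>\<^bsub>residual_module V\<^esub> = \<zero>\<^bsub>V\<^esub>" "x \<ominus>\<^bsub>residual_module V\<^esub> y = x \<ominus>\<^bsub>V\<^esub> y"
  by (simp_all add: residual_module_def a_minus_def a_inv_def m_inv_def)

lemma RbarE:
  assumes "C \<in> carrier Rbar"
  obtains r where "r \<in> carrier R" "C = I +>\<^bsub>R\<^esub> r"
  using assms by (auto simp: FactRing_def A_RCOSETS_def')

lemma Rbar_I: "r \<in> carrier R \<Longrightarrow> I +>\<^bsub>R\<^esub> r \<in> carrier Rbar"
  by (auto simp: FactRing_def A_RCOSETS_def')

lemma act_gen: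
  assumes n: "n \<in> NS" and x: "x \<in> Z i"
  shows "act n (cl x) \<ominus>\<^bsub>residual_module T\<^esub> (I +>\<^bsub>R\<^esub> \<theta> n) \<odot>\<^bsub>residual_module T\<^esub> cl x
    = cl (a n x \<ominus>\<^bsub>L\<^esub> \<theta> n \<odot>\<^bsub>L\<^esub> x)" "a n x \<ominus>\<^bsub>L\<^esub> \<theta> n \<odot>\<^bsub>L\<^esub> x \<in> Z i"
proof -
  have \<theta>x: "\<theta> n \<odot>\<^bsub>L\<^esub> x \<in> Z i" using submodule_closed(6)[OF Z_submodule _ x] \<theta> n by simp
  show "a n x \<ominus>\<^bsub>L\<^esub> \<theta> n \<odot>\<^bsub>L\<^esub> x \<in> Z i" by (rule submodule_closed(5)[OF Z_submodule a_Z[OF n x] \<theta>x])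
  show "act n (cl x) \<ominus>\<^bsub>residual_module T\<^esub> (I +>\<^bsub>R\<^esub> \<theta> n) \<odot>\<^bsub>residual_module T\<^esub> cl x
    = cl (a n x \<ominus>\<^bsub>L\<^esub> \<theta> n \<odot>\<^bsub>L\<^esub> x)"
    using n \<theta> by (simp add: residual_simps act_cl x RT_smult cl_carrier tate_smult tate_minus a_Z \<theta>x)
qed

lemma act_gen_closed:
  "n \<in> NS \<Longrightarrow> t \<in> carrier (residual_module T) \<Longrightarrow>
    act n t \<ominus>\<^bsub>residual_module T\<^esub> (I +>\<^bsub>R\<^esub> \<theta> n) \<odot>\<^bsub>residual_module T\<^esub> t \<in> carrier (residual_module T)"
  unfolding residual_simps(1) by (erule TE) (simp only: act_gen cl_carrier)

lemma K0_submodule: "submodule K0 Rbar (residual_module T)"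
  by (rule module.jacquet_kernel_submodule(1)[OF RT_module]) (rule act_gen_closed)

lemma K0_gen:
  "n \<in> NS \<Longrightarrow> t \<in> carrier (residual_module T) \<Longrightarrow>
    act n t \<ominus>\<^bsub>residual_module T\<^esub> (I +>\<^bsub>R\<^esub> \<theta> n) \<odot>\<^bsub>residual_module T\<^esub> t \<in> K0"
  by (rule module.jacquet_kernel_submodule(2)[OF RT_module, where N = NS and \<pi> = act]) (rule act_gen_closed)

lemma K0_least:
  assumes "submodule W Rbar (residual_module T)"
    "\<And>n t. n \<in> NS \<Longrightarrow> t \<in> carrier (residual_module T) \<Longrightarrow>
      act n t \<ominus>\<^bsub>residual_module T\<^esub> (I +>\<^bsub>R\<^esub> \<theta> n) \<odot>\<^bsub>residual_module T\<^esub> t \<in> W"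
  shows "K0 \<subseteq> W"
proof (rule module.jacquet_kernel_submodule(3)[OF RT_module])
  show "\<And>n t. n \<in> NS \<Longrightarrow> t \<in> carrier (residual_module T) \<Longrightarrow>
    act n t \<ominus>\<^bsub>residual_module T\<^esub> (I +>\<^bsub>R\<^esub> \<theta> n) \<odot>\<^bsub>residual_module T\<^esub> t \<in> carrier (residual_module T)"
    by (rule act_gen_closed)
qed (fact assms)+

lemmas K0_closed = module.submodule_closed[OF RT_module K0_submodule, unfolded residual_simps]

lemma tf_closed: "t \<in> carrier T \<Longrightarrow> tf t \<in> carrier T'"
  by (erule TE) (auto simp: tf_cl Q.tate_carrier proj_Z)

lemma tf_add: "t \<in> carrier T \<Longrightarrow> u \<in> carrier T \<Longrightarrow> tf (t \<oplus>\<^bsub>T\<^esub> u) = tf t \<oplus>\<^bsub>T'\<^esub> tf u"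
  by (elim TE) (simp add: tf_cl tate_add Q.tate_add proj_Z submodule_closed(3)[OF Z_submodule] QL_add Z_carrier)

lemma tf_smult: "r \<in> carrier R \<Longrightarrow> t \<in> carrier T \<Longrightarrow> tf (r \<odot>\<^bsub>T\<^esub> t) = r \<odot>\<^bsub>T'\<^esub> tf t"
  by (elim TE) (simp add: tf_cl tate_smult Q.tate_smult proj_Z submodule_closed(6)[OF Z_submodule] QL_smult Z_carrier)

lemma tf_zero_iff: "x \<in> Z i \<Longrightarrow> tf (cl x) = \<zero>\<^bsub>T'\<^esub> \<longleftrightarrow> proj x \<in> Q.B i"
  using Q.coset_zero_iff[OF Q.B_submodule proj_carrier[OF Z_carrier]] by (simp add: tf_cl Q.tate_zero)

lemma tf_residual_smult:
  "C \<in> carrier Rbar \<Longrightarrow> t \<in> carrier T \<Longrightarrow> tf (C \<odot>\<^bsub>residual_module T\<^esub> t) = C \<odot>\<^bsub>residual_module T'\<^esub> tf t"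
  by (erule RbarE) (simp add: RT_smult RT'_smult tf_smult tf_closed)

text \<open>Generators of \<open>K0\<close> are classes of generators of \<open>KL\<close>, which
  the projection kills. This is the factorization of the functorial map through the Jacquet
  module.\<close>

lemma tf_K0: "t \<in> K0 \<Longrightarrow> t \<in> carrier T \<and> tf t = \<zero>\<^bsub>T'\<^esub>"
proof -
  interpret RT: module Rbar "residual_module T" by (rule RT_module)
  interpret Tm: module R T by (rule tate_module)
  interpret Tm': module R T' by (rule Q.tate_module)
  have z: "tf \<zero>\<^bsub>T\<^esub> = \<zero>\<^bsub>T'\<^esub>"
  proof -
    have "tf \<zero>\<^bsub>T\<^esub> \<oplus>\<^bsub>T'\<^esub> tf \<zero>\<^bsub>T\<^esub> = tf \<zero>\<^bsub>T\<^esub>" using tf_add[of "\<zero>\<^bsub>T\<^esub>" "\<zero>\<^bsub>T\<^esub>"] by simp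
    then show ?thesis using tf_closed[of "\<zero>\<^bsub>T\<^esub>"] by simp
  qed
  have "K0 \<subseteq> {t \<in> carrier T. tf t = \<zero>\<^bsub>T'\<^esub>}"
  proof (rule K0_least)
    show "submodule {t \<in> carrier T. tf t = \<zero>\<^bsub>T'\<^esub>} Rbar (residual_module T)"
    proof (rule RT.submodule_criterion, unfold residual_simps)
      fix C t assume C: "C \<in> carrier Rbar" and t: "t \<in> {t \<in> carrier T. tf t = \<zero>\<^bsub>T'\<^esub>}"
      obtain r where r: "r \<in> carrier R" "C = I +>\<^bsub>R\<^esub> r" using C by (rule RbarE)
      show "C \<odot>\<^bsub>residual_module T\<^esub> t \<in> {t \<in> carrier T. tf t = \<zero>\<^bsub>T'\<^esub>}"
        using r t by (simp add: RT_smult tf_smult)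
    qed (use z in \<open>auto simp: tf_add\<close>)
    fix n t assume n: "n \<in> NS" and t: "t \<in> carrier (residual_module T)"
    then obtain x where x: "x \<in> Z i" "t = cl x" unfolding residual_simps by (elim TE)
    have nF: "n \<in> NF" using n by simp
    have "proj (a n x \<ominus>\<^bsub>L\<^esub> \<theta> n \<odot>\<^bsub>L\<^esub> x) = \<zero>\<^bsub>QL\<^esub>"
      using KL_gen[OF nF Z_carrier[OF x(1)]] gen_closed[OF nF Z_carrier[OF x(1)]]
      by (simp add: QL_zero coset_zero_iff[OF KL_submodule])
    then have "tf (cl (a n x \<ominus>\<^bsub>L\<^esub> \<theta> n \<odot>\<^bsub>L\<^esub> x)) = \<zero>\<^bsub>T'\<^esub>"
      using tf_zero_iff[OF act_gen(2)[OF n x(1)]] Q.submodule_closed(2)[OF Q.B_submodule] by simp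
    then show "act n t \<ominus>\<^bsub>residual_module T\<^esub> (I +>\<^bsub>R\<^esub> \<theta> n) \<odot>\<^bsub>residual_module T\<^esub> t \<in> {t \<in> carrier T. tf t = \<zero>\<^bsub>T'\<^esub>}"
      unfolding x(2) act_gen(1)[OF n x(1)] using cl_carrier[OF act_gen(2)[OF n x(1)]] by simp
  qed
  then show "t \<in> K0 \<Longrightarrow> t \<in> carrier T \<and> tf t = \<zero>\<^bsub>T'\<^esub>" by blast
qed

lemma K0_subset: "K0 \<subseteq> carrier (residual_module T)"
  using tf_K0 by (auto simp: residual_simps)

lemma JT_eq: "JT = subquotient (residual_module T) (carrier (residual_module T)) K0"
  by (simp add: jacquet_def)

lemma natural_map_coset:
  assumes t: "t \<in> carrier T"
  shows "descend tf (K0 +>\<^bsub>residual_module T\<^esub> t) = tf t"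
proof (rule module.descend_coset[OF RT_module K0_submodule], unfold residual_simps)
  interpret Tm: module R T by (rule tate_module)
  interpret Tm': module R T' by (rule Q.tate_module)
  fix u assume u: "u \<in> carrier T" "u \<ominus>\<^bsub>T\<^esub> t \<in> K0"
  have "tf u = tf ((u \<ominus>\<^bsub>T\<^esub> t) \<oplus>\<^bsub>T\<^esub> t)" using u t by (simp add: Tm.M.minus_eq Tm.M.a_assoc Tm.M.l_neg)
  also have "\<dots> = tf (u \<ominus>\<^bsub>T\<^esub> t) \<oplus>\<^bsub>T'\<^esub> tf t" using u t by (intro tf_add) auto
  finally show "tf u = tf t" using tf_K0[OF u(2)] tf_closed[OF t] by simp
qed (rule t)

lemmas JT_carrier = module.subquotient_carrier[OF RT_module module.carrier_is_submodule[OF RT_module] K0_submodule K0_subset, folded JT_eq, unfolded residual_simps]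
lemmas JT_add = module.subquotient_add[OF RT_module module.carrier_is_submodule[OF RT_module] K0_submodule K0_subset, folded JT_eq, unfolded residual_simps]
lemmas JT_smult = module.subquotient_smult[OF RT_module module.carrier_is_submodule[OF RT_module] K0_submodule K0_subset, folded JT_eq, unfolded residual_simps]

theorem natural_map_hom: "descend tf \<in> module_homs Rbar JT (residual_module T')"
proof -
  interpret Tm: module R T by (rule tate_module)
  interpret RT: module Rbar "residual_module T" by (rule RT_module)
  have sm: "C \<odot>\<^bsub>residual_module T\<^esub> t \<in> carrier T" if "C \<in> carrier Rbar" "t \<in> carrier T" for C t
    using RT.smult_closed[unfolded residual_simps] that by blast
  show ?thesis
    unfolding module_homs_def hom_def
    by (auto simp: JT_carrier JT_add JT_smult natural_map_coset residual_simps tf_closed tf_add tf_residual_smult sm)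
qed

text \<open>If a class becomes zero in the target, its projection is a boundary; a lift
  \<open>w\<close> of the element bounding it leaves x - bd w in \<open>KL\<close>. The premise
  \<open>core\<close> isolates what then remains to be shown.\<close>

theorem natural_map_inj:
  assumes core: "\<And>x w. x \<in> Z i \<Longrightarrow> w \<in> carrier L \<Longrightarrow> x \<ominus>\<^bsub>L\<^esub> bd i w \<in> KL \<Longrightarrow> cl x \<in> K0"
  shows "inj_on (descend tf) (carrier JT)"
proof (rule inj_onI)
  interpret Tm: module R T by (rule tate_module)
  interpret Tm': module R T' by (rule Q.tate_module)
  fix c d assume "c \<in> carrier JT" "d \<in> carrier JT" and eq: "descend tf c = descend tf d"
  then obtain t u where t: "t \<in> carrier T" "c = K0 +>\<^bsub>residual_module T\<^esub> t"
    and u: "u \<in> carrier T" "d = K0 +>\<^bsub>residual_module T\<^esub> u" by (auto simp: JT_carrier)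
  have tu: "t \<ominus>\<^bsub>T\<^esub> u \<in> carrier T" using t u by simp
  have "tf (t \<ominus>\<^bsub>T\<^esub> u) \<oplus>\<^bsub>T'\<^esub> tf u = tf t"
    using tf_add[OF tu u(1)] t u by (simp add: Tm.M.minus_eq Tm.M.a_assoc Tm.M.l_neg)
  also have "tf t = tf u" using eq t u by (simp add: natural_map_coset)
  finally have z: "tf (t \<ominus>\<^bsub>T\<^esub> u) = \<zero>\<^bsub>T'\<^esub>" using tf_closed[OF tu] tf_closed[OF u(1)] by simp
  obtain x where x: "x \<in> Z i" "t \<ominus>\<^bsub>T\<^esub> u = cl x" using tu by (rule TE)
  have "proj x \<in> Q.B i" using z tf_zero_iff[OF x(1)] x(2) by simp
  then obtain q where "q \<in> carrier QL" "proj x = Q.bd i q" by (auto simp: Q.B_eq)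
  then obtain w where w: "w \<in> carrier L" "proj x = Q.bd i (proj w)" by (auto elim: QLE)
  then have "proj x = proj (bd i w)" by (simp add: bd_proj)
  then have "x \<ominus>\<^bsub>L\<^esub> bd i w \<in> KL" using coset_eq_iff[OF KL_submodule Z_carrier[OF x(1)] bd_closed[OF w(1)]] by simp
  then have "t \<ominus>\<^bsub>T\<^esub> u \<in> K0" using core[OF x(1) w(1)] x(2) by simp
  then show "c = d"
    using module.coset_eq_iff[OF RT_module K0_submodule, unfolded residual_simps] t u by simp
qed

text \<open>Working modulo this submodule of \<open>L\<close> replaces computations in the Jacquet
  module of the Tate group by computations with cocycles.\<close>

definition preK0 :: "'m set" where "preK0 = {x \<in> Z i. cl x \<in> K0}"

lemma preK0_submodule: "submodule preK0 R L"
proof (rule submodule_criterion)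
  show "preK0 \<subseteq> carrier L" using Z_carrier by (auto simp: preK0_def)
  show "\<zero>\<^bsub>L\<^esub> \<in> preK0"
    using submodule_closed(2)[OF Z_submodule] submodule_closed(2)[OF B_submodule] coset_zero_iff[OF B_submodule, of "\<zero>\<^bsub>L\<^esub>" i]
      K0_closed(2) by (simp add: preK0_def tate_zero)
  show "x \<oplus>\<^bsub>L\<^esub> y \<in> preK0" if "x \<in> preK0" "y \<in> preK0" for x y
    using that K0_closed(3)[of "cl x" "cl y"] submodule_closed(3)[OF Z_submodule]
    by (simp add: preK0_def tate_add)
  show "r \<odot>\<^bsub>L\<^esub> x \<in> preK0" if "r \<in> carrier R" "x \<in> preK0" for r x
    using that K0_closed(6)[OF Rbar_I[OF that(1)], of "cl x"] submodule_closed(6)[OF Z_submodule]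
    by (simp add: preK0_def RT_smult cl_carrier tate_smult)
qed

lemma B_preK0: "B i \<subseteq> preK0"
proof
  fix x assume x: "x \<in> B i"
  then have "x \<in> Z i" using B_subset_Z by blast
  moreover have "cl x = B i" using coset_zero_iff[OF B_submodule] x Z_carrier[OF \<open>x \<in> Z i\<close>] by simp
  ultimately show "x \<in> preK0" using K0_closed(2) by (simp add: preK0_def tate_zero)
qed

lemma gen_preK0: "n \<in> NS \<Longrightarrow> x \<in> Z i \<Longrightarrow> a n x \<ominus>\<^bsub>L\<^esub> \<theta> n \<odot>\<^bsub>L\<^esub> x \<in> preK0"
  using K0_gen[of n "cl x"] act_gen[of n x] cl_carrier[of x] by (simp add: preK0_def residual_simps)

end

context averaging
begin

text \<open>An additive map commuting with \<open>b\<close> passes through the finite sum. It is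
  applied to scalar multiplications, under which vanishing of averages has to be stable.\<close>

lemma E_map:
  assumes f: "\<And>x. x \<in> carrier A \<Longrightarrow> f x \<in> carrier A"
    "\<And>x y. x \<in> carrier A \<Longrightarrow> y \<in> carrier A \<Longrightarrow> f (x \<oplus>\<^bsub>A\<^esub> y) = f x \<oplus>\<^bsub>A\<^esub> f y"
    and fb: "\<And>h x. h \<in> carrier Y \<Longrightarrow> x \<in> carrier A \<Longrightarrow> f (b h x) = b h (f x)"
    and y: "y \<in> fixedK"
  shows "f y \<in> fixedK" "E (f y) = f (E y)"
proof -
  show fy: "f y \<in> fixedK"
    using f(1)[OF fixedK_carrier[OF y]] fb[OF subgroup.mem_carrier[OF sK] fixedK_carrier[OF y]] y
    by (auto simp: fixedK_def)
  have Ff: "f (F y C) = F (f y) C" if C: "C \<in> rcosets\<^bsub>Y\<^esub> K" for C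
  proof (rule rcosetsE[OF C])
    fix h assume h: "h \<in> carrier Y" "C = K #>\<^bsub>Y\<^esub> h"
    then show ?thesis using F_coset[OF y h(1)] F_coset[OF fy h(1)] fb[OF h(1) fixedK_carrier[OF y]] by simp
  qed
  have "f (E y) = (\<Oplus>\<^bsub>A\<^esub>C\<in>rcosets\<^bsub>Y\<^esub> K. f (F y C))"
    unfolding E_def using f F_funcset[OF y] by (rule A.additive_finsum)
  also have "\<dots> = E (f y)"
    unfolding E_def using Ff F_closed[OF fy] by (intro A.finsum_cong') auto
  finally show "E (f y) = f (E y)" by simp
qed

lemma fixedK_zero: "\<zero>\<^bsub>A\<^esub> \<in> fixedK" and E_zero: "E \<zero>\<^bsub>A\<^esub> = \<zero>\<^bsub>A\<^esub>"
  using fixedK_finsum[of "{}"] by auto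

end

section \<open>Averages of the twisted Jacquet kernel of a unipotent matrix group\<close>

locale tate_jacquet_matrix = tate_jacquet R L s l \<Gamma> \<gamma> \<tau> e NF a \<theta> \<sigma> I i
  for R :: "('r, 'x) ring_scheme" and L :: "('r, 'm, 'y) module_scheme" and s :: "'m \<Rightarrow> 'm" and l :: nat
    and \<Gamma> :: "'c set" and \<gamma> :: 'c and \<tau> :: "'c \<Rightarrow> 'm \<Rightarrow> 'm" and e :: "nat \<Rightarrow> 'c"
    and NF :: "('f::field alg_closure^'n^'n) set" and a \<theta> and \<sigma> :: "'f alg_closure^'n^'n \<Rightarrow> 'f alg_closure^'n^'n"
    and I and i +
  fixes v :: "'f \<Rightarrow> real" and p :: nat
  assumes F: "nonarch_local_field v p" and l: "Factorial_Ring.prime l" "l \<noteq> p"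
    and NF: "subgroup NF GL" "\<And>A. A \<in> NF \<Longrightarrow> unipotent A" "\<And>A i j. A \<in> NF \<Longrightarrow> A $ i $ j \<in> base"
    and \<sigma>_mult: "\<And>x y. x \<in> NF \<Longrightarrow> y \<in> NF \<Longrightarrow> \<sigma> (x ** y) = \<sigma> x ** \<sigma> y"
    and \<sigma>_pow: "\<And>x. x \<in> NF \<Longrightarrow> (\<sigma> ^^ l) x = x"
    and a_mult: "\<And>n m x. n \<in> NF \<Longrightarrow> m \<in> NF \<Longrightarrow> x \<in> carrier L \<Longrightarrow> a (n ** m) x = a n (a m x)"
    and a_smult: "\<And>n r x. n \<in> NF \<Longrightarrow> r \<in> carrier R \<Longrightarrow> x \<in> carrier L \<Longrightarrow> a n (r \<odot>\<^bsub>L\<^esub> x) = r \<odot>\<^bsub>L\<^esub> a n x"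
    and \<theta>_unit: "\<And>n. n \<in> NF \<Longrightarrow> \<theta> n \<in> Units R"
    and \<theta>_mult: "\<And>n m. n \<in> NF \<Longrightarrow> m \<in> NF \<Longrightarrow> \<theta> (n ** m) = \<theta> n \<otimes>\<^bsub>R\<^esub> \<theta> m"
    and a_smooth: "\<And>x. x \<in> carrier L \<Longrightarrow> \<exists>\<epsilon>>0. \<forall>n\<in>NF. (\<forall>i j. v (of_ac ((n - mat 1) $ i $ j)) < \<epsilon>) \<longrightarrow> a n x = x"
    and \<theta>_smooth: "\<exists>\<epsilon>>0. \<forall>n\<in>NF. (\<forall>i j. v (of_ac ((n - mat 1) $ i $ j)) < \<epsilon>) \<longrightarrow> \<theta> n = \<one>\<^bsub>R\<^esub>"
begin

text \<open>The action twisted by \<open>\<theta>\<^sup>-\<^sup>1\<close>, whose coinvariants form the twisted Jacquet module.\<close>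

definition b :: "'f alg_closure^'n^'n \<Rightarrow> 'm \<Rightarrow> 'm" where
  "b n x = inv\<^bsub>R\<^esub> (\<theta> n) \<odot>\<^bsub>L\<^esub> a n x"

lemma \<theta>inv: "n \<in> NF \<Longrightarrow> inv\<^bsub>R\<^esub> (\<theta> n) \<in> carrier R" "n \<in> NF \<Longrightarrow> inv\<^bsub>R\<^esub> (\<theta> n) \<otimes>\<^bsub>R\<^esub> \<theta> n = \<one>\<^bsub>R\<^esub>"
  "n \<in> NF \<Longrightarrow> \<theta> n \<otimes>\<^bsub>R\<^esub> inv\<^bsub>R\<^esub> (\<theta> n) = \<one>\<^bsub>R\<^esub>"
  using \<theta>_unit by simp_all

lemma \<theta>inv_mult: "n \<in> NF \<Longrightarrow> m \<in> NF \<Longrightarrow> inv\<^bsub>R\<^esub> (\<theta> (n ** m)) = inv\<^bsub>R\<^esub> (\<theta> n) \<otimes>\<^bsub>R\<^esub> inv\<^bsub>R\<^esub> (\<theta> m)"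
proof -
  assume n: "n \<in> NF" and m: "m \<in> NF"
  have c: "\<theta> n \<in> carrier R" "\<theta> m \<in> carrier R" "inv\<^bsub>R\<^esub> (\<theta> n) \<in> carrier R" "inv\<^bsub>R\<^esub> (\<theta> m) \<in> carrier R"
    using n m \<theta> \<theta>inv by auto
  have "(inv\<^bsub>R\<^esub> (\<theta> n) \<otimes>\<^bsub>R\<^esub> inv\<^bsub>R\<^esub> (\<theta> m)) \<otimes>\<^bsub>R\<^esub> (\<theta> n \<otimes>\<^bsub>R\<^esub> \<theta> m)
      = (inv\<^bsub>R\<^esub> (\<theta> n) \<otimes>\<^bsub>R\<^esub> \<theta> n) \<otimes>\<^bsub>R\<^esub> (inv\<^bsub>R\<^esub> (\<theta> m) \<otimes>\<^bsub>R\<^esub> \<theta> m)"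
    using c by (simp add: R.m_ac)
  also have "\<dots> = \<one>\<^bsub>R\<^esub>" using \<theta>inv n m by simp
  finally show ?thesis
    using R.comm_inv_char[of "\<theta> n \<otimes>\<^bsub>R\<^esub> \<theta> m" "inv\<^bsub>R\<^esub> (\<theta> n) \<otimes>\<^bsub>R\<^esub> inv\<^bsub>R\<^esub> (\<theta> m)"] c
    by (simp add: \<theta>_mult[OF n m] R.m_comm)
qed

lemma b_closed: "n \<in> NF \<Longrightarrow> x \<in> carrier L \<Longrightarrow> b n x \<in> carrier L"
  by (simp add: b_def \<theta>inv a_closed)

lemma b_smult: "n \<in> NF \<Longrightarrow> r \<in> carrier R \<Longrightarrow> x \<in> carrier L \<Longrightarrow> b n (r \<odot>\<^bsub>L\<^esub> x) = r \<odot>\<^bsub>L\<^esub> b n x"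
  by (simp add: b_def a_smult \<theta>inv a_closed R.m_comm flip: smult_assoc1)

lemma b_mult: "n \<in> NF \<Longrightarrow> m \<in> NF \<Longrightarrow> x \<in> carrier L \<Longrightarrow> b (n ** m) x = b n (b m x)"
  by (simp add: b_def \<theta>inv_mult a_mult a_smult \<theta>inv a_closed smult_assoc1)

text \<open>As \<open>\<theta> n\<close> is a unit, these elements and the differences b n x - x
  generate the same submodule.\<close>

lemma gen_b: "n \<in> NF \<Longrightarrow> x \<in> carrier L \<Longrightarrow> a n x \<ominus>\<^bsub>L\<^esub> \<theta> n \<odot>\<^bsub>L\<^esub> x = \<theta> n \<odot>\<^bsub>L\<^esub> (b n x \<ominus>\<^bsub>L\<^esub> x)"
  by (simp add: b_def M.minus_eq smult_r_distr smult_r_minus a_closed \<theta> \<theta>inv flip: smult_assoc1)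

lemma averagingI:
  assumes H: "subgroup H GL" "H \<subseteq> NF" "\<sigma> ` H \<subseteq> H" and K: "K \<lhd> GLsub H" "\<sigma> ` K \<subseteq> K"
    and fin: "finite (rcosets\<^bsub>GLsub H\<^esub> K)"
  shows "averaging L s l (GLsub H) K b \<sigma>"
proof -
  interpret K: normal K "GLsub H" by fact
  interpret Y: group "GLsub H" using group.subgroup_imp_group[OF group_GL H(1)] .
  show ?thesis
  proof unfold_locales
    show "\<sigma> \<in> hom (GLsub H) (GLsub H)" using H \<sigma>_mult by (auto simp: hom_def subset_iff)
    fix h x assume "h \<in> carrier (GLsub H)" and x: "x \<in> carrier L"
    then have h: "h \<in> NF" using H by auto
    show "b h x \<in> carrier L" by (rule b_closed[OF h x])
    show "s (b h x) = b (\<sigma> h) (s x)"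
      using h x by (simp add: b_def s_smult \<theta>inv a_closed s_a \<theta>)
    show "b h (x \<oplus>\<^bsub>L\<^esub> y) = b h x \<oplus>\<^bsub>L\<^esub> b h y" if "y \<in> carrier L" for y
      using that h x by (simp add: b_def a_add smult_r_distr \<theta>inv a_closed)
  qed (use H K fin l b_mult \<sigma>_pow in \<open>auto simp: subset_iff\<close>)
qed

text \<open>Vanishing of the average is required for all \<open>H/K\<close> with \<open>H\<close> large and \<open>K\<close> small at once, which
  makes the condition stable under sums.\<close>

definition killed :: "'m \<Rightarrow> bool" where
  "killed z \<longleftrightarrow> (\<exists>S V. finite S \<and> S \<subseteq> NF \<and> finite V \<and> V \<subseteq> carrier L \<and>
     (\<forall>H K. averaging L s l (GLsub H) K b \<sigma> \<longrightarrow> S \<subseteq> H \<longrightarrow> H \<subseteq> NF \<longrightarrow> (\<forall>y\<in>V. \<forall>k\<in>K. b k y = y) \<longrightarrow>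
        z \<in> averaging.fixedK L K b \<and> averaging.E L (GLsub H) K b z = \<zero>\<^bsub>L\<^esub>))"

text \<open>The vectors with this property form a submodule, since the witnesses of two summands can
  be united. A generator is killed once \<open>n\<close> lies in \<open>H\<close> and
  \<open>K\<close> fixes \<open>x\<close>, because b n x and x have the same average.\<close>

lemma KL_killed: "z \<in> KL \<Longrightarrow> killed z"
proof -
  have "KL \<subseteq> {z \<in> carrier L. killed z}"
  proof (rule KL_least)
    show "submodule {z \<in> carrier L. killed z} R L"
    proof (rule submodule_criterion)
      have "killed \<zero>\<^bsub>L\<^esub>"
        unfolding killed_def
        by (intro exI[of _ "{}"]) (auto intro: averaging.fixedK_zero averaging.E_zero)
      then show "\<zero>\<^bsub>L\<^esub> \<in> {z \<in> carrier L. killed z}" by simp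
    next
      fix x y assume "x \<in> {z \<in> carrier L. killed z}" "y \<in> {z \<in> carrier L. killed z}"
      then have xy: "x \<in> carrier L" "killed x" "y \<in> carrier L" "killed y" by auto
      obtain S V where S: "finite S" "S \<subseteq> NF" "finite V" "V \<subseteq> carrier L"
        "\<And>H K. averaging L s l (GLsub H) K b \<sigma> \<Longrightarrow> S \<subseteq> H \<Longrightarrow> H \<subseteq> NF \<Longrightarrow> (\<forall>y\<in>V. \<forall>k\<in>K. b k y = y) \<Longrightarrow>
          x \<in> averaging.fixedK L K b \<and> averaging.E L (GLsub H) K b x = \<zero>\<^bsub>L\<^esub>"
        using xy(2) unfolding killed_def by blast
      obtain S' V' where S': "finite S'" "S' \<subseteq> NF" "finite V'" "V' \<subseteq> carrier L"
        "\<And>H K. averaging L s l (GLsub H) K b \<sigma> \<Longrightarrow> S' \<subseteq> H \<Longrightarrow> H \<subseteq> NF \<Longrightarrow> (\<forall>y\<in>V'. \<forall>k\<in>K. b k y = y) \<Longrightarrow>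
          y \<in> averaging.fixedK L K b \<and> averaging.E L (GLsub H) K b y = \<zero>\<^bsub>L\<^esub>"
        using xy(4) unfolding killed_def by blast
      have "killed (x \<oplus>\<^bsub>L\<^esub> y)"
        unfolding killed_def
      proof (intro exI[of _ "S \<union> S'"] exI[of _ "V \<union> V'"] conjI allI impI)
        fix H K assume "averaging L s l (GLsub H) K b \<sigma>" and H: "S \<union> S' \<subseteq> H" "H \<subseteq> NF"
          and VK: "\<forall>y\<in>V \<union> V'. \<forall>k\<in>K. b k y = y"
        then interpret av: averaging L s l "GLsub H" K b \<sigma> by simp
        have x: "x \<in> av.fixedK" "av.E x = \<zero>\<^bsub>L\<^esub>" using S(5)[OF av.averaging_axioms] H VK by auto
        have y: "y \<in> av.fixedK" "av.E y = \<zero>\<^bsub>L\<^esub>" using S'(5)[OF av.averaging_axioms] H VK by auto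
        show "x \<oplus>\<^bsub>L\<^esub> y \<in> av.fixedK" by (rule av.fixedK_add[OF x(1) y(1)])
        show "av.E (x \<oplus>\<^bsub>L\<^esub> y) = \<zero>\<^bsub>L\<^esub>" using av.E_add[OF x(1) y(1)] x y by simp
      qed (use S S' in auto)
      then show "x \<oplus>\<^bsub>L\<^esub> y \<in> {z \<in> carrier L. killed z}" using xy by simp
    next
      fix r x assume r: "r \<in> carrier R" and "x \<in> {z \<in> carrier L. killed z}"
      then have x: "x \<in> carrier L" "killed x" by auto
      obtain S V where S: "finite S" "S \<subseteq> NF" "finite V" "V \<subseteq> carrier L"
        "\<And>H K. averaging L s l (GLsub H) K b \<sigma> \<Longrightarrow> S \<subseteq> H \<Longrightarrow> H \<subseteq> NF \<Longrightarrow> (\<forall>y\<in>V. \<forall>k\<in>K. b k y = y) \<Longrightarrow>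
          x \<in> averaging.fixedK L K b \<and> averaging.E L (GLsub H) K b x = \<zero>\<^bsub>L\<^esub>"
        using x(2) unfolding killed_def by blast
      have "killed (r \<odot>\<^bsub>L\<^esub> x)"
        unfolding killed_def
      proof (intro exI[of _ S] exI[of _ V] conjI allI impI)
        fix H K assume "averaging L s l (GLsub H) K b \<sigma>" and H: "S \<subseteq> H" "H \<subseteq> NF"
          and VK: "\<forall>y\<in>V. \<forall>k\<in>K. b k y = y"
        then interpret av: averaging L s l "GLsub H" K b \<sigma> by simp
        have x: "x \<in> av.fixedK" "av.E x = \<zero>\<^bsub>L\<^esub>" using S(5)[OF av.averaging_axioms H VK] by auto
        have rb: "r \<odot>\<^bsub>L\<^esub> b h y = b h (r \<odot>\<^bsub>L\<^esub> y)" if "h \<in> carrier (GLsub H)" "y \<in> carrier L" for h y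
          using b_smult[OF _ r that(2)] that(1) H(2) by auto
        note m = av.E_map[of "\<lambda>y. r \<odot>\<^bsub>L\<^esub> y", OF smult_closed[OF r] smult_r_distr[OF r] rb x(1)]
        show "r \<odot>\<^bsub>L\<^esub> x \<in> av.fixedK" by (rule m(1))
        show "av.E (r \<odot>\<^bsub>L\<^esub> x) = \<zero>\<^bsub>L\<^esub>" using m(2) x(2) r by simp
      qed (use S in auto)
      then show "r \<odot>\<^bsub>L\<^esub> x \<in> {z \<in> carrier L. killed z}" using r x by simp
    qed auto
    fix n x assume n: "n \<in> NF" and x: "x \<in> carrier L"
    have "killed (a n x \<ominus>\<^bsub>L\<^esub> \<theta> n \<odot>\<^bsub>L\<^esub> x)"
      unfolding killed_def
    proof (intro exI[of _ "{n}"] exI[of _ "{x}"] conjI allI impI)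
      fix H K assume "averaging L s l (GLsub H) K b \<sigma>" and H: "{n} \<subseteq> H" "H \<subseteq> NF"
        and VK: "\<forall>y\<in>{x}. \<forall>k\<in>K. b k y = y"
      then interpret av: averaging L s l "GLsub H" K b \<sigma> by simp
      have xf: "x \<in> av.fixedK" using VK x by (simp add: av.fixedK_def)
      have nH: "n \<in> carrier (GLsub H)" using H by simp
      have bf: "b n x \<in> av.fixedK" by (rule av.fixedK_b[OF xf nH])
      have df: "b n x \<ominus>\<^bsub>L\<^esub> x \<in> av.fixedK" using av.fixedK_add[OF bf av.fixedK_minus[OF xf]] by (simp add: M.minus_eq)
      have Ed: "av.E (b n x \<ominus>\<^bsub>L\<^esub> x) = \<zero>\<^bsub>L\<^esub>"
        using av.E_diff[OF bf xf] av.E_b[OF xf nH] av.E_closed[OF xf] by (simp add: M.minus_eq M.r_neg)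
      have r: "\<theta> n \<in> carrier R" using \<theta> n by simp
      have rb: "\<theta> n \<odot>\<^bsub>L\<^esub> b h y = b h (\<theta> n \<odot>\<^bsub>L\<^esub> y)" if "h \<in> carrier (GLsub H)" "y \<in> carrier L" for h y
        using b_smult[OF _ r that(2)] that(1) H(2) by auto
      note m = av.E_map[of "\<lambda>y. \<theta> n \<odot>\<^bsub>L\<^esub> y", OF smult_closed[OF r] smult_r_distr[OF r] rb df]
      show "a n x \<ominus>\<^bsub>L\<^esub> \<theta> n \<odot>\<^bsub>L\<^esub> x \<in> av.fixedK" unfolding gen_b[OF n x] by (rule m(1))
      show "av.E (a n x \<ominus>\<^bsub>L\<^esub> \<theta> n \<odot>\<^bsub>L\<^esub> x) = \<zero>\<^bsub>L\<^esub>" unfolding gen_b[OF n x] using m(2) Ed r by simp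
    qed (use n x in auto)
    then show "a n x \<ominus>\<^bsub>L\<^esub> \<theta> n \<odot>\<^bsub>L\<^esub> x \<in> {z \<in> carrier L. killed z}" using gen_closed[OF n x] by simp
  qed
  then show "z \<in> KL \<Longrightarrow> killed z" by blast
qed

text \<open>The radius is a minimum of three: one for the vectors already treated, one for the new
  vector under \<open>a\<close>, and one for the character, because \<open>b\<close> involves
  both.\<close>

lemma smooth_finite:
  assumes "finite V" "V \<subseteq> carrier L"
  shows "\<exists>\<epsilon>>0. \<forall>n\<in>NF. (\<forall>i j. v (of_ac ((n - mat 1) $ i $ j)) < \<epsilon>) \<longrightarrow> (\<forall>y\<in>V. b n y = y)"
  using assms
proof (induction V)
  case empty
  show ?case by (rule exI[of _ 1]) auto
next
  case (insert y V)
  then obtain \<epsilon> where \<epsilon>: "\<epsilon> > 0" "\<And>n. n \<in> NF \<Longrightarrow> (\<forall>i j. v (of_ac ((n - mat 1) $ i $ j)) < \<epsilon>) \<Longrightarrow> (\<forall>y\<in>V. b n y = y)"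
    by auto
  obtain \<delta> where \<delta>: "\<delta> > 0" "\<And>n. n \<in> NF \<Longrightarrow> (\<forall>i j. v (of_ac ((n - mat 1) $ i $ j)) < \<delta>) \<Longrightarrow> a n y = y"
    using a_smooth[of y] insert.prems by auto
  obtain \<eta> where \<eta>: "\<eta> > 0" "\<And>n. n \<in> NF \<Longrightarrow> (\<forall>i j. v (of_ac ((n - mat 1) $ i $ j)) < \<eta>) \<Longrightarrow> \<theta> n = \<one>\<^bsub>R\<^esub>"
    using \<theta>_smooth by auto
  show ?case
  proof (intro exI[of _ "min \<epsilon> (min \<delta> \<eta>)"] conjI ballI impI)
    fix n z assume n: "n \<in> NF" "\<forall>i j. v (of_ac ((n - mat 1) $ i $ j)) < min \<epsilon> (min \<delta> \<eta>)" and z: "z \<in> insert y V"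
    have "b n y = y" using \<delta>(2)[OF n(1)] \<eta>(2)[OF n(1)] n(2) insert.prems by (simp add: b_def)
    then show "b n z = z" using \<epsilon>(2)[OF n(1)] n(2) z by auto
  qed (use \<epsilon> \<delta> \<eta> in auto)
qed

theorem core:
  assumes x: "x \<in> Z i" and w: "w \<in> carrier L" and d: "x \<ominus>\<^bsub>L\<^esub> bd i w \<in> KL"
  shows "cl x \<in> K0"
proof -
  have xc: "x \<in> carrier L" by (rule Z_carrier[OF x])
  let ?z = "x \<ominus>\<^bsub>L\<^esub> bd i w"
  obtain S V where S: "finite S" "S \<subseteq> NF" "finite V" "V \<subseteq> carrier L"
    "\<And>H K. averaging L s l (GLsub H) K b \<sigma> \<Longrightarrow> S \<subseteq> H \<Longrightarrow> H \<subseteq> NF \<Longrightarrow> (\<forall>y\<in>V. \<forall>k\<in>K. b k y = y) \<Longrightarrow>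
      ?z \<in> averaging.fixedK L K b \<and> averaging.E L (GLsub H) K b ?z = \<zero>\<^bsub>L\<^esub>"
    using KL_killed[OF d] unfolding killed_def by blast
  \<comment> \<open>\<open>K\<close> must fix \<open>x\<close> and \<open>w\<close> as well as the
    witnesses for the kernel element, so that the averages of \<open>x\<close> and of the boundary
    of \<open>w\<close> make sense separately.\<close>
  have V': "finite (insert x (insert w V))" "insert x (insert w V) \<subseteq> carrier L" using S w xc by auto
  obtain \<epsilon> where \<epsilon>: "\<epsilon> > 0" "\<And>n. n \<in> NF \<Longrightarrow> (\<forall>i j. v (of_ac ((n - mat 1) $ i $ j)) < \<epsilon>) \<Longrightarrow>
      (\<forall>y\<in>insert x (insert w V). b n y = y)"
    using smooth_finite[OF V'] by auto
  obtain H K where HK: "subgroup H GL" "S \<subseteq> H" "H \<subseteq> NF" "\<sigma> ` H \<subseteq> H" "K \<lhd> GLsub H" "\<sigma> ` K \<subseteq> K"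
    "finite (rcosets\<^bsub>GLsub H\<^esub> K)" "coprime l (card (rcosets\<^bsub>GLsub H\<^esub> K))"
    "\<And>h i j. h \<in> K \<Longrightarrow> v (of_ac ((h - mat 1) $ i $ j)) < \<epsilon>"
    "\<And>x. x \<in> H \<Longrightarrow> K #>\<^bsub>GLsub H\<^esub> \<sigma> x = K #>\<^bsub>GLsub H\<^esub> x \<Longrightarrow>
       \<exists>y\<in>H. K #>\<^bsub>GLsub H\<^esub> y = K #>\<^bsub>GLsub H\<^esub> x \<and> \<sigma> y = y"
    using good_quotient[OF F l NF \<sigma>_NF \<sigma>_mult \<sigma>_pow S(1,2) \<epsilon>(1)] by blast
  interpret av: averaging L s l "GLsub H" K b \<sigma> by (rule averagingI[OF HK(1,3,4,5,6,7)])
  have KH: "K \<subseteq> H" using subgroup.subset[OF av.sK] by simp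
  have fixV: "\<forall>y\<in>insert x (insert w V). \<forall>k\<in>K. b k y = y"
    using \<epsilon>(2) HK(9) KH HK(3) by blast
  have xf: "x \<in> av.fixedK" and wf: "w \<in> av.fixedK" using fixV xc w by (auto simp: av.fixedK_def)
  have z: "?z \<in> av.fixedK" "av.E ?z = \<zero>\<^bsub>L\<^esub>" using S(5)[OF av.averaging_axioms HK(2,3)] fixV by auto
  \<comment> \<open>Averaging commutes with both kinds of boundary maps. As the difference has
    average zero, the average of \<open>x\<close> is the boundary of the average of
    \<open>w\<close>.\<close>
  have bdf: "bd i w \<in> av.fixedK" "av.E (bd i w) = bd i (av.E w)"
    using av.nr_fixedK[OF wf] av.fixedK_add[OF wf av.fixedK_minus[OF av.fixedK_s[OF wf]]]
      av.E_diff[OF wf av.fixedK_s[OF wf]] av.E_s[OF wf] by (auto simp: bd_def M.minus_eq)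
  have "av.E x \<ominus>\<^bsub>L\<^esub> av.E (bd i w) = \<zero>\<^bsub>L\<^esub>" using av.E_diff[OF xf bdf(1)] z by simp
  moreover have "av.E x = (av.E x \<ominus>\<^bsub>L\<^esub> av.E (bd i w)) \<oplus>\<^bsub>L\<^esub> av.E (bd i w)"
    using av.E_closed[OF xf] av.E_closed[OF bdf(1)] by (simp add: M.minus_eq M.a_assoc M.l_neg)
  ultimately have "av.E x = bd i (av.E w)" using av.E_closed[OF bdf(1)] bdf(2) by simp
  then have EB: "av.E x \<in> B i" using av.E_closed[OF wf] by (auto simp: B_eq)
  have orbit: "(\<Oplus>\<^bsub>L\<^esub>j\<in>{..<l}. b ((\<sigma> ^^ j) h) x) \<in> B i" if h: "h \<in> carrier (GLsub H)" for h
  proof (cases "i = 0")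
    case True
    then have "s x = x" using x by (simp add: Z_iff)
    then show ?thesis using av.orbit_sum_nr[OF xc _ h] True av.b_closed[OF h xc] by (auto simp: B_eq' nr_boundaries_def)
  next
    case False
    then have "nr x = \<zero>\<^bsub>L\<^esub>" using x by (simp add: Z_iff)
    then show ?thesis using av.orbit_sum_diff[OF xc _ h] False by (simp add: B_eq')
  qed
  have lift: "\<exists>g\<in>carrier (GLsub H). K #>\<^bsub>GLsub H\<^esub> g = K #>\<^bsub>GLsub H\<^esub> h \<and> \<sigma> g = g"
    if "h \<in> carrier (GLsub H)" "K #>\<^bsub>GLsub H\<^esub> \<sigma> h = K #>\<^bsub>GLsub H\<^esub> h" for h
    using HK(10)[of h] that by simp
  obtain D where D: "finite D" "D \<subseteq> {h \<in> carrier (GLsub H). \<sigma> h = h}" "coprime l (card D)"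
    "(\<Oplus>\<^bsub>L\<^esub>h\<in>D. b h x) \<in> B i"
    using av.average_over_fixed_points[OF B_subgroup orbit xf EB HK(8) lift] by blast
  have DNS: "h \<in> NS" if "h \<in> D" for h using D(2) that HK(3) by auto
  note P = submodule_closed[OF preK0_submodule]
  have sP: "subgroup preK0 (add_monoid L)" using preK0_submodule by (simp add: submodule_def)
  have bx: "b h x \<in> carrier L" if "h \<in> D" for h using b_closed DNS[OF that] xc by simp
  \<comment> \<open>Modulo \<open>preK0\<close> a translate by a \<open>\<sigma>\<close>-fixed
    element agrees with \<open>x\<close>, so the sum of the translates becomes \<open>card D\<close>
    times \<open>x\<close>.\<close>
  have "b h x \<ominus>\<^bsub>L\<^esub> x \<in> preK0" if h: "h \<in> D" for h
  proof -
    have hN: "h \<in> NF" using DNS[OF h] by simp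
    have "inv\<^bsub>R\<^esub> (\<theta> h) \<odot>\<^bsub>L\<^esub> (a h x \<ominus>\<^bsub>L\<^esub> \<theta> h \<odot>\<^bsub>L\<^esub> x) \<in> preK0"
      by (rule P(6)[OF \<theta>inv(1)[OF hN] gen_preK0[OF DNS[OF h] x]])
    also have "inv\<^bsub>R\<^esub> (\<theta> h) \<odot>\<^bsub>L\<^esub> (a h x \<ominus>\<^bsub>L\<^esub> \<theta> h \<odot>\<^bsub>L\<^esub> x) = b h x \<ominus>\<^bsub>L\<^esub> x"
      using \<theta>inv[OF hN] \<theta>(1)[OF hN] bx[OF h] xc by (simp add: gen_b[OF hN xc] flip: smult_assoc1)
    finally show ?thesis .
  qed
  then have sum: "(\<Oplus>\<^bsub>L\<^esub>h\<in>D. b h x \<ominus>\<^bsub>L\<^esub> x) \<in> preK0" by (intro M.finsum_in_subgroup[OF sP]) auto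
  have "(\<Oplus>\<^bsub>L\<^esub>h\<in>D. b h x) = (\<Oplus>\<^bsub>L\<^esub>h\<in>D. (b h x \<ominus>\<^bsub>L\<^esub> x) \<oplus>\<^bsub>L\<^esub> x)"
    using bx xc by (intro M.finsum_cong') (auto simp: M.minus_eq M.a_assoc M.l_neg)
  also have "\<dots> = (\<Oplus>\<^bsub>L\<^esub>h\<in>D. b h x \<ominus>\<^bsub>L\<^esub> x) \<oplus>\<^bsub>L\<^esub> add_pow L (card D) x"
    using bx xc M.add.finprod_const[OF xc, of D] by (simp add: M.finsum_addf)
  finally have e: "(\<Oplus>\<^bsub>L\<^esub>h\<in>D. b h x) = (\<Oplus>\<^bsub>L\<^esub>h\<in>D. b h x \<ominus>\<^bsub>L\<^esub> x) \<oplus>\<^bsub>L\<^esub> add_pow L (card D) x" .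
  have sc: "(\<Oplus>\<^bsub>L\<^esub>h\<in>D. b h x \<ominus>\<^bsub>L\<^esub> x) \<in> carrier L" using sum P(1) by blast
  have c: "add_pow L k y \<in> carrier L" if "y \<in> carrier L" for k :: nat and y using M.add.nat_pow_closed[OF that] .
  have "\<ominus>\<^bsub>L\<^esub> (\<Oplus>\<^bsub>L\<^esub>h\<in>D. b h x \<ominus>\<^bsub>L\<^esub> x) \<oplus>\<^bsub>L\<^esub> (\<Oplus>\<^bsub>L\<^esub>h\<in>D. b h x) \<in> preK0"
    using P(3)[OF P(4)[OF sum]] D(4) B_preK0 by blast
  then have cD: "add_pow L (card D) x \<in> preK0"
    unfolding e using sc c[OF xc] by (simp add: M.r_neg1)
  have lx: "add_pow L l x \<in> preK0" using multiple_Z[OF x] B_preK0 by blast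
  have pk: "add_pow L k y \<in> preK0" if y: "y \<in> preK0" for k :: nat and y
  proof (induction k)
    case (Suc k)
    then show ?case using P(3)[OF Suc y] by (simp add: add_pow_def)
  qed (use P(2) in \<open>simp add: add_pow_def\<close>)
  have "card D \<noteq> 0" using D(3) l(1) by (metis coprime_0_right_iff not_prime_unit)
  \<comment> \<open>The multiples of \<open>x\<close> by \<open>card D\<close> and by
    \<open>l\<close> both lie in \<open>preK0\<close>; this Bezout relation recovers
    \<open>x\<close> itself.\<close>
  then obtain m k where mk: "card D * m = l * k + 1"
    using bezout_nat[of "card D" l] D(3) by (auto simp: coprime_commute)
  have "add_pow L m (add_pow L (card D) x) = add_pow L (card D * m) x" by (rule M.add.nat_pow_pow[OF xc])
  also have "\<dots> = add_pow L (l * k) x \<oplus>\<^bsub>L\<^esub> x" by (simp add: mk add_pow_def)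
  also have "add_pow L (l * k) x = add_pow L k (add_pow L l x)" by (rule M.add.nat_pow_pow[OF xc, symmetric])
  finally have f: "add_pow L m (add_pow L (card D) x) = add_pow L k (add_pow L l x) \<oplus>\<^bsub>L\<^esub> x" .
  have "\<ominus>\<^bsub>L\<^esub> add_pow L k (add_pow L l x) \<oplus>\<^bsub>L\<^esub> add_pow L m (add_pow L (card D) x) \<in> preK0"
    by (rule P(3)[OF P(4)[OF pk[OF lx]] pk[OF cD]])
  then have "x \<in> preK0" unfolding f using c[OF c[OF xc]] xc by (simp add: M.r_neg1)
  then show ?thesis by (simp add: preK0_def)
qed

lemmas natural_map_injective = natural_map_inj[OF core]

end

section \<open>The natural map for a reductive group\<close>

text \<open>Identifies the generator of the ideal behind \<open>resfield\<close> with the multiple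
  of one that annihilates Tate groups.\<close>

lemma add_pow_Lam: "add_pow (Lam w l) (k::nat) \<one>\<^bsub>Lam w l\<^esub> = of_nat k"
proof (induction k)
  case (Suc k)
  have "add_pow (Lam w l) (Suc k) \<one>\<^bsub>Lam w l\<^esub> = add_pow (Lam w l) k \<one>\<^bsub>Lam w l\<^esub> \<oplus>\<^bsub>Lam w l\<^esub> \<one>\<^bsub>Lam w l\<^esub>"
    by (simp add: add_pow_def)
  then show ?case using Suc by (simp add: Lam_def integers_of_def ring_of_type_algebra_def)
qed (simp add: add_pow_def Lam_def integers_of_def ring_of_type_algebra_def)

lemma matrix_metric:
  assumes v: "nonarch_abs v"
  shows "Metric_space (UNIV :: ('f::field^'n^'n) set) (\<lambda>A B. MAX (i, j) \<in> UNIV. v (A $ i $ j - B $ i $ j))"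
proof -
  let ?d = "\<lambda>A B :: 'f^'n^'n. MAX (i, j) \<in> UNIV. v (A $ i $ j - B $ i $ j)"
  have fin: "finite (range (\<lambda>(i, j). v (A $ i $ j - B $ i $ j)))" for A B :: "'f^'n^'n" by simp
  have ge: "v (A $ i $ j - B $ i $ j) \<le> ?d A B" for A B :: "'f^'n^'n" and i j
    by (rule Max_ge[OF fin]) (auto intro: image_eqI[of _ _ "(i, j)"])
  have le: "?d A B \<le> c \<longleftrightarrow> (\<forall>i j. v (A $ i $ j - B $ i $ j) \<le> c)" for A B :: "'f^'n^'n" and c
    by (subst Max_le_iff[OF fin]) auto
  have nn: "0 \<le> ?d A B" for A B :: "'f^'n^'n"
    using ge[of A undefined undefined B] nonarch_abs_nonneg[OF v] order_trans by blast
  show ?thesis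
  proof
    fix A B C :: "'f^'n^'n"
    show "0 \<le> ?d A B" by (rule nn)
    have "v (A $ i $ j - B $ i $ j) = v (B $ i $ j - A $ i $ j)" for i j
      using nonarch_abs_minus[OF v, of "A $ i $ j - B $ i $ j"] by simp
    then show "?d A B = ?d B A" by simp
    show "?d A B = 0 \<longleftrightarrow> A = B"
    proof
      assume "?d A B = 0"
      then have "v (A $ i $ j - B $ i $ j) \<le> 0" for i j using ge[of A i j B] by simp
      then have "v (A $ i $ j - B $ i $ j) = 0" for i j using nonarch_abs_nonneg[OF v] order_antisym by blast
      then show "A = B" by (simp add: nonarch_abs_eq_0[OF v] vec_eq_iff)
    next
      assume "A = B"
      then have "?d A B \<le> 0" using nonarch_abs_eq_0[OF v, of 0] by (subst le) simp
      then show "?d A B = 0" using nn[of A B] by linarith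
    qed
    show "?d A C \<le> ?d A B + ?d B C"
    proof (subst le, intro allI)
      fix i j
      have "v (A $ i $ j - C $ i $ j) \<le> max (v (A $ i $ j - B $ i $ j)) (v (B $ i $ j - C $ i $ j))"
        using nonarch_abs_add[OF v, of "A $ i $ j - B $ i $ j" "B $ i $ j - C $ i $ j"] by simp
      also have "\<dots> \<le> ?d A B + ?d B C" using ge[of A i j B] ge[of B i j C] nn[of A B] nn[of B C] by linarith
      finally show "v (A $ i $ j - C $ i $ j) \<le> ?d A B + ?d B C" .
    qed
  qed
qed

text \<open>The topology is pulled back from the maximum of the distances of entries, so a
  neighbourhood of the identity contains an entrywise ball. Smoothness of the action and of the
  character enters the argument in this form.\<close>

lemma open_subgroup_contains_ball:
  assumes v: "nonarch_abs v" and U: "open_subgroup v U H" and H: "subgroup (rational H) GL"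
  shows "\<exists>\<epsilon>>0. \<forall>g\<in>rational H. (\<forall>i j. v (of_ac ((g - mat 1) $ i $ j)) < \<epsilon>) \<longrightarrow> g \<in> U"
proof -
  let ?d = "\<lambda>A B :: 'a^'b^'b. MAX (i, j) \<in> UNIV. v (A $ i $ j - B $ i $ j)"
  let ?f = "\<lambda>A :: 'a alg_closure^'b^'b. (\<chi> i j. of_ac (A $ i $ j)) :: 'a^'b^'b"
  interpret M: Metric_space UNIV ?d by (rule matrix_metric[OF v])
  have sU: "subgroup U (GLsub (rational H))" and oU: "openin (rational_topology v H) U"
    using U by (auto simp: open_subgroup_def)
  have 1: "mat 1 \<in> U" using subgroup.one_closed[OF sU] by simp
  obtain V where V: "openin (matrix_topology v) V" "U = ?f -` V \<inter> rational H"
    using oU unfolding rational_topology_def openin_pullback_topology by blast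
  have "?f (mat 1) \<in> V" using 1 V(2) by blast
  then obtain r where r: "r > 0" "M.mball (?f (mat 1)) r \<subseteq> V"
    using V(1) unfolding matrix_topology_def M.openin_mtopology by blast
  have "g \<in> U" if g: "g \<in> rational H" "\<forall>i j. v (of_ac ((g - mat 1) $ i $ j)) < r" for g
  proof -
    have one: "mat 1 \<in> rational H" using subgroup.one_closed[OF H] by simp
    have "of_ac ((g - mat 1) $ i $ j) = of_ac (g $ i $ j) - of_ac (mat 1 $ i $ j)" for i j
    proof -
      have "g $ i $ j \<in> base" "(mat 1 :: 'a alg_closure^'b^'b) $ i $ j \<in> base"
        using g(1) one by (auto simp: rational_def)
      then show ?thesis by (auto simp flip: to_ac_diff)
    qed
    then have "v (?f (mat 1) $ i $ j - ?f g $ i $ j) < r" for i j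
      using g(2) nonarch_abs_minus[OF v, of "of_ac (g $ i $ j) - of_ac (mat 1 $ i $ j)"] by simp
    then have "?d (?f (mat 1)) (?f g) < r" by (subst Max_less_iff) auto
    then have "?f g \<in> M.mball (?f (mat 1)) r" by simp
    then show ?thesis using r(2) V(2) g(1) by blast
  qed
  then show ?thesis using r(1) by blast
qed

lemma semidirect_simps:
  "carrier (semidirect H A) = carrier H \<times> carrier A"
  "(g, \<gamma>) \<otimes>\<^bsub>semidirect H A\<^esub> (h, \<delta>) = (g \<otimes>\<^bsub>H\<^esub> \<gamma> h, \<gamma> \<otimes>\<^bsub>A\<^esub> \<delta>)"
  "\<one>\<^bsub>semidirect H A\<^esub> = (\<one>\<^bsub>H\<^esub>, \<one>\<^bsub>A\<^esub>)"
  by (simp_all add: semidirect_def)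

lemma rational_mult:
  fixes A B :: "'f::field alg_closure^'n^'n"
  assumes "\<And>i j. A $ i $ j \<in> base" "\<And>i j. B $ i $ j \<in> base"
  shows "(A ** B) $ i $ j \<in> base"
proof -
  have "A $ i $ j = to_ac (of_ac (A $ i $ j))" "B $ i $ j = to_ac (of_ac (B $ i $ j))" for i j
    using assms by (simp_all add: to_ac_of_ac)
  then have "(A ** B) $ i $ j = to_ac (\<Sum>k\<in>UNIV. of_ac (A $ i $ k) * of_ac (B $ k $ j))"
    by (simp add: matrix_matrix_mult_def to_ac_sum)
  then show ?thesis by blast
qed

theorem theorem3p3p2:
  fixes v :: "'f::field \<Rightarrow> real"
    and w :: "'q::field_char_0 \<Rightarrow> real"
    and p l i :: nat
    and G P N :: "('f alg_closure^'n^'n) set"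
    and \<sigma> :: "'f alg_closure^'n^'n \<Rightarrow> 'f alg_closure^'n^'n"
    and \<Theta> :: "'f alg_closure^'n^'n \<Rightarrow> 'q alg_closure"
    and L :: "('q alg_closure, 'm) module"
    and \<rho> :: "('f alg_closure^'n^'n) \<times> ('f alg_closure^'n^'n \<Rightarrow> 'f alg_closure^'n^'n) \<Rightarrow> 'm \<Rightarrow> 'm"
  assumes "nonarch_local_field v p"
    and "Factorial_Ring.prime l" and "l \<noteq> p"
    and "ladic_field w l"
    and "connected_reductive G" and "defined_over base G"
    and "automorphism_over base G \<sigma>"
    and "group.ord (AutoGroup (GLsub G)) \<sigma> = l"
    and "connected_reductive (identity_component (fixed_points \<sigma> G))"
    and "parabolic_over base P G" and "\<sigma> ` P = P"
    and "unipotent_radical N P"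
    and "smooth_character v N (Lam w l) \<Theta>"
    and "\<forall>n\<in>rational N. \<Theta> (\<sigma> n) = \<Theta> n"
    and "group_algebra_module (Lam w l) (semidirect (GLsub (rational G)) (cyclic_auts G \<sigma>)) L \<rho>"
    and "smooth_action v G (carrier L) (group_part G \<rho>)"
    and "i \<in> {0, 1}"
  shows "natural_map w l i G \<sigma> N \<Theta> L \<rho>
           \<in> module_homs (resfield w l) (jacquet_of_tate w l i G \<sigma> N \<Theta> L \<rho>)
               (tate_of_jacquet w l i G \<sigma> N \<Theta> L \<rho>)
       \<and> inj_on (natural_map w l i G \<sigma> N \<Theta> L \<rho>)
           (carrier (jacquet_of_tate w l i G \<sigma> N \<Theta> L \<rho>))"
proof -
  let ?A = "AutoGroup (GLsub G)" and ?S = "semidirect (GLsub (rational G)) (cyclic_auts G \<sigma>)"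
  let ?\<Gamma> = "carrier (cyclic_auts G \<sigma>)"
  have l0: "l > 0" "l \<noteq> 0" using assms(2) prime_gt_0_nat by auto
  have v: "nonarch_abs v" using assms(1) by (simp add: nonarch_local_field_def)
  have cG: "closed_subgroup G" using assms(5) by (simp add: connected_reductive_def)
  then have sG: "subgroup G GL" by (simp add: closed_subgroup_def)
  interpret GG: group "GLsub G" using group.subgroup_imp_group[OF group_GL sG] .
  interpret A: group ?A by (rule GG.AutoGroup)
  have P: "subgroup P GL" "P \<subseteq> G" using assms(10) by (auto simp: parabolic_over_def closed_subgroup_def)
  have \<sigma>A: "\<sigma> \<in> carrier ?A" using assms(7) by (simp add: automorphism_over_def)
  have sN: "subgroup N GL" and uN: "\<And>A. A \<in> N \<Longrightarrow> unipotent A" and nN: "N \<lhd> GLsub P"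
    using assms(12) by (auto simp: unipotent_radical_def conn_normal_unipotent_def closed_subgroup_def)
  have "N \<subseteq> P" using subgroup.subset[OF normal_imp_subgroup[OF nN]] by simp
  then have NG: "N \<subseteq> G" using P by blast
  have \<sigma>N: "\<sigma> ` N \<subseteq> N" by (rule unipotent_radical_stable[OF cG assms(7) P assms(11,12)])
  have Lm: "Module.module (Lam w l) L" and ga: "group_action ?S (carrier L) \<rho>"
    and \<rho>_add: "\<And>h x y. h \<in> carrier ?S \<Longrightarrow> x \<in> carrier L \<Longrightarrow> y \<in> carrier L \<Longrightarrow> \<rho> h (x \<oplus>\<^bsub>L\<^esub> y) = \<rho> h x \<oplus>\<^bsub>L\<^esub> \<rho> h y"
    and \<rho>_smult: "\<And>h r x. h \<in> carrier ?S \<Longrightarrow> r \<in> carrier (Lam w l) \<Longrightarrow> x \<in> carrier L \<Longrightarrow> \<rho> h (r \<odot>\<^bsub>L\<^esub> x) = r \<odot>\<^bsub>L\<^esub> \<rho> h x"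
    using assms(15) by (auto simp: group_algebra_module_def)
  interpret L: module "Lam w l" L by (rule Lm)
  interpret \<rho>: group_action ?S "carrier L" \<rho> by (rule ga)
  interpret S: group ?S using \<rho>.group_hom by (simp add: group_hom_def)
  have cS: "carrier ?S = rational G \<times> ?\<Gamma>" by (simp add: semidirect_simps)
  have \<Gamma>eq: "?\<Gamma> = generate ?A {\<sigma>}" by (simp add: cyclic_auts_def)
  have \<Gamma>A: "?\<Gamma> \<subseteq> carrier ?A" unfolding \<Gamma>eq using A.generate_incl[of "{\<sigma>}"] \<sigma>A by simp
  have \<sigma>\<Gamma>: "\<sigma> \<in> ?\<Gamma>" and one\<Gamma>: "\<one>\<^bsub>?A\<^esub> \<in> ?\<Gamma>"
    unfolding \<Gamma>eq by (auto intro: generate.incl generate.one)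
  have oneA: "\<one>\<^bsub>?A\<^esub> x = x" if "x \<in> G" for x using that by (simp add: AutoGroup_def BijGroup_def)
  have multA: "(\<gamma> \<otimes>\<^bsub>?A\<^esub> \<delta>) x = \<gamma> (\<delta> x)" if "\<gamma> \<in> carrier ?A" "\<delta> \<in> carrier ?A" "x \<in> G" for \<gamma> \<delta> x
    using that by (simp add: AutoGroup_def BijGroup_def auto_def compose_eq)
  have homA: "\<gamma> \<in> hom (GLsub G) (GLsub G)" if "\<gamma> \<in> carrier ?A" for \<gamma> using that by (simp add: AutoGroup_def auto_def)
  have \<gamma>1: "\<gamma> (mat 1) = mat 1" if "\<gamma> \<in> carrier ?A" for \<gamma>
  proof -
    have "group_hom (GLsub G) (GLsub G) \<gamma>"
      using homA[OF that] by (simp add: group_hom_def group_hom_axioms_def GG.is_group)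
    then show ?thesis using group_hom.hom_one by fastforce
  qed
  have \<sigma>m: "\<sigma> (x ** y) = \<sigma> x ** \<sigma> y" if "x \<in> G" "y \<in> G" for x y
    using homA[OF \<sigma>A] that by (auto simp: hom_def)
  have rG: "rational G \<subseteq> G" by (auto simp: rational_def)
  have one_rG: "mat 1 \<in> rational G" using S.one_closed by (simp add: cS semidirect_simps)
  \<comment> \<open>Stability of G(F) is read off from the semidirect product, which is a group
    because \<open>\<rho>\<close> is an action of it: the product of (1, \<sigma>) and (g, 1) has
    first component \<sigma> g.\<close>
  have \<sigma>rG: "\<sigma> g \<in> rational G" if "g \<in> rational G" for g
  proof -
    have "(mat 1, \<sigma>) \<otimes>\<^bsub>?S\<^esub> (g, \<one>\<^bsub>?A\<^esub>) \<in> carrier ?S"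
      using that one_rG \<sigma>\<Gamma> one\<Gamma> by (intro S.m_closed) (auto simp: cS)
    then show ?thesis by (simp add: semidirect_simps)
  qed
  have srG: "subgroup (rational G) GL"
  proof (rule group.subgroupI[OF group_GL])
    show "rational G \<subseteq> carrier GL" using rG subgroup.subset[OF sG] by blast
    show "rational G \<noteq> {}" using one_rG by blast
    show "x \<otimes>\<^bsub>GL\<^esub> y \<in> rational G" if "x \<in> rational G" "y \<in> rational G" for x y
      using that rational_mult[of x y] subgroup.m_closed[OF sG, of x y] by (auto simp: rational_def)
    \<comment> \<open>The inverse matrix is rational because it is the first component of an inverse
      in the semidirect product.\<close>
    fix x assume x: "x \<in> rational G"
    then have xS: "(x, \<one>\<^bsub>?A\<^esub>) \<in> carrier ?S" using one\<Gamma> by (simp add: cS)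
    obtain y \<delta> where y: "inv\<^bsub>?S\<^esub> (x, \<one>\<^bsub>?A\<^esub>) = (y, \<delta>)" by (cases "inv\<^bsub>?S\<^esub> (x, \<one>\<^bsub>?A\<^esub>)")
    have yG: "y \<in> rational G" using S.inv_closed[OF xS] y by (simp add: cS)
    have "(x, \<one>\<^bsub>?A\<^esub>) \<otimes>\<^bsub>?S\<^esub> (y, \<delta>) = \<one>\<^bsub>?S\<^esub>" using S.r_inv[OF xS] y by simp
    then have xy: "x ** y = mat 1" using yG rG oneA by (auto simp: semidirect_simps)
    have "inv\<^bsub>GL\<^esub> x = y"
    proof (rule group.inv_equality[OF group_GL])
      show "y \<otimes>\<^bsub>GL\<^esub> x = \<one>\<^bsub>GL\<^esub>" using xy matrix_left_right_inverse by auto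
    qed (use x yG rG subgroup.subset[OF sG] in auto)
    then show "inv\<^bsub>GL\<^esub> x \<in> rational G" using yG by simp
  qed
  have NFeq: "rational N = N \<inter> rational G" using NG by (auto simp: rational_def)
  have NFG: "rational N \<subseteq> rational G" using NFeq by blast
  have sNF: "subgroup (rational N) GL"
    unfolding NFeq using group.subgroups_Inter_pair[OF group_GL sN srG] by simp
  have NF\<sigma>: "\<sigma> n \<in> rational N" if "n \<in> rational N" for n using that \<sigma>N \<sigma>rG NFeq by blast
  have \<sigma>j: "(\<sigma> [^]\<^bsub>?A\<^esub> j) x = (\<sigma> ^^ j) x \<and> (\<sigma> ^^ j) x \<in> G" if "x \<in> G" for j :: nat and x
  proof (induction j)
    case 0
    then show ?case using oneA that by simp
  next
    case (Suc j)
    have "\<sigma> y \<in> G" if "y \<in> G" for y using homA[OF \<sigma>A] that by (auto simp: hom_def)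
    then show ?case
      using Suc multA[OF \<sigma>A A.nat_pow_closed[OF \<sigma>A] that] A.nat_pow_Suc2[OF \<sigma>A] by simp
  qed
  have \<sigma>l: "\<sigma> [^]\<^bsub>?A\<^esub> l = \<one>\<^bsub>?A\<^esub>" using A.pow_ord_eq_1[OF \<sigma>A] assms(8) by simp
  have \<sigma>pow: "(\<sigma> ^^ l) x = x" if "x \<in> G" for x using \<sigma>j[OF that, of l] oneA[OF that] \<sigma>l by simp
  \<comment> \<open>The order of \<open>\<sigma>\<close> is exactly \<open>l\<close>, so exponents
    below \<open>l\<close> enumerate \<Gamma> without repetition and the norm over \<Gamma> becomes
    a sum over exponents.\<close>
  define e where "e j = \<sigma> [^]\<^bsub>?A\<^esub> j" for j :: nat
  have e\<Gamma>: "e j \<in> ?\<Gamma>" for j unfolding e_def \<Gamma>eq using A.generate_pow_nat[OF \<sigma>A] assms(8) l0 by auto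
  have e: "bij_betw e {..<l} ?\<Gamma>"
    unfolding bij_betw_def
  proof
    have "inj_on (\<lambda>j. \<sigma> [^]\<^bsub>?A\<^esub> j) {0..A.ord \<sigma> - 1}" by (rule A.ord_inj[OF \<sigma>A])
    moreover have "{..<l} = {0..A.ord \<sigma> - 1}" using assms(8) l0 by auto
    ultimately show "inj_on e {..<l}" unfolding e_def by simp
    show "e ` {..<l} = ?\<Gamma>"
    proof
      show "e ` {..<l} \<subseteq> ?\<Gamma>" using e\<Gamma> by blast
      show "?\<Gamma> \<subseteq> e ` {..<l}"
      proof
        fix \<gamma> assume "\<gamma> \<in> ?\<Gamma>"
        then obtain k :: nat where k: "\<gamma> = \<sigma> [^]\<^bsub>?A\<^esub> k"
          unfolding \<Gamma>eq using A.generate_pow_nat[OF \<sigma>A] assms(8) l0 by auto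
        have "\<sigma> [^]\<^bsub>?A\<^esub> k = \<sigma> [^]\<^bsub>?A\<^esub> (l * (k div l) + k mod l)" by simp
        also have "\<dots> = (\<sigma> [^]\<^bsub>?A\<^esub> l) [^]\<^bsub>?A\<^esub> (k div l) \<otimes>\<^bsub>?A\<^esub> \<sigma> [^]\<^bsub>?A\<^esub> (k mod l)"
          using \<sigma>A by (simp add: A.nat_pow_mult A.nat_pow_pow)
        also have "\<dots> = e (k mod l)" using \<sigma>A \<sigma>l by (simp add: e_def)
        finally show "\<gamma> \<in> e ` {..<l}" using k l0 by auto
      qed
    qed
  qed
  have \<rho>c: "\<rho> h x \<in> carrier L" if "h \<in> carrier ?S" "x \<in> carrier L" for h x
    using \<rho>.element_image[OF that] by blast
  have G1: "(mat 1, \<gamma>) \<in> carrier ?S" if "\<gamma> \<in> ?\<Gamma>" for \<gamma> using that one_rG by (simp add: cS)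
  have N1: "(g, \<one>\<^bsub>?A\<^esub>) \<in> carrier ?S" if "g \<in> rational G" for g using that one\<Gamma> by (simp add: cS)
  have mulcA: "mult (cyclic_auts G \<sigma>) = mult ?A" "\<one>\<^bsub>cyclic_auts G \<sigma>\<^esub> = \<one>\<^bsub>?A\<^esub>" by (simp_all add: cyclic_auts_def)
  define s where "s = Gamma_part \<rho> \<sigma>"
  define a where "a = group_part G \<rho>"
  have s_eq: "s x = \<rho> (mat 1, \<sigma>) x" for x by (simp add: s_def Gamma_part_def)
  have a_eq: "a g x = \<rho> (g, \<one>\<^bsub>?A\<^esub>) x" for g x by (simp add: a_def group_part_def)
  have \<rho>1: "\<rho> (mat 1, \<one>\<^bsub>?A\<^esub>) x = x" if "x \<in> carrier L" for x
  proof -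
    have "\<rho> \<one>\<^bsub>?S\<^esub> x = x" using \<rho>.id_eq_one that by (metis restrict_apply')
    then show ?thesis by (simp add: semidirect_simps mulcA)
  qed
  have \<tau>e: "Gamma_part \<rho> (e j) x = (s ^^ j) x" if x: "x \<in> carrier L" for j x
  proof (induction j)
    case 0
    then show ?case using \<rho>1[OF x] by (simp add: Gamma_part_def e_def)
  next
    case (Suc j)
    have "(mat 1, \<sigma>) \<otimes>\<^bsub>?S\<^esub> (mat 1, e j) = (mat 1, e (Suc j))"
      using \<gamma>1[OF \<sigma>A] A.nat_pow_Suc2[OF \<sigma>A, of j] by (simp add: semidirect_simps mulcA e_def)
    then have "\<rho> (mat 1, e (Suc j)) x = \<rho> (mat 1, \<sigma>) (\<rho> (mat 1, e j) x)"
      using \<rho>.composition_rule[OF x G1[OF \<sigma>\<Gamma>] G1[OF e\<Gamma>[of j]]] by simp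
    then show ?case using Suc by (simp add: Gamma_part_def s_eq)
  qed
  have sl: "(s ^^ l) x = x" if "x \<in> carrier L" for x
    using \<tau>e[OF that, of l] \<rho>1[OF that] \<sigma>l by (simp add: e_def Gamma_part_def)
  \<comment> \<open>This expresses the relation (1, \<sigma>)(n, 1) = (\<sigma> n, 1)(1, \<sigma>)
    of the semidirect product.\<close>
  have s_a: "s (a n x) = a (\<sigma> n) (s x)" if n: "n \<in> rational G" and x: "x \<in> carrier L" for n x
  proof -
    have "(mat 1, \<sigma>) \<otimes>\<^bsub>?S\<^esub> (n, \<one>\<^bsub>?A\<^esub>) = (\<sigma> n, \<one>\<^bsub>?A\<^esub>) \<otimes>\<^bsub>?S\<^esub> (mat 1, \<sigma>)"
      using \<sigma>A \<gamma>1[OF A.one_closed] by (simp add: semidirect_simps mulcA)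
    then show ?thesis
      using \<rho>.composition_rule[OF x G1[OF \<sigma>\<Gamma>] N1[OF n]] \<rho>.composition_rule[OF x N1[OF \<sigma>rG[OF n]] G1[OF \<sigma>\<Gamma>]]
      by (simp add: s_eq a_eq)
  qed
  have a_mult: "a (n ** m) x = a n (a m x)" if n: "n \<in> rational G" "m \<in> rational G" and x: "x \<in> carrier L" for n m x
  proof -
    have "(n, \<one>\<^bsub>?A\<^esub>) \<otimes>\<^bsub>?S\<^esub> (m, \<one>\<^bsub>?A\<^esub>) = (n ** m, \<one>\<^bsub>?A\<^esub>)"
      using n rG oneA by (auto simp: semidirect_simps mulcA)
    then show ?thesis using \<rho>.composition_rule[OF x N1[OF n(1)] N1[OF n(2)]] by (simp add: a_eq)
  qed
  have \<Theta>h: "\<Theta> \<in> hom (GLsub (rational N)) (units_of (Lam w l))"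
    and \<Theta>s: "\<exists>U. open_subgroup v U N \<and> (\<forall>u\<in>U. \<Theta> u = \<one>\<^bsub>Lam w l\<^esub>)"
    using assms(13) by (auto simp: smooth_character_def)
  have \<Theta>U: "\<Theta> n \<in> Units (Lam w l)" if "n \<in> rational N" for n using \<Theta>h that by (auto simp: hom_def units_of_def)
  let ?I = "PIdl\<^bsub>Lam w l\<^esub> (of_nat l)"
  have lc: "of_nat l \<in> carrier (Lam w l)"
    using L.R.add.nat_pow_closed[OF L.R.one_closed, of l] add_pow_Lam[of w l l] by simp
  interpret I: ideal ?I "Lam w l" by (rule L.R.cgenideal_ideal[OF lc])
  interpret sNF: subgroup "rational N" GL by (rule sNF)
  interpret J: tate_jacquet_matrix "Lam w l" L s l ?\<Gamma> \<sigma> "Gamma_part \<rho>" e "rational N" a \<Theta> \<sigma> ?I i v p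
  proof unfold_locales
    show "nonarch_local_field v p" "Factorial_Ring.prime l" "l \<noteq> p" by fact+
    show "l > 0" by (rule l0)
    show "bij_betw e {..<l} ?\<Gamma>" by (rule e)
    show "\<exists>q\<in>carrier (Lam w l). r = q \<otimes>\<^bsub>Lam w l\<^esub> add_pow (Lam w l) l \<one>\<^bsub>Lam w l\<^esub>" if "r \<in> ?I" for r
      using that unfolding cgenideal_def add_pow_Lam by blast
    show "\<exists>\<epsilon>>0. \<forall>n\<in>rational N. (\<forall>i j. v (of_ac ((n - mat 1) $ i $ j)) < \<epsilon>) \<longrightarrow> \<Theta> n = \<one>\<^bsub>Lam w l\<^esub>"
      using \<Theta>s open_subgroup_contains_ball[OF v _ sNF] by blast
    fix x assume x: "x \<in> carrier L"
    show "s x \<in> carrier L" using \<rho>c[OF G1[OF \<sigma>\<Gamma>] x] by (simp add: s_eq)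
    show "(s ^^ l) x = x" by (rule sl[OF x])
    show "s (x \<oplus>\<^bsub>L\<^esub> y) = s x \<oplus>\<^bsub>L\<^esub> s y" if "y \<in> carrier L" for y
      using \<rho>_add[OF G1[OF \<sigma>\<Gamma>] x that] by (simp add: s_eq)
    show "s (r \<odot>\<^bsub>L\<^esub> x) = r \<odot>\<^bsub>L\<^esub> s x" if "r \<in> carrier (Lam w l)" for r
      using \<rho>_smult[OF G1[OF \<sigma>\<Gamma>] that x] by (simp add: s_eq)
    show "Gamma_part \<rho> (e j) x = (s ^^ j) x" for j by (rule \<tau>e[OF x])
    show "Gamma_part \<rho> \<sigma> x = s x" by (simp add: s_def)
    show "\<exists>\<epsilon>>0. \<forall>n\<in>rational N. (\<forall>i j. v (of_ac ((n - mat 1) $ i $ j)) < \<epsilon>) \<longrightarrow> a n x = x"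
    proof -
      obtain U where U: "open_subgroup v U G" "\<forall>u\<in>U. a u x = x"
        using assms(16) x by (auto simp: smooth_action_def a_def)
      then show ?thesis using open_subgroup_contains_ball[OF v U(1) srG] NFG by blast
    qed
    fix n assume n: "n \<in> rational N"
    have nG: "n \<in> rational G" using n NFG by blast
    show "a n x \<in> carrier L" using \<rho>c[OF N1[OF nG] x] by (simp add: a_eq)
    show "a n (x \<oplus>\<^bsub>L\<^esub> y) = a n x \<oplus>\<^bsub>L\<^esub> a n y" if "y \<in> carrier L" for y
      using \<rho>_add[OF N1[OF nG] x that] by (simp add: a_eq)
    show "a n (r \<odot>\<^bsub>L\<^esub> x) = r \<odot>\<^bsub>L\<^esub> a n x" if "r \<in> carrier (Lam w l)" for r
      using \<rho>_smult[OF N1[OF nG] that x] by (simp add: a_eq)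
    show "s (a n x) = a (\<sigma> n) (s x)" by (rule s_a[OF nG x])
    show "a (n ** m) x = a n (a m x)" if "m \<in> rational N" for m
      using a_mult[OF nG _ x] that NFG by blast
  next
    fix n assume n: "n \<in> rational N"
    have nG: "n \<in> rational G" using n NFG by blast
    show "\<sigma> n \<in> rational N" by (rule NF\<sigma>[OF n])
    show "\<Theta> n \<in> Units (Lam w l)" by (rule \<Theta>U[OF n])
    then show "\<Theta> n \<in> carrier (Lam w l)" by (rule L.R.Units_closed)
    show "\<Theta> (\<sigma> n) = \<Theta> n" using assms(14) n by blast
    show "unipotent n" using n uN by (simp add: rational_def)
    show "n $ i $ j \<in> base" for i j using n by (simp add: rational_def)
    show "(\<sigma> ^^ l) n = n" using \<sigma>pow nG rG by blast
    show "\<sigma> (n ** m) = \<sigma> n ** \<sigma> m" if "m \<in> rational N" for m using \<sigma>m nG that NFG rG by blast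
    show "\<Theta> (n ** m) = \<Theta> n \<otimes>\<^bsub>Lam w l\<^esub> \<Theta> m" if "m \<in> rational N" for m
      using \<Theta>h n that by (auto simp: hom_def units_of_def)
  qed
  \<comment> \<open>The rational points of N^\<sigma> are the \<open>\<sigma>\<close>-fixed points
    of N(F). With this, the two sides and the natural map unfold to their abstract
    counterparts.\<close>
  have NS: "rational (fixed_points \<sigma> N) = {n \<in> rational N. \<sigma> n = n}"
    by (auto simp: rational_def fixed_points_def)
  have QL: "jacquet_L (Lam w l) G N \<Theta> L \<rho> = jacquet (Lam w l) L (rational N) a \<Theta>"
    by (simp add: jacquet_L_def a_def)
  have \<tau>': "jacquet_L_action (Lam w l) G N \<Theta> L \<rho> = J.\<tau>'"
    by (intro ext) (simp add: jacquet_L_action_def jacquet_L_proj_def jacquet_L_kernel_def J.\<tau>'_def flip: a_def)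
  have nm: "natural_map w l i G \<sigma> N \<Theta> L \<rho> = descend J.tf"
    unfolding natural_map_def tate_functorial_def QL \<tau>' J.tf_def jacquet_L_proj_def jacquet_L_kernel_def a_def[symmetric] ..
  have act: "tate_L_action i G \<sigma> L \<rho> = J.act"
    by (intro ext) (simp add: tate_L_action_def J.act_def flip: a_def)
  have src: "jacquet_of_tate w l i G \<sigma> N \<Theta> L \<rho> = J.JT"
    unfolding jacquet_of_tate_def tate_L_def act NS resfield_def reduction_def ..
  have tgt: "tate_of_jacquet w l i G \<sigma> N \<Theta> L \<rho> = residual_module J.T'"
    unfolding tate_of_jacquet_def QL \<tau>' ..
  show ?thesis
    unfolding nm src tgt resfield_def by (rule conjI[OF J.natural_map_hom J.natural_map_injective])
qed

end
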